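(* Let $\alpha\ge\frac12$, $\beta\ge\frac12$, let $$(a,s,\sigma)\in\{(0,\infty)\times[-1,0)\times(1,\infty)\}\cup\{[0,\infty)\times\{0\}\times[1,\infty)\},$$ and let $(u_0,\theta_0)\in\mathcal{X}_{a,\sigma}^s(\mathbb{R}^3)$ with $\operatorname{div}u_0=0$. In the case $\alpha=\frac12$ or $\beta=\frac12$, assume in addition that $\|(u_0,\theta_0)\|_{\mathcal{X}_{a,\sigma}^s}$ is sufficiently small (smaller than a positive constant depending only on $a,\sigma,s,\alpha,\beta$). Then there exist $T>0$ and positive constants $C_1,C_2$ such that there is a unique (mild) solution $$(u,\theta)\in\big[C_T(\mathcal{X}_{a,\sigma}^s(\mathbb{R}^3))\cap L^1_T(\mathcal{X}_{a,\sigma}^{s+2\alpha}(\mathbb{R}^3))\big]\times\big[C_T(\mathcal{X}_{a,\sigma}^s(\mathbb{R}^3))\cap L^1_T(\mathcal{X}_{a,\sigma}^{s+2\beta}(\mathbb{R}^3))\big]$$ of the fractional Boussinesq equations with initial data $(u_0,\theta_0)$ satisfying $$\|u\|_{L^\infty_T(\mathcal{X}_{a,\sigma}^{s})}+\|u\|_{L^1_T(\mathcal{X}_{a,\sigma}^{s+2\alpha})}+\|\theta\|_{L^\infty_T(\mathcal{X}_{a,\sigma}^{s})}+\|\theta\|_{L^1_T(\mathcal{X}_{a,\sigma}^{s+2\beta})}<C_1 .$$ Moreover, $$\|u\|_{L^\infty_T(\mathcal{X}_{a,\sigma}^{s})}+\|u\|_{L^1_T(\mathcal{X}_{a,\sigma}^{s+2\alpha})}+\|\theta\|_{L^\infty_T(\mathcal{X}_{a,\sigma}^{s})}+\|\theta\|_{L^1_T(\mathcal{X}_{a,\sigma}^{s+2\beta})}\le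 C_2\,\|(u_0,\theta_0)\|_{\mathcal{X}_{a,\sigma}^{s}},$$ and, for every $p\ge 1$ (real), $$(u,\theta)\in L^p_T(\mathcal{X}_{a,\sigma}^{s+\frac{2\alpha}{p}}(\mathbb{R}^3))\times L^p_T(\mathcal{X}_{a,\sigma}^{s+\frac{2\beta}{p}}(\mathbb{R}^3)).$$
   Context: Equations. The fractional Boussinesq equations on $\mathbb{R}^3$ are $$u_t+(-\Delta)^\alpha u+u\cdot\nabla u+\nabla p=\theta e_3,\quad \theta_t+(-\Delta)^\beta\theta+u\cdot\nabla\theta=0,\quad \operatorname{div}u=0\quad (x\in\mathbb{R}^3,\ t>0),$$ with $u(x,0)=u_0(x)$, $\theta(x,0)=\theta_0(x)$, where $u(x,t)\in\mathbb{R}^3$, $p(x,t),\theta(x,t)\in\mathbb{R}$, $e_3=(0,0,1)$, and $\operatorname{div}u_0=0$. The Fourier transform is $\widehat f(\xi)=\mathcal{F}(f)(\xi)=\int_{\mathbb{R}^3}e^{-i\xi\cdot x}f(x)\,dx$, and $\mathcal{F}[(-\Delta)^\gamma f](\xi)=|\xi|^{2\gamma}\widehat f(\xi)$. Spaces. For $a\ge0$, $\sigma\ge1$, $s\in\mathbb{R}$, $$\mathcal{X}_{a,\sigma}^s(\mathbb{R}^3)=\Big\{f\in S'(\mathbb{R}^3):\widehat f\in L^1_{\mathrm{loc}}(\mathbb{R}^3),\ \|f\|_{\mathcal{X}_{a,\sigma}^s}:=\int_{\mathbb{R}^3}|\xi|^s e^{a|\xi|^{1/\sigma}}|\widehat f(\xi)|\,d\xi<\infty\Big\},$$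 with $S'$ the tempered distributions; for vector-valued $f$, $|\widehat f(\xi)|$ is the Euclidean norm. For a pair, $(f,g)\in\mathcal{X}_{a,\sigma}^s$ means that both entries belong to the space, and $\|(f,g)\|_{\mathcal{X}_{a,\sigma}^s}=\|f\|_{\mathcal{X}_{a,\sigma}^s}+\|g\|_{\mathcal{X}_{a,\sigma}^s}$. For a normed space $X$ and $T>0$: $C_T(X)=C([0,T];X)$ with norm $\|f\|_{L^\infty_T(X)}=\sup_{t\in[0,T]}\|f(t)\|_X$, and $L^p_T(X)=L^p([0,T];X)$ with its usual norm ($1\le p<\infty$). Solutions. Solutions are understood in the mild sense: with $\mathbb{P}$ the Leray projector onto divergence-free fields and $e^{-t(-\Delta)^\gamma}$ the Fourier multiplier $e^{-t|\xi|^{2\gamma}}$, $(u,\theta)$ satisfies $\operatorname{div}u=0$ and $$u(t)=e^{-t(-\Delta)^\alpha}u_0-\int_0^t e^{-(t-\tau)(-\Delta)^\alpha}\mathbb{P}(u\cdot\nabla u)\,d\tau+\int_0^t e^{-(t-\tau)(-\Delta)^\alpha}\mathbb{P}(\theta e_3)\,d\tau,$$ $$\theta(t)=e^{-t(-\Delta)^\beta}\theta_0-\int_0^t e^{-(t-\tau)(-\Delta)^\beta}(u\cdot\nabla\theta)\,d\tau .$$ *)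

theory Defs
  imports "HOL-Analysis.Analysis" "HOL-Library.Function_Algebras"
begin

subsection \<open>Tempered distributions on \<open>\<real>\<^sup>3\<close>\<close>

definition partial_deriv :: "3 \<Rightarrow> (real^3 \<Rightarrow> complex) \<Rightarrow> real^3 \<Rightarrow> complex" where
  "partial_deriv j f x = frechet_derivative f (at x) (axis j 1)"

text \<open>The list \<open>js\<close> plays the role of a multi-index: \<open>[j1, ..., jm]\<close> stands for
  \<open>\<partial>\<^sub>j\<^sub>1 ... \<partial>\<^sub>j\<^sub>m\<close>.\<close>

abbreviation iter_deriv :: "3 list \<Rightarrow> (real^3 \<Rightarrow> complex) \<Rightarrow> real^3 \<Rightarrow> complex" where
  "iter_deriv js f \<equiv> foldr partial_deriv js f"

definition smooth_fun :: "(real^3 \<Rightarrow> complex) \<Rightarrow> bool" where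
  "smooth_fun f \<longleftrightarrow> (\<forall>js x. iter_deriv js f differentiable (at x))"

definition test_fun :: "(real^3 \<Rightarrow> complex) \<Rightarrow> bool" where
  "test_fun \<phi> \<longleftrightarrow> smooth_fun \<phi> \<and> compact (closure {x. \<phi> x \<noteq> 0})"

definition schwartz :: "(real^3 \<Rightarrow> complex) \<Rightarrow> bool" where
  "schwartz \<phi> \<longleftrightarrow> smooth_fun \<phi> \<and>
     (\<forall>js N. bounded (range (\<lambda>x. (1 + norm x) ^ N *\<^sub>R iter_deriv js \<phi> x)))"

definition schwartz_norm :: "nat \<Rightarrow> (real^3 \<Rightarrow> complex) \<Rightarrow> real" where
  "schwartz_norm N \<phi> =
     (SUP (js, x) \<in> {js. length js \<le> N} \<times> UNIV. (1 + norm x) ^ N * norm (iter_deriv js \<phi> x))"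

type_synonym dist = "(real^3 \<Rightarrow> complex) \<Rightarrow> complex"

text \<open>A tempered distribution is only determined on the Schwartz space; it is extended by \<open>0\<close>
  to all other functions, so that equality of distributions is equality in HOL. All operations
  below respect this convention.\<close>

definition tempered :: "dist \<Rightarrow> bool" where
  "tempered f \<longleftrightarrow>
     (\<forall>\<phi> \<psi>. schwartz \<phi> \<longrightarrow> schwartz \<psi> \<longrightarrow> f (\<lambda>x. \<phi> x + \<psi> x) = f \<phi> + f \<psi>) \<and>
     (\<forall>c \<phi>. schwartz \<phi> \<longrightarrow> f (\<lambda>x. c * \<phi> x) = c * f \<phi>) \<and>
     (\<exists>C N. \<forall>\<phi>. schwartz \<phi> \<longrightarrow> norm (f \<phi>) \<le> C * schwartz_norm N \<phi>) \<and>
     (\<forall>\<phi>. \<not> schwartz \<phi> \<longrightarrow> f \<phi> = 0)"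

definition real_dist :: "dist \<Rightarrow> bool" where
  "real_dist f \<longleftrightarrow> (\<forall>\<phi>. schwartz \<phi> \<longrightarrow> (\<forall>x. \<phi> x \<in> \<real>) \<longrightarrow> f \<phi> \<in> \<real>)"

definition locally_integrable :: "(real^3 \<Rightarrow> complex) \<Rightarrow> bool" where
  "locally_integrable g \<longleftrightarrow> (\<forall>K. compact K \<longrightarrow> set_integrable lborel K g)"

definition represents :: "(real^3 \<Rightarrow> complex) \<Rightarrow> dist \<Rightarrow> bool" where
  "represents g f \<longleftrightarrow> locally_integrable g \<and>
     (\<forall>\<phi>. test_fun \<phi> \<longrightarrow> f \<phi> = (LINT x|lborel. g x * \<phi> x))"

text \<open>The locally integrable function with which a distribution is identified, unique up to
  null sets; meaningful only if such a function exists.\<close>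

definition density :: "dist \<Rightarrow> real^3 \<Rightarrow> complex" where
  "density f = (SOME g. represents g f)"

definition regular_dist :: "(real^3 \<Rightarrow> complex) \<Rightarrow> dist" where
  "regular_dist g = (\<lambda>\<phi>. if schwartz \<phi> then LINT x|lborel. g x * \<phi> x else 0)"

definition dist_deriv :: "3 \<Rightarrow> dist \<Rightarrow> dist" where
  "dist_deriv j f = (\<lambda>\<phi>. if schwartz \<phi> then - f (partial_deriv j \<phi>) else 0)"

text \<open>Pointwise product of two distributions that are locally integrable functions.\<close>

definition dist_prod :: "dist \<Rightarrow> dist \<Rightarrow> dist" where
  "dist_prod f g = regular_dist (\<lambda>x. density f x * density g x)"


subsection \<open>Fourier transform and Fourier multipliers\<close>

definition fourier_fun :: "(real^3 \<Rightarrow> complex) \<Rightarrow> real^3 \<Rightarrow> complex" where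
  "fourier_fun \<phi> \<xi> = (LINT x|lborel. exp (- \<i> * complex_of_real (\<xi> \<bullet> x)) * \<phi> x)"

definition inv_fourier_fun :: "(real^3 \<Rightarrow> complex) \<Rightarrow> real^3 \<Rightarrow> complex" where
  "inv_fourier_fun \<phi> x =
     (LINT \<xi>|lborel. exp (\<i> * complex_of_real (\<xi> \<bullet> x)) * \<phi> \<xi>) / complex_of_real ((2 * pi) ^ 3)"

definition fourier_dist :: "dist \<Rightarrow> dist" where
  "fourier_dist f = (\<lambda>\<phi>. if schwartz \<phi> then f (fourier_fun \<phi>) else 0)"

definition fourier_locally_integrable :: "dist \<Rightarrow> bool" where
  "fourier_locally_integrable f \<longleftrightarrow> (\<exists>g. represents g (fourier_dist f))"

text \<open>\<open>\<F> f\<close> as a function, for distributions with \<open>\<F> f \<in> L\<^sup>1\<^sub>l\<^sub>o\<^sub>c\<close>.\<close>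

definition fhat :: "dist \<Rightarrow> real^3 \<Rightarrow> complex" where
  "fhat f = density (fourier_dist f)"

text \<open>The distribution whose Fourier transform is the function \<open>g\<close>, obtained from
  \<open>\<langle>f, \<phi>\<rangle> = \<langle>\<F> f, \<F>\<^sup>-\<^sup>1 \<phi>\<rangle>\<close>.\<close>

definition inv_fourier :: "(real^3 \<Rightarrow> complex) \<Rightarrow> dist" where
  "inv_fourier g = (\<lambda>\<phi>. if schwartz \<phi> then LINT \<xi>|lborel. g \<xi> * inv_fourier_fun \<phi> \<xi> else 0)"

definition heat :: "real \<Rightarrow> real \<Rightarrow> dist \<Rightarrow> dist" where
  "heat \<gamma> t f =
     inv_fourier (\<lambda>\<xi>. complex_of_real (exp (- t * norm \<xi> powr (2 * \<gamma>))) * fhat f \<xi>)"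

definition heat_vec :: "real \<Rightarrow> real \<Rightarrow> dist^3 \<Rightarrow> dist^3" where
  "heat_vec \<gamma> t f = (\<chi> k. heat \<gamma> t (f $ k))"

text \<open>The Leray projector, with symbol \<open>\<delta>\<^sub>j\<^sub>k - \<xi>\<^sub>j \<xi>\<^sub>k / |\<xi>|\<^sup>2\<close>.\<close>

definition leray :: "dist^3 \<Rightarrow> dist^3" where
  "leray f = (\<chi> j. inv_fourier (\<lambda>\<xi>. fhat (f $ j) \<xi> -
     (\<Sum>k\<in>UNIV. complex_of_real (\<xi> $ j * \<xi> $ k / (norm \<xi>)\<^sup>2) * fhat (f $ k) \<xi>)))"


subsection \<open>The spaces \<open>\<X>\<^sup>s\<^sub>a\<^sub>,\<^sub>\<sigma>\<close> and spaces of time-dependent functions\<close>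

record 'v nspace =
  elems :: "'v set"
  nrm :: "'v \<Rightarrow> real"

definition X_weight :: "real \<Rightarrow> real \<Rightarrow> real \<Rightarrow> real^3 \<Rightarrow> real" where
  "X_weight a \<sigma> s \<xi> = norm \<xi> powr s * exp (a * norm \<xi> powr (1 / \<sigma>))"

definition X_scal :: "real \<Rightarrow> real \<Rightarrow> real \<Rightarrow> dist nspace" where
  "X_scal a \<sigma> s = \<lparr>
     elems = {f. tempered f \<and> fourier_locally_integrable f \<and>
                 integrable lborel (\<lambda>\<xi>. X_weight a \<sigma> s \<xi> * norm (fhat f \<xi>))},
     nrm = (\<lambda>f. LINT \<xi>|lborel. X_weight a \<sigma> s \<xi> * norm (fhat f \<xi>)) \<rparr>"

text \<open>For vector fields, the norm inside the integral is the Euclidean norm of \<open>\<complex>\<^sup>3\<close>.\<close>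

definition fhat_vec :: "dist^3 \<Rightarrow> real^3 \<Rightarrow> complex^3" where
  "fhat_vec f \<xi> = (\<chi> k. fhat (f $ k) \<xi>)"

definition X_vec :: "real \<Rightarrow> real \<Rightarrow> real \<Rightarrow> (dist^3) nspace" where
  "X_vec a \<sigma> s = \<lparr>
     elems = {f. (\<forall>k. tempered (f $ k) \<and> fourier_locally_integrable (f $ k)) \<and>
                 integrable lborel (\<lambda>\<xi>. X_weight a \<sigma> s \<xi> * norm (fhat_vec f \<xi>))},
     nrm = (\<lambda>f. LINT \<xi>|lborel. X_weight a \<sigma> s \<xi> * norm (fhat_vec f \<xi>)) \<rparr>"

definition C_T :: "real \<Rightarrow> ('v::minus) nspace \<Rightarrow> (real \<Rightarrow> 'v) set" where
  "C_T T X = {f. \<forall>t\<in>{0..T}. f t \<in> elems X \<and>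
                   ((\<lambda>r. nrm X (f r - f t)) \<longlongrightarrow> 0) (at t within {0..T})}"

definition Linf_norm :: "real \<Rightarrow> 'v nspace \<Rightarrow> (real \<Rightarrow> 'v) \<Rightarrow> real" where
  "Linf_norm T X f = (SUP t\<in>{0..T}. nrm X (f t))"

text \<open>The Bochner space \<open>L\<^sup>p([0,T];X)\<close>. Its elements need to lie in \<open>X\<close> only at almost every
  time; strong measurability is almost everywhere convergence in \<open>X\<close> of simple functions.\<close>

definition Lp_T :: "real \<Rightarrow> real \<Rightarrow> ('v::minus) nspace \<Rightarrow> (real \<Rightarrow> 'v) set" where
  "Lp_T p T X = {f.
     (AE t in lebesgue_on {0..T}. f t \<in> elems X) \<and>
     (\<exists>S. (\<forall>n. simple_function (lebesgue_on {0..T}) (S n) \<and> (\<forall>t\<in>{0..T}. S n t \<in> elems X)) \<and>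
          (AE t in lebesgue_on {0..T}. (\<lambda>n. nrm X (S n t - f t)) \<longlonglongrightarrow> 0)) \<and>
     integrable (lebesgue_on {0..T}) (\<lambda>t. nrm X (f t) powr p)}"

definition Lp_norm :: "real \<Rightarrow> real \<Rightarrow> 'v nspace \<Rightarrow> (real \<Rightarrow> 'v) \<Rightarrow> real" where
  "Lp_norm p T X f = (LINT t|lebesgue_on {0..T}. nrm X (f t) powr p) powr (1 / p)"


subsection \<open>Mild solutions of the fractional Boussinesq equations\<close>

definition div_free :: "dist^3 \<Rightarrow> bool" where
  "div_free u \<longleftrightarrow> (\<Sum>j\<in>UNIV. dist_deriv j (u $ j)) = 0"

text \<open>\<open>u \<cdot> \<nabla>f\<close>. In the solution class of the theorem, \<open>u\<close>, \<open>f\<close> and \<open>\<nabla>f\<close> are bounded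
  continuous functions at almost every time, so that the products are those of functions.\<close>

definition advect :: "dist^3 \<Rightarrow> dist \<Rightarrow> dist" where
  "advect u f = (\<Sum>j\<in>UNIV. dist_prod (u $ j) (dist_deriv j f))"

definition advect_vec :: "dist^3 \<Rightarrow> dist^3 \<Rightarrow> dist^3" where
  "advect_vec u v = (\<chi> k. advect u (v $ k))"

definition times_e3 :: "dist \<Rightarrow> dist^3" where
  "times_e3 \<theta> = (\<chi> k. if k = 3 then \<theta> else 0)"

text \<open>The time integral of a distribution-valued function over \<open>[0,t]\<close>, in the weak sense of \<open>S'\<close>.\<close>

definition dist_integrable :: "real \<Rightarrow> (real \<Rightarrow> dist) \<Rightarrow> bool" where
  "dist_integrable t F \<longleftrightarrow> (\<forall>\<phi>. schwartz \<phi> \<longrightarrow> set_integrable lebesgue {0..t} (\<lambda>\<tau>. F \<tau> \<phi>))"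

definition dist_integral :: "real \<Rightarrow> (real \<Rightarrow> dist) \<Rightarrow> dist" where
  "dist_integral t F = (\<lambda>\<phi>. if schwartz \<phi> then LINT \<tau>:{0..t}|lebesgue. F \<tau> \<phi> else 0)"

definition dist_integrable_vec :: "real \<Rightarrow> (real \<Rightarrow> dist^3) \<Rightarrow> bool" where
  "dist_integrable_vec t F \<longleftrightarrow> (\<forall>k. dist_integrable t (\<lambda>\<tau>. F \<tau> $ k))"

definition dist_integral_vec :: "real \<Rightarrow> (real \<Rightarrow> dist^3) \<Rightarrow> dist^3" where
  "dist_integral_vec t F = (\<chi> k. dist_integral t (\<lambda>\<tau>. F \<tau> $ k))"

definition mild_solution ::
  "real \<Rightarrow> real \<Rightarrow> real \<Rightarrow> dist^3 \<Rightarrow> dist \<Rightarrow> (real \<Rightarrow> dist^3) \<Rightarrow> (real \<Rightarrow> dist) \<Rightarrow> bool" where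
  "mild_solution \<alpha> \<beta> T u0 \<theta>0 u \<theta> \<longleftrightarrow>
     (\<forall>t\<in>{0..T}.
        (\<forall>k. real_dist (u t $ k)) \<and> real_dist (\<theta> t) \<and> div_free (u t) \<and>
        dist_integrable_vec t (\<lambda>\<tau>. heat_vec \<alpha> (t - \<tau>) (leray (advect_vec (u \<tau>) (u \<tau>)))) \<and>
        dist_integrable_vec t (\<lambda>\<tau>. heat_vec \<alpha> (t - \<tau>) (leray (times_e3 (\<theta> \<tau>)))) \<and>
        dist_integrable t (\<lambda>\<tau>. heat \<beta> (t - \<tau>) (advect (u \<tau>) (\<theta> \<tau>))) \<and>
        u t = heat_vec \<alpha> t u0
              - dist_integral_vec t (\<lambda>\<tau>. heat_vec \<alpha> (t - \<tau>) (leray (advect_vec (u \<tau>) (u \<tau>))))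
              + dist_integral_vec t (\<lambda>\<tau>. heat_vec \<alpha> (t - \<tau>) (leray (times_e3 (\<theta> \<tau>)))) \<and>
        \<theta> t = heat \<beta> t \<theta>0
              - dist_integral t (\<lambda>\<tau>. heat \<beta> (t - \<tau>) (advect (u \<tau>) (\<theta> \<tau>))))"

text \<open>A mild solution lying in the space in which the Cauchy problem is solved.\<close>

definition regular_solution ::
  "real \<Rightarrow> real \<Rightarrow> real \<Rightarrow> real \<Rightarrow> real \<Rightarrow> real \<Rightarrow> dist^3 \<Rightarrow> dist \<Rightarrow>
     (real \<Rightarrow> dist^3) \<Rightarrow> (real \<Rightarrow> dist) \<Rightarrow> bool" where
  "regular_solution a \<sigma> s \<alpha> \<beta> T u0 \<theta>0 u \<theta> \<longleftrightarrow>
     u \<in> C_T T (X_vec a \<sigma> s) \<inter> Lp_T 1 T (X_vec a \<sigma> (s + 2 * \<alpha>)) \<and>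
     \<theta> \<in> C_T T (X_scal a \<sigma> s) \<inter> Lp_T 1 T (X_scal a \<sigma> (s + 2 * \<beta>)) \<and>
     mild_solution \<alpha> \<beta> T u0 \<theta>0 u \<theta>"

definition solution_norm ::
  "real \<Rightarrow> real \<Rightarrow> real \<Rightarrow> real \<Rightarrow> real \<Rightarrow> real \<Rightarrow> (real \<Rightarrow> dist^3) \<Rightarrow> (real \<Rightarrow> dist) \<Rightarrow> real" where
  "solution_norm a \<sigma> s \<alpha> \<beta> T u \<theta> =
     Linf_norm T (X_vec a \<sigma> s) u + Lp_norm 1 T (X_vec a \<sigma> (s + 2 * \<alpha>)) u
     + Linf_norm T (X_scal a \<sigma> s) \<theta> + Lp_norm 1 T (X_scal a \<sigma> (s + 2 * \<beta>)) \<theta>"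

definition data_norm :: "real \<Rightarrow> real \<Rightarrow> real \<Rightarrow> dist^3 \<Rightarrow> dist \<Rightarrow> real" where
  "data_norm a \<sigma> s u0 \<theta>0 = nrm (X_vec a \<sigma> s) u0 + nrm (X_scal a \<sigma> s) \<theta>0"

end

theory Submission
 imports Defs "HOL-Probability.Probability"
begin

text \<open>
  On the Fourier side \<open>(u, \<theta>)\<close> becomes a state: four functions \<open>Z i t\<close> of the frequency, with \<open>Z (Some k)\<close>
 for \<open>u\<^sub>k\<close> and \<open>Z None\<close> for \<open>\<theta>\<close>. Products turn into convolutions, the Leray projector and the heat
 semigroup into multipliers, and the mild equations into a fixed point equation \<open>Z = \<Phi> Z\<close> between
 functions (\<open>mild_link\<close>). The norm of \<open>\<X>\<^sup>r\<close> is a weighted \<open>L\<^sup>1\<close> norm with weight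
 \<open>w r \<xi> = |\<xi>|\<^sup>r exp (a |\<xi>|\<^sup>1\<^sup>/\<^sup>\<sigma>)\<close>.

 The estimate behind the theorem is the product inequality
 \<open>w (s+1) (\<eta> + \<zeta>) \<le> 2 K (w (s+1) \<eta> w s \<zeta> + w s \<eta> w (s+1) \<zeta>)\<close> (\<open>w_product\<close>): the larger frequency carries
 the derivative in \<open>div (u \<otimes> u)\<close>, while for the smaller one concavity of \<open>r \<mapsto> r\<^sup>1\<^sup>/\<^sup>\<sigma>\<close> leaves a
 fraction of the exponential weight unused; it absorbs the factor \<open>|\<zeta>|\<^sup>-\<^sup>s\<close>, which is why
 \<open>s < 0\<close> goes with \<open>a > 0\<close> and \<open>\<sigma> > 1\<close>. Integrating the heat kernel in time gains \<open>2\<gamma>\<close>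
 derivatives in \<open>L\<^sup>1\<^sub>T\<close>, with \<open>\<gamma> = \<alpha>\<close> for the velocity and \<open>\<gamma> = \<beta>\<close> for the temperature (\<open>duhamel_NM\<close>),
 and interpolation between \<open>L\<^sup>\<infinity>\<^sub>T \<X>\<^sup>s\<close> and \<open>L\<^sup>1\<^sub>T \<X>\<^sup>s\<^sup>+\<^sup>2\<^sup>\<gamma>\<close> bounds
 \<open>L\<^sup>1\<^sub>T \<X>\<^sup>s\<^sup>+\<^sup>1\<close> with a factor \<open>\<lambda>(T)\<close>, the larger of the two powers
 \<open>T\<^sup>1\<^sup>-\<^sup>1\<^sup>/\<^sup>(\<^sup>2\<^sup>\<gamma>\<^sup>)\<close> (\<open>GN_le\<close>). Together these give \<open>Phi_lipschitz\<close>: \<open>\<Phi>\<close> contracts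
 the ball of radius \<open>M\<close> by \<open>1/2\<close> as soon as \<open>384 K \<lambda>(T) M + 48 T \<le> 1/2\<close>. If \<open>\<alpha>, \<beta> > 1/2\<close> then \<open>\<lambda>(T) \<rightarrow> 0\<close>
 and a small \<open>T\<close> serves for any data; if \<open>\<alpha> = 1/2\<close> or
 \<open>\<beta> = 1/2\<close> then \<open>\<lambda>(T)\<close> does not decay, and \<open>M\<close>, hence the data, has to be small.
 Existence is Picard iteration, uniqueness is the contraction property.

 The remaining work is the passage between distributions and functions. An element of \<open>\<X>\<^sup>s\<close> has an
 integrable Fourier transform and is the inverse transform of it (\<open>tempered_eq_inv_fourier\<close>); this
 needs Fourier inversion on the Schwartz space and the density of test functions. Products of such
 distributions correspond to convolutions (\<open>dist_prod_inv_fourier\<close>). A competing solution is only a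
 map from times to distributions; \<open>exists_state\<close> extracts a jointly measurable state from it, using its
 continuity in time, and \<open>mk_Lp\<close> uses the same sampling in time for strong measurability.
\<close>

section \<open>Smooth functions\<close>

abbreviation enorm :: "'a::real_normed_vector => ennreal" where "enorm x \<equiv> ennreal (norm x)"

abbreviation cr :: "real => complex" where "cr \<equiv> complex_of_real"

lemma partial_deriv_eqI:
 "(f has_derivative f') (at x) ==> partial_deriv j f x = f' (axis j 1)"
 by (simp add: partial_deriv_def frechet_derivative_at[symmetric])

lemma has_derivative_frechet:
 "f differentiable (at x) ==> (f has_derivative frechet_derivative f (at x)) (at x)"
 by (simp add: frechet_derivative_works)

lemma iter_deriv_mem:
 assumes "\<And>f j. f \<in> A ==> partial_deriv j f \<in> A" "f \<in> A"
 shows "iter_deriv js f \<in> A"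
 using assms(2) by (induct js) (auto intro: assms(1))

text \<open>Smoothness is shown by exhibiting a class of differentiable functions that contains the function
  and is closed under partial derivatives; no formula for iterated derivatives is then needed.\<close>

lemma smooth_fun_coinduct:
 assumes "f \<in> A" "\<And>f x. f \<in> A ==> f differentiable (at x)"
  and "\<And>f j. f \<in> A ==> partial_deriv j f \<in> A"
 shows "smooth_fun f"
 unfolding smooth_fun_def using iter_deriv_mem[of A f] assms by blast

lemma smooth_fun_differentiable: "smooth_fun f ==> f differentiable (at x)"
 using smooth_fun_def[THEN iffD1, rule_format, of f "[]" x] by simp

lemma smooth_fun_partial_deriv:
 assumes "smooth_fun f" shows "smooth_fun (partial_deriv j f)"
 unfolding smooth_fun_def
proof (intro allI)
 fix js x
 show "iter_deriv js (partial_deriv j f) differentiable at x"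
  using assms[unfolded smooth_fun_def, rule_format, of "js @ [j]" x] by simp
qed

lemma smooth_fun_continuous: "smooth_fun f ==> continuous_on A f"
 by (simp add: continuous_at_imp_continuous_on differentiable_imp_continuous_within
   smooth_fun_differentiable)

lemma smooth_fun_measurable: "smooth_fun f ==> f \<in> borel_measurable borel"
 by (simp add: borel_measurable_continuous_onI smooth_fun_continuous)

lemma partial_deriv_add:
 assumes "\<And>x. f differentiable (at x)" "\<And>x. g differentiable (at x)"
 shows "partial_deriv j (\<lambda>x. f x + g x) = (\<lambda>x. partial_deriv j f x + partial_deriv j g x)"
 by (rule ext, subst partial_deriv_eqI[OF has_derivative_add[OF
    has_derivative_frechet[OF assms(1)] has_derivative_frechet[OF assms(2)]]])
   (simp add: partial_deriv_def)

lemma partial_deriv_mult: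
 assumes "\<And>x. f differentiable (at x)" "\<And>x. g differentiable (at x)"
 shows "partial_deriv j (\<lambda>x. f x * g x) = (\<lambda>x. f x * partial_deriv j g x + partial_deriv j f x * g x)"
 by (rule ext, subst partial_deriv_eqI[OF has_derivative_mult[OF
    has_derivative_frechet[OF assms(1)] has_derivative_frechet[OF assms(2)]]])
   (simp add: partial_deriv_def)

lemma partial_deriv_const: "partial_deriv j (\<lambda>x. c) = (\<lambda>x. 0)"
 by (rule ext, subst partial_deriv_eqI[OF has_derivative_const]) simp

lemma partial_deriv_cmult:
 assumes "\<And>x. f differentiable (at x)"
 shows "partial_deriv j (\<lambda>x. c * f x) = (\<lambda>x. c * partial_deriv j f x)"
 using partial_deriv_mult[of "\<lambda>x. c" f] assms by (simp add: partial_deriv_const)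

lemma has_derivative_coord:
 "((\<lambda>x::real^3. cr (x $ j)) has_derivative (\<lambda>h. cr (h $ j))) (at x)"
 by (intro bounded_linear.has_derivative[OF bounded_linear_of_real]
   bounded_linear_imp_has_derivative bounded_linear_vec_nth)

lemma partial_deriv_coord:
 "partial_deriv k (\<lambda>x::real^3. cr (x $ j)) = (\<lambda>x. if k = j then 1 else 0)"
 by (rule ext, subst partial_deriv_eqI[OF has_derivative_coord]) (auto simp: axis_def)

lemma differentiable_coord:
 "(\<lambda>x::real^3. cr (x $ j)) differentiable (at x)"
 using has_derivative_coord differentiable_def by blast

lemma smooth_fun_const: "smooth_fun (\<lambda>x. c)"
 by (rule smooth_fun_coinduct[of _ "{\<lambda>x. c |c. True}"]) (auto simp: partial_deriv_const)

lemma smooth_fun_coord: "smooth_fun (\<lambda>x. cr (x $ j))"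
 by (rule smooth_fun_coinduct[of _ "{\<lambda>x. cr (x $ j)} \<union> {f. smooth_fun f}"])
   (auto simp: partial_deriv_coord differentiable_coord smooth_fun_const
    smooth_fun_differentiable smooth_fun_partial_deriv split: if_splits)

text \<open>Leibniz' rule leads from products to sums of products, so closure of smooth functions under
  sums and products is proved simultaneously.\<close>

inductive_set prod_sums :: "(real^3 => complex) set => (real^3 => complex) set => (real^3 => complex) set"
 for A B where
 prod: "f \<in> A ==> g \<in> B ==> (\<lambda>x. f x * g x) \<in> prod_sums A B"
| sum: "f \<in> prod_sums A B ==> g \<in> prod_sums A B ==> (\<lambda>x. f x + g x) \<in> prod_sums A B"

lemma prod_sums_differentiable:
 assumes "\<And>f x. f \<in> A \<union> B ==> f differentiable (at x)" "h \<in> prod_sums A B"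
 shows "h differentiable (at x)"
 using assms(2) by induct (simp_all add: differentiable_mult differentiable_add assms(1))

lemma prod_sums_partial_deriv:
 assumes d: "\<And>f x. f \<in> A \<union> B ==> f differentiable (at x)"
  and A: "\<And>f j. f \<in> A ==> partial_deriv j f \<in> A"
  and B: "\<And>f j. f \<in> B ==> partial_deriv j f \<in> B"
  and "h \<in> prod_sums A B"
 shows "partial_deriv j h \<in> prod_sums A B"
 using assms(4)
proof induct
 case (prod f g)
 then show ?case
  by (auto simp: partial_deriv_mult d intro!: prod_sums.intros A B)
next
 case (sum f g)
 then show ?case
  using prod_sums_differentiable[of A B, OF d]
  by (auto simp: partial_deriv_add intro!: prod_sums.intros)
qed

lemma smooth_fun_prod_sums:
 "h \<in> prod_sums {f. smooth_fun f} {f. smooth_fun f} ==> smooth_fun h"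
 by (rule smooth_fun_coinduct, assumption, erule prod_sums_differentiable[rotated],
   simp add: smooth_fun_differentiable, erule prod_sums_partial_deriv[rotated 3])
   (simp_all add: smooth_fun_partial_deriv smooth_fun_differentiable)

lemma smooth_fun_mult: "smooth_fun f ==> smooth_fun g ==> smooth_fun (\<lambda>x. f x * g x)"
 by (rule smooth_fun_prod_sums, rule prod_sums.prod) auto

lemma smooth_fun_add:
 assumes "smooth_fun f" "smooth_fun g" shows "smooth_fun (\<lambda>x. f x + g x)"
proof -
 have "(\<lambda>x. (f x * 1) + (g x * 1)) \<in> prod_sums {f. smooth_fun f} {f. smooth_fun f}"
  using assms smooth_fun_const[of 1] by (intro prod_sums.sum prod_sums.prod) auto
 from smooth_fun_prod_sums[OF this] show ?thesis by simp
qed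

lemma smooth_fun_cmult: "smooth_fun f ==> smooth_fun (\<lambda>x. c * f x)"
 by (intro smooth_fun_mult smooth_fun_const)

lemma smooth_fun_diff: "smooth_fun f ==> smooth_fun g ==> smooth_fun (\<lambda>x. f x - g x)"
 using smooth_fun_add[of f "\<lambda>x. -1 * g x"] smooth_fun_cmult[of g "-1"] by simp

lemma smooth_fun_prod:
 "finite I ==> (\<And>i. i \<in> I ==> smooth_fun (f i)) ==> smooth_fun (\<lambda>x. \<Prod>i\<in>I. f i x)"
 by (induct I rule: finite_induct) (auto simp: smooth_fun_const intro: smooth_fun_mult)

text \<open>The products of \<open>exp \<circ> f\<close> with smooth functions are closed under
  differentiation.\<close>

lemma smooth_fun_exp:
 assumes "smooth_fun g" shows "smooth_fun (\<lambda>x. exp (g x))"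
proof (rule smooth_fun_coinduct[of _ "{\<lambda>x. f x * exp (g x) | f. smooth_fun f}"])
 have D: "((\<lambda>x. exp (g x)) has_derivative (\<lambda>h. exp (g x) * frechet_derivative g (at x) h)) (at x)" for x
  by (rule has_derivative_compose[OF has_derivative_frechet[OF smooth_fun_differentiable[OF assms]]
     DERIV_exp[unfolded has_field_derivative_def]])
 have dE: "(\<lambda>x. exp (g x)) differentiable (at x)" for x
  using D differentiable_def by blast
 have pE: "partial_deriv j (\<lambda>x. exp (g x)) = (\<lambda>x. exp (g x) * partial_deriv j g x)" for j
  by (rule ext, subst partial_deriv_eqI[OF D]) (simp add: partial_deriv_def)
 show "(\<lambda>x. exp (g x)) \<in> {\<lambda>x. f x * exp (g x) | f. smooth_fun f}"
  by (auto intro!: exI[of _ "\<lambda>x. 1"] smooth_fun_const)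
 show "h differentiable (at x)" if "h \<in> {\<lambda>x. f x * exp (g x) | f. smooth_fun f}" for h x
  using that by (auto intro!: differentiable_mult dE simp: smooth_fun_differentiable)
 show "partial_deriv j h \<in> {\<lambda>x. f x * exp (g x) | f. smooth_fun f}"
  if "h \<in> {\<lambda>x. f x * exp (g x) | f. smooth_fun f}" for h j
 proof -
  obtain f where f: "smooth_fun f" "h = (\<lambda>x. f x * exp (g x))" using \<open>h \<in> _\<close> by blast
  have "partial_deriv j h = (\<lambda>x. (f x * partial_deriv j g x + partial_deriv j f x) * exp (g x))"
   by (simp add: f(2) partial_deriv_mult smooth_fun_differentiable f(1) dE pE algebra_simps)
  moreover have "smooth_fun (\<lambda>x. f x * partial_deriv j g x + partial_deriv j f x)"
   by (intro smooth_fun_add smooth_fun_mult f(1) smooth_fun_partial_deriv assms)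
  ultimately show ?thesis by (intro CollectI exI conjI)
 qed
qed

lemma iter_deriv_add:
 assumes "smooth_fun f" "smooth_fun g"
 shows "iter_deriv js (\<lambda>x. f x + g x) = (\<lambda>x. iter_deriv js f x + iter_deriv js g x)"
 using assms unfolding smooth_fun_def by (induct js) (auto simp: partial_deriv_add)

lemma iter_deriv_cmult:
 assumes "smooth_fun f"
 shows "iter_deriv js (\<lambda>x. c * f x) = (\<lambda>x. c * iter_deriv js f x)"
 using assms unfolding smooth_fun_def by (induct js) (auto simp: partial_deriv_cmult)

section \<open>Schwartz functions\<close>

lemma schwartz_iff:
 "schwartz \<phi> \<longleftrightarrow> smooth_fun \<phi> \<and>
   (\<forall>js N. \<exists>C. \<forall>x. (1 + norm x) ^ N * norm (iter_deriv js \<phi> x) \<le> C)"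
 unfolding schwartz_def bounded_iff by (auto simp: norm_mult)

lemma schwartz_coinduct:
 assumes "f \<in> A" "\<And>f x. f \<in> A ==> f differentiable (at x)"
  and "\<And>f j. f \<in> A ==> partial_deriv j f \<in> A"
  and "\<And>f N. f \<in> A ==> \<exists>C. \<forall>x. (1 + norm x) ^ N * norm (f x) \<le> C"
 shows "schwartz f"
 unfolding schwartz_iff
 using smooth_fun_coinduct[of f A] iter_deriv_mem[of A f] assms by blast

lemma schwartz_smooth: "schwartz \<phi> ==> smooth_fun \<phi>"
 by (simp add: schwartz_def)

lemmas schwartz_differentiable = smooth_fun_differentiable[OF schwartz_smooth]

lemma schwartz_partial_deriv:
 assumes "schwartz \<phi>" shows "schwartz (partial_deriv j \<phi>)"
 unfolding schwartz_iff
proof (intro conjI allI)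
 fix js N
 show "\<exists>C. \<forall>x. (1 + norm x) ^ N * norm (iter_deriv js (partial_deriv j \<phi>) x) \<le> C"
  using assms[unfolded schwartz_iff, THEN conjunct2, rule_format, of N "js @ [j]"] by simp
qed (simp add: assms schwartz_smooth smooth_fun_partial_deriv)

lemma schwartz_fast: "schwartz \<phi> ==> \<exists>C. \<forall>x. (1 + norm x) ^ N * norm (\<phi> x) \<le> C"
 using schwartz_iff[THEN iffD1, THEN conjunct2, rule_format, of \<phi> N "[]"] by simp

lemma schwartz_add:
 assumes "schwartz f" "schwartz g" shows "schwartz (\<lambda>x. f x + g x)"
 unfolding schwartz_iff
proof (intro conjI allI)
 fix js N
 obtain C D where "\<And>x. (1 + norm x) ^ N * norm (iter_deriv js f x) \<le> C"
  "\<And>x. (1 + norm x) ^ N * norm (iter_deriv js g x) \<le> D"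
  using assms unfolding schwartz_iff by metis
 moreover have "(1 + norm x) ^ N * norm (iter_deriv js (\<lambda>x. f x + g x) x)
   \<le> (1 + norm x) ^ N * norm (iter_deriv js f x) + (1 + norm x) ^ N * norm (iter_deriv js g x)" for x
  unfolding iter_deriv_add[OF assms[THEN schwartz_smooth]] distrib_left[symmetric]
  by (intro mult_left_mono norm_triangle_ineq) auto
 ultimately show "\<exists>C. \<forall>x. (1 + norm x) ^ N * norm (iter_deriv js (\<lambda>x. f x + g x) x) \<le> C"
  by (intro exI[of _ "C + D"]) (meson add_mono order_trans)
qed (simp add: assms schwartz_smooth smooth_fun_add)

text \<open>A smooth function whose derivatives grow polynomially is a multiplier of the Schwartz
  space.\<close>

lemma schwartz_mult_bounded:
 assumes "schwartz \<phi>" "smooth_fun g" "\<And>js. \<exists>C n. \<forall>x. norm (iter_deriv js g x) \<le> C * (1 + norm x) ^ n"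
 shows "schwartz (\<lambda>x. \<phi> x * g x)"
proof -
 define B where "B = {g. smooth_fun g \<and> (\<forall>js. \<exists>C n. \<forall>x. norm (iter_deriv js g x) \<le> C * (1 + norm x) ^ n)}"
 have Bd: "partial_deriv j f \<in> B" if "f \<in> B" for f j
 proof -
  have "iter_deriv js (partial_deriv j f) = iter_deriv (js @ [j]) f" for js by simp
  moreover have "\<exists>C n. \<forall>x. norm (iter_deriv (js @ [j]) f x) \<le> C * (1 + norm x) ^ n" for js
   using that unfolding B_def by blast
  ultimately show ?thesis using that unfolding B_def by (simp add: smooth_fun_partial_deriv)
 qed
 let ?A = "prod_sums {f. schwartz f} B"
 have dif: "f differentiable (at x)" if "f \<in> {f. schwartz f} \<union> B" for f x
  using that by (auto simp: B_def schwartz_differentiable smooth_fun_differentiable)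
 show ?thesis
 proof (rule schwartz_coinduct[of _ ?A])
  show "(\<lambda>x. \<phi> x * g x) \<in> ?A" using assms by (intro prod_sums.intros) (auto simp: B_def)
  show "f differentiable (at x)" if "f \<in> ?A" for f x
   using that by (rule prod_sums_differentiable[rotated]) (auto intro: dif)
  show "partial_deriv j f \<in> ?A" if "f \<in> ?A" for f j
   using that by (rule prod_sums_partial_deriv[rotated 3]) (auto intro: dif Bd simp: schwartz_partial_deriv)
  show "\<exists>C. \<forall>x. (1 + norm x) ^ N * norm (f x) \<le> C" if "f \<in> ?A" for f N
   using that
  proof induct
   case (prod f g)
   obtain D n where D: "\<And>x. norm (g x) \<le> D * (1 + norm x) ^ n"
   proof -
    have "\<exists>C n. \<forall>x. norm (iter_deriv [] g x) \<le> C * (1 + norm x) ^ n"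
     using prod(2) unfolding B_def by blast
    then show ?thesis using that by auto
   qed
   obtain C where C: "\<And>x. (1 + norm x) ^ (N + n) * norm (f x) \<le> C"
    using schwartz_fast prod(1) by blast
   have D0: "D \<ge> 0" using order_trans[OF norm_ge_zero[of "g 0"] D[of 0]] by simp
   have "(1 + norm x) ^ N * norm (f x * g x) \<le> C * D" for x
   proof -
    have "(1 + norm x) ^ N * norm (f x * g x) \<le> (1 + norm x) ^ N * (norm (f x) * (D * (1 + norm x) ^ n))"
     unfolding norm_mult by (intro mult_left_mono D) auto
    also have "... = ((1 + norm x) ^ (N + n) * norm (f x)) * D" by (simp add: power_add)
    also have "... \<le> C * D" by (intro mult_right_mono C D0)
    finally show ?thesis .
   qed
   then show ?case by blast
  next
   case (sum f g)
   then obtain C D where "\<And>x. (1 + norm x) ^ N * norm (f x) \<le> C" "\<And>x. (1 + norm x) ^ N * norm (g x) \<le> D" by blast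
   moreover have "(1 + norm x) ^ N * norm (f x + g x)
     \<le> (1 + norm x) ^ N * norm (f x) + (1 + norm x) ^ N * norm (g x)" for x
    unfolding distrib_left[symmetric] by (intro mult_left_mono norm_triangle_ineq) auto
   ultimately show ?case by (intro exI[of _ "C + D"]) (meson add_mono order_trans)
  qed
 qed
qed

lemma schwartz_cmult: assumes "schwartz f" shows "schwartz (\<lambda>x. c * f x)"
proof -
 have "iter_deriv js (\<lambda>x. c) \<in> {\<lambda>x. c |c. True}" for js
  by (rule iter_deriv_mem) (auto simp: partial_deriv_const)
 then have "\<exists>d. iter_deriv js (\<lambda>x. c) = (\<lambda>x. d)" for js by blast
 then obtain d where d: "\<And>js. iter_deriv js (\<lambda>x. c) = (\<lambda>x. d js)" by metis
 have "\<exists>C n. \<forall>x. norm (iter_deriv js (\<lambda>x. c) x) \<le> C * (1 + norm x) ^ n" for js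
  unfolding d by (rule exI[of _ "norm (d js)"], rule exI[of _ 0]) simp
 from schwartz_mult_bounded[OF assms smooth_fun_const this] show ?thesis
  by (simp add: mult.commute)
qed

lemma schwartz_coord_mult: assumes "schwartz f" shows "schwartz (\<lambda>x. cr (x $ j) * f x)"
proof -
 have "iter_deriv js (\<lambda>x. cr (x $ j)) \<in> {\<lambda>x. cr (x $ j)} \<union> {\<lambda>x. c |c. True}" for js
  by (rule iter_deriv_mem) (auto simp: partial_deriv_const partial_deriv_coord)
 then have "\<exists>C n. \<forall>x. norm (iter_deriv js (\<lambda>x. cr (x $ j)) x) \<le> C * (1 + norm x) ^ n" for js
 proof -
  consider "iter_deriv js (\<lambda>x. cr (x $ j)) = (\<lambda>x. cr (x $ j))"
   | c where "iter_deriv js (\<lambda>x. cr (x $ j)) = (\<lambda>x. c)"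
   using \<open>iter_deriv js _ \<in> _\<close> by auto
  then show ?thesis
  proof cases
   case 1
   have "norm (cr (x $ j)) \<le> 1 * (1 + norm x) ^ 1" for x
    using component_le_norm_cart[of x j] by simp
   then show ?thesis unfolding 1 by blast
  next
   case 2
   have "norm c \<le> norm c * (1 + norm x) ^ 0" for x :: "real^3" by simp
   then show ?thesis unfolding 2 by blast
  qed
 qed
 from schwartz_mult_bounded[OF assms smooth_fun_coord this] show ?thesis
  by (simp add: mult.commute)
qed

section \<open>Schwartz seminorms\<close>

lemma finite_lists_le: "finite {js :: 3 list. length js \<le> N}"
 using finite_lists_length_le[of "UNIV :: 3 set" N] by simp

lemma schwartz_norm_upper:
 assumes "schwartz \<phi>" "length js \<le> N"
 shows "(1 + norm x) ^ N * norm (iter_deriv js \<phi> x) \<le> schwartz_norm N \<phi>"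
proof -
 obtain C where C: "\<And>js x. (1 + norm x) ^ N * norm (iter_deriv js \<phi> x) \<le> C js"
 proof -
  have "\<forall>js. \<exists>C. \<forall>x. (1 + norm x) ^ N * norm (iter_deriv js \<phi> x) \<le> C"
   using assms(1)[unfolded schwartz_iff] by blast
  from choice[OF this] that show ?thesis by blast
 qed
 have "(1 + norm x) ^ N * norm (iter_deriv js \<phi> x) \<le> Max (C ` {js. length js \<le> N})"
  if "length js \<le> N" for js x
  by (rule order_trans[OF C Max_ge]) (use that finite_lists_le in auto)
 then have "bdd_above ((\<lambda>(js, x). (1 + norm x) ^ N * norm (iter_deriv js \<phi> x)) ` ({js. length js \<le> N} \<times> UNIV))"
  by (intro bdd_aboveI) auto
 from cSUP_upper[OF _ this, of "(js, x)"] assms(2) show ?thesis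
  unfolding schwartz_norm_def by auto
qed

lemma schwartz_norm_le:
 assumes "\<And>js x. length js \<le> N ==> (1 + norm x) ^ N * norm (iter_deriv js \<phi> x) \<le> c"
 shows "schwartz_norm N \<phi> \<le> c"
 unfolding schwartz_norm_def
proof (rule cSUP_least)
 show "{js::3 list. length js \<le> N} \<times> (UNIV :: (real^3) set) \<noteq> {}" by (auto intro: exI[of _ "[]"])
qed (use assms in auto)

lemma schwartz_norm_nonneg: "schwartz \<phi> ==> 0 \<le> schwartz_norm N \<phi>"
 using order_trans[OF norm_ge_zero[of "\<phi> 0"], of "schwartz_norm N \<phi>"] schwartz_norm_upper[of \<phi> "[]" N 0]
 by simp

lemma schwartz_norm_mono:
 assumes "schwartz \<phi>" "N \<le> M" shows "schwartz_norm N \<phi> \<le> schwartz_norm M \<phi>"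
proof (rule schwartz_norm_le)
 fix js :: "3 list" and x :: "real^3" assume "length js \<le> N"
 have "(1 + norm x) ^ N * norm (iter_deriv js \<phi> x) \<le> (1 + norm x) ^ M * norm (iter_deriv js \<phi> x)"
  using assms by (intro mult_right_mono power_increasing) auto
 also have "... \<le> schwartz_norm M \<phi>"
  using \<open>length js \<le> N\<close> assms by (intro schwartz_norm_upper) auto
 finally show "(1 + norm x) ^ N * norm (iter_deriv js \<phi> x) \<le> schwartz_norm M \<phi>" .
qed

lemma schwartz_norm_partial_deriv:
 assumes "schwartz \<phi>" shows "schwartz_norm N (partial_deriv j \<phi>) \<le> schwartz_norm (Suc N) \<phi>"
proof (rule schwartz_norm_le)
 fix js :: "3 list" and x :: "real^3" assume js: "length js \<le> N"
 have "(1 + norm x) ^ N * norm (iter_deriv js (partial_deriv j \<phi>) x)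
   = (1 + norm x) ^ N * norm (iter_deriv (js @ [j]) \<phi> x)" by simp
 also have "... \<le> (1 + norm x) ^ (Suc N) * norm (iter_deriv (js @ [j]) \<phi> x)"
  by (intro mult_right_mono power_increasing) auto
 also have "... \<le> schwartz_norm (Suc N) \<phi>"
  using js assms by (intro schwartz_norm_upper) auto
 finally show "(1 + norm x) ^ N * norm (iter_deriv js (partial_deriv j \<phi>) x) \<le> schwartz_norm (Suc N) \<phi>" .
qed

text \<open>Differentiating \<open>x\<^sub>j f\<close> produces \<open>x\<^sub>j \<partial> f\<close> and at
  most \<open>length js\<close> lower order terms.\<close>

lemma schwartz_norm_coord_mult:
 assumes "schwartz \<phi>"
 shows "schwartz_norm N (\<lambda>x. cr (x $ j) * \<phi> x) \<le> (1 + N) * schwartz_norm (2 * N + 1) \<phi>"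
proof -
 have *: "(1 + norm x) ^ N * norm (iter_deriv js (\<lambda>x. cr (x $ j) * \<phi> x) x)
   \<le> (1 + length js) * schwartz_norm (N + 1 + length js) \<phi>" if "schwartz \<phi>" for js \<phi> x
  using that
 proof (induct js arbitrary: \<phi> rule: rev_induct)
  case Nil
  have "(1 + norm x) ^ N * (\<bar>x $ j\<bar> * norm (\<phi> x)) \<le> (1 + norm x) ^ N * ((1 + norm x) * norm (\<phi> x))"
   using component_le_norm_cart[of x j] by (intro mult_mono) auto
  also have "... \<le> schwartz_norm (N + 1) \<phi>"
   using schwartz_norm_upper[of \<phi> "[]" "N + 1" x] Nil by (simp add: mult_ac)
  finally show ?case by (simp add: norm_mult)
 next
  case (snoc k js)
  let ?m = "\<lambda>\<phi> x. cr (x $ j) * \<phi> x"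
  have "partial_deriv k (?m \<phi>) = (\<lambda>x. ?m (partial_deriv k \<phi>) x + (if k = j then 1 else 0) * \<phi> x)"
   by (simp add: partial_deriv_mult differentiable_coord schwartz_differentiable snoc(2) partial_deriv_coord)
  then have eq: "iter_deriv (js @ [k]) (?m \<phi>)
    = (\<lambda>x. iter_deriv js (?m (partial_deriv k \<phi>)) x + (if k = j then 1 else 0) * iter_deriv js \<phi> x)"
   using snoc(2) by (simp add: iter_deriv_add iter_deriv_cmult schwartz_smooth smooth_fun_cmult
     schwartz_coord_mult schwartz_partial_deriv)
  have "(1 + norm x) ^ N * norm (iter_deriv (js @ [k]) (?m \<phi>) x)
   \<le> (1 + norm x) ^ N * (norm (iter_deriv js (?m (partial_deriv k \<phi>)) x) + 1 * norm (iter_deriv js \<phi> x))"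
   unfolding eq
   by (intro mult_left_mono order_trans[OF norm_triangle_ineq] add_mono) (auto simp: norm_mult)
  also have "... = (1 + norm x) ^ N * norm (iter_deriv js (?m (partial_deriv k \<phi>)) x)
    + (1 + norm x) ^ N * norm (iter_deriv js \<phi> x)"
   by (simp add: distrib_left)
  also have "... \<le> (1 + length js) * schwartz_norm (N + 1 + length js) (partial_deriv k \<phi>)
    + (1 + norm x) ^ (N + 1 + length (js @ [k])) * norm (iter_deriv js \<phi> x)"
   by (intro add_mono snoc schwartz_partial_deriv mult_right_mono power_increasing) auto
  also have "... \<le> (1 + length js) * schwartz_norm (N + 1 + length (js @ [k])) \<phi>
    + schwartz_norm (N + 1 + length (js @ [k])) \<phi>"
   using schwartz_norm_partial_deriv[OF snoc(2), of "N + 1 + length js" k]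
   by (intro add_mono mult_left_mono schwartz_norm_upper snoc(2)) auto
  finally show ?case by (simp add: algebra_simps)
 qed
 have "(1 + norm x) ^ N * norm (iter_deriv js (\<lambda>x. cr (x $ j) * \<phi> x) x)
  \<le> (1 + N) * schwartz_norm (2 * N + 1) \<phi>" if "length js \<le> N" for js x
  by (rule order_trans[OF *[OF assms]], rule mult_mono)
    (use that in \<open>auto intro!: schwartz_norm_mono schwartz_norm_nonneg assms\<close>)
 then show ?thesis by (intro schwartz_norm_le) simp
qed

lemma schwartz_norm_cmult:
 assumes "schwartz \<phi>" shows "schwartz_norm N (\<lambda>x. c * \<phi> x) \<le> norm c * schwartz_norm N \<phi>"
proof (rule schwartz_norm_le)
 fix js :: "3 list" and x :: "real^3" assume js: "length js \<le> N"
 show "(1 + norm x) ^ N * norm (iter_deriv js (\<lambda>x. c * \<phi> x) x) \<le> norm c * schwartz_norm N \<phi>"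
  using mult_left_mono[OF schwartz_norm_upper[OF assms js], of "norm c" x]
  by (simp add: iter_deriv_cmult[OF schwartz_smooth[OF assms]] norm_mult mult_ac)
qed

section \<open>Integrals over \<open>\<real>\<^sup>3\<close>\<close>

lemma Basis_real3: "(Basis :: (real^3) set) = range (\<lambda>j. axis j 1)"
 by (auto simp: Basis_vec_def)

lemma nn_integral_prod_coord:
 fixes f :: "real => ennreal"
 assumes [measurable]: "f \<in> borel_measurable borel"
 shows "(\<integral>\<^sup>+x. (\<Prod>j\<in>UNIV. f (x $ j)) \<partial>(lborel :: (real^3) measure)) = (\<integral>\<^sup>+y. f y \<partial>lborel) ^ 3"
proof -
 have inj: "inj (\<lambda>j::3. axis j (1::real))"
  by (auto simp: inj_on_def axis_eq_axis)
 have "(\<Prod>j\<in>UNIV. f (x $ j)) = (\<Prod>b\<in>Basis. f (x \<bullet> b))" for x :: "real^3"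
  unfolding Basis_real3 by (simp add: prod.reindex[OF inj] inner_axis)
 moreover have "(\<integral>\<^sup>+x. (\<Prod>b\<in>Basis. f (x \<bullet> b)) \<partial>(lborel :: (real^3) measure)) = (\<Prod>b\<in>(Basis :: (real^3) set). (\<integral>\<^sup>+y. f y \<partial>lborel))"
  by (rule nn_integral_lborel_prod[of "\<lambda>_. f"]) auto
 ultimately show ?thesis by simp
qed

lemma integrable_inverse_1_plus_square: "integrable lborel (\<lambda>x::real. inverse (1 + x\<^sup>2))"
 using Sinc_Integral.integrable_inverse_1_plus_square by (simp add: set_integrable_def)

text \<open>\<open>(1 + |x|)\<^sup>6\<close> dominates the product of the three factors \<open>1 +
  x\<^sub>j\<^sup>2\<close>, whose inverses are integrable in one variable.\<close>

lemma integrable_bracket: "integrable lborel (\<lambda>x::real^3. 1 / (1 + norm x) ^ 6)"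
proof (rule integrableI_bounded)
 have le: "enorm (1 / (1 + norm x) ^ 6) \<le> (\<Prod>j\<in>UNIV. ennreal (inverse (1 + (x $ j)\<^sup>2)))" for x :: "real^3"
 proof -
  have "(\<Prod>j\<in>(UNIV::3 set). 1 + (x $ j)\<^sup>2) \<le> (\<Prod>j\<in>(UNIV::3 set). (1 + norm x)\<^sup>2)"
  proof (rule prod_mono, goal_cases)
   case (1 j)
   have "(x $ j)\<^sup>2 \<le> (norm x)\<^sup>2" using component_le_norm_cart[of x j]
    using abs_le_square_iff[of "x $ j" "norm x"] by simp
   then show ?case
    by (simp add: power2_sum add_increasing2)
  qed
  also have "... = (1 + norm x) ^ 6" by (simp flip: power_mult)
  finally have "inverse ((1 + norm x) ^ 6) \<le> inverse (\<Prod>j\<in>(UNIV::3 set). 1 + (x $ j)\<^sup>2)"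
   by (intro le_imp_inverse_le prod_pos) (auto intro: add_pos_nonneg)
  then have "1 / (1 + norm x) ^ 6 \<le> (\<Prod>j\<in>(UNIV::3 set). inverse (1 + (x $ j)\<^sup>2))"
   using prod_inversef[of "\<lambda>j. 1 + (x $ j)\<^sup>2" "UNIV :: 3 set"] by (simp add: inverse_eq_divide comp_def)
  then show ?thesis by (subst prod_ennreal) (auto intro!: ennreal_leI)
 qed
 have "(\<integral>\<^sup>+x. enorm (1 / (1 + norm x) ^ 6) \<partial>(lborel :: (real^3) measure))
   \<le> (\<integral>\<^sup>+x. (\<Prod>j\<in>UNIV. ennreal (inverse (1 + (x $ j)\<^sup>2))) \<partial>(lborel :: (real^3) measure))"
  by (intro nn_integral_mono le)
 also have "... = (\<integral>\<^sup>+y. ennreal (inverse (1 + y\<^sup>2)) \<partial>lborel) ^ 3"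
  by (rule nn_integral_prod_coord) simp
 also have "... < \<infinity>"
  using integrable_inverse_1_plus_square[unfolded integrable_iff_bounded]
  by (simp add: power_less_top_ennreal)
 finally show "(\<integral>\<^sup>+x. enorm (1 / (1 + norm x) ^ 6) \<partial>(lborel :: (real^3) measure)) < \<infinity>" .
qed simp

definition bracket_int :: real where
 "bracket_int = (LINT x|(lborel :: (real^3) measure). 1 / (1 + norm x) ^ 6)"

lemma bracket_int_nonneg: "0 \<le> bracket_int"
 unfolding bracket_int_def by (rule integral_nonneg_AE) simp

lemma integrable_of_decay:
 fixes f :: "real^3 => complex"
 assumes [measurable]: "f \<in> borel_measurable borel"
  and C: "\<And>x. (1 + norm x) ^ 6 * norm (f x) \<le> C"
 shows "integrable lborel f" and "(LINT x|lborel. norm (f x)) \<le> C * bracket_int"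
proof -
 have le: "norm (f x) \<le> C * (1 / (1 + norm x) ^ 6)" for x
 proof -
  have "0 < (1 + norm x) ^ 6" by (intro zero_less_power add_pos_nonneg) auto
  then show ?thesis using C[of x] by (simp add: field_simps)
 qed
 have i: "integrable lborel (\<lambda>x::real^3. C * (1 / (1 + norm x) ^ 6))"
  by (intro integrable_mult_right integrable_bracket)
 show f: "integrable lborel f"
  by (rule Bochner_Integration.integrable_bound[OF i]) (use order_trans[OF le abs_ge_self] in auto)
 show "(LINT x|lborel. norm (f x)) \<le> C * bracket_int"
  unfolding bracket_int_def integral_mult_right_zero[symmetric]
  by (rule integral_mono[OF integrable_norm[OF f] i le])
qed

lemma integral_affine3:
 fixes f :: "real^3 => complex"
 assumes [measurable]: "f \<in> borel_measurable borel" and c: "c \<noteq> 0"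
 shows "(LINT x|lborel. f (t + c *\<^sub>R x)) = (LINT x|lborel. f x) / cr (\<bar>c\<bar> ^ 3)"
proof -
 have "(LINT x|lborel. f x) = (LINT x|Nonnegative_Lebesgue_Integration.density (distr lborel borel (\<lambda>x. t + c *\<^sub>R x)) (\<lambda>_. \<bar>c\<bar> ^ DIM(real^3)). f x)"
  by (rule arg_cong[where f = "\<lambda>M. LINT x|M. f x"], rule lborel_affine[OF c])
 also have "... = (LINT x|lborel. \<bar>c\<bar> ^ 3 *\<^sub>R f (t + c *\<^sub>R x))"
  by (subst integral_density) (auto simp: integral_distr)
 also have "... = cr (\<bar>c\<bar> ^ 3) * (LINT x|lborel. f (t + c *\<^sub>R x))"
  by (simp add: scaleR_conv_of_real)
 finally show ?thesis using c by simp
qed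

lemma integrable_affine3:
 fixes f :: "real^3 => complex"
 assumes "integrable lborel f" and c: "c \<noteq> 0"
 shows "integrable lborel (\<lambda>x. f (t + c *\<^sub>R x))"
proof -
 have [measurable]: "f \<in> borel_measurable borel" using assms by auto
 have "integrable (Nonnegative_Lebesgue_Integration.density (distr lborel borel (\<lambda>x. t + c *\<^sub>R x)) (\<lambda>_. ennreal (\<bar>c\<bar> ^ DIM(real^3)))) f"
  using assms(1) lborel_affine[OF c, of t] by (simp add: ennreal_power)
 then have "integrable lborel (\<lambda>x. \<bar>c\<bar> ^ 3 *\<^sub>R f (t + c *\<^sub>R x))"
  by (subst (asm) integrable_density) (auto simp: integrable_distr_eq)
 then have "integrable lborel (\<lambda>x. inverse (\<bar>c\<bar> ^ 3) *\<^sub>R \<bar>c\<bar> ^ 3 *\<^sub>R f (t + c *\<^sub>R x))"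
  by (rule integrable_scaleR_right)
 then show ?thesis using c by simp
qed

section \<open>The Fourier transform of decaying functions\<close>

abbreviation Fexp :: "real^3 => real^3 => complex" where
 "Fexp \<xi> x \<equiv> exp (- \<i> * cr (\<xi> \<bullet> x))"

lemma norm_Fexp [simp]: "norm (Fexp \<xi> x) = 1"
 using norm_exp_i_times[of "- (\<xi> \<bullet> x)"] by simp

lemma Fexp_measurable [measurable]: "(\<lambda>x. Fexp \<xi> x) \<in> borel_measurable borel"
 "(\<lambda>(\<xi>, x). Fexp \<xi> x) \<in> borel_measurable (borel \<Otimes>\<^sub>M borel)"
 by measurable

lemma integrable_Fexp:
 fixes f :: "real^3 => complex"
 assumes "integrable lborel f" shows "integrable lborel (\<lambda>x. Fexp \<xi> x * f x)"
 by (rule Bochner_Integration.integrable_bound[OF assms])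
   (use borel_measurable_integrable[OF assms] in \<open>auto simp: norm_mult\<close>)

lemma norm_fourier_fun_le:
 assumes "integrable lborel f"
 shows "norm (fourier_fun f \<xi>) \<le> (LINT x|lborel. norm (f x))"
 unfolding fourier_fun_def
 by (rule order_trans[OF integral_norm_bound]) (simp add: norm_mult)

lemma fourier_fun_cmult: "fourier_fun (\<lambda>x. c * f x) = (\<lambda>\<xi>. c * fourier_fun f \<xi>)"
proof
 fix \<xi>
 have "(LINT x|lborel. Fexp \<xi> x * (c * f x)) = (LINT x|lborel. c * (Fexp \<xi> x * f x))"
  by (simp add: mult_ac)
 then show "fourier_fun (\<lambda>x. c * f x) \<xi> = c * fourier_fun f \<xi>"
  unfolding fourier_fun_def by (simp only: integral_mult_right_zero)
qed

lemma fourier_fun_diff: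
 assumes "integrable lborel f" "integrable lborel g"
 shows "fourier_fun (\<lambda>x. f x - g x) \<xi> = fourier_fun f \<xi> - fourier_fun g \<xi>"
 unfolding fourier_fun_def using integrable_Fexp[OF assms(1), of \<xi>] integrable_Fexp[OF assms(2), of \<xi>]
 by (simp add: right_diff_distrib)

lemma fourier_fun_translate:
 assumes [measurable]: "f \<in> borel_measurable borel"
 shows "fourier_fun (\<lambda>x. f (t + x)) \<xi> = exp (\<i> * cr (\<xi> \<bullet> t)) * fourier_fun f \<xi>"
proof -
 have "fourier_fun (\<lambda>x. f (t + x)) \<xi> = (LINT x|lborel. Fexp \<xi> (t + 1 *\<^sub>R x - t) * f (t + 1 *\<^sub>R x))"
  by (simp add: fourier_fun_def)
 also have "... = (LINT x|lborel. Fexp \<xi> (x - t) * f x)"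
  by (subst integral_affine3[of "\<lambda>x. Fexp \<xi> (x - t) * f x" 1 t]) auto
 also have "... = (LINT x|lborel. exp (\<i> * cr (\<xi> \<bullet> t)) * (Fexp \<xi> x * f x))"
  by (rule Bochner_Integration.integral_cong)
    (auto simp: inner_diff_right exp_diff exp_minus divide_simps algebra_simps exp_add)
 finally show ?thesis by (simp add: fourier_fun_def)
qed

lemma inner_real3: "x \<bullet> y = (\<Sum>j\<in>UNIV. x $ j * y $ j)" for x y :: "real^3"
 by (simp add: inner_vec_def)

text \<open>Differentiation under the integral, with the second order error
  \<open>|e\<^sup>-\<^sup>i\<^sup>h\<^sup>x - 1 + i h x| \<le> |h|\<^sup>2 |x|\<^sup>2\<close>, which decay of
  order 8 makes integrable.\<close>

lemma has_derivative_fourier_fun: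
 assumes [measurable]: "f \<in> borel_measurable borel"
  and C: "\<And>x. (1 + norm x) ^ 8 * norm (f x) \<le> C"
 shows "(fourier_fun f has_derivative
   (\<lambda>h. \<Sum>j\<in>UNIV. cr (h $ j) * fourier_fun (\<lambda>x. - \<i> * (cr (x $ j) * f x)) \<xi>)) (at \<xi>)"
  (is "(_ has_derivative ?L) _")
proof (rule has_derivativeI_sandwich[of 1])
 show "bounded_linear ?L"
  by (intro bounded_linear_sum bounded_linear_mult_const bounded_linear_compose[OF bounded_linear_of_real]
    bounded_linear_vec_nth)
 have C1: "(1 + norm x) ^ n * norm (f x) \<le> C" if "n \<le> 8" for x n
  by (rule order_trans[OF mult_right_mono[OF power_increasing] C]) (use that in auto)
 have i0: "integrable lborel f" by (rule integrable_of_decay[of f C]) (use C1[of 6] in auto)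
 have i1: "integrable lborel (\<lambda>x. - \<i> * (cr (x $ j) * f x))" for j
 proof (rule integrable_of_decay[of _ C])
  fix x :: "real^3"
  have "(1 + norm x) ^ 6 * norm (- \<i> * (cr (x $ j) * f x)) \<le> (1 + norm x) ^ 6 * ((1 + norm x) * norm (f x))"
   unfolding norm_mult using component_le_norm_cart[of x j] by (intro mult_left_mono) (auto intro!: mult_right_mono)
  also have "... = (1 + norm x) ^ 7 * norm (f x)" by (simp add: power_numeral_reduce)
  finally show "(1 + norm x) ^ 6 * norm (- \<i> * (cr (x $ j) * f x)) \<le> C"
   using C1[of 7 x] by simp
 qed simp
 have i2: "integrable lborel (\<lambda>x. cr ((norm x)\<^sup>2) * f x)"
 proof (rule integrable_of_decay[of _ C])
  fix x :: "real^3"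
  have "(1 + norm x) ^ 6 * norm (cr ((norm x)\<^sup>2) * f x) \<le> (1 + norm x) ^ 6 * ((1 + norm x)\<^sup>2 * norm (f x))"
   unfolding norm_mult by (intro mult_left_mono mult_right_mono) (auto intro!: power_mono simp: norm_power)
  also have "... = (1 + norm x) ^ 8 * norm (f x)" by (simp add: power_numeral_reduce)
  finally show "(1 + norm x) ^ 6 * norm (cr ((norm x)\<^sup>2) * f x) \<le> C"
   using C[of x] by simp
 qed simp
 define D where "D = (LINT x|lborel. norm (cr ((norm x)\<^sup>2) * f x))"
 show "norm (fourier_fun f y - fourier_fun f \<xi> - ?L (y - \<xi>)) / norm (y - \<xi>) \<le> norm (y - \<xi>) * D"
  if "y \<noteq> \<xi>" for y
 proof -
  define h where "h = y - \<xi>"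
  have "fourier_fun f y - fourier_fun f \<xi> - ?L h
   = (LINT x|lborel. Fexp y x * f x - Fexp \<xi> x * f x
     - (\<Sum>j\<in>UNIV. cr (h $ j) * (Fexp \<xi> x * (- \<i> * (cr (x $ j) * f x)))))"
   unfolding fourier_fun_def
   by (subst Bochner_Integration.integral_diff Bochner_Integration.integral_sum;
     (intro Bochner_Integration.integrable_diff integrable_Fexp i0 Bochner_Integration.integrable_sum
      integrable_mult_right i1)?)+
     (simp_all only: integral_mult_right_zero)
  also have "... = (LINT x|lborel. Fexp \<xi> x * (Fexp h x - 1 - (- \<i>) * cr (h \<bullet> x)) * f x)"
  proof (rule Bochner_Integration.integral_cong)
   fix x
   have "Fexp y x = Fexp \<xi> x * Fexp h x"
    by (simp add: h_def inner_diff_left exp_add[symmetric] algebra_simps)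
   then show "Fexp y x * f x - Fexp \<xi> x * f x
     - (\<Sum>j\<in>UNIV. cr (h $ j) * (Fexp \<xi> x * (- \<i> * (cr (x $ j) * f x))))
    = Fexp \<xi> x * (Fexp h x - 1 - (- \<i>) * cr (h \<bullet> x)) * f x"
    by (simp add: inner_real3 sum_distrib_left sum_distrib_right algebra_simps)
  qed simp
  finally have eq: "fourier_fun f y - fourier_fun f \<xi> - ?L h
   = (LINT x|lborel. Fexp \<xi> x * (Fexp h x - 1 - (- \<i>) * cr (h \<bullet> x)) * f x)" .
  have "norm (LINT x|lborel. Fexp \<xi> x * (Fexp h x - 1 - (- \<i>) * cr (h \<bullet> x)) * f x)
    \<le> (LINT x|lborel. (norm h)\<^sup>2 * norm (cr ((norm x)\<^sup>2) * f x))"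
  proof (rule order_trans[OF integral_norm_bound integral_mono])
   have le: "norm (Fexp \<xi> x * (Fexp h x - 1 - (- \<i>) * cr (h \<bullet> x)) * f x)
     \<le> (norm h)\<^sup>2 * norm (cr ((norm x)\<^sup>2) * f x)" for x
   proof -
    have "norm (Fexp h x - 1 - (- \<i>) * cr (h \<bullet> x)) \<le> \<bar>- (h \<bullet> x)\<bar>\<^sup>2 / 2"
     using iexp_approx1[of "- (h \<bullet> x)" 1] by (simp add: numeral_2_eq_2 algebra_simps)
    also have "... \<le> (norm h)\<^sup>2 * (norm x)\<^sup>2"
     using power_mono[OF Cauchy_Schwarz_ineq2[of h x], of 2]
      mult_nonneg_nonneg[OF zero_le_power2[of "norm h"] zero_le_power2[of "norm x"]]
     by (simp add: power_mult_distrib del: zero_le_power2 mult_nonneg_nonneg)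
    finally have "norm (Fexp h x - 1 - (- \<i>) * cr (h \<bullet> x)) * norm (f x)
     \<le> (norm h)\<^sup>2 * (norm x)\<^sup>2 * norm (f x)" by (rule mult_right_mono) simp
    then show ?thesis by (simp only: norm_mult norm_Fexp norm_power norm_of_real) (simp add: mult_ac)
   qed
   show "norm (Fexp \<xi> x * (Fexp h x - 1 - (- \<i>) * cr (h \<bullet> x)) * f x)
     \<le> (norm h)\<^sup>2 * norm (cr ((norm x)\<^sup>2) * f x)" for x by (rule le)
   show I: "integrable lborel (\<lambda>x. (norm h)\<^sup>2 * norm (cr ((norm x)\<^sup>2) * f x))"
    by (intro integrable_mult_right integrable_norm i2)
   show "integrable lborel (\<lambda>x. norm (Fexp \<xi> x * (Fexp h x - 1 - (- \<i>) * cr (h \<bullet> x)) * f x))"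
    by (rule integrable_norm, rule Bochner_Integration.integrable_bound[OF I]) (use le in auto)
  qed
  also have "... = (norm h)\<^sup>2 * D" by (simp only: D_def integral_mult_right_zero)
  finally have "norm (fourier_fun f y - fourier_fun f \<xi> - ?L h) / norm h \<le> norm h * D"
   unfolding eq using that by (simp add: h_def divide_simps power2_eq_square mult_ac)
  then show ?thesis by (simp only: h_def)
 qed
 have "((\<lambda>y. norm (y - \<xi>) * D) \<longlongrightarrow> norm (\<xi> - \<xi>) * D) (at \<xi>)"
  by (intro tendsto_intros)
 then show "((\<lambda>y. norm (y - \<xi>) * D) \<longlongrightarrow> 0) (at \<xi>)" by simp
qed simp

lemma partial_deriv_measurable:
 assumes "\<And>x. f differentiable (at x)"
 shows "partial_deriv j f \<in> borel_measurable borel"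
  and "(\<lambda>n. (f (x + inverse (Suc n) *\<^sub>R axis j 1) - f x) * cr (Suc n)) \<longlonglongrightarrow> partial_deriv j f x"
proof -
 have f: "f \<in> borel_measurable borel"
  by (intro borel_measurable_continuous_onI continuous_at_imp_continuous_on ballI
    differentiable_imp_continuous_within assms)
 have lim: "(\<lambda>n. (f (x + inverse (Suc n) *\<^sub>R axis j 1) - f x) * cr (Suc n)) \<longlonglongrightarrow> partial_deriv j f x" for x
 proof -
  have "((\<lambda>t. f (x + t *\<^sub>R axis j 1)) has_derivative (\<lambda>t. frechet_derivative f (at x) (t *\<^sub>R axis j 1))) (at (0::real))"
   by (rule has_derivative_compose[of "\<lambda>t. x + t *\<^sub>R axis j 1" "\<lambda>t. t *\<^sub>R axis j 1"])
     (auto intro!: derivative_eq_intros has_derivative_frechet assms)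
  moreover have "frechet_derivative f (at x) (t *\<^sub>R axis j 1) = t *\<^sub>R partial_deriv j f x" for t
   unfolding partial_deriv_def
   by (rule linear_scale[OF linear_frechet_derivative[OF assms]])
  ultimately have "((\<lambda>t. f (x + t *\<^sub>R axis j 1)) has_vector_derivative partial_deriv j f x) (at (0::real))"
   by (simp add: has_vector_derivative_def)
  then have "((\<lambda>t. (f (x + t *\<^sub>R axis j 1) - f x) /\<^sub>R t) \<longlongrightarrow> partial_deriv j f x) (at (0::real))"
   (is "(?q \<longlongrightarrow> ?v) _")
  proof -
   assume "((\<lambda>t. f (x + t *\<^sub>R axis j 1)) has_vector_derivative ?v) (at (0::real))"
   then have "((\<lambda>t. norm (f (x + t *\<^sub>R axis j 1) - f x - t *\<^sub>R ?v) / norm t) \<longlongrightarrow> 0) (at (0::real))"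
    unfolding has_vector_derivative_def has_derivative_at by simp
   then have "((\<lambda>t. norm (?q t - ?v)) \<longlongrightarrow> 0) (at (0::real))"
   proof (rule Lim_transform_eventually)
    have "norm (f (x + t *\<^sub>R axis j 1) - f x - t *\<^sub>R ?v) / norm t = norm (?q t - ?v)" if "t \<noteq> 0" for t :: real
    proof -
     have "?q t - ?v = (f (x + t *\<^sub>R axis j 1) - f x - t *\<^sub>R ?v) /\<^sub>R t"
      using that by (simp add: scaleR_diff_right)
     then show ?thesis by (simp add: divide_inverse mult.commute)
    qed
    then show "\<forall>\<^sub>F t in at 0. norm (f (x + t *\<^sub>R axis j 1) - f x - t *\<^sub>R ?v) / norm t = norm (?q t - ?v)"
     by (simp add: eventually_at_filter)
   qed
   then show ?thesis by (simp add: tendsto_norm_zero_iff LIM_zero_iff)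
  qed
  moreover have "filterlim (\<lambda>n. inverse (real (Suc n))) (at 0) sequentially"
   unfolding filterlim_at using LIMSEQ_inverse_real_of_nat by (auto)
  ultimately have "(\<lambda>n. (f (x + inverse (Suc n) *\<^sub>R axis j 1) - f x) /\<^sub>R inverse (Suc n)) \<longlonglongrightarrow> partial_deriv j f x"
   by (rule filterlim_compose)
  then show ?thesis by (simp add: scaleR_conv_of_real mult.commute)
 qed
 show "partial_deriv j f \<in> borel_measurable borel"
  by (rule borel_measurable_LIMSEQ_metric[OF _ lim]) (use f in measurable)
 show "(\<lambda>n. (f (x + inverse (Suc n) *\<^sub>R axis j 1) - f x) * cr (Suc n)) \<longlonglongrightarrow> partial_deriv j f x"
  by (rule lim)
qed

lemma bracket_pos: "0 < (1 + norm x) ^ n"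
 by (intro zero_less_power add_pos_nonneg) auto

lemma decay_difference_quotient:
 assumes d: "\<And>x. f differentiable (at x)"
  and C: "\<And>x. (1 + norm x) ^ 6 * norm (partial_deriv j f x) \<le> C"
 shows "(1 + norm x) ^ 6 * norm ((f (x + inverse (Suc n) *\<^sub>R axis j 1) - f x) * cr (Suc n)) \<le> 2 ^ 6 * C"
proof -
 define h where "h = inverse (real (Suc n))"
 have h: "0 < h" "h \<le> 1" by (auto simp: h_def divide_simps)
 have D: "((\<lambda>t. f (x + t *\<^sub>R axis j 1)) has_derivative (\<lambda>s. s *\<^sub>R partial_deriv j f (x + t *\<^sub>R axis j 1))) (at t within {0..h})" for t
 proof -
  have "((\<lambda>t. f (x + t *\<^sub>R axis j 1)) has_derivative (\<lambda>s. frechet_derivative f (at (x + t *\<^sub>R axis j 1)) (s *\<^sub>R axis j 1))) (at t within {0..h})"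
   by (rule has_derivative_compose[of "\<lambda>t. x + t *\<^sub>R axis j 1" "\<lambda>t. t *\<^sub>R axis j 1"])
     (auto intro!: derivative_eq_intros has_derivative_frechet d)
  moreover have "frechet_derivative f (at y) (t *\<^sub>R axis j 1) = t *\<^sub>R partial_deriv j f y" for t y
   unfolding partial_deriv_def by (rule linear_scale[OF linear_frechet_derivative[OF d]])
  ultimately show ?thesis by simp
 qed
 have B: "norm (partial_deriv j f (x + t *\<^sub>R axis j 1)) \<le> 2 ^ 6 * C / (1 + norm x) ^ 6" if t: "t \<in> {0..h}" for t
 proof -
  let ?y = "x + t *\<^sub>R axis j 1"
  have "norm x \<le> norm ?y + norm (t *\<^sub>R axis j (1::real) :: real^3)"
   using norm_triangle_ineq4[of ?y "t *\<^sub>R axis j 1"] by simp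
  also have "... \<le> norm ?y + 1" using t h by simp
  finally have "norm x \<le> norm ?y + 1" .
  moreover have "0 \<le> norm ?y" by simp
  ultimately have "1 + norm x \<le> 2 * (1 + norm ?y)" unfolding distrib_left by linarith
  then have "(1 + norm x) ^ 6 \<le> (2 * (1 + norm ?y)) ^ 6" by (intro power_mono) auto
  then have "(1 + norm x) ^ 6 * norm (partial_deriv j f ?y) \<le> (2 * (1 + norm ?y)) ^ 6 * norm (partial_deriv j f ?y)"
   by (intro mult_right_mono) auto
  also have "... \<le> 2 ^ 6 * C" unfolding power_mult_distrib using C[of ?y] by simp
  finally show ?thesis
   by (simp add: pos_le_divide_eq[OF bracket_pos] mult.commute)
 qed
 have "norm (f (x + h *\<^sub>R axis j 1) - f (x + 0 *\<^sub>R axis j 1)) \<le> 2 ^ 6 * C / (1 + norm x) ^ 6 * norm (h - 0)"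
 proof (rule differentiable_bound[OF _ D])
  fix t assume "t \<in> {0..h}"
  show "onorm (\<lambda>s. s *\<^sub>R partial_deriv j f (x + t *\<^sub>R axis j 1)) \<le> 2 ^ 6 * C / (1 + norm x) ^ 6"
   using B[OF \<open>t \<in> {0..h}\<close>] onorm_scaleR_left[of "\<lambda>s::real. s" "partial_deriv j f (x + t *\<^sub>R axis j 1)"]
   by (simp add: onorm_id[unfolded id_def] bounded_linear_ident)
 qed (use h in auto)
 then have "norm ((f (x + h *\<^sub>R axis j 1) - f x) * cr (Suc n)) \<le> 2 ^ 6 * C / (1 + norm x) ^ 6"
 proof -
  let ?K = "2 ^ 6 * C / (1 + norm x) ^ 6"
  assume "norm (f (x + h *\<^sub>R axis j 1) - f (x + 0 *\<^sub>R axis j 1)) \<le> ?K * norm (h - 0)"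
  then have "norm (f (x + h *\<^sub>R axis j 1) - f x) * Suc n \<le> (?K * h) * Suc n"
   using h by (intro mult_right_mono) auto
  also have "(?K * h) * Suc n = ?K" by (simp add: h_def del: of_nat_Suc)
  finally show ?thesis by (simp only: norm_mult norm_of_real abs_of_nat)
 qed
 then show ?thesis unfolding pos_le_divide_eq[OF bracket_pos] by (simp only: h_def mult.commute)
qed

text \<open>The difference quotients are dominated by the decay of the derivative (mean value inequality), and
  the transform of a difference quotient is explicit; integration by parts is thus avoided.\<close>

lemma fourier_fun_partial_deriv:
 assumes d: "\<And>x. f differentiable (at x)"
  and i: "integrable lborel f"
  and C: "\<And>x. (1 + norm x) ^ 6 * norm (partial_deriv j f x) \<le> C"
 shows "fourier_fun (partial_deriv j f) \<xi> = \<i> * cr (\<xi> $ j) * fourier_fun f \<xi>"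
proof -
 have [measurable]: "f \<in> borel_measurable borel" using i by auto
 let ?q = "\<lambda>n x. (f (x + inverse (Suc n) *\<^sub>R axis j 1) - f x) * cr (Suc n)"
 let ?h = "\<lambda>n. inverse (real (Suc n))"
 have "(\<lambda>n. LINT x|lborel. Fexp \<xi> x * ?q n x) \<longlonglongrightarrow> (LINT x|lborel. Fexp \<xi> x * partial_deriv j f x)"
 proof (rule integral_dominated_convergence)
  show "integrable lborel (\<lambda>x::real^3. 2 ^ 6 * C * (1 / (1 + norm x) ^ 6))"
   by (intro integrable_mult_right integrable_bracket)
  show "AE x in lborel. (\<lambda>n. Fexp \<xi> x * ?q n x) \<longlonglongrightarrow> Fexp \<xi> x * partial_deriv j f x"
   by (intro AE_I2 tendsto_intros partial_deriv_measurable(2) d)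
  show "AE x in lborel. norm (Fexp \<xi> x * ?q n x) \<le> 2 ^ 6 * C * (1 / (1 + norm x) ^ 6)" for n
  proof (rule AE_I2, goal_cases)
   case (1 x)
   show ?case
    unfolding norm_mult[of "Fexp \<xi> x"] norm_Fexp times_divide_eq_right mult_1_left mult_1_right
     pos_le_divide_eq[OF bracket_pos]
    by (subst mult.commute) (rule decay_difference_quotient[OF d C])
  qed
 qed (use partial_deriv_measurable(1)[OF d] in measurable)
 moreover have "(LINT x|lborel. Fexp \<xi> x * ?q n x)
   = (exp (\<i> * cr (\<xi> $ j * ?h n)) - 1) * cr (Suc n) * fourier_fun f \<xi>" for n
 proof -
  have it: "integrable lborel (\<lambda>x. f (?h n *\<^sub>R axis j 1 + x))"
   using integrable_affine3[OF i, of 1 "?h n *\<^sub>R axis j 1"] by simp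
  have "(LINT x|lborel. Fexp \<xi> x * ?q n x)
   = cr (Suc n) * fourier_fun (\<lambda>x. f (?h n *\<^sub>R axis j 1 + x) - f x) \<xi>"
   unfolding fourier_fun_def integral_mult_right_zero[symmetric] by (simp add: mult_ac add_ac)
  also have "... = cr (Suc n) * (exp (\<i> * cr (\<xi> \<bullet> (?h n *\<^sub>R axis j 1))) * fourier_fun f \<xi> - fourier_fun f \<xi>)"
   by (subst fourier_fun_diff[OF it i], subst fourier_fun_translate) simp_all
  finally show ?thesis by (simp add: inner_axis algebra_simps)
 qed
 moreover have "(\<lambda>n. (exp (\<i> * cr (\<xi> $ j * ?h n)) - 1) * cr (Suc n) * fourier_fun f \<xi>)
   \<longlonglongrightarrow> \<i> * cr (\<xi> $ j) * fourier_fun f \<xi>"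
 proof -
  have "((\<lambda>z. exp (\<i> * cr (\<xi> $ j) * z)) has_field_derivative \<i> * cr (\<xi> $ j)) (at 0)"
   by (auto intro!: derivative_eq_intros)
  then have "((\<lambda>z. (exp (\<i> * cr (\<xi> $ j) * z) - 1) / z) \<longlongrightarrow> \<i> * cr (\<xi> $ j)) (at 0)"
   by (simp add: DERIV_def)
  moreover have "filterlim (\<lambda>n. cr (?h n)) (at 0) sequentially"
  proof -
   have "(\<lambda>n. cr (?h n)) \<longlonglongrightarrow> cr 0"
    by (intro tendsto_of_real LIMSEQ_inverse_real_of_nat)
   then show ?thesis unfolding filterlim_at by (auto simp del: of_nat_Suc)
  qed
  ultimately have "(\<lambda>n. (exp (\<i> * cr (\<xi> $ j) * cr (?h n)) - 1) / cr (?h n))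
    \<longlonglongrightarrow> \<i> * cr (\<xi> $ j)"
   by (rule filterlim_compose)
  from tendsto_mult_right[OF this, of "fourier_fun f \<xi>"] show ?thesis
   by (simp add: divide_inverse mult_ac del: of_nat_Suc)
 qed
 ultimately show ?thesis
  unfolding fourier_fun_def[of "partial_deriv j f"] by (metis (no_types, lifting) LIMSEQ_unique ext)
qed

section \<open>The Fourier transform on the Schwartz space\<close>

lemma schwartz_measurable: "schwartz \<phi> ==> \<phi> \<in> borel_measurable borel"
 by (simp add: smooth_fun_measurable schwartz_smooth)

lemma schwartz_decay:
 assumes "schwartz \<phi>" shows "(1 + norm x) ^ N * norm (\<phi> x) \<le> schwartz_norm N \<phi>"
 using schwartz_norm_upper[OF assms, of "[]" N x] by simp

lemma schwartz_integrable:
 assumes "schwartz \<phi>"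
 shows "integrable lborel \<phi>" "(LINT x|lborel. norm (\<phi> x)) \<le> schwartz_norm 6 \<phi> * bracket_int"
 using integrable_of_decay[OF schwartz_measurable schwartz_decay] assms by auto

lemma partial_deriv_fourier_fun:
 assumes "schwartz \<phi>"
 shows "partial_deriv j (fourier_fun \<phi>) = fourier_fun (\<lambda>x. - \<i> * (cr (x $ j) * \<phi> x))"
proof
 fix \<xi>
 show "partial_deriv j (fourier_fun \<phi>) \<xi> = fourier_fun (\<lambda>x. - \<i> * (cr (x $ j) * \<phi> x)) \<xi>"
  by (subst partial_deriv_eqI[OF has_derivative_fourier_fun[OF schwartz_measurable[OF assms] schwartz_decay[OF assms]]])
    (simp add: axis_def if_distrib[of cr] if_distrib[of "\<lambda>a. a * _"] cong: if_cong)
qed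

lemma fourier_fun_schwartz_partial_deriv:
 assumes "schwartz \<phi>"
 shows "fourier_fun (partial_deriv j \<phi>) \<xi> = \<i> * cr (\<xi> $ j) * fourier_fun \<phi> \<xi>"
 by (rule fourier_fun_partial_deriv[OF schwartz_differentiable[OF assms] schwartz_integrable(1)[OF assms]
    schwartz_decay[OF schwartz_partial_deriv[OF assms]]])

text \<open>Each power of the frequency is paid for with one derivative, by
  \<open>fourier_fun_schwartz_partial_deriv\<close>.\<close>

lemma fourier_fun_decay:
 assumes "schwartz \<phi>"
 shows "(1 + norm \<xi>) ^ N * norm (fourier_fun \<phi> \<xi>) \<le> 4 ^ N * bracket_int * schwartz_norm (6 + N) \<phi>"
 using assms
proof (induct N arbitrary: \<phi>)
 case 0
 then show ?case
  using order_trans[OF norm_fourier_fun_le schwartz_integrable(2)] schwartz_integrable(1)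
  by (simp add: mult.commute)
next
 case (Suc N)
 let ?F = "\<lambda>\<phi>. norm (fourier_fun \<phi> \<xi>)"
 have "norm \<xi> * ?F \<phi> \<le> (\<Sum>j\<in>UNIV. \<bar>\<xi> $ j\<bar>) * ?F \<phi>"
  by (intro mult_right_mono norm_le_l1_cart) auto
 also have "... = (\<Sum>j\<in>UNIV. ?F (partial_deriv j \<phi>))"
  using Suc(2) by (simp add: fourier_fun_schwartz_partial_deriv norm_mult sum_distrib_right)
 finally have "(1 + norm \<xi>) ^ N * ((1 + norm \<xi>) * ?F \<phi>)
   \<le> (1 + norm \<xi>) ^ N * (?F \<phi> + (\<Sum>j\<in>UNIV. ?F (partial_deriv j \<phi>)))"
  by (intro mult_left_mono) (auto simp: algebra_simps)
 also have "... = (1 + norm \<xi>) ^ N * ?F \<phi> + (\<Sum>j\<in>UNIV. (1 + norm \<xi>) ^ N * ?F (partial_deriv j \<phi>))"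
  by (simp add: distrib_left sum_distrib_left)
 also have "... \<le> 4 ^ N * bracket_int * schwartz_norm (6 + Suc N) \<phi>
   + (\<Sum>j\<in>(UNIV :: 3 set). 4 ^ N * bracket_int * schwartz_norm (6 + Suc N) \<phi>)"
 proof (intro add_mono sum_mono)
  show "(1 + norm \<xi>) ^ N * ?F \<phi> \<le> 4 ^ N * bracket_int * schwartz_norm (6 + Suc N) \<phi>"
   by (rule order_trans[OF Suc(1)]) (auto intro!: mult_left_mono schwartz_norm_mono Suc(2) bracket_int_nonneg)
  show "(1 + norm \<xi>) ^ N * ?F (partial_deriv j \<phi>) \<le> 4 ^ N * bracket_int * schwartz_norm (6 + Suc N) \<phi>" for j
   using schwartz_norm_partial_deriv[OF Suc(2), of "6 + N" j]
   by (intro order_trans[OF Suc(1)])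
     (auto intro!: mult_left_mono Suc(2) bracket_int_nonneg schwartz_partial_deriv)
 qed
 also have "... = 4 ^ Suc N * bracket_int * schwartz_norm (6 + Suc N) \<phi>" by simp
 finally show ?case by (simp add: mult_ac)
qed

lemma schwartz_fourier_fun:
 assumes "schwartz \<phi>" shows "schwartz (fourier_fun \<phi>)"
proof (rule schwartz_coinduct[of _ "fourier_fun ` {\<phi>. schwartz \<phi>}"])
 fix f N
 assume "f \<in> fourier_fun ` {\<phi>. schwartz \<phi>}"
 then obtain \<phi> where f: "f = fourier_fun \<phi>" and \<phi>: "schwartz \<phi>" by auto
 show "f differentiable (at x)" for x
  unfolding f using has_derivative_fourier_fun[OF schwartz_measurable[OF \<phi>] schwartz_decay[OF \<phi>], of x]
  by (auto simp: differentiable_def)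
 show "partial_deriv j f \<in> fourier_fun ` {\<phi>. schwartz \<phi>}" for j
  unfolding f by (auto simp only: partial_deriv_fourier_fun[OF \<phi>] intro!: imageI schwartz_cmult schwartz_coord_mult \<phi>)
 show "\<exists>C. \<forall>x. (1 + norm x) ^ N * norm (f x) \<le> C"
  unfolding f using fourier_fun_decay[OF \<phi>] by blast
qed (use assms in auto)

text \<open>The derivative next to the function turns into multiplication by a coordinate, hence induction
  over the list from its end.\<close>

lemma iter_deriv_fourier_fun_bound:
 "\<exists>C M. C \<ge> 0 \<and> (\<forall>js \<phi> \<xi>. length js \<le> n \<longrightarrow> schwartz \<phi> \<longrightarrow>
   (1 + norm \<xi>) ^ N * norm (iter_deriv js (fourier_fun \<phi>) \<xi>) \<le> C * schwartz_norm M \<phi>)"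
proof (induct n)
 case 0
 show ?case
  using fourier_fun_decay[of _ _ N]
  by (intro exI[of _ "4 ^ N * bracket_int"] exI[of _ "6 + N"]) (auto simp: bracket_int_nonneg)
next
 case (Suc n)
 then obtain C M where C: "C \<ge> 0" and IH: "\<And>js \<phi> \<xi>. length js \<le> n ==> schwartz \<phi> ==>
   (1 + norm \<xi>) ^ N * norm (iter_deriv js (fourier_fun \<phi>) \<xi>) \<le> C * schwartz_norm M \<phi>" by blast
 have "(1 + norm \<xi>) ^ N * norm (iter_deriv js (fourier_fun \<phi>) \<xi>) \<le> C * (1 + M) * schwartz_norm (2 * M + 1) \<phi>"
  if js: "length js \<le> Suc n" and \<phi>: "schwartz \<phi>" for js \<phi> \<xi>
 proof (cases js rule: rev_cases)
  case Nil
  have "C * schwartz_norm M \<phi> \<le> (C * (1 + M)) * schwartz_norm (2 * M + 1) \<phi>"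
   by (intro mult_mono schwartz_norm_mono \<phi> schwartz_norm_nonneg) (use C in \<open>auto simp: mult_le_cancel_left1\<close>)
  then show ?thesis using IH[of "[]" \<phi> \<xi>] \<phi> by (simp add: Nil)
 next
  case (snoc ks j)
  let ?\<psi> = "\<lambda>x. - \<i> * (cr (x $ j) * \<phi> x)"
  have \<psi>: "schwartz ?\<psi>" by (intro schwartz_cmult schwartz_coord_mult \<phi>)
  have "(1 + norm \<xi>) ^ N * norm (iter_deriv js (fourier_fun \<phi>) \<xi>) \<le> C * schwartz_norm M ?\<psi>"
   using IH[of ks ?\<psi> \<xi>] js \<psi> snoc by (simp add: partial_deriv_fourier_fun[OF \<phi>])
  also have "... \<le> C * (norm (- \<i>) * ((1 + M) * schwartz_norm (2 * M + 1) \<phi>))"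
   using schwartz_norm_coord_mult[OF \<phi>, of M j]
   by (intro mult_left_mono order_trans[OF schwartz_norm_cmult] schwartz_coord_mult \<phi> C) auto
  finally show ?thesis by (simp add: mult_ac)
 qed
 then show ?case using C by (intro exI[of _ "C * (1 + M)"] exI[of _ "2 * M + 1"]) auto
qed

lemma schwartz_norm_fourier_fun:
 "\<exists>C M. C \<ge> 0 \<and> (\<forall>\<phi>. schwartz \<phi> \<longrightarrow> schwartz_norm N (fourier_fun \<phi>) \<le> C * schwartz_norm M \<phi>)"
proof -
 obtain C M where C: "C \<ge> 0" and B: "\<forall>js \<phi> \<xi>. length js \<le> N \<longrightarrow> schwartz \<phi> \<longrightarrow>
   (1 + norm \<xi>) ^ N * norm (iter_deriv js (fourier_fun \<phi>) \<xi>) \<le> C * schwartz_norm M \<phi>"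
  using iter_deriv_fourier_fun_bound by blast
 have "schwartz_norm N (fourier_fun \<phi>) \<le> C * schwartz_norm M \<phi>" if "schwartz \<phi>" for \<phi>
  by (rule schwartz_norm_le) (use B that in blast)
 then show ?thesis using C by blast
qed

section \<open>The Gaussian and Fourier inversion\<close>

definition gauss :: "real^3 => complex" where
 "gauss x = cr (exp (- (x \<bullet> x) / 2))"

lemma gauss_measurable [measurable]: "gauss \<in> borel_measurable borel"
 unfolding gauss_def by measurable

lemma gauss_decay: "\<exists>C. \<forall>x. (1 + norm x) ^ N * norm (gauss x) \<le> C"
proof (intro exI allI)
 fix x :: "real^3"
 have "(1 + norm x) ^ N \<le> fact N * exp (1 + norm x)"
 proof -
  have "(1 + norm x) ^ N / fact N \<le> (\<Sum>n. (1 + norm x) ^ n / fact n)"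
   using sum_le_suminf[OF summable_exp_generic[of "1 + norm x"], of "{N}"]
   by (simp add: divide_inverse mult.commute)
  also have "... = exp (1 + norm x)" by (simp add: exp_def divide_inverse mult.commute)
  finally show ?thesis by (simp add: divide_simps mult.commute)
 qed
 also have "... \<le> fact N * exp (3/2 + (x \<bullet> x) / 2)"
 proof -
  have "0 \<le> (norm x - 1)\<^sup>2" by simp
  then have "1 + norm x \<le> 3/2 + (x \<bullet> x) / 2" by (simp add: power2_diff power2_norm_eq_inner)
  then show ?thesis by simp
 qed
 finally have "(1 + norm x) ^ N * norm (gauss x) \<le> fact N * exp (3/2 + (x \<bullet> x) / 2) * norm (gauss x)"
  by (intro mult_right_mono) auto
 also have "... = fact N * exp (3/2)" by (simp add: gauss_def exp_add[symmetric] mult.assoc)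
 finally show "(1 + norm x) ^ N * norm (gauss x) \<le> fact N * exp (3/2)" .
qed

lemma has_derivative_gauss:
 "(gauss has_derivative (\<lambda>h. - cr (x \<bullet> h) * gauss x)) (at x)"
proof -
 have "((\<lambda>x. exp (- (x \<bullet> x) / 2)) has_derivative (\<lambda>h. - (x \<bullet> h) * exp (- (x \<bullet> x) / 2))) (at x)"
  by (auto intro!: derivative_eq_intros simp: inner_commute fun_eq_iff)
 from bounded_linear.has_derivative[OF bounded_linear_of_real this] show ?thesis
  unfolding gauss_def[abs_def] by simp
qed

lemma gauss_differentiable: "gauss differentiable (at x)"
 using has_derivative_gauss differentiable_def by blast

lemma partial_deriv_gauss: "partial_deriv j gauss = (\<lambda>x. - (cr (x $ j) * gauss x))"
 by (rule ext, subst partial_deriv_eqI[OF has_derivative_gauss]) (simp add: inner_axis)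

lemma gauss_integrable: "integrable lborel gauss"
 using integrable_of_decay[OF gauss_measurable] gauss_decay by blast

text \<open>Both sides solve \<open>\<nabla>h = - \<xi> h\<close>, so that their quotient has derivative
  zero.\<close>

lemma fourier_fun_gauss: "fourier_fun gauss \<xi> = fourier_fun gauss 0 * gauss \<xi>"
proof -
 obtain C where C: "\<And>x. (1 + norm x) ^ 8 * norm (gauss x) \<le> C" using gauss_decay by blast
 have decay: "(1 + norm x) ^ 6 * norm (partial_deriv j gauss x) \<le> C" for x j
 proof -
  have "(1 + norm x) ^ 6 * norm (partial_deriv j gauss x) \<le> (1 + norm x) ^ 6 * ((1 + norm x)\<^sup>2 * norm (gauss x))"
   unfolding partial_deriv_gauss norm_minus_cancel norm_mult norm_of_real
  proof (intro mult_left_mono mult_right_mono)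
   show "\<bar>x $ j\<bar> \<le> (1 + norm x)\<^sup>2"
    using component_le_norm_cart[of x j] zero_le_power2[of "norm x"] norm_ge_zero[of x]
    unfolding power2_sum power_one mult_1_right by linarith
  qed auto
  also have "... = (1 + norm x) ^ 8 * norm (gauss x)" by (simp add: power_numeral_reduce)
  finally show ?thesis using C[of x] by simp
 qed
 have c: "fourier_fun (\<lambda>x. - \<i> * (cr (x $ j) * gauss x)) \<xi>
   = - cr (\<xi> $ j) * fourier_fun gauss \<xi>" for j \<xi>
  using fourier_fun_partial_deriv[OF gauss_differentiable gauss_integrable decay, of j \<xi>]
   fourier_fun_cmult[of \<i> "partial_deriv j gauss"]
  by (simp add: partial_deriv_gauss algebra_simps)
 define Q where "Q = (\<lambda>\<xi>. cr (exp ((\<xi> \<bullet> \<xi>) / 2)) * fourier_fun gauss \<xi>)"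
 have "(Q has_derivative (\<lambda>h. 0)) (at \<xi> within UNIV)" for \<xi>
 proof -
  have "((\<lambda>x. exp ((x \<bullet> x) / 2)) has_derivative (\<lambda>h. (\<xi> \<bullet> h) * exp ((\<xi> \<bullet> \<xi>) / 2))) (at \<xi>)"
   by (auto intro!: derivative_eq_intros simp: inner_commute fun_eq_iff)
  from has_derivative_mult[OF bounded_linear.has_derivative[OF bounded_linear_of_real this]
    has_derivative_fourier_fun[OF gauss_measurable C]]
  show ?thesis
   unfolding Q_def c
   by (rule has_derivative_eq_rhs)
     (auto simp: fun_eq_iff inner_real3 sum_distrib_left sum_distrib_right algebra_simps sum_negf)
 qed
 from has_derivative_zero_constant[OF convex_UNIV this] have "Q \<xi> = Q 0" by fastforce
 then have "cr (exp ((\<xi> \<bullet> \<xi>) / 2)) * fourier_fun gauss \<xi> = fourier_fun gauss 0" by (simp add: Q_def)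
 then have "gauss \<xi> * (cr (exp ((\<xi> \<bullet> \<xi>) / 2)) * fourier_fun gauss \<xi>) = gauss \<xi> * fourier_fun gauss 0" by simp
 moreover have "gauss \<xi> * cr (exp ((\<xi> \<bullet> \<xi>) / 2)) = 1"
  by (simp add: gauss_def exp_minus flip: of_real_mult exp_add)
 ultimately show ?thesis unfolding mult.assoc[symmetric] by (simp add: mult.commute)
qed

text \<open>The Gaussian factorises, and in one variable it is a multiple of the standard normal
  density.\<close>

lemma integral_gauss: "fourier_fun gauss 0 = cr (sqrt (2 * pi) ^ 3)"
proof -
 have 1: "(\<integral>\<^sup>+y. ennreal (exp (- y\<^sup>2 / 2)) \<partial>lborel) = ennreal (sqrt (2 * pi))"
 proof -
  have i: "integrable lborel (\<lambda>y::real. exp (- y\<^sup>2 / 2))" "(LINT y|lborel. exp (- y\<^sup>2 / 2)) = sqrt (2 * pi)"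
  proof -
   have eq: "(\<lambda>y. exp (- y\<^sup>2 / 2)) = (\<lambda>y. sqrt (2 * pi) * std_normal_density y)"
    by (auto simp: std_normal_density_def fun_eq_iff)
   have "integrable lborel (\<lambda>y. sqrt (2 * pi) * std_normal_density y)"
    by (intro integrable_mult_right integrable_normal_density) simp
   then show "integrable lborel (\<lambda>y::real. exp (- y\<^sup>2 / 2))" by (simp only: eq)
   show "(LINT y|lborel. exp (- y\<^sup>2 / 2)) = sqrt (2 * pi)"
    unfolding eq integral_mult_right_zero using integral_normal_density[of 1 0] by simp
  qed
  show ?thesis unfolding i(2)[symmetric] by (rule nn_integral_eq_integral[OF i(1)]) auto
 qed
 have "ennreal (LINT x|(lborel :: (real^3) measure). exp (- (x \<bullet> x) / 2)) = (\<integral>\<^sup>+x. ennreal (exp (- (x \<bullet> x) / 2)) \<partial>(lborel :: (real^3) measure))"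
  using gauss_integrable[unfolded gauss_def[abs_def] complex_of_real_integrable_eq]
  by (subst nn_integral_eq_integral) auto
 also have "... = (\<integral>\<^sup>+x. (\<Prod>j\<in>UNIV. ennreal (exp (- (x $ j)\<^sup>2 / 2))) \<partial>(lborel :: (real^3) measure))"
  by (rule nn_integral_cong)
    (simp add: prod_ennreal exp_sum[symmetric] inner_real3 power2_eq_square sum_negf sum_divide_distrib)
 also have "... = ennreal (sqrt (2 * pi)) ^ 3"
  by (subst nn_integral_prod_coord) (simp, simp only: 1)
 finally have "(LINT x|(lborel :: (real^3) measure). exp (- (x \<bullet> x) / 2)) = sqrt (2 * pi) ^ 3"
  by (subst (asm) ennreal_power) (auto simp: ennreal_inj integral_nonneg_AE simp del: real_sqrt_mult)
 then show ?thesis by (simp add: fourier_fun_def gauss_def integral_complex_of_real del: of_real_exp of_real_power)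
qed

lemma integrable_product:
 fixes f g :: "real^3 => complex"
 assumes f: "integrable lborel f" and g: "integrable lborel g"
  and [measurable]: "(\<lambda>(x, y). k x y) \<in> borel_measurable (borel \<Otimes>\<^sub>M borel)"
  and k: "\<And>x y. norm (k x y) \<le> K"
 shows "integrable (lborel \<Otimes>\<^sub>M lborel) (\<lambda>(x, y). k x y * (f x * g y) :: complex)"
proof -
 have [measurable]: "f \<in> borel_measurable borel" "g \<in> borel_measurable borel" using f g by auto
 have fg: "integrable (lborel \<Otimes>\<^sub>M lborel) (\<lambda>(x, y). f x * g y)"
 proof (rule lborel_pair.Fubini_integrable)
  show "integrable lborel (\<lambda>x. LINT y|lborel. norm (case (x, y) of (x, y) => f x * g y))"
   using f by (simp add: norm_mult)
  show "AE x in lborel. integrable lborel (\<lambda>y. case (x, y) of (x, y) => f x * g y)" using g by simp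
 qed simp
 from integrable_mult_right[OF integrable_norm[OF this], of K] show ?thesis
 proof (rule Bochner_Integration.integrable_bound)
  show "AE z in lborel \<Otimes>\<^sub>M lborel. norm (case z of (x, y) => k x y * (f x * g y)) \<le> norm (K * norm (case z of (x, y) => f x * g y))"
  proof (rule AE_I2, goal_cases)
   case (1 z)
   show ?case
    using k[of "fst z" "snd z"]
    by (auto simp: norm_mult abs_mult split: prod.split intro!: mult_right_mono)
  qed
 qed (simp add: lborel_prod[symmetric])
qed

text \<open>Fubini for \<open>e\<^sup>-\<^sup>i\<^sup>x\<^sup>\<xi> f x g \<xi>\<close>.\<close>

lemma fourier_fun_multiplication_formula:
 assumes f: "integrable lborel f" and g: "integrable lborel g"
 shows "(LINT \<xi>|lborel. fourier_fun f \<xi> * g \<xi>) = (LINT x|lborel. f x * fourier_fun g x)"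
proof -
 have "integrable (lborel \<Otimes>\<^sub>M lborel) (\<lambda>(x, y). Fexp x y * (g x * f y))"
  by (rule integrable_product[OF g f, of _ 1]) (auto intro: Fexp_measurable)
 from lborel_pair.Fubini_integral[OF this]
 have "(LINT y|lborel. LINT x|lborel. Fexp x y * (g x * f y)) = (LINT x|lborel. LINT y|lborel. Fexp x y * (g x * f y))" .
 moreover have "(LINT x|lborel. Fexp x y * (g x * f y)) = f y * fourier_fun g y" for y
  unfolding fourier_fun_def integral_mult_right_zero[symmetric] by (simp add: mult_ac inner_commute)
 moreover have "(LINT y|lborel. Fexp x y * (g x * f y)) = fourier_fun f x * g x" for x
  unfolding fourier_fun_def integral_mult_left_zero[symmetric] by (simp add: mult_ac)
 ultimately show ?thesis by simp
qed

lemma fourier_fun_scale: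
 assumes [measurable]: "f \<in> borel_measurable borel" and c: "c > 0"
 shows "fourier_fun (\<lambda>x. f (c *\<^sub>R x)) \<xi> = fourier_fun f (\<xi> /\<^sub>R c) / cr (c ^ 3)"
proof -
 have "fourier_fun (\<lambda>x. f (c *\<^sub>R x)) \<xi> = (LINT x|lborel. Fexp (\<xi> /\<^sub>R c) (0 + c *\<^sub>R x) * f (0 + c *\<^sub>R x))"
 proof -
  have "(\<xi> /\<^sub>R c) \<bullet> (c *\<^sub>R x) = \<xi> \<bullet> x" for x using c by simp
  then show ?thesis by (simp only: fourier_fun_def add_0_left)
 qed
 also have "... = (LINT x|lborel. Fexp (\<xi> /\<^sub>R c) x * f x) / cr (\<bar>c\<bar> ^ 3)"
  by (rule integral_affine3) (use c in auto)
 finally show ?thesis using c by (simp add: fourier_fun_def)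
qed

text \<open>Inversion at the origin: the multiplication formula with Gaussians of growing width, whose
  transforms concentrate at \<open>0\<close>.\<close>

lemma integral_fourier_fun:
 assumes f: "continuous_on UNIV f" "integrable lborel f" and b: "\<And>x. norm (f x) \<le> B"
  and Ff: "integrable lborel (fourier_fun f)"
 shows "(LINT \<xi>|lborel. fourier_fun f \<xi>) = cr ((2 * pi) ^ 3) * f 0"
proof -
 have [measurable]: "f \<in> borel_measurable borel" "fourier_fun f \<in> borel_measurable borel" using f Ff by auto
 define e where "e n = inverse (real (Suc n))" for n
 have e: "e n > 0" for n by (simp add: e_def)
 have e0: "e \<longlonglongrightarrow> 0" unfolding e_def by (rule LIMSEQ_inverse_real_of_nat)
 have cg: "isCont gauss 0" using gauss_differentiable differentiable_imp_continuous_within by blast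
 have g1: "norm (gauss x) \<le> 1" for x by (simp add: gauss_def)
 let ?c = "cr (sqrt (2 * pi) ^ 3)"
 have L: "(\<lambda>n. LINT \<xi>|lborel. fourier_fun f \<xi> * gauss (e n *\<^sub>R \<xi>)) \<longlonglongrightarrow> (LINT \<xi>|lborel. fourier_fun f \<xi> * gauss 0)"
 proof (rule integral_dominated_convergence[where w = "\<lambda>\<xi>. norm (fourier_fun f \<xi>)"])
  have "(\<lambda>n. gauss (e n *\<^sub>R \<xi>)) \<longlonglongrightarrow> gauss 0" for \<xi>
   by (rule isCont_tendsto_compose[OF cg]) (use tendsto_scaleR[OF e0 tendsto_const[of \<xi>]] in simp)
  then show "AE \<xi> in lborel. (\<lambda>n. fourier_fun f \<xi> * gauss (e n *\<^sub>R \<xi>)) \<longlonglongrightarrow> fourier_fun f \<xi> * gauss 0"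
   by (intro AE_I2 tendsto_intros)
  show "AE \<xi> in lborel. norm (fourier_fun f \<xi> * gauss (e n *\<^sub>R \<xi>)) \<le> norm (fourier_fun f \<xi>)" for n
   using mult_left_mono[OF g1 norm_ge_zero] by (intro AE_I2) (simp add: norm_mult)
 qed (use Ff in auto)
 have R: "(\<lambda>n. LINT x|lborel. f (e n *\<^sub>R x) * (?c * gauss x)) \<longlonglongrightarrow> (LINT x|lborel. f 0 * (?c * gauss x))"
 proof (rule integral_dominated_convergence[where w = "\<lambda>x. B * norm (?c * gauss x)"])
  have "isCont f 0" using f(1) by (simp add: continuous_on_eq_continuous_at)
  then have "(\<lambda>n. f (e n *\<^sub>R x)) \<longlonglongrightarrow> f 0" for x
   by (rule isCont_tendsto_compose) (use tendsto_scaleR[OF e0 tendsto_const[of x]] in simp)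
  then show "AE x in lborel. (\<lambda>n. f (e n *\<^sub>R x) * (?c * gauss x)) \<longlonglongrightarrow> f 0 * (?c * gauss x)"
   by (intro AE_I2 tendsto_intros)
  show "AE x in lborel. norm (f (e n *\<^sub>R x) * (?c * gauss x)) \<le> B * norm (?c * gauss x)" for n
   by (rule AE_I2, subst norm_mult, intro mult_right_mono b) simp
  show "integrable lborel (\<lambda>x. B * norm (?c * gauss x))"
   by (intro integrable_mult_right integrable_norm gauss_integrable)
 qed auto
 have eq: "(LINT \<xi>|lborel. fourier_fun f \<xi> * gauss (e n *\<^sub>R \<xi>)) = (LINT x|lborel. f (e n *\<^sub>R x) * (?c * gauss x))" for n
 proof -
  have ig: "integrable lborel (\<lambda>\<xi>. gauss (e n *\<^sub>R \<xi>))"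
   using integrable_affine3[OF gauss_integrable, of "e n" 0] e[of n] by simp
  have "(LINT \<xi>|lborel. fourier_fun f \<xi> * gauss (e n *\<^sub>R \<xi>)) = (LINT x|lborel. f x * fourier_fun (\<lambda>\<xi>. gauss (e n *\<^sub>R \<xi>)) x)"
   by (rule fourier_fun_multiplication_formula[OF f(2) ig])
  also have "... = (LINT x|lborel. f x * (?c * gauss (x /\<^sub>R e n)) / cr (e n ^ 3))"
   by (subst fourier_fun_scale[OF _ e]) (simp_all add: fourier_fun_gauss[of "_ /\<^sub>R _"] integral_gauss)
  also have "... = (LINT x|lborel. f x * (?c * gauss (x /\<^sub>R e n))) / cr (e n ^ 3)"
   by simp
  also have "... = (LINT x|lborel. f (0 + e n *\<^sub>R x) * (?c * gauss ((0 + e n *\<^sub>R x) /\<^sub>R e n)))"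
   by (subst integral_affine3[of "\<lambda>x. f x * (?c * gauss (x /\<^sub>R e n))"]) (use e[of n] in auto)
  finally show ?thesis using e[of n] by simp
 qed
 have "(LINT \<xi>|lborel. fourier_fun f \<xi> * gauss 0) = (LINT x|lborel. f 0 * (?c * gauss x))"
  using L R unfolding eq by (rule LIMSEQ_unique)
 also have "... = f 0 * ?c * fourier_fun gauss 0"
  unfolding fourier_fun_def by (simp add: integral_mult_right_zero)
 also have "... = f 0 * cr ((sqrt (2 * pi) * sqrt (2 * pi)) ^ 3)"
  unfolding integral_gauss by (simp only: power_mult_distrib of_real_mult mult.assoc of_real_power)
 finally show ?thesis by (simp add: gauss_def mult.commute)
qed

lemma inv_fourier_fun_eq: "inv_fourier_fun \<phi> x = fourier_fun \<phi> (- x) / cr ((2 * pi) ^ 3)"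
 by (simp add: inv_fourier_fun_def fourier_fun_def inner_commute)

lemma schwartz_uminus:
 assumes "schwartz \<phi>" shows "schwartz (\<lambda>x. \<phi> (- x))"
proof -
 have D: "((\<lambda>x. f (- x)) has_derivative (\<lambda>h. frechet_derivative f (at (- x)) (- h))) (at x)" if "schwartz f" for f x
  by (rule has_derivative_compose[of uminus uminus])
    (auto intro!: derivative_eq_intros has_derivative_frechet schwartz_differentiable that)
 show ?thesis
 proof (rule schwartz_coinduct[of _ "{\<lambda>x. f (- x) |f. schwartz f}"])
  fix h assume "h \<in> {\<lambda>x. f (- x) |f. schwartz f}"
  then obtain f where h: "h = (\<lambda>x. f (- x))" and f: "schwartz f" by auto
  show "h differentiable (at x)" for x unfolding h using D[OF f] by (auto simp: differentiable_def)
  show "partial_deriv j h \<in> {\<lambda>x. f (- x) |f. schwartz f}" for j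
  proof -
   have "partial_deriv j h = (\<lambda>x. - 1 * partial_deriv j f (- x))"
    unfolding h
    by (rule ext, subst partial_deriv_eqI[OF D[OF f]])
      (simp add: partial_deriv_def linear_neg[OF linear_frechet_derivative[OF schwartz_differentiable[OF f]]])
   moreover have "schwartz (\<lambda>x. - 1 * partial_deriv j f x)" by (intro schwartz_cmult schwartz_partial_deriv f)
   ultimately show ?thesis by (intro CollectI exI[of _ "\<lambda>x. - 1 * partial_deriv j f x"]) simp
  qed
  show "\<exists>C. \<forall>x. (1 + norm x) ^ N * norm (h x) \<le> C" for N
  proof -
   obtain C where "\<And>x. (1 + norm x) ^ N * norm (f x) \<le> C" using schwartz_fast[OF f] by blast
   from this[of "- _"] show ?thesis unfolding h by (intro exI[of _ C]) simp
  qed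
 qed (use assms in auto)
qed

lemma schwartz_inv_fourier_fun: assumes "schwartz \<phi>" shows "schwartz (inv_fourier_fun \<phi>)"
proof -
 have "inv_fourier_fun \<phi> = (\<lambda>x. inverse (cr ((2 * pi) ^ 3)) * fourier_fun \<phi> (- x))"
  by (rule ext) (simp only: inv_fourier_fun_eq divide_inverse mult.commute)
 then show ?thesis
  by (rule ssubst) (rule schwartz_cmult[OF schwartz_uminus[OF schwartz_fourier_fun[OF assms]]])
qed

lemma inv_fourier_fourier:
 assumes "schwartz \<phi>" shows "inv_fourier_fun (fourier_fun \<phi>) = \<phi>"
proof
 fix x
 let ?f = "\<lambda>y. \<phi> (x + y)"
 have m: "\<phi> \<in> borel_measurable borel" by (rule schwartz_measurable[OF assms])
 have Ff: "fourier_fun ?f = (\<lambda>\<xi>. exp (\<i> * cr (\<xi> \<bullet> x)) * fourier_fun \<phi> \<xi>)"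
  by (rule ext) (rule fourier_fun_translate[OF m])
 have i: "integrable lborel (fourier_fun ?f)"
  unfolding Ff using integrable_Fexp[OF schwartz_integrable(1)[OF schwartz_fourier_fun[OF assms]], of "- x"]
  by (simp add: inner_commute)
 have "(LINT \<xi>|lborel. fourier_fun ?f \<xi>) = cr ((2 * pi) ^ 3) * ?f 0"
 proof (rule integral_fourier_fun[OF _ _ _ i])
  show "continuous_on UNIV ?f"
   by (rule continuous_on_compose2[OF smooth_fun_continuous[OF schwartz_smooth[OF assms], of UNIV]])
     (auto intro!: continuous_intros)
  show "integrable lborel ?f" using integrable_affine3[OF schwartz_integrable(1)[OF assms], of 1 x] by simp
  show "norm (?f y) \<le> schwartz_norm 0 \<phi>" for y using schwartz_decay[OF assms, of _ 0] by simp
 qed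
 then show "inv_fourier_fun (fourier_fun \<phi>) x = \<phi> x"
  unfolding Ff by (simp add: inv_fourier_fun_def inner_commute)
qed

lemma fourier_inv_fourier:
 assumes "schwartz \<phi>" shows "fourier_fun (inv_fourier_fun \<phi>) = \<phi>"
proof
 fix x
 have "fourier_fun (inv_fourier_fun \<phi>) x = (LINT y|lborel. Fexp x y * (fourier_fun \<phi> (- y) / cr ((2 * pi) ^ 3)))"
  by (simp add: fourier_fun_def[of "inv_fourier_fun \<phi>"] inv_fourier_fun_eq)
 also have "... = (LINT y|lborel. Fexp x (0 + (-1) *\<^sub>R y) * (fourier_fun \<phi> (- (0 + (-1) *\<^sub>R y)) / cr ((2 * pi) ^ 3)))"
  by (subst integral_affine3[of "\<lambda>y. Fexp x y * (fourier_fun \<phi> (- y) / cr ((2 * pi) ^ 3))"])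
    (use schwartz_measurable[OF schwartz_fourier_fun[OF assms]] in \<open>auto intro!: borel_measurable_times
     borel_measurable_divide measurable_compose[of uminus, OF _ schwartz_measurable[OF schwartz_fourier_fun[OF assms]]]\<close>)
 also have "... = inv_fourier_fun (fourier_fun \<phi>) x"
  unfolding inv_fourier_fun_def
  by (subst integral_divide_zero[symmetric]) (simp add: inner_commute)
 finally show "fourier_fun (inv_fourier_fun \<phi>) x = \<phi> x" by (simp add: inv_fourier_fourier[OF assms])
qed

section \<open>Test functions\<close>

text \<open>The functions \<open>P(1/y) e\<^sup>-\<^sup>1\<^sup>/\<^sup>y\<close> are closed under
  differentiation, which makes smoothness at \<open>0\<close> a single limit.\<close>

definition flat :: "real poly => real => real" where
 "flat P y = (if y > 0 then poly P (1 / y) * exp (- (1 / y)) else 0)"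

lemma poly_times_exp_tendsto_0: "((\<lambda>z. poly P z * exp (- z)) \<longlongrightarrow> (0::real)) at_top"
proof -
 have "((\<lambda>z. \<Sum>i\<le>degree P. coeff P i * (z ^ i / exp z)) \<longlongrightarrow> (\<Sum>i\<le>degree P. coeff P i * 0)) at_top"
  by (intro tendsto_intros tendsto_power_div_exp_0)
 then show ?thesis
  by (simp add: poly_altdef exp_minus divide_inverse sum_distrib_right mult.assoc)
qed

lemma DERIV_flat: "(flat P has_real_derivative flat ([:0, 0, 1:] * (P - pderiv P)) y) (at y)"
proof -
 consider "y > 0" | "y < 0" | "y = 0" by linarith
 then show ?thesis
 proof cases
  case 1
  have "((\<lambda>y. poly P (1 / y) * exp (- (1 / y))) has_real_derivative flat ([:0, 0, 1:] * (P - pderiv P)) y) (at y)"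
   using 1 by (auto intro!: derivative_eq_intros DERIV_chain2[OF poly_DERIV] simp: flat_def power2_eq_square field_simps)
  then show ?thesis
   by (rule DERIV_cong_ev[THEN iffD1, rotated -1])
     (use 1 eventually_nhds_in_open[of "{0<..}" y] in \<open>auto simp: flat_def elim!: eventually_mono\<close>)
 next
  case 2
  have "((\<lambda>y. 0) has_real_derivative flat ([:0, 0, 1:] * (P - pderiv P)) y) (at y)"
   using 2 by (simp add: flat_def)
  then show ?thesis
   by (rule DERIV_cong_ev[THEN iffD1, rotated -1])
     (use 2 eventually_nhds_in_open[of "{..<0}" y] in \<open>auto simp: flat_def elim!: eventually_mono\<close>)
 next
  case 3
  have "((\<lambda>h. (flat P (0 + h) - flat P 0) / h) \<longlongrightarrow> 0) (at 0)"
  proof (rule filterlim_split_at)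
   show "((\<lambda>h. (flat P (0 + h) - flat P 0) / h) \<longlongrightarrow> 0) (at_left 0)"
    by (rule Lim_transform_eventually[OF tendsto_const]) (auto simp: flat_def eventually_at_filter)
   have "((\<lambda>h. poly ([:0, 1:] * P) (inverse h) * exp (- inverse h)) \<longlongrightarrow> (0::real)) (at_right 0)"
    by (rule filterlim_compose[OF poly_times_exp_tendsto_0 filterlim_inverse_at_top_right])
   then show "((\<lambda>h. (flat P (0 + h) - flat P 0) / h) \<longlongrightarrow> 0) (at_right 0)"
    by (rule Lim_transform_eventually)
      (auto simp: flat_def eventually_at_filter divide_inverse mult_ac)
  qed
  then show ?thesis using 3 by (simp add: DERIV_def flat_def)
 qed
qed

lemma smooth_fun_flat: "smooth_fun (\<lambda>x. cr (flat P (e * x $ j + d)))"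
proof (rule smooth_fun_coinduct[of _ "{\<lambda>x. cr (c * flat P (e * x $ j + d)) |c P. True}"])
 have D: "((\<lambda>x. cr (c * flat P (e * x $ j + d))) has_derivative
   (\<lambda>h. cr (c * e * flat ([:0, 0, 1:] * (P - pderiv P)) (e * x $ j + d) * h $ j))) (at x)" for c P and x :: "real^3"
 proof -
  have "((\<lambda>x::real^3. e * x $ j + d) has_derivative (\<lambda>h. e * h $ j)) (at x)"
   by (auto intro!: derivative_eq_intros bounded_linear_imp_has_derivative bounded_linear_vec_nth)
  from has_derivative_compose[OF this DERIV_flat[unfolded has_field_derivative_def]]
  have "((\<lambda>x::real^3. c * flat P (e * x $ j + d)) has_derivative
   (\<lambda>h. c * (flat ([:0, 0, 1:] * (P - pderiv P)) (e * x $ j + d) * (e * h $ j)))) (at x)"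
   by (rule has_derivative_mult_right)
  from bounded_linear.has_derivative[OF bounded_linear_of_real this] show ?thesis by (simp add: mult_ac)
 qed
 show "(\<lambda>x. cr (flat P (e * x $ j + d))) \<in> {\<lambda>x. cr (c * flat P (e * x $ j + d)) |c P. True}"
  by (intro CollectI exI[of _ 1] exI[of _ P]) simp
 fix f assume "f \<in> {\<lambda>x. cr (c * flat P (e * x $ j + d)) |c P. True}"
 then obtain c P where f: "f = (\<lambda>x. cr (c * flat P (e * x $ j + d)))" by blast
 show "f differentiable (at x)" for x unfolding f using D differentiable_def by blast
 show "partial_deriv k f \<in> {\<lambda>x. cr (c * flat P (e * x $ j + d)) |c P. True}" for k
 proof -
  have "partial_deriv k f = (\<lambda>x. cr ((if k = j then c * e else 0) * flat ([:0, 0, 1:] * (P - pderiv P)) (e * x $ j + d)))"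
   unfolding f by (rule ext, subst partial_deriv_eqI[OF D]) (simp add: axis_def)
  then show ?thesis by blast
 qed
qed

lemma flat_1: "0 \<le> flat 1 y" "flat 1 y \<le> 1" "flat 1 y > 0 \<longleftrightarrow> y > 0"
 by (auto simp: flat_def)

definition bump :: "real^3 => real^3 => real^3 => real" where
 "bump a b x = (\<Prod>j\<in>UNIV. flat 1 (x $ j - a $ j) * flat 1 (b $ j - x $ j))"

lemma bump_nonneg: "0 \<le> bump a b x"
 unfolding bump_def by (intro prod_nonneg) (simp add: flat_1)

lemma bump_pos_iff: "0 < bump a b x \<longleftrightarrow> x \<in> box a b"
proof
 assume p: "0 < bump a b x"
 have "a $ j < x $ j \<and> x $ j < b $ j" for j
 proof -
  have "bump a b x \<noteq> 0" using p by simp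
  then have "\<forall>j\<in>UNIV. flat 1 (x $ j - a $ j) * flat 1 (b $ j - x $ j) \<noteq> 0"
   unfolding bump_def by (subst (asm) prod_zero_iff) auto
  then have "flat 1 (x $ j - a $ j) * flat 1 (b $ j - x $ j) \<noteq> 0" by blast
  then have "flat 1 (x $ j - a $ j) \<noteq> 0" "flat 1 (b $ j - x $ j) \<noteq> 0" by auto
  then have "x $ j - a $ j > 0" "b $ j - x $ j > 0" by (auto simp: flat_def split: if_splits)
  then show ?thesis by simp
 qed
 then show "x \<in> box a b" by (simp add: mem_box_cart)
next
 assume "x \<in> box a b"
 then show "0 < bump a b x" unfolding bump_def by (intro prod_pos) (auto simp: flat_1 mem_box_cart)
qed

lemma smooth_fun_bump: "smooth_fun (\<lambda>x. cr (bump a b x))"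
proof -
 have "smooth_fun (\<lambda>x. \<Prod>j\<in>UNIV. cr (flat 1 (1 * x $ j + (- a $ j))) * cr (flat 1 ((-1) * x $ j + b $ j)))"
  by (intro smooth_fun_prod smooth_fun_mult smooth_fun_flat) simp
 then show ?thesis by (simp add: bump_def add.commute)
qed

lemma test_funI:
 assumes "smooth_fun \<phi>" "\<And>x. x \<notin> cbox a b ==> \<phi> x = 0"
 shows "test_fun \<phi>"
proof -
 have "closure {x. \<phi> x \<noteq> 0} \<subseteq> cbox a b" using assms(2) by (intro closure_minimal) auto
 then have "bounded (closure {x. \<phi> x \<noteq> 0})" by (rule bounded_subset[OF bounded_cbox])
 then show ?thesis unfolding test_fun_def using assms(1) by (simp add: compact_eq_bounded_closed)
qed

lemma test_fun_bump: "test_fun (\<lambda>x. cr (bump a b x))"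
proof (rule test_funI[OF smooth_fun_bump])
 fix x assume "x \<notin> cbox a b"
 then have "x \<notin> box a b" using box_subset_cbox by blast
 then show "cr (bump a b x) = 0" using bump_nonneg[of a b x] bump_pos_iff[of a b x] by simp
qed

text \<open>These functions increase to the indicator of an open box as \<open>c \<rightarrow>
  \<infinity>\<close>. The exponential replaces a family of bumps adapted to the box.\<close>

lemma test_fun_one_minus_exp:
 "test_fun (\<lambda>x. cr (1 - exp (- (c * bump a b x))))"
proof (rule test_funI)
 have "smooth_fun (\<lambda>x. 1 - exp (cr (- c) * cr (bump a b x)))"
  by (intro smooth_fun_diff smooth_fun_const smooth_fun_exp smooth_fun_cmult smooth_fun_bump)
 then show "smooth_fun (\<lambda>x. cr (1 - exp (- (c * bump a b x))))"
  by (simp add: exp_of_real[symmetric])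
 fix x assume "x \<notin> cbox a b"
 then have "x \<notin> box a b" using box_subset_cbox by blast
 then show "cr (1 - exp (- (c * bump a b x))) = 0"
  using bump_nonneg[of a b x] bump_pos_iff[of a b x] by simp
qed

lemma iter_deriv_eq_0_outside:
 assumes "open U" "\<And>x. x \<in> U ==> f x = 0" "x \<in> U" shows "iter_deriv js f x = 0"
proof -
 have "iter_deriv js f \<in> {f. \<forall>x\<in>U. f x = 0}"
 proof (rule iter_deriv_mem)
  fix f :: "real^3 => complex" and j assume f: "f \<in> {f. \<forall>x\<in>U. f x = 0}"
  have "partial_deriv j f x = 0" if "x \<in> U" for x
   using partial_deriv_eqI[OF has_derivative_transform_within_open[OF has_derivative_const[of 0] assms(1) that, of f], of j] f
   by auto
  then show "partial_deriv j f \<in> {f. \<forall>x\<in>U. f x = 0}" by simp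
 qed (use assms in auto)
 then show ?thesis using assms(3) by auto
qed

text \<open>Outside the support all derivatives vanish, and on it they are bounded by continuity.\<close>

lemma test_fun_schwartz: assumes "test_fun \<phi>" shows "schwartz \<phi>"
 unfolding schwartz_iff
proof (intro conjI allI)
 show s: "smooth_fun \<phi>" using assms by (simp add: test_fun_def)
 fix js N
 let ?K = "closure {x. \<phi> x \<noteq> 0}"
 let ?g = "\<lambda>x. (1 + norm x) ^ N * norm (iter_deriv js \<phi> x)"
 have "smooth_fun (iter_deriv js \<phi>)"
  using iter_deriv_mem[of "{f. smooth_fun f}" \<phi> js] s by (auto simp: smooth_fun_partial_deriv)
 then have "continuous_on ?K ?g" by (intro continuous_intros smooth_fun_continuous)
 then have "bounded (?g ` ?K)"
  using assms by (intro compact_imp_bounded compact_continuous_image) (auto simp: test_fun_def)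
 then obtain C where C: "\<And>x. x \<in> ?K ==> norm (?g x) \<le> C" by (auto simp: bounded_iff)
 have "iter_deriv js \<phi> x = 0" if "x \<notin> ?K" for x
  by (rule iter_deriv_eq_0_outside[of "- ?K"]) (use that closure_subset[of "{x. \<phi> x \<noteq> 0}"] in auto)
 then have "?g x \<le> max C 0" for x using C[of x] by (cases "x \<in> ?K") auto
 then show "\<exists>C. \<forall>x. ?g x \<le> C" by blast
qed

lemma test_fun_mult: assumes "smooth_fun g" "test_fun \<phi>" shows "test_fun (\<lambda>x. g x * \<phi> x)"
 unfolding test_fun_def
proof
 show "smooth_fun (\<lambda>x. g x * \<phi> x)" using assms by (intro smooth_fun_mult) (auto simp: test_fun_def)
 have "closure {x. g x * \<phi> x \<noteq> 0} \<subseteq> closure {x. \<phi> x \<noteq> 0}" by (intro closure_mono) auto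
 then show "compact (closure {x. g x * \<phi> x \<noteq> 0})"
  using assms(2) closed_Int_compact[OF closed_closure, of "closure {x. \<phi> x \<noteq> 0}" "{x. g x * \<phi> x \<noteq> 0}"]
  unfolding test_fun_def by (simp add: inf.absorb1)
qed

section \<open>Locally integrable functions are determined by test functions\<close>

lemma locally_integrable_measurable:
 assumes "locally_integrable g" shows "g \<in> borel_measurable borel"
proof (rule borel_measurable_LIMSEQ_metric)
 show "(\<lambda>x. indicator (cball 0 (real n)) x *\<^sub>R g x) \<in> borel_measurable borel" for n
  using assms[unfolded locally_integrable_def, rule_format, of "cball 0 (real n)"]
  by (auto simp: set_integrable_def dest: borel_measurable_integrable)
 fix x :: "real^3"
 obtain N :: nat where N: "norm x \<le> real N" using real_arch_simple by blast
 have "\<forall>\<^sub>F n in sequentially. indicator (cball 0 (real n)) x *\<^sub>R g x = g x"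
  using eventually_ge_at_top[of N] by eventually_elim (use N in \<open>auto simp: indicator_def\<close>)
 then show "(\<lambda>n. indicator (cball 0 (real n)) x *\<^sub>R g x) \<longlonglongrightarrow> g x" by (rule tendsto_eventually)
qed

lemma integrable_imp_locally_integrable:
 assumes "integrable lborel g" shows "locally_integrable g"
 unfolding locally_integrable_def set_integrable_def
proof (intro allI impI)
 fix K :: "(real^3) set" assume K: "compact K"
 have "K \<in> sets lborel" using borel_closed[OF compact_imp_closed[OF K]] by simp
 then show "integrable lborel (\<lambda>x. indicator K x *\<^sub>R g x)" by (rule integrable_mult_indicator[OF _ assms])
qed

lemma integrable_times_test:
 assumes g: "locally_integrable g" and "test_fun \<phi>"
 shows "integrable lborel (\<lambda>x. g x * \<phi> x)"
proof -
 let ?K = "closure {x. \<phi> x \<noteq> 0}"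
 have s: "schwartz \<phi>" by (rule test_fun_schwartz[OF assms(2)])
 have [measurable]: "g \<in> borel_measurable borel" "\<phi> \<in> borel_measurable borel"
  using locally_integrable_measurable[OF g] schwartz_measurable[OF s] by auto
 have "integrable lborel (\<lambda>x. indicator ?K x *\<^sub>R g x)"
  using g[unfolded locally_integrable_def set_integrable_def, rule_format, of ?K] assms(2)
  by (simp add: test_fun_def)
 then have "integrable lborel (\<lambda>x. schwartz_norm 0 \<phi> * norm (indicator ?K x *\<^sub>R g x))"
  by (intro integrable_mult_right integrable_norm)
 then show ?thesis
 proof (rule Bochner_Integration.integrable_bound)
  have "norm (g x * \<phi> x) \<le> norm (schwartz_norm 0 \<phi> * norm (indicator ?K x *\<^sub>R g x))" for x
  proof (cases "\<phi> x = 0")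
   case False
   then have "x \<in> ?K" using closure_subset[of "{x. \<phi> x \<noteq> 0}"] by auto
   moreover have "norm (\<phi> x) * norm (g x) \<le> schwartz_norm 0 \<phi> * norm (g x)"
    using schwartz_decay[OF s, of x 0] by (intro mult_right_mono) auto
   ultimately show ?thesis using schwartz_norm_nonneg[OF s, of 0]
    by (simp only: norm_mult indicator_simps scaleR_one real_norm_def abs_of_nonneg abs_norm_cancel mult.commute)
  qed simp
  then show "AE x in lborel. norm (g x * \<phi> x) \<le> norm (schwartz_norm 0 \<phi> * norm (indicator ?K x *\<^sub>R g x))" by simp
 qed simp
qed

lemma integral_box_eq_0:
 assumes g: "locally_integrable g" and z: "\<And>\<phi>. test_fun \<phi> ==> (LINT x|lborel. g x * \<phi> x) = 0"
 shows "(LINT x|lborel. indicator (box a b) x *\<^sub>R g x) = 0"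
proof -
 have [measurable]: "g \<in> borel_measurable borel" using locally_integrable_measurable[OF g] .
 let ?\<phi> = "\<lambda>n x. cr (1 - exp (- (real n * bump a b x)))"
 have "(\<lambda>n. LINT x|lborel. g x * ?\<phi> n x) \<longlonglongrightarrow> (LINT x|lborel. indicator (box a b) x *\<^sub>R g x)"
 proof (rule integral_dominated_convergence)
  show "integrable lborel (\<lambda>x. norm (indicator (cbox a b) x *\<^sub>R g x))"
   using g unfolding locally_integrable_def set_integrable_def by (intro integrable_norm) auto
  have b0: "bump a b x = 0" if "x \<notin> box a b" for x
   using that bump_nonneg[of a b x] bump_pos_iff[of a b x] by simp
  show "AE x in lborel. (\<lambda>n. g x * ?\<phi> n x) \<longlonglongrightarrow> indicator (box a b) x *\<^sub>R g x"
  proof (rule AE_I2, goal_cases)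
   case (1 x)
   show ?case
   proof (cases "x \<in> box a b")
    case True
    then have p: "0 < bump a b x" by (simp add: bump_pos_iff)
    have "(\<lambda>n. exp (- (real n * bump a b x))) = (\<lambda>n. exp (- bump a b x) ^ n)"
     by (simp add: exp_of_nat_mult[symmetric] mult.commute)
    then have "(\<lambda>n. exp (- (real n * bump a b x))) \<longlonglongrightarrow> 0"
     using p LIMSEQ_realpow_zero[of "exp (- bump a b x)"] by simp
    then have "(\<lambda>n. g x * ?\<phi> n x) \<longlonglongrightarrow> g x * cr (1 - 0)" by (intro tendsto_intros)
    then show ?thesis using True by simp
   qed (simp add: b0)
  qed
  show "AE x in lborel. norm (g x * ?\<phi> n x) \<le> norm (indicator (cbox a b) x *\<^sub>R g x)" for n
  proof (rule AE_I2, goal_cases)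
   case (1 x)
   show ?case
   proof (cases "x \<in> box a b")
    case True
    then have "x \<in> cbox a b" using box_subset_cbox by blast
    moreover have "norm (?\<phi> n x) \<le> 1" using bump_nonneg[of a b x] by (simp del: of_real_diff)
    ultimately show ?thesis using mult_left_mono[of "norm (?\<phi> n x)" 1 "norm (g x)"] by (simp add: norm_mult)
   qed (simp add: b0)
  qed
  show "(\<lambda>x. g x * ?\<phi> n x) \<in> borel_measurable lborel" for n
   using integrable_times_test[OF g test_fun_one_minus_exp, of "real n" a b] by auto
 qed simp
 then show ?thesis
  unfolding z[OF test_fun_one_minus_exp] by (simp add: LIMSEQ_const_iff)
qed

text \<open>Positive and negative part define two measures that agree on open boxes, hence everywhere.\<close>

lemma real_AE_0_of_boxes:
 fixes g :: "real^3 => real"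
 assumes [measurable]: "g \<in> borel_measurable borel"
  and i: "\<And>a b. integrable lborel (\<lambda>x. indicator (box a b) x *\<^sub>R g x)"
  and z: "\<And>a b. (LINT x|lborel. indicator (box a b) x *\<^sub>R g x) = 0"
 shows "AE x in lborel. g x = 0"
proof -
 let ?p = "\<lambda>x. ennreal (g x)" and ?m = "\<lambda>x. ennreal (- g x)"
 let ?E = "range (\<lambda>(a, b). box a b :: (real^3) set)"
 have fin: "(\<integral>\<^sup>+x. ?p x * indicator (box a b) x \<partial>lborel) < \<infinity>" for a b
 proof -
  have "(\<integral>\<^sup>+x. ?p x * indicator (box a b) x \<partial>lborel) \<le> (\<integral>\<^sup>+x. enorm (indicator (box a b) x *\<^sub>R g x) \<partial>lborel)"
   by (intro nn_integral_mono) (auto simp: indicator_def intro!: ennreal_leI)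
  also have "... < \<infinity>" using i[of a b] by (simp add: integrable_iff_bounded)
  finally show ?thesis .
 qed
 have eq: "(\<integral>\<^sup>+x. ?p x * indicator (box a b) x \<partial>lborel) = (\<integral>\<^sup>+x. ?m x * indicator (box a b) x \<partial>lborel)" for a b
 proof -
  have 1: "(\<integral>\<^sup>+x. ?p x * indicator (box a b) x \<partial>lborel) = (\<integral>\<^sup>+x. ennreal (indicator (box a b) x *\<^sub>R g x) \<partial>lborel)"
   by (intro nn_integral_cong) (auto simp: indicator_def)
  have 2: "(\<integral>\<^sup>+x. ?m x * indicator (box a b) x \<partial>lborel) = (\<integral>\<^sup>+x. ennreal (- (indicator (box a b) x *\<^sub>R g x)) \<partial>lborel)"
   by (intro nn_integral_cong) (auto simp: indicator_def)
  have f2: "(\<integral>\<^sup>+x. ennreal (- (indicator (box a b) x *\<^sub>R g x)) \<partial>lborel) < \<infinity>"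
   and f1: "(\<integral>\<^sup>+x. ennreal (indicator (box a b) x *\<^sub>R g x) \<partial>lborel) < \<infinity>"
   using i[of a b] by (auto simp: real_integrable_def less_top)
  have "enn2real (\<integral>\<^sup>+x. ennreal (indicator (box a b) x *\<^sub>R g x) \<partial>lborel)
    = enn2real (\<integral>\<^sup>+x. ennreal (- (indicator (box a b) x *\<^sub>R g x)) \<partial>lborel)"
   using z[of a b] real_lebesgue_integral_def[OF i[of a b]] by simp
  then show ?thesis
   unfolding 1 2 using f1 f2 ennreal_enn2real by (metis infinity_ennreal_def)
 qed
 have "Nonnegative_Lebesgue_Integration.density lborel ?p = Nonnegative_Lebesgue_Integration.density lborel ?m"
 proof (rule measure_eqI_generator_eq[where E = ?E and \<Omega> = UNIV and A = "\<lambda>n::nat. box (- (real n *\<^sub>R One)) (real n *\<^sub>R One)"])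
  show "Int_stable ?E" unfolding Int_stable_def
  proof (intro ballI)
   fix A B :: "(real^3) set" assume "A \<in> ?E" "B \<in> ?E"
   then obtain a b c d where "A = box a b" "B = box c d" by auto
   then have "A \<inter> B = (\<lambda>(a, b). box a b) (\<Sum>i\<in>Basis. max (a \<bullet> i) (c \<bullet> i) *\<^sub>R i, \<Sum>i\<in>Basis. min (b \<bullet> i) (d \<bullet> i) *\<^sub>R i)"
    by (simp add: box_Int_box)
   then show "A \<inter> B \<in> ?E" by (simp only: rangeI)
  qed
  show "sets (Nonnegative_Lebesgue_Integration.density lborel ?p) = sigma_sets UNIV ?E"
   "sets (Nonnegative_Lebesgue_Integration.density lborel ?m) = sigma_sets UNIV ?E"
   by (simp_all add: borel_eq_box)
  show "emeasure (Nonnegative_Lebesgue_Integration.density lborel ?p) X = emeasure (Nonnegative_Lebesgue_Integration.density lborel ?m) X"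
   if "X \<in> ?E" for X using that eq by (auto simp: emeasure_density)
  show "(\<Union>n. box (- (real n *\<^sub>R One)) (real n *\<^sub>R One)) = (UNIV :: (real^3) set)" by (rule UN_box_eq_UNIV)
  show "emeasure (Nonnegative_Lebesgue_Integration.density lborel ?p) (box (- (real n *\<^sub>R One)) (real n *\<^sub>R One)) \<noteq> \<infinity>" for n
   using fin by (simp add: emeasure_density less_top)
 qed auto
 then have "AE x in lborel. ?p x = ?m x"
  by (subst (asm) sigma_finite_measure.density_unique_iff[OF sigma_finite_lborel]) auto
 then show ?thesis
 proof eventually_elim
  case (elim x)
  then show ?case by (cases "g x \<ge> 0") (auto simp: ennreal_neg ennreal_eq_0_iff)
 qed
qed

text \<open>Testing with functions that converge to the indicator of a box shows that \<open>g\<close> has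
  integral zero over every box.\<close>

lemma fundamental_lemma:
 assumes g: "locally_integrable g" and z: "\<And>\<phi>. test_fun \<phi> ==> (LINT x|lborel. g x * \<phi> x) = 0"
 shows "AE x in lborel. g x = 0"
proof -
 have [measurable]: "g \<in> borel_measurable borel" using locally_integrable_measurable[OF g] .
 have i: "integrable lborel (\<lambda>x. indicator (box a b) x *\<^sub>R g x)" for a b
 proof -
  have "integrable lborel (\<lambda>x. indicator (box a b) x *\<^sub>R indicator (cbox a b) x *\<^sub>R g x)"
   by (rule integrable_mult_indicator) (use g in \<open>auto simp: locally_integrable_def set_integrable_def\<close>)
  moreover have "(\<lambda>x. indicator (box a b) x *\<^sub>R indicator (cbox a b) x *\<^sub>R g x) = (\<lambda>x. indicator (box a b) x *\<^sub>R g x)"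
   using box_subset_cbox[of a b] by (auto simp: fun_eq_iff indicator_def)
  ultimately show ?thesis by simp
 qed
 have Re1: "integrable lborel (\<lambda>x. indicator (box a b) x *\<^sub>R Re (g x))" for a b
  using integrable_Re[OF i[of a b]] by simp
 have Re2: "(LINT x|lborel. indicator (box a b) x *\<^sub>R Re (g x)) = 0" for a b
  using integral_Re[OF i[of a b]] integral_box_eq_0[OF g z, of a b] by simp
 have Im1: "integrable lborel (\<lambda>x. indicator (box a b) x *\<^sub>R Im (g x))" for a b
  using integrable_Im[OF i[of a b]] by simp
 have Im2: "(LINT x|lborel. indicator (box a b) x *\<^sub>R Im (g x)) = 0" for a b
  using integral_Im[OF i[of a b]] integral_box_eq_0[OF g z, of a b] by simp
 have "AE x in lborel. Re (g x) = 0"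
  by (rule real_AE_0_of_boxes[OF _ Re1 Re2]) measurable
 moreover have "AE x in lborel. Im (g x) = 0"
  by (rule real_AE_0_of_boxes[OF _ Im1 Im2]) measurable
 ultimately show ?thesis by eventually_elim (simp add: complex_eq_iff)
qed

lemma locally_integrable_diff:
 "locally_integrable f ==> locally_integrable g ==> locally_integrable (\<lambda>x. f x - g x)"
 unfolding locally_integrable_def using set_integral_diff(1)[of lborel _ f g] by blast

lemma represents_unique:
 assumes "represents g f" "represents h f" shows "AE x in lborel. g x = h x"
proof -
 have l: "locally_integrable g" "locally_integrable h" using assms by (auto simp: represents_def)
 have "AE x in lborel. g x - h x = 0"
 proof (rule fundamental_lemma)
  show "locally_integrable (\<lambda>x. g x - h x)" using l by (rule locally_integrable_diff)
  fix \<phi> assume t: "test_fun \<phi>"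
  then show "(LINT x|lborel. (g x - h x) * \<phi> x) = 0"
   using assms integrable_times_test[OF l(1) t] integrable_times_test[OF l(2) t]
   by (simp add: represents_def left_diff_distrib)
 qed
 then show ?thesis by simp
qed

lemma represents_density: "represents g f ==> represents (density f) f"
 unfolding density_def by (rule someI[of "\<lambda>g. represents g f"])

lemma density_AE_eq: "represents g f ==> AE x in lborel. density f x = g x"
 using represents_unique represents_density by blast

section \<open>Distributions with integrable Fourier transform\<close>

lemma fourier_fun_add:
 assumes "integrable lborel f" "integrable lborel g"
 shows "fourier_fun (\<lambda>x. f x + g x) \<xi> = fourier_fun f \<xi> + fourier_fun g \<xi>"
 unfolding fourier_fun_def using integrable_Fexp[OF assms(1), of \<xi>] integrable_Fexp[OF assms(2), of \<xi>]
 by (simp add: distrib_left)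

lemma inv_fourier_fun_add:
 assumes "schwartz f" "schwartz g"
 shows "inv_fourier_fun (\<lambda>x. f x + g x) = (\<lambda>\<xi>. inv_fourier_fun f \<xi> + inv_fourier_fun g \<xi>)"
 by (rule ext) (simp only: inv_fourier_fun_eq fourier_fun_add[OF schwartz_integrable(1)[OF assms(1)] schwartz_integrable(1)[OF assms(2)]]
   add_divide_distrib)

lemma inv_fourier_fun_cmult: "inv_fourier_fun (\<lambda>x. c * f x) = (\<lambda>\<xi>. c * inv_fourier_fun f \<xi>)"
 by (rule ext) (simp only: inv_fourier_fun_eq fourier_fun_cmult times_divide_eq_right)

lemma inv_fourier_fun_bound:
 assumes "integrable lborel f"
 shows "norm (inv_fourier_fun f \<xi>) \<le> (LINT x|lborel. norm (f x))"
proof -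
 have "norm (inv_fourier_fun f \<xi>) = norm (fourier_fun f (- \<xi>)) / (2 * pi) ^ 3"
  by (simp only: inv_fourier_fun_eq norm_divide norm_of_real) simp
 also have "... \<le> norm (fourier_fun f (- \<xi>)) / 1"
 proof (intro divide_left_mono)
  have "1 \<le> 2 * pi" using pi_gt3 by simp
  then show "1 \<le> (2 * pi) ^ 3" by (rule one_le_power)
 qed auto
 finally show ?thesis using norm_fourier_fun_le[OF assms, of "- \<xi>"] by simp
qed

lemma fourier_fun_measurable:
 assumes [measurable]: "f \<in> borel_measurable borel" shows "fourier_fun f \<in> borel_measurable borel"
proof -
 have "(\<lambda>\<xi>. LINT x|lborel. Fexp \<xi> x * f x) \<in> borel_measurable borel"
  by (rule lborel.borel_measurable_lebesgue_integral) measurable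
 then show ?thesis by (simp only: fourier_fun_def[abs_def])
qed

lemma inv_fourier_fun_measurable:
 assumes "f \<in> borel_measurable borel" shows "inv_fourier_fun f \<in> borel_measurable borel"
proof -
 have [measurable]: "fourier_fun f \<in> borel_measurable borel" by (rule fourier_fun_measurable[OF assms])
 have "(\<lambda>x. fourier_fun f (- x) / cr ((2 * pi) ^ 3)) \<in> borel_measurable borel" by measurable
 then show ?thesis by (simp only: inv_fourier_fun_eq[abs_def])
qed

lemma integrable_mult_bounded:
 fixes g h :: "real^3 => complex"
 assumes g: "integrable lborel g" and [measurable]: "h \<in> borel_measurable borel" and b: "\<And>x. norm (h x) \<le> C"
 shows "integrable lborel (\<lambda>x. g x * h x)"
proof (rule Bochner_Integration.integrable_bound[OF integrable_mult_left[OF integrable_norm[OF g], of C]])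
 show "(\<lambda>x. g x * h x) \<in> borel_measurable lborel" using borel_measurable_integrable[OF g] by measurable
 show "AE x in lborel. norm (g x * h x) \<le> norm (norm (g x) * C)"
 proof (rule AE_I2, goal_cases)
  case (1 x)
  have "norm (g x) * norm (h x) \<le> norm (g x) * C" by (intro mult_left_mono b) auto
  then show ?case by (simp add: norm_mult)
 qed
qed

lemma integrable_mult_inv_fourier:
 assumes "integrable lborel g" "schwartz \<phi>"
 shows "integrable lborel (\<lambda>\<xi>. g \<xi> * inv_fourier_fun \<phi> \<xi>)"
 by (rule integrable_mult_bounded[OF assms(1) inv_fourier_fun_measurable inv_fourier_fun_bound])
   (use assms(2) schwartz_measurable schwartz_integrable in auto)

lemma inv_fourier_multiplication_formula:
 assumes f: "integrable lborel f" and g: "integrable lborel g"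
 shows "(LINT \<xi>|lborel. inv_fourier_fun f \<xi> * g \<xi>) = (LINT x|lborel. f x * inv_fourier_fun g x)"
proof -
 have [measurable]: "f \<in> borel_measurable borel" "g \<in> borel_measurable borel" using f g by auto
 have g': "integrable lborel (\<lambda>x. g (- x))" using integrable_affine3[OF g, of "-1" 0] by simp
 have m: "(\<lambda>\<xi>. fourier_fun f (- \<xi>) * g \<xi>) \<in> borel_measurable borel"
  using fourier_fun_measurable[of f] by measurable
 have "(LINT \<xi>|lborel. fourier_fun f (- \<xi>) * g \<xi>) = (LINT \<xi>|lborel. fourier_fun f \<xi> * g (- \<xi>))"
  using integral_affine3[OF m, of "-1" 0] by simp
 also have "... = (LINT x|lborel. f x * fourier_fun (\<lambda>x. g (- x)) x)"
  by (rule fourier_fun_multiplication_formula[OF f g'])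
 also have "fourier_fun (\<lambda>x. g (- x)) = (\<lambda>x. fourier_fun g (- x))"
 proof
  fix x
  show "fourier_fun (\<lambda>x. g (- x)) x = fourier_fun g (- x)"
   using integral_affine3[of "\<lambda>y. Fexp (- x) y * g y" "-1" 0] by (simp add: fourier_fun_def)
 qed
 finally have "(LINT \<xi>|lborel. fourier_fun f (- \<xi>) * g \<xi>) = (LINT x|lborel. f x * fourier_fun g (- x))" .
 then show ?thesis
  unfolding inv_fourier_fun_eq by (simp only: times_divide_eq_left times_divide_eq_right integral_divide_zero)
qed

lemma inv_fourier_non_schwartz [simp]: "\<not> schwartz \<phi> ==> inv_fourier g \<phi> = 0"
 by (simp add: inv_fourier_def)

text \<open>The inverse transform of a Schwartz function is bounded by a Schwartz seminorm, so an integrable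
  density defines a continuous functional.\<close>

lemma tempered_inv_fourier:
 assumes "integrable lborel g" shows "tempered (inv_fourier g)"
 unfolding tempered_def
proof (intro conjI allI impI)
 fix \<phi> \<psi> assume "schwartz \<phi>" "schwartz \<psi>"
 then show "inv_fourier g (\<lambda>x. \<phi> x + \<psi> x) = inv_fourier g \<phi> + inv_fourier g \<psi>"
  using integrable_mult_inv_fourier[OF assms]
  by (simp add: inv_fourier_def schwartz_add inv_fourier_fun_add distrib_left)
next
 fix c \<phi> assume s: "schwartz \<phi>"
 have "(LINT \<xi>|lborel. g \<xi> * (c * inv_fourier_fun \<phi> \<xi>)) = (LINT \<xi>|lborel. c * (g \<xi> * inv_fourier_fun \<phi> \<xi>))"
  by (simp only: mult_ac)
 also have "... = c * (LINT \<xi>|lborel. g \<xi> * inv_fourier_fun \<phi> \<xi>)" by (rule integral_mult_right_zero)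
 finally show "inv_fourier g (\<lambda>x. c * \<phi> x) = c * inv_fourier g \<phi>"
  using s by (simp add: inv_fourier_def schwartz_cmult inv_fourier_fun_cmult)
next
 show "\<exists>C N. \<forall>\<phi>. schwartz \<phi> \<longrightarrow> norm (inv_fourier g \<phi>) \<le> C * schwartz_norm N \<phi>"
 proof (intro exI allI impI)
  fix \<phi> assume s: "schwartz \<phi>"
  have "norm (inv_fourier g \<phi>) \<le> (LINT \<xi>|lborel. norm (g \<xi> * inv_fourier_fun \<phi> \<xi>))"
   using s by (simp add: inv_fourier_def)
  also have "... \<le> (LINT \<xi>|lborel. norm (g \<xi>) * (schwartz_norm 6 \<phi> * bracket_int))"
  proof (rule integral_mono)
   show "norm (g \<xi> * inv_fourier_fun \<phi> \<xi>) \<le> norm (g \<xi>) * (schwartz_norm 6 \<phi> * bracket_int)" for \<xi>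
    unfolding norm_mult
    by (intro mult_left_mono order_trans[OF inv_fourier_fun_bound] schwartz_integrable s) auto
  qed (auto intro!: integrable_norm integrable_mult_inv_fourier assms s)
  also have "... = ((LINT \<xi>|lborel. norm (g \<xi>)) * bracket_int) * schwartz_norm 6 \<phi>"
   by simp
  finally show "norm (inv_fourier g \<phi>) \<le> ((LINT \<xi>|lborel. norm (g \<xi>)) * bracket_int) * schwartz_norm 6 \<phi>" .
 qed
qed simp

lemma represents_fourier_inv_fourier:
 assumes "locally_integrable g" shows "represents g (fourier_dist (inv_fourier g))"
 unfolding represents_def fourier_dist_def inv_fourier_def
 using assms by (auto simp: test_fun_schwartz schwartz_fourier_fun inv_fourier_fourier)

lemma fhat_inv_fourier:
 assumes "locally_integrable g" shows "AE \<xi> in lborel. fhat (inv_fourier g) \<xi> = g \<xi>"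
 unfolding fhat_def by (rule density_AE_eq[OF represents_fourier_inv_fourier[OF assms]])

lemma fourier_locally_integrable_inv_fourier:
 "locally_integrable g ==> fourier_locally_integrable (inv_fourier g)"
 unfolding fourier_locally_integrable_def using represents_fourier_inv_fourier by blast

lemma represents_fhat: "fourier_locally_integrable f ==> represents (fhat f) (fourier_dist f)"
 unfolding fourier_locally_integrable_def fhat_def by (auto intro: represents_density)

lemma fhat_measurable: "fourier_locally_integrable f ==> fhat f \<in> borel_measurable borel"
 using represents_fhat locally_integrable_measurable by (auto simp: represents_def)

lemma inv_fourier_inj:
 assumes "inv_fourier g = inv_fourier h" "locally_integrable g" "locally_integrable h"
 shows "AE \<xi> in lborel. g \<xi> = h \<xi>"
 using represents_unique[OF represents_fourier_inv_fourier[OF assms(2), unfolded assms(1)]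
   represents_fourier_inv_fourier[OF assms(3)]] .

lemma inv_fourier_cong:
 assumes "AE \<xi> in lborel. g \<xi> = h \<xi>" and [measurable]: "g \<in> borel_measurable borel" "h \<in> borel_measurable borel"
 shows "inv_fourier g = inv_fourier h"
proof
 fix \<phi>
 show "inv_fourier g \<phi> = inv_fourier h \<phi>"
 proof (cases "schwartz \<phi>")
  case True
  have [measurable]: "inv_fourier_fun \<phi> \<in> borel_measurable borel"
   by (rule inv_fourier_fun_measurable[OF schwartz_measurable[OF True]])
  have "(LINT \<xi>|lborel. g \<xi> * inv_fourier_fun \<phi> \<xi>) = (LINT \<xi>|lborel. h \<xi> * inv_fourier_fun \<phi> \<xi>)"
   by (rule integral_cong_AE) (use assms(1) in \<open>auto elim!: eventually_mono\<close>)
  then show ?thesis using True by (simp add: inv_fourier_def)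
 qed simp
qed

lemma inv_fourier_add:
 assumes "integrable lborel g" "integrable lborel h"
 shows "inv_fourier (\<lambda>\<xi>. g \<xi> + h \<xi>) = inv_fourier g + inv_fourier h"
 using integrable_mult_inv_fourier[OF assms(1)] integrable_mult_inv_fourier[OF assms(2)]
 by (auto simp: fun_eq_iff inv_fourier_def distrib_right)

lemma inv_fourier_diff:
 assumes "integrable lborel g" "integrable lborel h"
 shows "inv_fourier (\<lambda>\<xi>. g \<xi> - h \<xi>) = inv_fourier g - inv_fourier h"
 using integrable_mult_inv_fourier[OF assms(1)] integrable_mult_inv_fourier[OF assms(2)]
 by (auto simp: fun_eq_iff inv_fourier_def left_diff_distrib)

lemma inv_fourier_zero: "inv_fourier (\<lambda>\<xi>. 0) = 0"
 by (auto simp: fun_eq_iff inv_fourier_def)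

lemma inv_fourier_sum:
 assumes "finite I" "\<And>i. i \<in> I ==> integrable lborel (g i)"
 shows "inv_fourier (\<lambda>\<xi>. \<Sum>i\<in>I. g i \<xi>) = (\<Sum>i\<in>I. inv_fourier (g i))"
 using assms
proof (induct I rule: finite_induct)
 case (insert i I)
 then show ?case by (simp add: inv_fourier_add)
qed (simp add: inv_fourier_zero)

lemma represents_inv_fourier:
 assumes "integrable lborel g" shows "represents (inv_fourier_fun g) (inv_fourier g)"
 unfolding represents_def
proof (intro conjI allI impI)
 have [measurable]: "inv_fourier_fun g \<in> borel_measurable borel"
  using assms by (intro inv_fourier_fun_measurable) auto
 show "locally_integrable (inv_fourier_fun g)"
  unfolding locally_integrable_def set_integrable_def
 proof (intro allI impI)
  fix K :: "(real^3) set" assume K: "compact K"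
  have [measurable]: "K \<in> sets borel" by (rule borel_closed[OF compact_imp_closed[OF K]])
  have "emeasure lborel K < \<infinity>" by (rule emeasure_compact_finite[OF K])
  then have i: "integrable lborel (\<lambda>x. (LINT x|lborel. norm (g x)) * indicator K x)"
   by (intro integrable_mult_right integrable_real_indicator) auto
  show "integrable lborel (\<lambda>x. indicator K x *\<^sub>R inv_fourier_fun g x)"
  proof (rule Bochner_Integration.integrable_bound[OF i])
   show "AE x in lborel. norm (indicator K x *\<^sub>R inv_fourier_fun g x) \<le> norm ((LINT x|lborel. norm (g x)) * indicator K x)"
    using order_trans[OF inv_fourier_fun_bound[OF assms] abs_ge_self]
    by (intro AE_I2) (auto simp: indicator_def)
  qed measurable
 qed
 fix \<phi> assume "test_fun \<phi>"
 then have s: "schwartz \<phi>" by (rule test_fun_schwartz)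
 then show "inv_fourier g \<phi> = (LINT x|lborel. inv_fourier_fun g x * \<phi> x)"
  using inv_fourier_multiplication_formula[OF assms schwartz_integrable(1)[OF s]] by (simp add: inv_fourier_def)
qed

text \<open>As a distribution, the inverse transform of an integrable function is the bounded function given
  by the inversion integral.\<close>

lemma density_inv_fourier:
 assumes "integrable lborel g"
 shows "AE x in lborel. density (inv_fourier g) x = inv_fourier_fun g x"
 by (rule density_AE_eq[OF represents_inv_fourier[OF assms]])

lemma density_inv_fourier_measurable:
 assumes "integrable lborel g" shows "density (inv_fourier g) \<in> borel_measurable borel"
 using represents_density[OF represents_inv_fourier[OF assms]] locally_integrable_measurable
 by (auto simp: represents_def)

lemma inv_fourier_fun_partial_deriv:
 assumes "schwartz \<phi>"
 shows "inv_fourier_fun (partial_deriv j \<phi>) \<xi> = - (\<i> * cr (\<xi> $ j) * inv_fourier_fun \<phi> \<xi>)"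
 by (simp add: inv_fourier_fun_eq fourier_fun_schwartz_partial_deriv[OF assms])

lemma dist_deriv_inv_fourier:
 "dist_deriv j (inv_fourier g) = inv_fourier (\<lambda>\<xi>. \<i> * cr (\<xi> $ j) * g \<xi>)"
proof
 fix \<phi>
 show "dist_deriv j (inv_fourier g) \<phi> = inv_fourier (\<lambda>\<xi>. \<i> * cr (\<xi> $ j) * g \<xi>) \<phi>"
 proof (cases "schwartz \<phi>")
  case True
  have "- (LINT \<xi>|lborel. g \<xi> * - (\<i> * cr (\<xi> $ j) * inv_fourier_fun \<phi> \<xi>))
    = (LINT \<xi>|lborel. \<i> * cr (\<xi> $ j) * g \<xi> * inv_fourier_fun \<phi> \<xi>)"
   unfolding integral_minus[symmetric] by (rule Bochner_Integration.integral_cong) (auto simp: mult_ac)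
  then show ?thesis
   using True by (simp only: dist_deriv_def inv_fourier_def schwartz_partial_deriv[OF True] if_True
     inv_fourier_fun_partial_deriv[OF True])
 qed (simp add: dist_deriv_def)
qed

section \<open>Products and convolutions\<close>

definition conv :: "(real^3 => complex) => (real^3 => complex) => real^3 => complex" where
 "conv f g \<xi> = (LINT \<eta>|lborel. f \<eta> * g (\<xi> - \<eta>))"

lemma integrable_conv_pair:
 fixes f g :: "real^3 => complex"
 assumes f: "integrable lborel f" and g: "integrable lborel g"
 shows "integrable (lborel \<Otimes>\<^sub>M lborel) (\<lambda>(\<eta>, \<xi>). f \<eta> * g (\<xi> - \<eta>))"
proof (rule lborel_pair.Fubini_integrable)
 have [measurable]: "f \<in> borel_measurable borel" "g \<in> borel_measurable borel" using f g by auto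
 have gs: "integrable lborel (\<lambda>\<xi>. g (\<xi> - \<eta>))" for \<eta>
  using integrable_affine3[OF g, of 1 "- \<eta>"] by simp
 have "(LINT \<xi>|lborel. cr (norm (g (- \<eta> + 1 *\<^sub>R \<xi>)))) = (LINT \<xi>|lborel. cr (norm (g \<xi>)))" for \<eta>
  by (subst integral_affine3[of "\<lambda>\<xi>. cr (norm (g \<xi>))"]) auto
 then have n: "(LINT \<xi>|lborel. norm (g (\<xi> - \<eta>))) = (LINT \<xi>|lborel. norm (g \<xi>))" for \<eta>
  by (simp add: integral_complex_of_real)
 show "(\<lambda>(\<eta>, \<xi>). f \<eta> * g (\<xi> - \<eta>)) \<in> borel_measurable (lborel \<Otimes>\<^sub>M lborel)" by measurable
 show "integrable lborel (\<lambda>\<eta>. LINT \<xi>|lborel. norm (case (\<eta>, \<xi>) of (\<eta>, \<xi>) => f \<eta> * g (\<xi> - \<eta>)))"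
  using f by (simp add: norm_mult n)
 show "AE \<eta> in lborel. integrable lborel (\<lambda>\<xi>. case (\<eta>, \<xi>) of (\<eta>, \<xi>) => f \<eta> * g (\<xi> - \<eta>))"
  using gs by (intro AE_I2) simp
qed

lemma conv_integrable:
 assumes f: "integrable lborel f" and g: "integrable lborel g"
 shows "integrable lborel (conv f g)"
 using lborel_pair.integrable_snd[OF integrable_conv_pair[OF assms]] by (simp add: conv_def[abs_def])

lemma fourier_fun_conv:
 assumes f: "integrable lborel f" and g: "integrable lborel g"
 shows "fourier_fun (conv f g) x = fourier_fun f x * fourier_fun g x"
proof -
 have [measurable]: "f \<in> borel_measurable borel" "g \<in> borel_measurable borel" using f g by auto
 have "integrable (lborel \<Otimes>\<^sub>M lborel) (\<lambda>(\<eta>, \<xi>). Fexp x \<xi> * (f \<eta> * g (\<xi> - \<eta>)))"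
  by (rule Bochner_Integration.integrable_bound[OF integrable_conv_pair[OF assms]]) (auto simp: norm_mult)
 from lborel_pair.Fubini_integral[OF this]
 have "fourier_fun (conv f g) x = (LINT \<eta>|lborel. LINT \<xi>|lborel. Fexp x \<xi> * (f \<eta> * g (\<xi> - \<eta>)))"
  by (simp add: fourier_fun_def conv_def)
 also have "... = (LINT \<eta>|lborel. Fexp x \<eta> * f \<eta> * fourier_fun g x)"
 proof (rule Bochner_Integration.integral_cong)
  fix \<eta>
  have "(LINT \<xi>|lborel. Fexp x \<xi> * (f \<eta> * g (\<xi> - \<eta>))) = (LINT \<xi>|lborel. f \<eta> * (Fexp x (\<xi>) * g (- \<eta> + \<xi>)))"
   by (simp add: mult_ac)
  also have "... = f \<eta> * fourier_fun (\<lambda>\<xi>. g (- \<eta> + \<xi>)) x"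
   by (simp only: integral_mult_right_zero fourier_fun_def)
  also have "... = f \<eta> * (exp (\<i> * cr (x \<bullet> (- \<eta>))) * fourier_fun g x)"
   by (subst fourier_fun_translate) simp_all
  finally show "(LINT \<xi>|lborel. Fexp x \<xi> * (f \<eta> * g (\<xi> - \<eta>))) = Fexp x \<eta> * f \<eta> * fourier_fun g x"
   by (simp add: mult_ac)
 qed simp
 also have "... = fourier_fun f x * fourier_fun g x" by (simp only: integral_mult_left_zero fourier_fun_def)
 finally show ?thesis .
qed

text \<open>The product of the two bounded functions is the inverse transform of the convolution.\<close>

lemma dist_prod_inv_fourier:
 assumes f: "integrable lborel f" and g: "integrable lborel g"
 shows "dist_prod (inv_fourier f) (inv_fourier g) = inv_fourier (\<lambda>\<xi>. conv f g \<xi> / cr ((2 * pi) ^ 3))"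
  (is "_ = inv_fourier ?C")
proof
 fix \<phi>
 show "dist_prod (inv_fourier f) (inv_fourier g) \<phi> = inv_fourier ?C \<phi>"
 proof (cases "schwartz \<phi>")
  case True
  have C: "integrable lborel ?C" using conv_integrable[OF f g] by simp
  have [measurable]: "density (inv_fourier f) \<in> borel_measurable borel" "density (inv_fourier g) \<in> borel_measurable borel"
   "inv_fourier_fun ?C \<in> borel_measurable borel" "\<phi> \<in> borel_measurable borel"
   using density_inv_fourier_measurable f g inv_fourier_fun_measurable[of ?C] C schwartz_measurable[OF True] by auto
  have p: "inv_fourier_fun f x * inv_fourier_fun g x = inv_fourier_fun ?C x" for x
  proof -
   have "fourier_fun ?C (- x) = fourier_fun (\<lambda>\<xi>. inverse (cr ((2 * pi) ^ 3)) * conv f g \<xi>) (- x)"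
    by (simp only: divide_inverse mult.commute)
   also have "... = inverse (cr ((2 * pi) ^ 3)) * (fourier_fun f (- x) * fourier_fun g (- x))"
    by (simp only: fourier_fun_cmult fourier_fun_conv[OF f g])
   finally show ?thesis
    unfolding inv_fourier_fun_eq by (simp only: divide_inverse mult_ac)
  qed
  have "(LINT x|lborel. density (inv_fourier f) x * density (inv_fourier g) x * \<phi> x) = (LINT x|lborel. inv_fourier_fun ?C x * \<phi> x)"
  proof (rule integral_cong_AE)
   show "AE x in lborel. density (inv_fourier f) x * density (inv_fourier g) x * \<phi> x = inv_fourier_fun ?C x * \<phi> x"
    using density_inv_fourier[OF f] density_inv_fourier[OF g] by eventually_elim (simp only: p[symmetric])
  qed measurable
  also have "... = (LINT \<xi>|lborel. ?C \<xi> * inv_fourier_fun \<phi> \<xi>)"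
   by (rule inv_fourier_multiplication_formula[OF C schwartz_integrable(1)[OF True]])
  finally show ?thesis using True by (simp add: dist_prod_def regular_dist_def inv_fourier_def)
 qed (simp add: dist_prod_def regular_dist_def)
qed

section \<open>Test functions are dense in the Schwartz space\<close>

lemma smooth_fun_iter_deriv: "smooth_fun f ==> smooth_fun (iter_deriv js f)"
 using iter_deriv_mem[of "{f. smooth_fun f}" f js] by (auto simp: smooth_fun_partial_deriv)

lemma partial_deriv_scale:
 assumes "\<And>x. f differentiable (at x)"
 shows "partial_deriv j (\<lambda>x. f (c *\<^sub>R x)) = (\<lambda>x. cr c * partial_deriv j f (c *\<^sub>R x))"
  and "(\<lambda>x. f (c *\<^sub>R x)) differentiable (at x)"
proof -
 have D: "((\<lambda>x. f (c *\<^sub>R x)) has_derivative (\<lambda>h. frechet_derivative f (at (c *\<^sub>R x)) (c *\<^sub>R h))) (at x)" for x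
  by (rule has_derivative_compose[of "\<lambda>x. c *\<^sub>R x" "\<lambda>h. c *\<^sub>R h"])
    (auto intro!: derivative_eq_intros has_derivative_frechet assms)
 show "(\<lambda>x. f (c *\<^sub>R x)) differentiable (at x)" using D differentiable_def by blast
 show "partial_deriv j (\<lambda>x. f (c *\<^sub>R x)) = (\<lambda>x. cr c * partial_deriv j f (c *\<^sub>R x))"
  by (rule ext, subst partial_deriv_eqI[OF D])
    (simp add: partial_deriv_def linear_scale[OF linear_frechet_derivative[OF assms]] scaleR_conv_of_real[where 'a = complex])
qed

lemma smooth_fun_scale: assumes "smooth_fun f" shows "smooth_fun (\<lambda>x. f (c *\<^sub>R x))"
proof (rule smooth_fun_coinduct[of _ "{\<lambda>x. d * f (c *\<^sub>R x) |d f. smooth_fun f}"])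
 show "(\<lambda>x. f (c *\<^sub>R x)) \<in> {\<lambda>x. d * f (c *\<^sub>R x) |d f. smooth_fun f}"
  by (intro CollectI exI[of _ 1] exI[of _ f]) (simp add: assms)
 fix h assume "h \<in> {\<lambda>x. d * f (c *\<^sub>R x) |d f. smooth_fun f}"
 then obtain d f where h: "h = (\<lambda>x. d * f (c *\<^sub>R x))" and f: "smooth_fun f" by blast
 have df: "f differentiable (at x)" for x using f by (rule smooth_fun_differentiable)
 show "h differentiable (at x)" for x
  unfolding h by (intro differentiable_mult differentiable_const partial_deriv_scale(2) df)
 show "partial_deriv j h \<in> {\<lambda>x. d * f (c *\<^sub>R x) |d f. smooth_fun f}" for j
 proof -
  have "partial_deriv j h = (\<lambda>x. (d * cr c) * partial_deriv j f (c *\<^sub>R x))"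
   unfolding h by (subst partial_deriv_cmult) (auto simp: partial_deriv_scale[OF df] mult.assoc)
  then show ?thesis using smooth_fun_partial_deriv[OF f, of j] by blast
 qed
qed

lemma iter_deriv_scale:
 assumes "smooth_fun f"
 shows "iter_deriv js (\<lambda>x. f (c *\<^sub>R x)) = (\<lambda>x. cr (c ^ length js) * iter_deriv js f (c *\<^sub>R x))"
proof (induct js)
 case (Cons j js)
 have d: "iter_deriv js f differentiable (at x)" for x
  by (rule smooth_fun_differentiable[OF smooth_fun_iter_deriv[OF assms]])
 show ?case
  unfolding foldr.simps comp_def Cons
  by (subst partial_deriv_cmult) (auto simp: partial_deriv_scale[OF d] mult_ac)
qed simp

text \<open>Bounded first derivatives; this is the source of the factor \<open>1/n\<close> in the error of the
  cut-off.\<close>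

lemma schwartz_lipschitz:
 assumes "schwartz f" shows "norm (f x - f 0) \<le> (3 * schwartz_norm 1 f) * norm x"
proof -
 have "norm (f x - f 0) \<le> (3 * schwartz_norm 1 f) * norm (x - 0)"
 proof (rule differentiable_bound[OF convex_UNIV])
  fix x
  show "(f has_derivative frechet_derivative f (at x)) (at x within UNIV)"
   using has_derivative_frechet[OF schwartz_differentiable[OF assms]] by simp
  show "onorm (frechet_derivative f (at x)) \<le> 3 * schwartz_norm 1 f"
  proof (rule onorm_le, goal_cases)
   case (1 h)
   have lin: "linear (frechet_derivative f (at x))"
    by (rule linear_frechet_derivative[OF schwartz_differentiable[OF assms]])
   have "frechet_derivative f (at x) h = frechet_derivative f (at x) (\<Sum>j\<in>UNIV. (h $ j) *\<^sub>R axis j 1)"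
    by (simp add: basis_expansion[of h, unfolded scalar_mult_eq_scaleR])
   also have "... = (\<Sum>j\<in>UNIV. (h $ j) *\<^sub>R partial_deriv j f x)"
    unfolding partial_deriv_def linear_sum[OF lin] by (simp only: linear_scale[OF lin])
   also have "norm ... \<le> (\<Sum>j\<in>(UNIV::3 set). norm h * schwartz_norm 1 f)"
   proof (rule sum_norm_le, goal_cases)
    case (1 j)
    have "norm (partial_deriv j f x) \<le> (1 + norm x) ^ 1 * norm (partial_deriv j f x)"
     by (simp add: mult_le_cancel_right1)
    also have "... \<le> schwartz_norm 1 f" using schwartz_norm_upper[OF assms, of "[j]" 1 x] by simp
    finally show ?case
     unfolding norm_scaleR using component_le_norm_cart[of h j] by (intro mult_mono) auto
   qed
   finally show ?case by (simp add: mult_ac)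
  qed
 qed auto
 then show ?thesis by simp
qed

text \<open>Families whose derivatives of all orders are \<open>O((1 + |x|) / n)\<close>. The class is closed under
  differentiation, so that Leibniz' rule needs no explicit formula.\<close>

definition small_family :: "(nat => real^3 => complex) => bool" where
 "small_family g \<longleftrightarrow> (\<forall>n. smooth_fun (g n)) \<and>
   (\<forall>js. \<exists>C\<ge>0. \<forall>n x. norm (iter_deriv js (g n) x) \<le> C * (1 + norm x) / real (Suc n))"

lemma small_family_partial_deriv:
 assumes "small_family g" shows "small_family (\<lambda>n. partial_deriv j (g n))"
 unfolding small_family_def
proof (intro conjI allI)
 show "smooth_fun (partial_deriv j (g n))" for n
  using assms by (simp add: small_family_def smooth_fun_partial_deriv)
 fix js
 show "\<exists>C\<ge>0. \<forall>n x. norm (iter_deriv js (partial_deriv j (g n)) x) \<le> C * (1 + norm x) / real (Suc n)"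
  using assms[unfolded small_family_def, THEN conjunct2, rule_format, of "js @ [j]"] by simp
qed

lemma small_family_mult:
 assumes "schwartz \<phi>" "small_family g"
 shows "\<exists>K\<ge>0. \<forall>n x. (1 + norm x) ^ N * norm (iter_deriv js (\<lambda>x. \<phi> x * g n x) x) \<le> K / real (Suc n)"
 using assms
proof (induct js arbitrary: \<phi> g rule: rev_induct)
 case Nil
 obtain C where C: "C \<ge> 0" "\<And>n x. norm (g n x) \<le> C * (1 + norm x) / real (Suc n)"
  using Nil(2)[unfolded small_family_def, THEN conjunct2, rule_format, of "[]"] by auto
 have "(1 + norm x) ^ N * norm (\<phi> x * g n x) \<le> (schwartz_norm (Suc N) \<phi> * C) / real (Suc n)" for n x
 proof -
  have "(1 + norm x) ^ N * norm (\<phi> x * g n x) \<le> (1 + norm x) ^ N * (norm (\<phi> x) * (C * (1 + norm x) / real (Suc n)))"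
   unfolding norm_mult by (intro mult_left_mono C) auto
  also have "... = ((1 + norm x) ^ Suc N * norm (\<phi> x)) * (C / real (Suc n))" by simp
  also have "... \<le> schwartz_norm (Suc N) \<phi> * (C / real (Suc n))"
   using C(1) by (intro mult_right_mono schwartz_decay Nil(1)) auto
  finally show ?thesis by simp
 qed
 then show ?case using C(1) schwartz_norm_nonneg[OF Nil(1)]
  by (intro exI[of _ "schwartz_norm (Suc N) \<phi> * C"]) auto
next
 case (snoc j js)
 have gs: "smooth_fun (g n)" for n using snoc(3) by (simp add: small_family_def)
 have ps: "smooth_fun \<phi>" by (rule schwartz_smooth[OF snoc(2)])
 obtain K where K: "K \<ge> 0" "\<And>n x. (1 + norm x) ^ N * norm (iter_deriv js (\<lambda>x. \<phi> x * partial_deriv j (g n) x) x) \<le> K / real (Suc n)"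
  using snoc(1)[OF snoc(2) small_family_partial_deriv[OF snoc(3), of j]] by blast
 obtain L where L: "L \<ge> 0" "\<And>n x. (1 + norm x) ^ N * norm (iter_deriv js (\<lambda>x. partial_deriv j \<phi> x * g n x) x) \<le> L / real (Suc n)"
  using snoc(1)[OF schwartz_partial_deriv[OF snoc(2), of j] snoc(3)] by blast
 have "(1 + norm x) ^ N * norm (iter_deriv (js @ [j]) (\<lambda>x. \<phi> x * g n x) x) \<le> (K + L) / real (Suc n)" for n x
 proof -
  have "iter_deriv (js @ [j]) (\<lambda>x. \<phi> x * g n x) =
   (\<lambda>x. iter_deriv js (\<lambda>x. \<phi> x * partial_deriv j (g n) x) x + iter_deriv js (\<lambda>x. partial_deriv j \<phi> x * g n x) x)"
   unfolding foldr_append foldr.simps comp_def id_def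
   by (subst partial_deriv_mult, simp add: smooth_fun_differentiable ps, simp add: smooth_fun_differentiable gs)
     (rule iter_deriv_add; intro smooth_fun_mult smooth_fun_partial_deriv ps gs)
  then have "(1 + norm x) ^ N * norm (iter_deriv (js @ [j]) (\<lambda>x. \<phi> x * g n x) x)
   \<le> (1 + norm x) ^ N * (norm (iter_deriv js (\<lambda>x. \<phi> x * partial_deriv j (g n) x) x) + norm (iter_deriv js (\<lambda>x. partial_deriv j \<phi> x * g n x) x))"
   by (simp only:) (intro mult_left_mono norm_triangle_ineq; simp)
  also have "... \<le> K / real (Suc n) + L / real (Suc n)"
   unfolding distrib_left by (intro add_mono K L)
  finally show ?thesis by (simp add: add_divide_distrib)
 qed
 then show ?case using K(1) L(1) by (intro exI[of _ "K + L"]) auto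
qed

text \<open>A fixed bump, normalised to be 1 at the origin and stretched by the factor \<open>n +
  1\<close>.\<close>

definition cutoff :: "nat => real^3 => complex" where
 "cutoff n x = cr (bump (\<chi> j. -1) (\<chi> j. 1) (inverse (real (Suc n)) *\<^sub>R x) / bump (\<chi> j. -1) (\<chi> j. 1) 0)"

lemma bump_0_pos: "0 < bump (\<chi> j. -1) (\<chi> j. 1) 0"
 by (simp add: bump_pos_iff mem_box_cart)

definition chi1 :: "real^3 => complex" where
 "chi1 x = inverse (cr (bump (\<chi> j. -1) (\<chi> j. 1) 0)) * cr (bump (\<chi> j. -1) (\<chi> j. 1) x)"

lemma test_fun_chi1: "test_fun chi1"
 unfolding chi1_def[abs_def] by (rule test_fun_mult[OF smooth_fun_const test_fun_bump])

lemma chi1_0: "chi1 0 = 1"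
 using bump_0_pos by (simp add: chi1_def)

lemma cutoff_eq: "cutoff n = (\<lambda>x. chi1 (inverse (real (Suc n)) *\<^sub>R x))"
 by (rule ext) (simp add: cutoff_def chi1_def divide_inverse mult.commute)

lemma test_fun_cutoff: "test_fun (cutoff n)"
proof (rule test_funI)
 show "smooth_fun (cutoff n)"
  unfolding cutoff_eq by (rule smooth_fun_scale) (use test_fun_chi1 in \<open>simp add: test_fun_def\<close>)
 fix x :: "real^3" assume x: "x \<notin> cbox (\<chi> j. - real (Suc n)) (\<chi> j. real (Suc n))"
 have "inverse (real (Suc n)) *\<^sub>R x \<notin> box (\<chi> j. -1) (\<chi> j. 1)"
 proof
  assume *: "inverse (real (Suc n)) *\<^sub>R x \<in> box (\<chi> j. -1) (\<chi> j. 1)"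
  have "- real (Suc n) \<le> x $ j \<and> x $ j \<le> real (Suc n)" for j
  proof -
   have "-1 < inverse (real (Suc n)) * x $ j" "inverse (real (Suc n)) * x $ j < 1"
    using * by (auto simp: mem_box_cart)
   then show ?thesis by (auto simp: divide_simps mult.commute simp del: of_nat_Suc)
  qed
  then show False using x by (simp add: mem_box_cart)
 qed
 then have "bump (\<chi> j. -1) (\<chi> j. 1) (inverse (real (Suc n)) *\<^sub>R x) = 0"
  using bump_pos_iff bump_nonneg less_eq_real_def by metis
 then show "cutoff n x = 0" by (simp only: cutoff_def) simp
qed

lemma small_family_cutoff: "small_family (\<lambda>n x. 1 - cutoff n x)"
 unfolding small_family_def
proof (intro conjI allI)
 have s: "schwartz chi1" by (rule test_fun_schwartz[OF test_fun_chi1])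
 have sc: "smooth_fun (cutoff n)" for n using test_fun_cutoff by (simp add: test_fun_def)
 show "smooth_fun (\<lambda>x. 1 - cutoff n x)" for n by (intro smooth_fun_diff smooth_fun_const sc)
 fix js
 show "\<exists>C\<ge>0. \<forall>n x. norm (iter_deriv js (\<lambda>x. 1 - cutoff n x) x) \<le> C * (1 + norm x) / real (Suc n)"
 proof (cases js rule: rev_cases)
  case Nil
  have "norm (1 - cutoff n x) \<le> (3 * schwartz_norm 1 chi1) * (1 + norm x) / real (Suc n)" for n x
  proof -
   have "norm (1 - cutoff n x) \<le> (3 * schwartz_norm 1 chi1) * norm (inverse (real (Suc n)) *\<^sub>R x)"
    using schwartz_lipschitz[OF s, of "inverse (real (Suc n)) *\<^sub>R x"] unfolding chi1_0 cutoff_eq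
    by (simp only: norm_minus_commute)
   also have "... = (3 * schwartz_norm 1 chi1) * norm x / real (Suc n)"
    by (simp add: divide_inverse mult_ac del: of_nat_Suc)
   also have "... \<le> (3 * schwartz_norm 1 chi1) * (1 + norm x) / real (Suc n)"
    using schwartz_norm_nonneg[OF s] by (intro divide_right_mono mult_left_mono) auto
   finally show ?thesis .
  qed
  then show ?thesis
   unfolding Nil using schwartz_norm_nonneg[OF s, of 1] by (intro exI[of _ "3 * schwartz_norm 1 chi1"]) auto
 next
  case (snoc ks j)
  have B: "norm (iter_deriv js chi1 y) \<le> schwartz_norm (length js) chi1" for y
  proof -
   have "1 * norm (iter_deriv js chi1 y) \<le> (1 + norm y) ^ length js * norm (iter_deriv js chi1 y)"
    by (intro mult_right_mono one_le_power) auto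
   then show ?thesis using schwartz_norm_upper[OF s, of js "length js" y] by simp
  qed
  have "norm (iter_deriv js (\<lambda>x. 1 - cutoff n x) x) \<le> schwartz_norm (length js) chi1 * (1 + norm x) / real (Suc n)" for n x
  proof -
   let ?c = "inverse (real (Suc n))"
   have "partial_deriv j (\<lambda>x. 1 - cutoff n x) = partial_deriv j (\<lambda>x. 1 + (-1) * cutoff n x)" by simp
   also have "... = (\<lambda>x. -1 * partial_deriv j (cutoff n) x)"
    unfolding partial_deriv_add[OF differentiable_const smooth_fun_differentiable[OF smooth_fun_cmult[OF sc]]]
     partial_deriv_const partial_deriv_cmult[OF smooth_fun_differentiable[OF sc]] by simp
   finally have "iter_deriv js (\<lambda>x. 1 - cutoff n x) = iter_deriv ks (\<lambda>x. -1 * partial_deriv j (cutoff n) x)"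
    unfolding snoc by simp
   also have "... = (\<lambda>x. -1 * iter_deriv js (cutoff n) x)"
    by (subst iter_deriv_cmult) (auto simp: snoc smooth_fun_partial_deriv sc)
   finally have "norm (iter_deriv js (\<lambda>x. 1 - cutoff n x) x) = ?c ^ length js * norm (iter_deriv js chi1 (?c *\<^sub>R x))"
    unfolding cutoff_eq iter_deriv_scale[OF schwartz_smooth[OF s]]
    by (simp only: norm_mult norm_of_real norm_minus_cancel norm_one mult_1_left abs_of_nonneg zero_le_power
      inverse_nonnegative_iff_nonnegative of_nat_0_le_iff)
   also have "... \<le> ?c * schwartz_norm (length js) chi1"
   proof (intro mult_mono B)
    have "?c ^ length js \<le> ?c ^ 1" by (intro power_decreasing) (auto simp: snoc divide_simps)
    then show "?c ^ length js \<le> ?c" by simp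
   qed auto
   also have "... \<le> schwartz_norm (length js) chi1 * (1 + norm x) / real (Suc n)"
    using schwartz_norm_nonneg[OF s, of "length js"]
    by (simp add: divide_inverse mult_ac mult_le_cancel_left1 mult_left_mono)
   finally show ?thesis .
  qed
  then show ?thesis using schwartz_norm_nonneg[OF s] by blast
 qed
qed

text \<open>The error \<open>1 - cutoff n\<close> and its derivatives are \<open>O((1 + |x|)/n)\<close>, and
  the Schwartz function compensates the growth.\<close>

lemma schwartz_norm_cutoff:
 assumes "schwartz \<phi>"
 shows "\<exists>K\<ge>0. \<forall>n. schwartz_norm N (\<lambda>x. \<phi> x * (1 - cutoff n x)) \<le> K / real (Suc n)"
proof -
 have "\<forall>js. \<exists>K\<ge>0. \<forall>n x. (1 + norm x) ^ N * norm (iter_deriv js (\<lambda>x. \<phi> x * (1 - cutoff n x)) x) \<le> K / real (Suc n)"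
  using small_family_mult[OF assms small_family_cutoff] by blast
 from choice[OF this] obtain K where K0: "\<And>js. K js \<ge> 0" and
  K: "\<And>js n x. (1 + norm x) ^ N * norm (iter_deriv js (\<lambda>x. \<phi> x * (1 - cutoff n x)) x) \<le> K js / real (Suc n)" by blast
 let ?S = "{js :: 3 list. length js \<le> N}"
 have "schwartz_norm N (\<lambda>x. \<phi> x * (1 - cutoff n x)) \<le> (\<Sum>js\<in>?S. K js) / real (Suc n)" for n
 proof (rule schwartz_norm_le)
  fix js :: "3 list" and x :: "real^3" assume "length js \<le> N"
  then have "K js \<le> (\<Sum>js\<in>?S. K js)"
   by (intro member_le_sum) (auto simp: K0 finite_lists_le)
  then show "(1 + norm x) ^ N * norm (iter_deriv js (\<lambda>x. \<phi> x * (1 - cutoff n x)) x) \<le> (\<Sum>js\<in>?S. K js) / real (Suc n)"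
   by (intro order_trans[OF K] divide_right_mono) auto
 qed
 moreover have "(\<Sum>js\<in>?S. K js) \<ge> 0" by (intro sum_nonneg K0)
 ultimately show ?thesis by blast
qed

text \<open>Both sides agree on the Fourier transforms of test functions. For a general Schwartz function the
  cut-off makes the difference tend to zero: on the left by continuity of \<open>f\<close> in a Schwartz
  seminorm, on the right by dominated convergence.\<close>

lemma tempered_eq_inv_fourier:
 assumes f: "tempered f" "fourier_locally_integrable f" and i: "integrable lborel (fhat f)"
 shows "f = inv_fourier (fhat f)"
proof
 fix \<psi>
 obtain C N where C: "\<And>\<phi>. schwartz \<phi> ==> norm (f \<phi>) \<le> C * schwartz_norm N \<phi>"
  using f(1) unfolding tempered_def by blast
 have addf: "f (\<lambda>x. \<phi> x + \<psi> x) = f \<phi> + f \<psi>" if "schwartz \<phi>" "schwartz \<psi>" for \<phi> \<psi>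
  using f(1) that unfolding tempered_def by blast
 have f0: "f \<psi> = 0" if "\<not> schwartz \<psi>" using f(1) that unfolding tempered_def by blast
 obtain D M where D: "D \<ge> 0" "\<And>\<phi>. schwartz \<phi> ==> schwartz_norm N (fourier_fun \<phi>) \<le> D * schwartz_norm M \<phi>"
  using schwartz_norm_fourier_fun by blast
 show "f \<psi> = inv_fourier (fhat f) \<psi>"
 proof (cases "schwartz \<psi>")
  case True
  let ?\<phi> = "inv_fourier_fun \<psi>"
  have \<phi>: "schwartz ?\<phi>" by (rule schwartz_inv_fourier_fun[OF True])
  obtain K where K: "K \<ge> 0" "\<And>n. schwartz_norm M (\<lambda>x. ?\<phi> x * (1 - cutoff n x)) \<le> K / real (Suc n)"
   using schwartz_norm_cutoff[OF \<phi>] by blast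
  have t: "test_fun (\<lambda>x. ?\<phi> x * cutoff n x)" for n
   by (rule test_fun_mult[OF schwartz_smooth[OF \<phi>] test_fun_cutoff])
  have s1: "schwartz (\<lambda>x. ?\<phi> x * cutoff n x)" for n by (rule test_fun_schwartz[OF t])
  have s2: "schwartz (\<lambda>x. ?\<phi> x * (1 - cutoff n x))" for n
   using schwartz_add[OF \<phi> schwartz_cmult[OF s1, of "-1"]] by (simp add: algebra_simps)
  have split: "f (fourier_fun ?\<phi>) = f (fourier_fun (\<lambda>x. ?\<phi> x * cutoff n x)) + f (fourier_fun (\<lambda>x. ?\<phi> x * (1 - cutoff n x)))" for n
  proof -
   have "fourier_fun (\<lambda>x. ?\<phi> x * cutoff n x + ?\<phi> x * (1 - cutoff n x))
     = (\<lambda>\<xi>. fourier_fun (\<lambda>x. ?\<phi> x * cutoff n x) \<xi> + fourier_fun (\<lambda>x. ?\<phi> x * (1 - cutoff n x)) \<xi>)"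
    by (rule ext) (rule fourier_fun_add[OF schwartz_integrable(1)[OF s1] schwartz_integrable(1)[OF s2]])
   moreover have "(\<lambda>x. ?\<phi> x * cutoff n x + ?\<phi> x * (1 - cutoff n x)) = ?\<phi>"
    by (simp add: fun_eq_iff algebra_simps)
   ultimately have "fourier_fun ?\<phi>
     = (\<lambda>\<xi>. fourier_fun (\<lambda>x. ?\<phi> x * cutoff n x) \<xi> + fourier_fun (\<lambda>x. ?\<phi> x * (1 - cutoff n x)) \<xi>)" by simp
   from arg_cong[OF this, of f] show ?thesis
    by (simp only: addf[OF schwartz_fourier_fun[OF s1] schwartz_fourier_fun[OF s2]])
  qed
  have "(\<lambda>n. f (fourier_fun ?\<phi>) - f (fourier_fun (\<lambda>x. ?\<phi> x * cutoff n x))) \<longlonglongrightarrow> 0"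
  proof (rule tendsto_norm_zero_cancel, rule tendsto_sandwich[OF _ _ tendsto_const])
   show "\<forall>\<^sub>F n in sequentially. norm (f (fourier_fun ?\<phi>) - f (fourier_fun (\<lambda>x. ?\<phi> x * cutoff n x))) \<le> (\<bar>C\<bar> * (D * K)) * inverse (real (Suc n))"
   proof (rule always_eventually, rule allI, goal_cases)
    case (1 n)
    let ?r = "\<lambda>x. ?\<phi> x * (1 - cutoff n x)"
    have "norm (f (fourier_fun ?r)) \<le> C * schwartz_norm N (fourier_fun ?r)"
     by (rule C[OF schwartz_fourier_fun[OF s2]])
    also have "... \<le> \<bar>C\<bar> * schwartz_norm N (fourier_fun ?r)"
     by (intro mult_right_mono schwartz_norm_nonneg schwartz_fourier_fun s2) auto
    also have "... \<le> \<bar>C\<bar> * (D * (K / real (Suc n)))"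
     by (intro mult_left_mono order_trans[OF D(2)[OF s2]] mult_left_mono[OF K(2) D(1)]) auto
    finally show ?case
     unfolding split[of n] by (simp add: divide_inverse mult_ac)
   qed
   show "(\<lambda>n. (\<bar>C\<bar> * (D * K)) * inverse (real (Suc n))) \<longlonglongrightarrow> 0"
    using tendsto_mult_right_zero[OF LIMSEQ_inverse_real_of_nat] by simp
  qed simp
  then have L1: "(\<lambda>n. f (fourier_fun (\<lambda>x. ?\<phi> x * cutoff n x))) \<longlonglongrightarrow> f (fourier_fun ?\<phi>)"
   using tendsto_diff[OF tendsto_const[of "f (fourier_fun ?\<phi>)"]] by fastforce
  have r: "f (fourier_fun (\<lambda>x. ?\<phi> x * cutoff n x)) = (LINT \<xi>|lborel. fhat f \<xi> * (?\<phi> \<xi> * cutoff n \<xi>))" for n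
  proof -
   have "fourier_dist f (\<lambda>x. ?\<phi> x * cutoff n x) = (LINT \<xi>|lborel. fhat f \<xi> * (?\<phi> \<xi> * cutoff n \<xi>))"
    using represents_fhat[OF f(2)] t[of n] unfolding represents_def by blast
   then show ?thesis using s1[of n] by (simp add: fourier_dist_def)
  qed
  have m: "?\<phi> \<in> borel_measurable borel" "cutoff n \<in> borel_measurable borel" "fhat f \<in> borel_measurable borel" for n
   using schwartz_measurable \<phi> test_fun_schwartz[OF test_fun_cutoff] fhat_measurable[OF f(2)] by auto
  note [measurable] = m
  have cb: "norm (cutoff n x) \<le> schwartz_norm 0 chi1" for n x
   using schwartz_decay[OF test_fun_schwartz[OF test_fun_chi1], of _ 0] by (simp add: cutoff_eq)
  have "(\<lambda>n. LINT \<xi>|lborel. fhat f \<xi> * (?\<phi> \<xi> * cutoff n \<xi>)) \<longlonglongrightarrow> (LINT \<xi>|lborel. fhat f \<xi> * ?\<phi> \<xi>)"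
  proof (rule integral_dominated_convergence)
   show "integrable lborel (\<lambda>\<xi>. norm (fhat f \<xi> * ?\<phi> \<xi>) * schwartz_norm 0 chi1)"
    by (intro integrable_mult_left integrable_norm integrable_mult_inv_fourier i True)
   show "AE \<xi> in lborel. (\<lambda>n. fhat f \<xi> * (?\<phi> \<xi> * cutoff n \<xi>)) \<longlonglongrightarrow> fhat f \<xi> * ?\<phi> \<xi>"
   proof (rule AE_I2, goal_cases)
    case (1 \<xi>)
    have c: "isCont chi1 0" using schwartz_differentiable[OF test_fun_schwartz[OF test_fun_chi1]]
     by (rule differentiable_imp_continuous_within)
    have "(\<lambda>n. inverse (real (Suc n)) *\<^sub>R \<xi>) \<longlonglongrightarrow> 0 *\<^sub>R \<xi>"
     by (rule tendsto_scaleR[OF LIMSEQ_inverse_real_of_nat tendsto_const])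
    then have "(\<lambda>n. cutoff n \<xi>) \<longlonglongrightarrow> 1"
     unfolding cutoff_eq chi1_0[symmetric] by (intro isCont_tendsto_compose[OF c]) simp
    then have "(\<lambda>n. fhat f \<xi> * (?\<phi> \<xi> * cutoff n \<xi>)) \<longlonglongrightarrow> fhat f \<xi> * (?\<phi> \<xi> * 1)" by (intro tendsto_intros)
    then show ?case by simp
   qed
   show "AE \<xi> in lborel. norm (fhat f \<xi> * (?\<phi> \<xi> * cutoff n \<xi>)) \<le> norm (fhat f \<xi> * ?\<phi> \<xi>) * schwartz_norm 0 chi1" for n
    by (intro AE_I2) (simp only: norm_mult mult.assoc[symmetric], intro mult_left_mono cb, simp)
  qed measurable
  then have "f (fourier_fun ?\<phi>) = (LINT \<xi>|lborel. fhat f \<xi> * ?\<phi> \<xi>)"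
   using L1 unfolding r by (rule LIMSEQ_unique[rotated])
  then show ?thesis using True by (simp add: fourier_inv_fourier inv_fourier_def)
 qed (simp add: f0)
qed

section \<open>Inequalities between the weights\<close>

lemma power_div_fact_le_exp: "0 \<le> x ==> x ^ n / fact n \<le> exp (x::real)"
 using sum_le_suminf[OF summable_exp_generic[of x], of "{n}"]
 by (simp add: divide_inverse mult.commute exp_def)

lemma powr_le_exp:
 fixes b p q :: real
 assumes "b > 0" "p \<ge> 0" "q > 0"
 shows "\<exists>K\<ge>0. \<forall>r>0. r powr p \<le> K * exp (b * r powr q)"
proof -
 define n where "n = nat \<lceil>p / q\<rceil>"
 have n: "p / q \<le> real n" unfolding n_def using assms by linarith
 have "r powr p \<le> (1 + fact n / b ^ n) * exp (b * r powr q)" if r: "r > 0" for r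
 proof -
  let ?x = "r powr q"
  have x: "?x > 0" using r by simp
  have "r powr p = ?x powr (p / q)" using assms r by (simp add: powr_powr)
  also have "... \<le> 1 + ?x ^ n"
  proof (cases "?x \<le> 1")
   case True
   then have "?x powr (p / q) \<le> 1" using assms x by (intro powr_le1) auto
   then show ?thesis using x zero_le_power[of ?x n] by linarith
  next
   case False
   then have "?x powr (p / q) \<le> ?x powr real n" by (intro powr_mono n) auto
   then show ?thesis using x by (simp add: powr_realpow)
  qed
  also have "... \<le> exp (b * ?x) + fact n / b ^ n * exp (b * ?x)"
  proof (rule add_mono)
   show "1 \<le> exp (b * ?x)" using assms x by simp
   have "(b * ?x) ^ n / fact n \<le> exp (b * ?x)" using assms x by (intro power_div_fact_le_exp) auto
   then have "fact n / b ^ n * ((b * ?x) ^ n / fact n) \<le> fact n / b ^ n * exp (b * ?x)"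
    using assms by (intro mult_left_mono) auto
   then show "?x ^ n \<le> fact n / b ^ n * exp (b * ?x)" using assms by (simp add: power_mult_distrib)
  qed
  finally show ?thesis by (simp add: distrib_right)
 qed
 moreover have "0 \<le> 1 + fact n / b ^ n" using assms by simp
 ultimately show ?thesis by blast
qed

text \<open>Concavity of \<open>r \<mapsto> r\<^sup>p\<close>: the smaller summand contributes with the factor
  \<open>p\<close>, which is below 1 when \<open>\<sigma> > 1\<close>.\<close>

lemma powr_add_le:
 fixes p m M :: real
 assumes "0 < p" "p \<le> 1" "0 < m" "m \<le> M"
 shows "(m + M) powr p \<le> M powr p + p * m powr p"
proof -
 have M: "M > 0" using assms by linarith
 have "(1 + m / M) powr p * 1 powr (1 - p) \<le> p * (1 + m / M) + (1 - p) * 1"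
  using assms M by (intro Youngs_inequality_0) (auto intro: add_pos_pos)
 then have 1: "(1 + m / M) powr p \<le> 1 + p * (m / M)" by (simp add: algebra_simps)
 have "m / M \<le> (m / M) powr p"
  using assms M powr_mono'[of p 1 "m / M"] by simp
 then have "(1 + m / M) powr p \<le> 1 + p * (m / M) powr p"
  using 1 assms(1) by (meson add_left_mono mult_left_mono order_trans less_imp_le)
 then have "M powr p * (1 + m / M) powr p \<le> M powr p * (1 + p * (m / M) powr p)"
  by (intro mult_left_mono) auto
 also have "... = M powr p + p * m powr p"
  using assms M by (simp add: powr_divide distrib_left)
 also have "M powr p * (1 + m / M) powr p = (m + M) powr p"
  using assms M by (simp add: powr_mult[symmetric] distrib_left add.commute)
 finally show ?thesis .
qed

locale boussinesq =
 fixes \<alpha> \<beta> a s \<sigma> :: real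
 assumes alpha: "\<alpha> \<ge> 1/2" and beta: "\<beta> \<ge> 1/2"
  and params: "(a, s, \<sigma>) \<in> {0<..} \<times> {-1..<0} \<times> {1<..} \<union> {0..} \<times> {0} \<times> {1..}"
begin

abbreviation w :: "real => real^3 => real" where
 "w r \<equiv> X_weight a \<sigma> r"

lemma par: "0 \<le> a" "-1 \<le> s" "s \<le> 0" "1 \<le> \<sigma>" "s < 0 ==> 0 < a" "s < 0 ==> 1 < \<sigma>"
 using params by auto

lemma w_measurable [measurable]: "w r \<in> borel_measurable borel"
 unfolding X_weight_def by measurable

lemma w_nonneg [simp]: "0 \<le> w r \<xi>"
 by (simp add: X_weight_def)

lemma w_pos: "\<xi> \<noteq> 0 ==> 0 < w r \<xi>"
 by (simp add: X_weight_def)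

lemma w_0 [simp]: "w r 0 = 0"
 by (simp add: X_weight_def)

lemma w_shift: "w (r + q) \<xi> = norm \<xi> powr q * w r \<xi>"
 by (simp add: X_weight_def powr_add)

lemma w_succ: "w (r + 1) \<xi> = norm \<xi> * w r \<xi>"
 by (cases "\<xi> = 0") (simp_all add: w_shift)

text \<open>The low frequency in a product only costs a fraction of the exponential weight; the remaining
  fraction absorbs the negative power of the frequency.\<close>

lemma low_frequency_weight:
 "\<exists>K>0. \<forall>r>0. exp (a / \<sigma> * r powr (1 / \<sigma>)) \<le> K * (r powr s * exp (a * r powr (1 / \<sigma>)))"
proof (cases "s = 0")
 case True
 have "a / \<sigma> \<le> a" using par by (simp add: divide_le_eq mult_le_cancel_left1)
 then have "exp (a / \<sigma> * r powr (1 / \<sigma>)) \<le> 1 * (r powr s * exp (a * r powr (1 / \<sigma>)))" if "r > 0" for r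
  using that True mult_right_mono[OF \<open>a / \<sigma> \<le> a\<close>, of "r powr (1 / \<sigma>)"] by simp
 then show ?thesis using zero_less_one by blast
next
 case False
 then have s: "s < 0" "0 < a" "1 < \<sigma>" using par by auto
 obtain K where K: "K \<ge> 0" "\<And>r. r > 0 ==> r powr (- s) \<le> K * exp ((a - a / \<sigma>) * r powr (1 / \<sigma>))"
  using powr_le_exp[of "a - a / \<sigma>" "- s" "1 / \<sigma>"] s by (auto simp: divide_less_eq)
 have "exp (a / \<sigma> * r powr (1 / \<sigma>)) \<le> (K + 1) * (r powr s * exp (a * r powr (1 / \<sigma>)))" if r: "r > 0" for r
 proof -
  let ?x = "r powr (1 / \<sigma>)"
  have "exp (a / \<sigma> * ?x) = r powr (- s) * (r powr s * exp (a / \<sigma> * ?x))"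
   using r by (simp add: powr_minus)
  also have "... \<le> ((K + 1) * exp ((a - a / \<sigma>) * ?x)) * (r powr s * exp (a / \<sigma> * ?x))"
   using K(2)[OF r] by (intro mult_right_mono) (auto simp: distrib_right intro: add_increasing2)
  also have "... = (K + 1) * (r powr s * (exp ((a - a / \<sigma>) * ?x) * exp (a / \<sigma> * ?x)))" by simp
  also have "exp ((a - a / \<sigma>) * ?x) * exp (a / \<sigma> * ?x) = exp (a * ?x)"
   by (simp add: exp_add[symmetric] algebra_simps)
  finally show ?thesis .
 qed
 then show ?thesis using K(1) by (intro exI[of _ "K + 1"]) auto
qed

text \<open>The same constant bounds \<open>1 / w s\<close> (\<open>one_le_w\<close>), so that elements of
  \<open>\<X>\<^sup>s\<close> have integrable Fourier transforms.\<close>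

definition Kw :: real where
 "Kw = (SOME K. K > 0 \<and> (\<forall>r>0. exp (a / \<sigma> * r powr (1 / \<sigma>)) \<le> K * (r powr s * exp (a * r powr (1 / \<sigma>)))))"

lemma Kw: "Kw > 0" "r > 0 ==> exp (a / \<sigma> * r powr (1 / \<sigma>)) \<le> Kw * (r powr s * exp (a * r powr (1 / \<sigma>)))"
 using someI_ex[OF low_frequency_weight[unfolded Bex_def]] unfolding Kw_def by blast+

lemma one_le_w: "\<xi> \<noteq> 0 ==> 1 \<le> Kw * w s \<xi>"
proof -
 assume "\<xi> \<noteq> 0"
 then have "1 \<le> exp (a / \<sigma> * norm \<xi> powr (1 / \<sigma>))" using par by simp
 also have "... \<le> Kw * w s \<xi>" using Kw(2)[of "norm \<xi>"] \<open>\<xi> \<noteq> 0\<close> by (simp add: X_weight_def)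
 finally show ?thesis .
qed

lemma norm_le_w: "norm \<xi> \<le> Kw * w (s + 1) \<xi>"
proof (cases "\<xi> = 0")
 case False
 then show ?thesis using mult_left_mono[OF one_le_w norm_ge_zero, of \<xi> \<xi>]
  by (simp add: w_succ mult_ac)
qed simp

text \<open>The sum of the frequencies is at most \<open>2 |\<eta>|\<close>, whence the factor
  \<open>2\<^sup>s\<^sup>+\<^sup>1 \<le> 2\<close>, and concavity reduces the exponential weight of
  \<open>\<zeta>\<close> to \<open>exp (a/\<sigma> |\<zeta>|\<^sup>1\<^sup>/\<^sup>\<sigma>)\<close>, which
  \<open>Kw * w s \<zeta>\<close> dominates.\<close>

lemma w_product_aux:
 assumes "norm \<zeta> \<le> norm \<eta>" "\<zeta> \<noteq> 0"
 shows "w (s + 1) (\<eta> + \<zeta>) \<le> 2 * Kw * (w (s + 1) \<eta> * w s \<zeta>)"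
proof (cases "\<eta> + \<zeta> = 0")
 case True
 then show ?thesis using Kw(1) by simp
next
 case False
 let ?M = "norm \<eta>" and ?m = "norm \<zeta>" and ?p = "1 / \<sigma>"
 have m: "0 < ?m" "0 < ?M" using assms by auto
 have p: "0 < ?p" "?p \<le> 1" using par by auto
 have tri: "norm (\<eta> + \<zeta>) \<le> ?m + ?M" by (metis add.commute norm_triangle_ineq)
 have "norm (\<eta> + \<zeta>) powr (s + 1) \<le> (2 * ?M) powr (s + 1)"
  using tri assms par by (intro powr_mono2) auto
 also have "... = 2 powr (s + 1) * ?M powr (s + 1)" using m by (simp add: powr_mult)
 also have "... \<le> 2 * ?M powr (s + 1)"
  using powr_mono[of "s + 1" 1 2] par by (intro mult_right_mono) auto
 finally have 1: "norm (\<eta> + \<zeta>) powr (s + 1) \<le> 2 * ?M powr (s + 1)" .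
 have "norm (\<eta> + \<zeta>) powr ?p \<le> (?m + ?M) powr ?p" using tri p by (intro powr_mono2) auto
 also have "... \<le> ?M powr ?p + ?p * ?m powr ?p" using p m assms by (intro powr_add_le) auto
 finally have "a * norm (\<eta> + \<zeta>) powr ?p \<le> a * (?M powr ?p + ?p * ?m powr ?p)"
  using par by (intro mult_left_mono) auto
 then have "exp (a * norm (\<eta> + \<zeta>) powr ?p) \<le> exp (a * ?M powr ?p) * exp (a / \<sigma> * ?m powr ?p)"
  by (simp add: exp_add[symmetric] algebra_simps)
 also have "... \<le> exp (a * ?M powr ?p) * (Kw * w s \<zeta>)"
  using Kw(2)[OF m(1)] by (intro mult_left_mono) (auto simp: X_weight_def)
 finally have 2: "exp (a * norm (\<eta> + \<zeta>) powr ?p) \<le> exp (a * ?M powr ?p) * (Kw * w s \<zeta>)" .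
 have "w (s + 1) (\<eta> + \<zeta>) \<le> (2 * ?M powr (s + 1)) * (exp (a * ?M powr ?p) * (Kw * w s \<zeta>))"
  unfolding X_weight_def[of a \<sigma> "s + 1" "\<eta> + \<zeta>"] by (intro mult_mono 1 2) auto
 then show ?thesis by (simp add: X_weight_def[of a \<sigma> "s + 1" \<eta>] mult_ac)
qed

text \<open>By symmetry it suffices to treat a first frequency that is at least as large as the
  second.\<close>

lemma w_product:
 assumes "\<eta> \<noteq> 0" "\<zeta> \<noteq> 0"
 shows "w (s + 1) (\<eta> + \<zeta>) \<le> 2 * Kw * (w (s + 1) \<eta> * w s \<zeta> + w s \<eta> * w (s + 1) \<zeta>)"
proof (cases "norm \<zeta> \<le> norm \<eta>")
 case True
 have "w (s + 1) (\<eta> + \<zeta>) \<le> 2 * Kw * (w (s + 1) \<eta> * w s \<zeta>)" by (rule w_product_aux[OF True assms(2)])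
 also have "... \<le> 2 * Kw * (w (s + 1) \<eta> * w s \<zeta> + w s \<eta> * w (s + 1) \<zeta>)"
  using Kw(1) by (intro mult_left_mono) auto
 finally show ?thesis .
next
 case False
 then have "w (s + 1) (\<eta> + \<zeta>) \<le> 2 * Kw * (w (s + 1) \<zeta> * w s \<eta>)"
  using w_product_aux[of \<eta> \<zeta>] assms by (simp add: add.commute)
 also have "... \<le> 2 * Kw * (w (s + 1) \<eta> * w s \<zeta> + w s \<eta> * w (s + 1) \<zeta>)"
  using Kw(1) by (intro mult_left_mono) (auto simp: mult.commute)
 finally show ?thesis .
qed

text \<open>Below the frequency \<open>\<rho>\<close> the first term suffices, above it the second.\<close>

lemma w_interpolate:
 assumes "\<gamma> \<ge> 1/2" "\<rho> > 0"
 shows "w (s + 1) \<xi> \<le> \<rho> * w s \<xi> + \<rho> powr (1 - 2 * \<gamma>) * w (s + 2 * \<gamma>) \<xi>"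
proof (cases "\<xi> = 0")
 case False
 let ?r = "norm \<xi>"
 have r: "?r > 0" using False by simp
 have "?r \<le> \<rho> + \<rho> powr (1 - 2 * \<gamma>) * ?r powr (2 * \<gamma>)"
 proof (cases "?r \<le> \<rho>")
  case False
  have "?r = ?r powr (1 - 2 * \<gamma>) * ?r powr (2 * \<gamma>)" using r by (simp add: powr_add[symmetric])
  also have "... \<le> \<rho> powr (1 - 2 * \<gamma>) * ?r powr (2 * \<gamma>)"
   using False assms by (intro mult_right_mono powr_mono2') auto
  finally show ?thesis using assms(2) by linarith
 qed (simp add: add_increasing2)
 then have "?r * w s \<xi> \<le> (\<rho> + \<rho> powr (1 - 2 * \<gamma>) * ?r powr (2 * \<gamma>)) * w s \<xi>" by (rule mult_right_mono) simp
 then show ?thesis unfolding w_succ w_shift[of s] by (simp add: algebra_simps)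
qed simp

end

section \<open>Estimates for integrals of nonnegative functions\<close>

text \<open>If exactly one of the two functions is integrable, the other Bochner integral is 0 by convention
  and the right-hand side is infinite.\<close>

lemma norm_integral_diff_le:
 fixes f g :: "'a => 'b::{banach, second_countable_topology}"
 assumes [measurable]: "f \<in> borel_measurable M" "g \<in> borel_measurable M"
 shows "enorm ((LINT x|M. f x) - (LINT x|M. g x)) \<le> (\<integral>\<^sup>+x. enorm (f x - g x) \<partial>M)"
proof (cases "integrable M (\<lambda>x. f x - g x)")
 case True
 show ?thesis
 proof (cases "integrable M f")
  case f: True
  have g: "integrable M g" using Bochner_Integration.integrable_diff[OF f True] by simp
  have "enorm ((LINT x|M. f x) - (LINT x|M. g x)) = enorm (LINT x|M. f x - g x)"
   using f g by simp
  also have "... \<le> (\<integral>\<^sup>+x. enorm (f x - g x) \<partial>M)" by (rule integral_norm_bound_ennreal[OF True])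
  finally show ?thesis .
 next
  case f: False
  have "\<not> integrable M g"
   using f Bochner_Integration.integrable_add[OF True, of g] by auto
  then show ?thesis using f by (simp add: not_integrable_integral_eq)
 qed
next
 case False
 then have "(\<integral>\<^sup>+x. enorm (f x - g x) \<partial>M) = \<infinity>"
  by (simp add: integrable_iff_bounded less_top[symmetric])
 then show ?thesis by simp
qed

lemma norm_integral_le:
 fixes f :: "'a => 'b::{banach, second_countable_topology}"
 assumes "f \<in> borel_measurable M"
 shows "enorm (LINT x|M. f x) \<le> (\<integral>\<^sup>+x. enorm (f x) \<partial>M)"
 using norm_integral_diff_le[OF assms, of "\<lambda>_. 0"] by simp

lemma nn_integral_translate:
 fixes f :: "real^3 => ennreal"
 assumes [measurable]: "f \<in> borel_measurable borel"
 shows "(\<integral>\<^sup>+x. f (x - t) \<partial>lborel) = (\<integral>\<^sup>+x. f x \<partial>lborel)"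
proof -
 have "(\<integral>\<^sup>+x. f x \<partial>lborel) = (\<integral>\<^sup>+x. f x \<partial>(distr lborel borel ((+) (- t))))"
  by (simp only: lborel_distr_plus)
 also have "... = (\<integral>\<^sup>+x. f (- t + x) \<partial>lborel)" by (rule nn_integral_distr) auto
 finally show ?thesis by simp
qed

lemma nn_integral_convolution:
 fixes f g :: "real^3 => ennreal"
 assumes [measurable]: "f \<in> borel_measurable borel" "g \<in> borel_measurable borel"
 shows "(\<integral>\<^sup>+\<xi>. \<integral>\<^sup>+\<eta>. f \<eta> * g (\<xi> - \<eta>) \<partial>lborel \<partial>lborel) = (\<integral>\<^sup>+\<eta>. f \<eta> \<partial>lborel) * (\<integral>\<^sup>+\<eta>. g \<eta> \<partial>lborel)"
proof -
 have "(\<integral>\<^sup>+\<xi>. \<integral>\<^sup>+\<eta>. f \<eta> * g (\<xi> - \<eta>) \<partial>lborel \<partial>lborel) = (\<integral>\<^sup>+\<eta>. \<integral>\<^sup>+\<xi>. f \<eta> * g (\<xi> - \<eta>) \<partial>lborel \<partial>lborel)"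
  by (rule lborel_pair.Fubini') measurable
 also have "... = (\<integral>\<^sup>+\<eta>. f \<eta> * (\<integral>\<^sup>+\<xi>. g \<xi> \<partial>lborel) \<partial>lborel)"
  by (simp add: nn_integral_cmult nn_integral_translate)
 finally show ?thesis by (simp add: nn_integral_multc)
qed

text \<open>The smoothing of the heat semigroup: \<open>r \<integral>\<^sub>\<tau>\<^sup>T e\<^sup>-\<^sup>(\<^sup>t\<^sup>-\<^sup>\<tau>\<^sup>)\<^sup>r dt \<le> 1\<close>.\<close>

lemma nn_integral_heat_le_1:
 fixes r \<tau> T :: real
 assumes "r \<ge> 0"
 shows "ennreal r * (\<integral>\<^sup>+t. ennreal (exp (- (t - \<tau>) * r)) * indicator {\<tau>..T} t \<partial>lborel) \<le> 1"
proof (cases "\<tau> \<le> T")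
 case True
 have "ennreal r * (\<integral>\<^sup>+t. ennreal (exp (- (t - \<tau>) * r)) * indicator {\<tau>..T} t \<partial>lborel)
  = (\<integral>\<^sup>+t. ennreal (r * exp (- (t - \<tau>) * r)) * indicator {\<tau>..T} t \<partial>lborel)"
  using assms by (subst nn_integral_cmult[symmetric]) (auto simp: ennreal_mult mult.assoc)
 also have "... = ennreal (- exp (- (T - \<tau>) * r) - (- exp (- (\<tau> - \<tau>) * r)))"
  by (rule nn_integral_FTC_Icc[OF _ _ _ True])
    (use assms in \<open>auto intro!: derivative_eq_intros\<close>)
 also have "... \<le> 1" by simp
 finally show ?thesis .
qed simp

section \<open>The equations on the Fourier side\<close>

type_synonym slice = "3 option => real^3 => complex"
type_synonym state = "3 option => real => real^3 => complex"

lemma sum_UNIV_option: "(\<Sum>i\<in>UNIV. f i) = f None + (\<Sum>k\<in>UNIV. f (Some k))" for f :: "3 option => 'b::comm_monoid_add"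
 by (simp add: UNIV_option_conv sum.reindex)

definition mag :: "slice => real^3 => real" where
 "mag z \<xi> = (\<Sum>i\<in>UNIV. norm (z i \<xi>))"

text \<open>The transform of \<open>div (u f)\<close> for the component \<open>f\<close> with index
  \<open>k\<close>. For a divergence free \<open>u\<close> this is the transform of \<open>u \<cdot> \<nabla>
  f\<close>; the divergence form puts the derivative on the product.\<close>

definition flux :: "slice => 3 option => real^3 => complex" where
 "flux z k \<xi> = (\<Sum>j\<in>UNIV. \<i> * cr (\<xi> $ j) * conv (z (Some j)) (z k) \<xi>) / cr ((2 * pi) ^ 3)"

text \<open>Symbol of the Leray projector; at \<open>\<xi> = 0\<close> the quotient is 0 by the convention for
  division.\<close>

definition proj :: "3 => 3 => real^3 => complex" where
 "proj l k \<xi> = (if k = l then 1 else 0) - cr (\<xi> $ l * \<xi> $ k / (norm \<xi>)\<^sup>2)"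

text \<open>The right-hand sides of the two equations, including the sign of the transport terms.\<close>

definition force :: "slice => 3 option => real^3 => complex" where
 "force z i \<xi> = (case i of None => - flux z None \<xi>
   | Some l => (\<Sum>k\<in>UNIV. proj l k \<xi> * ((if k = 3 then z None \<xi> else 0) - flux z (Some k) \<xi>)))"

lemma mag_nonneg [simp]: "0 \<le> mag z \<xi>"
 unfolding mag_def by (intro sum_nonneg) auto

lemma norm_le_mag: "norm (z i \<xi>) \<le> mag z \<xi>"
 unfolding mag_def by (rule member_le_sum) auto

lemma norm_proj: "norm (proj l k \<xi>) \<le> 2"
proof -
 have "\<bar>\<xi> $ l * \<xi> $ k / (norm \<xi>)\<^sup>2\<bar> \<le> 1"
 proof (cases "\<xi> = 0")
  case False
  have "\<bar>\<xi> $ l\<bar> * \<bar>\<xi> $ k\<bar> \<le> norm \<xi> * norm \<xi>"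
   by (intro mult_mono component_le_norm_cart) auto
  then show ?thesis using False by (simp add: abs_mult power2_eq_square divide_le_eq)
 qed simp
 then have "norm (cr (\<xi> $ l * \<xi> $ k / (norm \<xi>)\<^sup>2)) \<le> 1" by (simp only: norm_of_real)
 moreover have "norm (if k = l then 1 else 0 :: complex) \<le> 1" by simp
 ultimately show ?thesis unfolding proj_def by (intro order_trans[OF norm_triangle_ineq4]) simp
qed

lemma proj_measurable [measurable]: "proj l k \<in> borel_measurable borel"
 unfolding proj_def by measurable

definition slice_meas :: "slice => bool" where
 "slice_meas z \<longleftrightarrow> (\<forall>i. z i \<in> borel_measurable borel)"

lemma slice_measD: "slice_meas z ==> z i \<in> borel_measurable borel"
 by (simp add: slice_meas_def)

lemma mag_measurable: "slice_meas z ==> mag z \<in> borel_measurable borel"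
 unfolding mag_def[abs_def] by (intro borel_measurable_sum borel_measurable_norm[THEN measurable_compose[rotated]]) (auto simp: slice_meas_def)

lemma slice_meas_diff: "slice_meas z ==> slice_meas z' ==> slice_meas (\<lambda>i \<xi>. z i \<xi> - z' i \<xi>)"
 by (auto simp: slice_meas_def intro: borel_measurable_diff)

text \<open>Convolution of the magnitudes in the extended reals, which can be estimated before the
  convolutions in the flux are known to converge.\<close>

definition bilin :: "slice => slice => real^3 => ennreal" where
 "bilin y z \<xi> = (\<integral>\<^sup>+\<eta>. ennreal (mag y \<eta> * mag z (\<xi> - \<eta>)) \<partial>lborel)"

abbreviation sdiff :: "slice => slice => slice" where
 "sdiff z z' \<equiv> (\<lambda>i \<xi>. z i \<xi> - z' i \<xi>)"

lemma bilin_measurable: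
 assumes "slice_meas y" "slice_meas z" shows "bilin y z \<in> borel_measurable borel"
proof -
 note [measurable] = mag_measurable[OF assms(1)] mag_measurable[OF assms(2)]
 show ?thesis unfolding bilin_def[abs_def] by measurable
qed

text \<open>\<open>z\<^sub>j * z\<^sub>k - z'\<^sub>j * z'\<^sub>k = (z\<^sub>j - z'\<^sub>j) * z\<^sub>k +
  z'\<^sub>j * (z\<^sub>k - z'\<^sub>k)\<close>.\<close>

lemma conv_diff_le:
 assumes z: "slice_meas z" and z': "slice_meas z'"
 shows "(\<Sum>j\<in>UNIV. enorm (conv (z (Some j)) (z k) \<xi> - conv (z' (Some j)) (z' k) \<xi>))
   \<le> bilin (sdiff z z') z \<xi> + bilin z' (sdiff z z') \<xi>"
proof -
 note [measurable] = slice_measD[OF z] slice_measD[OF z'] mag_measurable[OF z] mag_measurable[OF z']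
  mag_measurable[OF slice_meas_diff[OF z z']]
 let ?d = "sdiff z z'"
 have "(\<Sum>j\<in>UNIV. enorm (conv (z (Some j)) (z k) \<xi> - conv (z' (Some j)) (z' k) \<xi>))
   \<le> (\<Sum>j\<in>UNIV. \<integral>\<^sup>+\<eta>. enorm (z (Some j) \<eta> * z k (\<xi> - \<eta>) - z' (Some j) \<eta> * z' k (\<xi> - \<eta>)) \<partial>lborel)"
  unfolding conv_def by (intro sum_mono norm_integral_diff_le) measurable
 also have "... = (\<integral>\<^sup>+\<eta>. (\<Sum>j\<in>UNIV. enorm (z (Some j) \<eta> * z k (\<xi> - \<eta>) - z' (Some j) \<eta> * z' k (\<xi> - \<eta>))) \<partial>lborel)"
  by (rule nn_integral_sum[symmetric]) measurable
 also have "... \<le> (\<integral>\<^sup>+\<eta>. ennreal (mag ?d \<eta> * mag z (\<xi> - \<eta>)) + ennreal (mag z' \<eta> * mag ?d (\<xi> - \<eta>)) \<partial>lborel)"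
 proof (rule nn_integral_mono, goal_cases)
  case (1 \<eta>)
  let ?\<zeta> = "\<xi> - \<eta>"
  have "(\<Sum>j\<in>UNIV. norm (z (Some j) \<eta> * z k ?\<zeta> - z' (Some j) \<eta> * z' k ?\<zeta>))
   \<le> (\<Sum>j\<in>UNIV. norm (?d (Some j) \<eta>) * mag z ?\<zeta> + norm (z' (Some j) \<eta>) * mag ?d ?\<zeta>)"
  proof (rule sum_mono, goal_cases)
   case (1 j)
   have "z (Some j) \<eta> * z k ?\<zeta> - z' (Some j) \<eta> * z' k ?\<zeta> = ?d (Some j) \<eta> * z k ?\<zeta> + z' (Some j) \<eta> * ?d k ?\<zeta>"
    by (simp add: algebra_simps)
   then have "norm (z (Some j) \<eta> * z k ?\<zeta> - z' (Some j) \<eta> * z' k ?\<zeta>)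
    \<le> norm (?d (Some j) \<eta>) * norm (z k ?\<zeta>) + norm (z' (Some j) \<eta>) * norm (?d k ?\<zeta>)"
    by (simp only:) (intro order_trans[OF norm_triangle_ineq] add_mono; simp only: norm_mult; simp)
   also have "... \<le> norm (?d (Some j) \<eta>) * mag z ?\<zeta> + norm (z' (Some j) \<eta>) * mag ?d ?\<zeta>"
    using norm_le_mag[of z k ?\<zeta>] norm_le_mag[of ?d k ?\<zeta>] by (intro add_mono mult_left_mono) auto
   finally show ?case .
  qed
  also have "... = (\<Sum>j\<in>UNIV. norm (?d (Some j) \<eta>)) * mag z ?\<zeta> + (\<Sum>j\<in>UNIV. norm (z' (Some j) \<eta>)) * mag ?d ?\<zeta>"
   by (simp add: sum.distrib sum_distrib_right)
  also have "... \<le> mag ?d \<eta> * mag z ?\<zeta> + mag z' \<eta> * mag ?d ?\<zeta>"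
   unfolding mag_def[of ?d \<eta>] mag_def[of z' \<eta>] sum_UNIV_option
   by (intro add_mono mult_right_mono) auto
  finally show ?case
   by (simp add: sum_ennreal ennreal_plus[symmetric] ennreal_leI del: ennreal_plus)
 qed
 also have "... = bilin ?d z \<xi> + bilin z' ?d \<xi>"
  unfolding bilin_def by (rule nn_integral_add) measurable
 finally show ?thesis .
qed

lemma flux_diff_le:
 assumes z: "slice_meas z" and z': "slice_meas z'"
 shows "enorm (flux z k \<xi> - flux z' k \<xi>)
   \<le> ennreal (norm \<xi>) * (bilin (sdiff z z') z \<xi> + bilin z' (sdiff z z') \<xi>)"
proof -
 let ?c = "\<lambda>j. conv (z (Some j)) (z k) \<xi> - conv (z' (Some j)) (z' k) \<xi>"
 have "1 \<le> (2 * pi) ^ 3" using pi_gt3 by (intro one_le_power) simp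
 have eq: "flux z k \<xi> - flux z' k \<xi> = (\<Sum>j\<in>UNIV. \<i> * cr (\<xi> $ j) * ?c j) / cr ((2 * pi) ^ 3)"
  unfolding flux_def by (simp only: diff_divide_distrib[symmetric] sum_subtractf[symmetric] right_diff_distrib)
 have "norm (flux z k \<xi> - flux z' k \<xi>) \<le> norm (\<Sum>j\<in>UNIV. \<i> * cr (\<xi> $ j) * ?c j)"
  unfolding eq norm_divide norm_of_real using \<open>1 \<le> (2 * pi) ^ 3\<close> by (intro divide_le_eq_1_pos[THEN iffD2] | simp add: divide_le_eq mult_le_cancel_left1)+
 also have "... \<le> (\<Sum>j\<in>UNIV. norm \<xi> * norm (?c j))"
  by (rule sum_norm_le) (auto simp: norm_mult intro!: mult_right_mono component_le_norm_cart)
 also have "... = norm \<xi> * (\<Sum>j\<in>UNIV. norm (?c j))" by (simp add: sum_distrib_left)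
 finally have "enorm (flux z k \<xi> - flux z' k \<xi>) \<le> ennreal (norm \<xi>) * (\<Sum>j\<in>UNIV. enorm (?c j))"
  by (simp add: sum_ennreal ennreal_mult[symmetric] sum_nonneg ennreal_leI)
 also have "... \<le> ennreal (norm \<xi>) * (bilin (sdiff z z') z \<xi> + bilin z' (sdiff z z') \<xi>)"
  by (intro mult_left_mono conv_diff_le z z') simp
 finally show ?thesis .
qed

lemma force_diff_le:
 assumes z: "slice_meas z" and z': "slice_meas z'"
 shows "(\<Sum>i\<in>UNIV. enorm (force z i \<xi> - force z' i \<xi>))
   \<le> 24 * (ennreal (norm \<xi>) * (bilin (sdiff z z') z \<xi> + bilin z' (sdiff z z') \<xi>) + ennreal (mag (sdiff z z') \<xi>))"
proof -
 let ?Q = "ennreal (norm \<xi>) * (bilin (sdiff z z') z \<xi> + bilin z' (sdiff z z') \<xi>)"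
 let ?d = "ennreal (mag (sdiff z z') \<xi>)"
 have N: "enorm (force z None \<xi> - force z' None \<xi>) \<le> ?Q + ?d"
  using flux_diff_le[OF z z', of None \<xi>]
  by (simp add: force_def norm_minus_commute add_increasing2)
 have S: "enorm (force z (Some l) \<xi> - force z' (Some l) \<xi>) \<le> 6 * (?Q + ?d)" for l
 proof -
  let ?h = "\<lambda>z k. (if k = 3 then z None \<xi> else 0) - flux z (Some k) \<xi>"
  have "norm (force z (Some l) \<xi> - force z' (Some l) \<xi>) = norm (\<Sum>k\<in>UNIV. proj l k \<xi> * (?h z k - ?h z' k))"
   by (simp add: force_def sum_subtractf[symmetric] right_diff_distrib)
  also have "... \<le> (\<Sum>k\<in>UNIV. 2 * (norm (sdiff z z' None \<xi>) + norm (flux z (Some k) \<xi> - flux z' (Some k) \<xi>)))"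
  proof (rule sum_norm_le, goal_cases)
   case (1 k)
   have "norm (?h z k - ?h z' k) = norm ((if k = 3 then sdiff z z' None \<xi> else 0) - (flux z (Some k) \<xi> - flux z' (Some k) \<xi>))"
    by (simp add: algebra_simps)
   also have "... \<le> norm (sdiff z z' None \<xi>) + norm (flux z (Some k) \<xi> - flux z' (Some k) \<xi>)"
    by (rule order_trans[OF norm_triangle_ineq4], rule add_mono, simp, rule order_refl)
   finally show ?case
    unfolding norm_mult by (intro mult_mono norm_proj) auto
  qed
  also have "... \<le> (\<Sum>k\<in>(UNIV :: 3 set). 2 * (mag (sdiff z z') \<xi> + norm (flux z (Some k) \<xi> - flux z' (Some k) \<xi>)))"
   using norm_le_mag[of "sdiff z z'" None \<xi>] by (intro sum_mono mult_left_mono add_mono) auto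
  finally have "enorm (force z (Some l) \<xi> - force z' (Some l) \<xi>)
   \<le> (\<Sum>k\<in>(UNIV :: 3 set). ennreal (2 * (mag (sdiff z z') \<xi> + norm (flux z (Some k) \<xi> - flux z' (Some k) \<xi>))))"
   by (subst sum_ennreal) (auto intro!: ennreal_leI)
  also have "... \<le> (\<Sum>k\<in>(UNIV :: 3 set). 2 * (?d + ?Q))"
  proof (rule sum_mono, goal_cases)
   case (1 k)
   have "ennreal (2 * (mag (sdiff z z') \<xi> + norm (flux z (Some k) \<xi> - flux z' (Some k) \<xi>)))
    = 2 * (?d + enorm (flux z (Some k) \<xi> - flux z' (Some k) \<xi>))"
    by (simp add: ennreal_mult)
   also have "... \<le> 2 * (?d + ?Q)" by (intro mult_left_mono add_mono flux_diff_le z z') auto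
   finally show ?case .
  qed
  also have "... = 6 * (?Q + ?d)" by (simp add: mult.assoc[symmetric] add.commute)
  finally show ?thesis .
 qed
 have "(\<Sum>i\<in>UNIV. enorm (force z i \<xi> - force z' i \<xi>)) \<le> (?Q + ?d) + (\<Sum>l\<in>(UNIV :: 3 set). 6 * (?Q + ?d))"
  unfolding sum_UNIV_option by (intro add_mono sum_mono N S)
 also have "... = 1 * (?Q + ?d) + 18 * (?Q + ?d)" by (simp add: mult.assoc[symmetric])
 also have "... = 19 * (?Q + ?d)" by (simp only: distrib_right[symmetric]) simp
 also have "... \<le> 24 * (?Q + ?d)" by (intro mult_right_mono) auto
 finally show ?thesis .
qed

context boussinesq begin

definition wint :: "real => (real^3 => real) => ennreal" where
 "wint r f = (\<integral>\<^sup>+\<xi>. ennreal (w r \<xi> * f \<xi>) \<partial>lborel)"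

lemma bilin_wint:
 assumes y: "slice_meas y" and z: "slice_meas z"
 shows "(\<integral>\<^sup>+\<xi>. ennreal (w (s + 1) \<xi>) * bilin y z \<xi> \<partial>lborel)
  \<le> ennreal (2 * Kw) * (wint (s + 1) (mag y) * wint s (mag z) + wint s (mag y) * wint (s + 1) (mag z))"
proof -
 note [measurable] = mag_measurable[OF y] mag_measurable[OF z]
 have ne: "AE \<eta> in lborel. \<eta> \<noteq> c" for c :: "real^3" by (rule AE_lborel_singleton)
 have "(\<integral>\<^sup>+\<xi>. ennreal (w (s + 1) \<xi>) * bilin y z \<xi> \<partial>lborel)
  = (\<integral>\<^sup>+\<xi>. \<integral>\<^sup>+\<eta>. ennreal (w (s + 1) \<xi>) * ennreal (mag y \<eta> * mag z (\<xi> - \<eta>)) \<partial>lborel \<partial>lborel)"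
  unfolding bilin_def by (subst nn_integral_cmult) auto
 also have "... \<le> (\<integral>\<^sup>+\<xi>. \<integral>\<^sup>+\<eta>. ennreal (2 * Kw) *
    (ennreal (w (s + 1) \<eta> * mag y \<eta>) * ennreal (w s (\<xi> - \<eta>) * mag z (\<xi> - \<eta>))
   + ennreal (w s \<eta> * mag y \<eta>) * ennreal (w (s + 1) (\<xi> - \<eta>) * mag z (\<xi> - \<eta>))) \<partial>lborel \<partial>lborel)"
 proof (rule nn_integral_mono, rule nn_integral_mono_AE, goal_cases)
  case (1 \<xi>)
  show ?case
   using ne[of 0] ne[of \<xi>]
  proof eventually_elim
   case (elim \<eta>)
   let ?\<zeta> = "\<xi> - \<eta>"
   have "w (s + 1) \<xi> \<le> 2 * Kw * (w (s + 1) \<eta> * w s ?\<zeta> + w s \<eta> * w (s + 1) ?\<zeta>)"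
    using w_product[of \<eta> ?\<zeta>] elim by simp
   then have "w (s + 1) \<xi> * (mag y \<eta> * mag z ?\<zeta>) \<le> (2 * Kw * (w (s + 1) \<eta> * w s ?\<zeta> + w s \<eta> * w (s + 1) ?\<zeta>)) * (mag y \<eta> * mag z ?\<zeta>)"
    by (intro mult_right_mono) auto
   also have "... = 2 * Kw * ((w (s + 1) \<eta> * mag y \<eta>) * (w s ?\<zeta> * mag z ?\<zeta>) + (w s \<eta> * mag y \<eta>) * (w (s + 1) ?\<zeta> * mag z ?\<zeta>))"
    by (simp add: algebra_simps)
   finally show ?case using Kw(1)
    by (simp add: ennreal_mult[symmetric] ennreal_plus[symmetric] ennreal_leI del: ennreal_plus)
  qed
 qed
 also have "... = ennreal (2 * Kw) *
   ((\<integral>\<^sup>+\<xi>. \<integral>\<^sup>+\<eta>. ennreal (w (s + 1) \<eta> * mag y \<eta>) * ennreal (w s (\<xi> - \<eta>) * mag z (\<xi> - \<eta>)) \<partial>lborel \<partial>lborel)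
  + (\<integral>\<^sup>+\<xi>. \<integral>\<^sup>+\<eta>. ennreal (w s \<eta> * mag y \<eta>) * ennreal (w (s + 1) (\<xi> - \<eta>) * mag z (\<xi> - \<eta>)) \<partial>lborel \<partial>lborel))"
  by (simp add: nn_integral_cmult nn_integral_add)
 also have "... = ennreal (2 * Kw) * (wint (s + 1) (mag y) * wint s (mag z) + wint s (mag y) * wint (s + 1) (mag z))"
  unfolding wint_def
  by (subst nn_integral_convolution[of "\<lambda>\<eta>. ennreal (w (s + 1) \<eta> * mag y \<eta>)" "\<lambda>\<eta>. ennreal (w s \<eta> * mag z \<eta>)"], measurable)
    (subst nn_integral_convolution[of "\<lambda>\<eta>. ennreal (w s \<eta> * mag y \<eta>)" "\<lambda>\<eta>. ennreal (w (s + 1) \<eta> * mag z \<eta>)"], measurable)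
 finally show ?thesis .
qed

text \<open>The derivative in the flux turns the weight \<open>w s\<close> into \<open>w (s + 1)\<close>, to which the product
  inequality for the weights applies.\<close>

lemma force_wint:
 assumes z: "slice_meas z" and z': "slice_meas z'"
 shows "(\<integral>\<^sup>+\<xi>. ennreal (w s \<xi>) * (\<Sum>i\<in>UNIV. enorm (force z i \<xi> - force z' i \<xi>)) \<partial>lborel)
  \<le> 24 * (ennreal (2 * Kw) * (wint (s + 1) (mag (sdiff z z')) * (wint s (mag z) + wint s (mag z'))
     + wint s (mag (sdiff z z')) * (wint (s + 1) (mag z) + wint (s + 1) (mag z')))
    + wint s (mag (sdiff z z')))"
proof -
 let ?d = "sdiff z z'"
 note d = slice_meas_diff[OF z z']
 note [measurable] = mag_measurable[OF d] bilin_measurable[OF d z] bilin_measurable[OF z' d]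
 have "(\<integral>\<^sup>+\<xi>. ennreal (w s \<xi>) * (\<Sum>i\<in>UNIV. enorm (force z i \<xi> - force z' i \<xi>)) \<partial>lborel)
  \<le> (\<integral>\<^sup>+\<xi>. ennreal (w s \<xi>) * (24 * (ennreal (norm \<xi>) * (bilin ?d z \<xi> + bilin z' ?d \<xi>) + ennreal (mag ?d \<xi>))) \<partial>lborel)"
  by (intro nn_integral_mono mult_left_mono force_diff_le z z') simp
 also have "... = (\<integral>\<^sup>+\<xi>. 24 * ((ennreal (w (s + 1) \<xi>) * bilin ?d z \<xi> + ennreal (w (s + 1) \<xi>) * bilin z' ?d \<xi>) + ennreal (w s \<xi> * mag ?d \<xi>)) \<partial>lborel)"
  by (rule nn_integral_cong) (unfold w_succ, simp only: ennreal_mult w_nonneg norm_ge_zero mag_nonneg distrib_left distrib_right mult_ac add_ac)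
 also have "... = 24 * (((\<integral>\<^sup>+\<xi>. ennreal (w (s + 1) \<xi>) * bilin ?d z \<xi> \<partial>lborel) + (\<integral>\<^sup>+\<xi>. ennreal (w (s + 1) \<xi>) * bilin z' ?d \<xi> \<partial>lborel)) + wint s (mag ?d))"
  by (simp add: nn_integral_cmult nn_integral_add wint_def)
 also have "... \<le> 24 * ((ennreal (2 * Kw) * (wint (s + 1) (mag ?d) * wint s (mag z) + wint s (mag ?d) * wint (s + 1) (mag z))
   + ennreal (2 * Kw) * (wint (s + 1) (mag z') * wint s (mag ?d) + wint s (mag z') * wint (s + 1) (mag ?d))) + wint s (mag ?d))"
  by (intro mult_left_mono add_mono bilin_wint z z' d) auto
 also have "... = 24 * (ennreal (2 * Kw) * (wint (s + 1) (mag ?d) * (wint s (mag z) + wint s (mag z'))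
     + wint s (mag ?d) * (wint (s + 1) (mag z) + wint (s + 1) (mag z'))) + wint s (mag ?d))"
  by (simp add: algebra_simps)
 finally show ?thesis .
qed

end

section \<open>Space-time norms\<close>

abbreviation stdiff :: "state => state => state" where
 "stdiff Z Z' \<equiv> (\<lambda>i t \<xi>. Z i t \<xi> - Z' i t \<xi>)"

abbreviation sl :: "state => real => slice" where "sl Z t \<equiv> (\<lambda>i. Z i t)"

text \<open>Borel measurability in time and frequency together, which Fubini's theorem requires.\<close>

definition jmeas :: "state => bool" where
 "jmeas Z \<longleftrightarrow> (\<forall>i. (\<lambda>p. Z i (fst p) (snd p)) \<in> borel_measurable (borel \<Otimes>\<^sub>M borel))"

lemma jmeasD:
 assumes "jmeas Z" and f: "f \<in> M \<rightarrow>\<^sub>M borel" and g: "g \<in> M \<rightarrow>\<^sub>M borel"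
 shows "(\<lambda>x. Z i (f x) (g x)) \<in> borel_measurable M"
proof -
 have "(\<lambda>x. (f x, g x)) \<in> M \<rightarrow>\<^sub>M borel \<Otimes>\<^sub>M borel" using f g by measurable
 from measurable_compose[OF this, of "\<lambda>p. Z i (fst p) (snd p)" borel] show ?thesis
  using assms(1) by (simp add: jmeas_def)
qed

lemma jmeas_slice: "jmeas Z ==> slice_meas (sl Z t)"
 unfolding slice_meas_def by (auto intro: jmeasD)

lemma jmeas_diff: "jmeas Z ==> jmeas Z' ==> jmeas (stdiff Z Z')"
 unfolding jmeas_def by (auto intro: borel_measurable_diff)

lemma jmeas_zero: "jmeas (\<lambda>i t \<xi>. 0)"
 by (simp add: jmeas_def)

lemma jmeas_conv:
 assumes "jmeas Z"
 shows "(\<lambda>p. conv (Z j (fst p)) (Z k (fst p)) (snd p)) \<in> borel_measurable (borel \<Otimes>\<^sub>M borel)"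
proof -
 note [measurable (raw)] = jmeasD[OF assms]
 show ?thesis unfolding conv_def
  by (rule lborel.borel_measurable_lebesgue_integral) measurable
qed

lemma vec_nth_measurable [measurable]: "(\<lambda>x::real^3. x $ j) \<in> borel \<rightarrow>\<^sub>M borel"
 by (auto intro!: borel_measurable_continuous_onI continuous_intros)

lemma jmeas_flux:
 assumes "jmeas Z"
 shows "(\<lambda>p. flux (\<lambda>i. Z i (fst p)) k (snd p)) \<in> borel_measurable (borel \<Otimes>\<^sub>M borel)"
proof -
 note [measurable] = jmeas_conv[OF assms]
 show ?thesis unfolding flux_def by measurable
qed

lemma jmeas_force_pair:
 assumes "jmeas Z"
 shows "(\<lambda>p. force (\<lambda>i. Z i (fst p)) i (snd p)) \<in> borel_measurable (borel \<Otimes>\<^sub>M borel)"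
proof -
 note [measurable] = jmeas_flux[OF assms] and [measurable (raw)] = jmeasD[OF assms]
 show ?thesis by (cases i) (simp_all add: force_def, measurable)
qed

lemma jmeas_force:
 assumes "jmeas Z" and f: "f \<in> M \<rightarrow>\<^sub>M borel" and g: "g \<in> M \<rightarrow>\<^sub>M borel"
 shows "(\<lambda>x. force (\<lambda>i. Z i (f x)) i (g x)) \<in> borel_measurable M"
proof -
 have "(\<lambda>x. (f x, g x)) \<in> M \<rightarrow>\<^sub>M borel \<Otimes>\<^sub>M borel" using f g by measurable
 from measurable_compose[OF this jmeas_force_pair[OF assms(1)]] show ?thesis by simp
qed

lemma force_zero: "force (\<lambda>i \<xi>. 0) i \<xi> = 0"
 by (cases i) (simp_all add: force_def flux_def conv_def)

context boussinesq begin

definition gam :: "3 option => real" where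
 "gam i = (case i of None => \<beta> | Some _ => \<alpha>)"

lemma gam: "gam i \<ge> 1/2" "gam i > 0"
proof -
 show "gam i \<ge> 1/2" using alpha beta by (cases i) (simp_all add: gam_def)
 then show "gam i > 0" by simp
qed

definition hk :: "3 option => real => real^3 => real" where
 "hk i t \<xi> = exp (- t * norm \<xi> powr (2 * gam i))"

lemma hk_measurable [measurable (raw)]:
 assumes [measurable]: "f \<in> borel_measurable M" "g \<in> borel_measurable M"
 shows "(\<lambda>x. hk i (f x) (g x)) \<in> borel_measurable M"
 unfolding hk_def by measurable

lemma hk_bounds: "0 \<le> hk i t \<xi>" "0 \<le> t ==> hk i t \<xi> \<le> 1"
 by (auto simp: hk_def)

text \<open>The Duhamel integrand, extended by 0 to all times so that the integral is over a fixed
  space.\<close>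

abbreviation dint :: "state => 3 option => real => real^3 => real => complex" where
 "dint Z i t \<xi> \<tau> \<equiv> (if 0 \<le> \<tau> \<and> \<tau> \<le> t then cr (hk i (t - \<tau>) \<xi>) * force (sl Z \<tau>) i \<xi> else 0)"

text \<open>The right-hand side of the mild equations on the Fourier side.\<close>

definition Phi :: "slice => state => state" where
 "Phi z0 Z i t \<xi> = cr (hk i t \<xi>) * z0 i \<xi>
   + (LINT \<tau>|lborel. (dint Z i t \<xi> \<tau>))"

lemma jmeas_Phi:
 assumes Z: "jmeas Z" and z0: "slice_meas z0" shows "jmeas (Phi z0 Z)"
 unfolding jmeas_def
proof
 fix i
 note [measurable (raw)] = jmeas_force[OF Z] and [measurable] = slice_measD[OF z0]
 show "(\<lambda>p. Phi z0 Z i (fst p) (snd p)) \<in> borel_measurable (borel \<Otimes>\<^sub>M borel)"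
  unfolding Phi_def
 proof (intro borel_measurable_add lborel.borel_measurable_lebesgue_integral)
  show "(\<lambda>p. cr (hk i (fst p) (snd p)) * z0 i (snd p)) \<in> borel_measurable (borel \<Otimes>\<^sub>M borel)"
   by measurable
  show "(\<lambda>(p, \<tau>). if 0 \<le> \<tau> \<and> \<tau> \<le> fst p then cr (hk i (fst p - \<tau>) (snd p)) * force (sl Z \<tau>) i (snd p) else 0)
   \<in> borel_measurable ((borel \<Otimes>\<^sub>M borel) \<Otimes>\<^sub>M lborel)"
   by measurable
 qed
qed

text \<open>The components of the velocity and the temperature may carry different powers \<open>q i\<close>,
  because the gains \<open>2\<alpha>\<close> and \<open>2\<beta>\<close> differ.\<close>

definition wn :: "(3 option => real) => slice => ennreal" where
 "wn q z = (\<integral>\<^sup>+\<xi>. (\<Sum>i\<in>UNIV. ennreal (w (q i) \<xi> * norm (z i \<xi>))) \<partial>lborel)"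

lemma wn_const: "wn (\<lambda>_. r) z = wint r (mag z)"
 unfolding wn_def wint_def mag_def by (intro nn_integral_cong) (simp add: sum_ennreal sum_distrib_left)

abbreviation sH :: "3 option => real" where
 "sH \<equiv> (\<lambda>i. s + 2 * gam i)"

definition EN :: "real => state => ennreal" where
 "EN T Z = (SUP t\<in>{0..T}. wn (\<lambda>_. s) (sl Z t))"

definition HN :: "real => state => ennreal" where
 "HN T Z = (\<integral>\<^sup>+t. wn sH (sl Z t) * indicator {0..T} t \<partial>lborel)"

text \<open>The norm of \<open>L\<^sup>\<infinity>\<^sub>T \<X>\<^sup>s \<inter> L\<^sup>1\<^sub>T
  \<X>\<^sup>s\<^sup>+\<^sup>2\<^sup>\<gamma>\<close> with values in the extended reals. It controls every
  time, not almost every time, as the solutions are continuous.\<close>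

definition NM :: "real => state => ennreal" where
 "NM T Z = EN T Z + HN T Z"

lemma wn_measurable:
 assumes "jmeas Z" shows "(\<lambda>t. wn q (sl Z t)) \<in> borel_measurable borel"
proof -
 note [measurable (raw)] = jmeasD[OF assms]
 show ?thesis unfolding wn_def by measurable
qed

lemma EN_upper: "t \<in> {0..T} ==> wn (\<lambda>_. s) (sl Z t) \<le> EN T Z"
 unfolding EN_def by (rule SUP_upper)

lemma wn_suminf:
 assumes m: "\<And>n. slice_meas (Y n)"
  and le: "AE \<xi> in lborel. \<forall>i. enorm (X i \<xi>) \<le> (\<Sum>n. enorm (Y n i \<xi>))"
 shows "wn q X \<le> (\<Sum>n. wn q (Y n))"
proof -
 note [measurable] = slice_measD[OF m]
 have "wn q X \<le> (\<integral>\<^sup>+\<xi>. (\<Sum>n. \<Sum>i\<in>UNIV. ennreal (w (q i) \<xi> * norm (Y n i \<xi>))) \<partial>lborel)"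
  unfolding wn_def
 proof (rule nn_integral_mono_AE)
  show "AE \<xi> in lborel. (\<Sum>i\<in>UNIV. ennreal (w (q i) \<xi> * norm (X i \<xi>))) \<le> (\<Sum>n. \<Sum>i\<in>UNIV. ennreal (w (q i) \<xi> * norm (Y n i \<xi>)))"
   using le
  proof eventually_elim
   case (elim \<xi>)
   have "(\<Sum>i\<in>UNIV. ennreal (w (q i) \<xi> * norm (X i \<xi>))) \<le> (\<Sum>i\<in>UNIV. ennreal (w (q i) \<xi>) * (\<Sum>n. enorm (Y n i \<xi>)))"
    by (intro sum_mono) (simp only: ennreal_mult w_nonneg norm_ge_zero, intro mult_left_mono elim[rule_format] zero_le)
   also have "... = (\<Sum>i\<in>UNIV. \<Sum>n. ennreal (w (q i) \<xi> * norm (Y n i \<xi>)))"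
    by (simp only: ennreal_mult w_nonneg norm_ge_zero ennreal_suminf_cmult)
   also have "... = (\<Sum>n. \<Sum>i\<in>UNIV. ennreal (w (q i) \<xi> * norm (Y n i \<xi>)))"
    by (rule suminf_sum[symmetric]) simp
   finally show ?case .
  qed
 qed
 also have "... = (\<Sum>n. wn q (Y n))" unfolding wn_def by (rule nn_integral_suminf) measurable
 finally show ?thesis .
qed

text \<open>Countable subadditivity, for estimating the limit of the Picard iterates by the sum of their
  increments.\<close>

lemma NM_suminf:
 assumes m: "\<And>n. jmeas (Y n)"
  and le: "\<And>t. t \<in> {0..T} ==> AE \<xi> in lborel. \<forall>i. enorm (X i t \<xi>) \<le> (\<Sum>n. enorm (Y n i t \<xi>))"
 shows "NM T X \<le> (\<Sum>n. NM T (Y n))"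
proof -
 note [measurable] = wn_measurable[OF m]
 have 1: "EN T X \<le> (\<Sum>n. EN T (Y n))"
  unfolding EN_def[of T X]
 proof (rule SUP_least)
  fix t assume t: "t \<in> {0..T}"
  have "wn (\<lambda>_. s) (sl X t) \<le> (\<Sum>n. wn (\<lambda>_. s) (\<lambda>i. Y n i t))"
   by (rule wn_suminf[OF jmeas_slice[OF m] le[OF t]])
  also have "... \<le> (\<Sum>n. EN T (Y n))" by (intro suminf_le EN_upper t) auto
  finally show "wn (\<lambda>_. s) (sl X t) \<le> (\<Sum>n. EN T (Y n))" .
 qed
 have "HN T X \<le> (\<integral>\<^sup>+t. (\<Sum>n. wn sH (\<lambda>i. Y n i t) * indicator {0..T} t) \<partial>lborel)"
  unfolding HN_def
 proof (rule nn_integral_mono, goal_cases)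
  case (1 t)
  show ?case
  proof (cases "t \<in> {0..T}")
   case True
   then show ?thesis using wn_suminf[OF jmeas_slice[OF m] le[OF True]] by simp
  qed simp
 qed
 also have "... = (\<Sum>n. HN T (Y n))" unfolding HN_def by (rule nn_integral_suminf) measurable
 finally have "EN T X + HN T X \<le> (\<Sum>n. EN T (Y n)) + (\<Sum>n. HN T (Y n))" by (intro add_mono 1)
 also have "... = (\<Sum>n. NM T (Y n))" unfolding NM_def by (rule suminf_add) auto
 finally show ?thesis by (simp add: NM_def)
qed

lemma wn_zero: "wn q (\<lambda>i \<xi>. 0) = 0"
 by (simp add: wn_def)

lemma NM_zero: "NM T (\<lambda>i t \<xi>. 0) = 0"
 by (simp add: NM_def EN_def HN_def wn_zero SUP_constant bot_ennreal)

lemma NM_triangle: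
 assumes m: "jmeas X" "jmeas Y"
  and le: "\<And>t. t \<in> {0..T} ==> AE \<xi> in lborel. \<forall>i. norm (V i t \<xi>) \<le> norm (X i t \<xi>) + norm (Y i t \<xi>)"
 shows "NM T V \<le> NM T X + NM T Y"
proof -
 define S where "S = (\<lambda>n::nat. if n = 0 then X else if n = 1 then Y else (\<lambda>i t \<xi>. 0))"
 have sum2: "(\<Sum>n. f n) = f 0 + f 1" if "\<And>n. n \<ge> 2 ==> f n = 0" for f :: "nat => ennreal"
 proof -
  have "(\<Sum>n. f n) = (\<Sum>n\<in>{0, 1}. f n)" by (rule suminf_finite) (use that in \<open>auto simp: not_less_eq_eq numeral_2_eq_2\<close>)
  then show ?thesis by simp
 qed
 have "NM T V \<le> (\<Sum>n. NM T (S n))"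
 proof (rule NM_suminf)
  show "jmeas (S n)" for n using m by (simp add: S_def jmeas_zero)
  fix t assume t: "t \<in> {0..T}"
  show "AE \<xi> in lborel. \<forall>i. enorm (V i t \<xi>) \<le> (\<Sum>n. enorm (S n i t \<xi>))"
   using le[OF t]
  proof eventually_elim
   case (elim \<xi>)
   have "(\<Sum>n. enorm (S n i t \<xi>)) = enorm (X i t \<xi>) + enorm (Y i t \<xi>)" for i
    by (subst sum2) (auto simp: S_def)
   then show ?case using elim by (auto simp: ennreal_plus[symmetric] ennreal_leI simp del: ennreal_plus)
  qed
 qed
 also have "... = NM T X + NM T Y" by (subst sum2) (auto simp: S_def NM_zero)
 finally show ?thesis .
qed

lemma NM_mono:
 assumes m: "jmeas X"
  and le: "\<And>t. t \<in> {0..T} ==> AE \<xi> in lborel. \<forall>i. norm (V i t \<xi>) \<le> norm (X i t \<xi>)"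
 shows "NM T V \<le> NM T X"
 using NM_triangle[OF m jmeas_zero, of T V] le by (simp add: NM_zero)

lemma NM_eq_0D:
 assumes "NM T X = 0" "jmeas X" "t \<in> {0..T}"
 shows "AE \<xi> in lborel. \<forall>i. X i t \<xi> = 0"
proof -
 note [measurable (raw)] = jmeasD[OF assms(2)]
 have "wn (\<lambda>_. s) (sl X t) = 0"
  using EN_upper[OF assms(3), of X] assms(1) by (simp add: NM_def)
 then have "AE \<xi> in lborel. (\<Sum>i\<in>UNIV. ennreal (w s \<xi> * norm (X i t \<xi>))) = 0"
  unfolding wn_def by (subst (asm) nn_integral_0_iff_AE) measurable
 moreover have "AE \<xi> in lborel. \<xi> \<noteq> (0::real^3)" by (rule AE_lborel_singleton)
 ultimately show ?thesis
 proof eventually_elim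
  case (elim \<xi>)
  have "ennreal (w s \<xi> * norm (X i t \<xi>)) = 0" for i
   using sum_nonneg_eq_0_iff[THEN iffD1, OF _ _ elim(1)] by auto
  then have "w s \<xi> * norm (X i t \<xi>) \<le> 0" for i by (simp only: ennreal_eq_0_iff)
  then show ?case using w_pos[OF elim(2), of s] by (auto simp: mult_le_0_iff)
 qed
qed

definition lam :: "real => real" where
 "lam T = max (T powr (1 - 1 / (2 * \<alpha>))) (T powr (1 - 1 / (2 * \<beta>)))"

lemma lam_nonneg: "lam T \<ge> 0"
 unfolding lam_def by (rule max.coboundedI1) simp

text \<open>Interpolation at the frequency \<open>\<rho> = T\<^sup>-\<^sup>1\<^sup>/\<^sup>2\<^sup>\<gamma>\<close>, where the heat kernel starts to
  decay on the time scale \<open>T\<close>.\<close>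

lemma wn_interpolate:
 assumes T: "T > 0" and m: "slice_meas z"
 shows "wn (\<lambda>_. s + 1) z \<le> ennreal (lam T / T) * wn (\<lambda>_. s) z + ennreal (lam T) * wn sH z"
proof -
 note [measurable] = slice_measD[OF m]
 note l0 = lam_nonneg[of T]
 have pt: "w (s + 1) \<xi> \<le> lam T / T * w s \<xi> + lam T * w (sH i) \<xi>" for i \<xi>
 proof -
  let ?g = "gam i" let ?\<rho> = "T powr (- (1 / (2 * ?g)))"
  have le: "T powr (1 - 1 / (2 * ?g)) \<le> lam T" unfolding lam_def gam_def by (cases i) auto
  have 1: "?\<rho> \<le> lam T / T"
  proof -
   have "T powr (1 - 1 / (2 * ?g)) / T = T powr ((1 - 1 / (2 * ?g)) - 1)"
    unfolding powr_diff[of T "1 - 1 / (2 * ?g)" 1] using T by simp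
   then have "?\<rho> = T powr (1 - 1 / (2 * ?g)) / T" by simp
   then show ?thesis using le T by (simp add: divide_right_mono)
  qed
  have 2: "?\<rho> powr (1 - 2 * ?g) \<le> lam T"
  proof -
   have "- (1 / (2 * ?g)) * (1 - 2 * ?g) = 1 - 1 / (2 * ?g)" using gam(2)[of i] by (simp add: field_simps)
   then have "?\<rho> powr (1 - 2 * ?g) = T powr (1 - 1 / (2 * ?g))"
    by (simp only: powr_powr)
   then show ?thesis using le by simp
  qed
  have "w (s + 1) \<xi> \<le> ?\<rho> * w s \<xi> + ?\<rho> powr (1 - 2 * ?g) * w (s + 2 * ?g) \<xi>"
   by (rule w_interpolate[OF gam(1)]) (use T in simp)
  also have "... \<le> lam T / T * w s \<xi> + lam T * w (sH i) \<xi>"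
   by (intro add_mono mult_right_mono 1 2) auto
  finally show ?thesis .
 qed
 have "wn (\<lambda>_. s + 1) z \<le> (\<integral>\<^sup>+\<xi>. ennreal (lam T / T) * (\<Sum>i\<in>UNIV. ennreal (w s \<xi> * norm (z i \<xi>)))
   + ennreal (lam T) * (\<Sum>i\<in>UNIV. ennreal (w (sH i) \<xi> * norm (z i \<xi>))) \<partial>lborel)"
  unfolding wn_def
 proof (rule nn_integral_mono, goal_cases)
  case (1 \<xi>)
  have "(\<Sum>i\<in>UNIV. ennreal (w (s + 1) \<xi> * norm (z i \<xi>)))
   \<le> (\<Sum>i\<in>UNIV. ennreal (lam T / T * (w s \<xi> * norm (z i \<xi>)) + lam T * (w (sH i) \<xi> * norm (z i \<xi>))))"
  proof (intro sum_mono ennreal_leI)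
   fix i
   show "w (s + 1) \<xi> * norm (z i \<xi>) \<le> lam T / T * (w s \<xi> * norm (z i \<xi>)) + lam T * (w (sH i) \<xi> * norm (z i \<xi>))"
    using mult_right_mono[OF pt[of \<xi> i] norm_ge_zero[of "z i \<xi>"]] by (simp add: distrib_right mult.assoc)
  qed
  also have "... = ennreal (lam T / T) * (\<Sum>i\<in>UNIV. ennreal (w s \<xi> * norm (z i \<xi>)))
   + ennreal (lam T) * (\<Sum>i\<in>UNIV. ennreal (w (sH i) \<xi> * norm (z i \<xi>)))"
  proof -
   have "ennreal (lam T / T * (w s \<xi> * norm (z i \<xi>)) + lam T * (w (sH i) \<xi> * norm (z i \<xi>)))
    = ennreal (lam T / T) * ennreal (w s \<xi> * norm (z i \<xi>)) + ennreal (lam T) * ennreal (w (sH i) \<xi> * norm (z i \<xi>))" for i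
    using T l0 by (subst ennreal_plus) (auto simp only: ennreal_mult w_nonneg norm_ge_zero mult_nonneg_nonneg divide_nonneg_pos)
   then show ?thesis by (simp only: sum.distrib sum_distrib_left)
  qed
  finally show ?case .
 qed
 also have "... = ennreal (lam T / T) * wn (\<lambda>_. s) z + ennreal (lam T) * wn sH z"
  unfolding wn_def by (simp add: nn_integral_add nn_integral_cmult)
 finally show ?thesis .
qed

lemma GN_le:
 assumes T: "T > 0" and m: "jmeas Z"
 shows "(\<integral>\<^sup>+t. wn (\<lambda>_. s + 1) (sl Z t) * indicator {0..T} t \<partial>lborel) \<le> ennreal (lam T) * NM T Z"
proof -
 note [measurable] = wn_measurable[OF m]
 note l0 = lam_nonneg[of T]
 have "(\<integral>\<^sup>+t. wn (\<lambda>_. s + 1) (sl Z t) * indicator {0..T} t \<partial>lborel)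
  \<le> (\<integral>\<^sup>+t. ennreal (lam T / T) * EN T Z * indicator {0..T} t + ennreal (lam T) * (wn sH (sl Z t) * indicator {0..T} t) \<partial>lborel)"
 proof (rule nn_integral_mono, goal_cases)
  case (1 t)
  show ?case
  proof (cases "t \<in> {0..T}")
   case True
   have "wn (\<lambda>_. s + 1) (sl Z t) \<le> ennreal (lam T / T) * wn (\<lambda>_. s) (sl Z t) + ennreal (lam T) * wn sH (sl Z t)"
    by (rule wn_interpolate[OF T jmeas_slice[OF m]])
   also have "... \<le> ennreal (lam T / T) * EN T Z + ennreal (lam T) * wn sH (sl Z t)"
    by (intro add_mono mult_left_mono EN_upper True) auto
   finally show ?thesis using True by simp
  qed simp
 qed
 also have "... = ennreal (lam T / T) * EN T Z * ennreal T + ennreal (lam T) * HN T Z"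
  unfolding HN_def using T by (simp add: nn_integral_add nn_integral_cmult)
 also have "ennreal (lam T / T) * EN T Z * ennreal T = ennreal (lam T) * EN T Z"
 proof -
  have "ennreal (lam T / T) * EN T Z * ennreal T = ennreal (lam T / T * T) * EN T Z"
   using T l0 by (subst ennreal_mult) (auto simp: mult_ac)
  then show ?thesis using T by simp
 qed
 finally show ?thesis by (simp add: NM_def distrib_left)
qed

end

section \<open>The contraction estimate\<close>

lemma contraction_algebra:
 fixes k l a b d t :: ennreal
 shows "24 * (2 * k * ((a + b) * (l * d) + d * (l * a + l * b)) + d * t) = (96 * (k * l) * (a + b) + 24 * t) * d"
proof -
 have X: "d * (l * a + l * b) = (a + b) * (l * d)" by (simp only: distrib_left distrib_right mult_ac)
 have "24 * (2 * k * ((a + b) * (l * d) + d * (l * a + l * b)) + d * t) = 24 * (2 * k * (2 * ((a + b) * (l * d))) + d * t)"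
  by (simp only: X mult_2[symmetric])
 also have "... = (24 * 2 * 2) * (k * ((a + b) * (l * d))) + 24 * (d * t)"
  by (simp only: distrib_left mult_ac)
 also have "(24 * 2 * 2 :: ennreal) = 96" by simp
 finally have "24 * (2 * k * ((a + b) * (l * d) + d * (l * a + l * b)) + d * t) = 96 * (k * ((a + b) * (l * d))) + 24 * (d * t)" .
 also have "... = 96 * (k * l) * (a + b) * d + 24 * t * d" by (simp only: mult_ac)
 also have "... = (96 * (k * l) * (a + b) + 24 * t) * d" by (rule distrib_right[symmetric])
 finally show ?thesis .
qed

context boussinesq begin

text \<open>The norm of \<open>L\<^sup>1\<^sub>T \<X>\<^sup>s\<close>, the space of the forces.\<close>

definition FN :: "real => (3 option => real => real^3 => ennreal) => ennreal" where
 "FN T f = (\<integral>\<^sup>+\<tau>. (\<integral>\<^sup>+\<xi>. ennreal (w s \<xi>) * (\<Sum>i\<in>UNIV. f i \<tau> \<xi>) \<partial>lborel) * indicator {0..T} \<tau> \<partial>lborel)"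

text \<open>Maximal regularity in \<open>L\<^sup>1\<close>: the bound in \<open>L\<^sup>\<infinity>\<^sub>T
  \<X>\<^sup>s\<close> uses that the kernel is at most 1; for \<open>L\<^sup>1\<^sub>T
  \<X>\<^sup>s\<^sup>+\<^sup>2\<^sup>\<gamma>\<close> the order of integration is exchanged and
  \<open>nn_integral_heat_le_1\<close> applied for each \<open>\<tau>\<close> and
  \<open>\<xi>\<close>.\<close>

lemma duhamel_NM:
 assumes f: "\<And>i. (\<lambda>p. f i (fst p) (snd p)) \<in> borel_measurable (borel \<Otimes>\<^sub>M borel)"
  and le: "\<And>i t \<xi>. t \<in> {0..T} ==> enorm (X i t \<xi>)
    \<le> (\<integral>\<^sup>+\<tau>. ennreal (hk i (t - \<tau>) \<xi>) * f i \<tau> \<xi> * indicator {0..t} \<tau> \<partial>lborel)"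
 shows "NM T X \<le> 2 * FN T f"
proof -
 have fm: "(\<lambda>x. f i (g x) (h x)) \<in> borel_measurable M" if g: "g \<in> M \<rightarrow>\<^sub>M borel" and h: "h \<in> M \<rightarrow>\<^sub>M borel" for i g h and M :: "'z measure"
 proof -
  have "(\<lambda>x. (g x, h x)) \<in> M \<rightarrow>\<^sub>M borel \<Otimes>\<^sub>M borel" using g h by measurable
  from measurable_compose[OF this f] show ?thesis by simp
 qed
 have fm1 [measurable]: "(\<lambda>\<xi>. f i \<tau> \<xi>) \<in> borel_measurable borel" "(\<lambda>\<tau>. f i \<tau> \<xi>) \<in> borel_measurable borel" for i \<tau> \<xi>
  by (rule fm; simp)+
 have fm2 [measurable]: "(\<lambda>p. f i (snd p) (fst p)) \<in> borel_measurable (lborel \<Otimes>\<^sub>M lborel)"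
  "(\<lambda>p. f i (fst p) (snd p)) \<in> borel_measurable (lborel \<Otimes>\<^sub>M lborel)"
  "(\<lambda>p. f i (snd p) (fst (fst p))) \<in> borel_measurable ((lborel \<Otimes>\<^sub>M lborel) \<Otimes>\<^sub>M lborel)"
  "(\<lambda>p. f i (fst p) \<xi>) \<in> borel_measurable (lborel \<Otimes>\<^sub>M lborel)"
  "(\<lambda>p. f i (snd p) \<xi>) \<in> borel_measurable (lborel \<Otimes>\<^sub>M lborel)" for i \<xi>
  by (rule fm; simp)+
 have swap: "(\<integral>\<^sup>+\<xi>. \<integral>\<^sup>+\<tau>. (\<Sum>i\<in>UNIV. ennreal (w s \<xi>) * f i \<tau> \<xi>) * indicator {0..T} \<tau> \<partial>lborel \<partial>lborel) = FN T f"
 proof -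
  have "(\<integral>\<^sup>+\<xi>. \<integral>\<^sup>+\<tau>. (\<Sum>i\<in>UNIV. ennreal (w s \<xi>) * f i \<tau> \<xi>) * indicator {0..T} \<tau> \<partial>lborel \<partial>lborel)
   = (\<integral>\<^sup>+\<tau>. \<integral>\<^sup>+\<xi>. (\<Sum>i\<in>UNIV. ennreal (w s \<xi>) * f i \<tau> \<xi>) * indicator {0..T} \<tau> \<partial>lborel \<partial>lborel)"
   by (rule lborel_pair.Fubini') measurable
  also have "... = FN T f"
   unfolding FN_def by (intro nn_integral_cong) (simp only: sum_distrib_left[symmetric], rule nn_integral_multc, measurable)
  finally show ?thesis .
 qed
 have E: "EN T X \<le> FN T f"
  unfolding EN_def
 proof (rule SUP_least)
  fix t assume t: "t \<in> {0..T}"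
  have "wn (\<lambda>_. s) (sl X t) \<le> (\<integral>\<^sup>+\<xi>. \<integral>\<^sup>+\<tau>. (\<Sum>i\<in>UNIV. ennreal (w s \<xi>) * f i \<tau> \<xi>) * indicator {0..T} \<tau> \<partial>lborel \<partial>lborel)"
   unfolding wn_def
  proof (rule nn_integral_mono, goal_cases)
   case (1 \<xi>)
   have "(\<Sum>i\<in>UNIV. ennreal (w s \<xi> * norm (X i t \<xi>))) \<le> (\<Sum>i\<in>UNIV. \<integral>\<^sup>+\<tau>. ennreal (w s \<xi>) * f i \<tau> \<xi> * indicator {0..T} \<tau> \<partial>lborel)"
   proof (rule sum_mono, goal_cases)
    case (1 i)
    have "ennreal (w s \<xi> * norm (X i t \<xi>)) \<le> ennreal (w s \<xi>) * (\<integral>\<^sup>+\<tau>. f i \<tau> \<xi> * indicator {0..T} \<tau> \<partial>lborel)"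
     unfolding ennreal_mult[OF w_nonneg norm_ge_zero]
    proof (intro mult_left_mono order_trans[OF le[OF t]] nn_integral_mono)
     fix \<tau>
     have "ennreal (hk i (t - \<tau>) \<xi>) \<le> 1" if "\<tau> \<le> t" using hk_bounds(2)[of "t - \<tau>" i \<xi>] that by simp
     then have "ennreal (hk i (t - \<tau>) \<xi>) * f i \<tau> \<xi> \<le> 1 * f i \<tau> \<xi>" if "\<tau> \<le> t" using that by (intro mult_right_mono) auto
     then show "ennreal (hk i (t - \<tau>) \<xi>) * f i \<tau> \<xi> * indicator {0..t} \<tau> \<le> f i \<tau> \<xi> * indicator {0..T} \<tau>"
      using t by (auto simp: indicator_def)
    qed simp
    also have "... = (\<integral>\<^sup>+\<tau>. ennreal (w s \<xi>) * f i \<tau> \<xi> * indicator {0..T} \<tau> \<partial>lborel)"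
     by (simp add: nn_integral_cmult mult.assoc)
    finally show ?case .
   qed
   also have "... = (\<integral>\<^sup>+\<tau>. (\<Sum>i\<in>UNIV. ennreal (w s \<xi>) * f i \<tau> \<xi>) * indicator {0..T} \<tau> \<partial>lborel)"
    unfolding sum_distrib_right by (rule nn_integral_sum[symmetric]) measurable
   finally show ?case .
  qed
  then show "wn (\<lambda>_. s) (sl X t) \<le> FN T f" by (simp only: swap)
 qed
 define g where "g = (\<lambda>t \<xi> \<tau>. \<Sum>i\<in>UNIV. ennreal (w (sH i) \<xi> * hk i (t - \<tau>) \<xi>) * f i \<tau> \<xi> * (if 0 \<le> \<tau> \<and> \<tau> \<le> t \<and> t \<le> T then 1 else 0))"
 have gm: "(\<lambda>p. g (snd (fst p)) (fst (fst p)) (snd p)) \<in> borel_measurable ((lborel \<Otimes>\<^sub>M lborel) \<Otimes>\<^sub>M lborel)"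
  unfolding g_def by measurable
 have H1: "HN T X \<le> (\<integral>\<^sup>+t. \<integral>\<^sup>+\<xi>. \<integral>\<^sup>+\<tau>. g t \<xi> \<tau> \<partial>lborel \<partial>lborel \<partial>lborel)"
  unfolding HN_def
 proof (rule nn_integral_mono, goal_cases)
  case (1 t)
  show ?case
  proof (cases "t \<in> {0..T}")
   case True
   have "wn sH (sl X t) \<le> (\<integral>\<^sup>+\<xi>. \<integral>\<^sup>+\<tau>. g t \<xi> \<tau> \<partial>lborel \<partial>lborel)"
    unfolding wn_def
   proof (rule nn_integral_mono, goal_cases)
    case (1 \<xi>)
    have "(\<Sum>i\<in>UNIV. ennreal (w (sH i) \<xi> * norm (X i t \<xi>)))
     \<le> (\<Sum>i\<in>UNIV. \<integral>\<^sup>+\<tau>. ennreal (w (sH i) \<xi> * hk i (t - \<tau>) \<xi>) * f i \<tau> \<xi> * (if 0 \<le> \<tau> \<and> \<tau> \<le> t \<and> t \<le> T then 1 else 0) \<partial>lborel)"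
    proof (rule sum_mono, goal_cases)
     case (1 i)
     have "ennreal (w (sH i) \<xi> * norm (X i t \<xi>)) \<le> ennreal (w (sH i) \<xi>) * (\<integral>\<^sup>+\<tau>. ennreal (hk i (t - \<tau>) \<xi>) * f i \<tau> \<xi> * indicator {0..t} \<tau> \<partial>lborel)"
      unfolding ennreal_mult[OF w_nonneg norm_ge_zero] by (intro mult_left_mono le True) simp
     also have "... = (\<integral>\<^sup>+\<tau>. ennreal (w (sH i) \<xi>) * (ennreal (hk i (t - \<tau>) \<xi>) * f i \<tau> \<xi> * indicator {0..t} \<tau>) \<partial>lborel)"
      by (rule nn_integral_cmult[symmetric]) measurable
     also have "... = (\<integral>\<^sup>+\<tau>. ennreal (w (sH i) \<xi> * hk i (t - \<tau>) \<xi>) * f i \<tau> \<xi> * (if 0 \<le> \<tau> \<and> \<tau> \<le> t \<and> t \<le> T then 1 else 0) \<partial>lborel)"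
      using True by (intro nn_integral_cong) (auto simp: indicator_def ennreal_mult hk_bounds mult.assoc)
     finally show ?case .
    qed
    also have "... = (\<integral>\<^sup>+\<tau>. g t \<xi> \<tau> \<partial>lborel)"
     unfolding g_def by (rule nn_integral_sum[symmetric]) measurable
    finally show ?case .
   qed
   then show ?thesis using True by simp
  qed simp
 qed
 also have "... = (\<integral>\<^sup>+\<xi>. \<integral>\<^sup>+t. \<integral>\<^sup>+\<tau>. g t \<xi> \<tau> \<partial>lborel \<partial>lborel \<partial>lborel)"
 proof (rule lborel_pair.Fubini')
  have "(\<lambda>p. \<integral>\<^sup>+\<tau>. g (snd p) (fst p) \<tau> \<partial>lborel) \<in> borel_measurable (lborel \<Otimes>\<^sub>M lborel)"
   using gm by (intro lborel.borel_measurable_nn_integral) (simp add: case_prod_unfold)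
  then show "(\<lambda>(\<xi>, t). \<integral>\<^sup>+\<tau>. g t \<xi> \<tau> \<partial>lborel) \<in> borel_measurable (lborel \<Otimes>\<^sub>M lborel)" by (simp add: case_prod_unfold)
 qed
 also have "... = (\<integral>\<^sup>+\<xi>. \<integral>\<^sup>+\<tau>. \<integral>\<^sup>+t. g t \<xi> \<tau> \<partial>lborel \<partial>lborel \<partial>lborel)"
 proof (rule nn_integral_cong, rule lborel_pair.Fubini', goal_cases)
  case (1 \<xi>)
  show ?case
   unfolding g_def by measurable
 qed
 also have "... \<le> (\<integral>\<^sup>+\<xi>. \<integral>\<^sup>+\<tau>. (\<Sum>i\<in>UNIV. ennreal (w s \<xi>) * f i \<tau> \<xi>) * indicator {0..T} \<tau> \<partial>lborel \<partial>lborel)"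
 proof (intro nn_integral_mono)
  fix \<xi> :: "real^3" and \<tau> :: real
  have "(\<integral>\<^sup>+t. g t \<xi> \<tau> \<partial>lborel)
   = (\<Sum>i\<in>UNIV. \<integral>\<^sup>+t. ennreal (w (sH i) \<xi> * hk i (t - \<tau>) \<xi>) * f i \<tau> \<xi> * (if 0 \<le> \<tau> \<and> \<tau> \<le> t \<and> t \<le> T then 1 else 0) \<partial>lborel)"
   unfolding g_def by (rule nn_integral_sum) measurable
  also have "... \<le> (\<Sum>i\<in>UNIV. (ennreal (w s \<xi>) * f i \<tau> \<xi>) * indicator {0..T} \<tau>)"
  proof (rule sum_mono, goal_cases)
   case (1 i)
   let ?r = "norm \<xi> powr (2 * gam i)"
   have "(\<integral>\<^sup>+t. ennreal (w (sH i) \<xi> * hk i (t - \<tau>) \<xi>) * f i \<tau> \<xi> * (if 0 \<le> \<tau> \<and> \<tau> \<le> t \<and> t \<le> T then 1 else 0) \<partial>lborel)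
    = (\<integral>\<^sup>+t. (ennreal (w s \<xi>) * f i \<tau> \<xi> * indicator {0..T} \<tau> * ennreal ?r) * (ennreal (exp (- (t - \<tau>) * ?r)) * indicator {\<tau>..T} t) \<partial>lborel)"
    by (intro nn_integral_cong) (auto simp: indicator_def w_shift[of s] hk_def ennreal_mult mult_ac)
   also have "... = (ennreal (w s \<xi>) * f i \<tau> \<xi> * indicator {0..T} \<tau>) * (ennreal ?r * (\<integral>\<^sup>+t. ennreal (exp (- (t - \<tau>) * ?r)) * indicator {\<tau>..T} t \<partial>lborel))"
    by (subst nn_integral_cmult) (auto simp: mult.assoc)
   also have "... \<le> (ennreal (w s \<xi>) * f i \<tau> \<xi> * indicator {0..T} \<tau>) * 1"
    by (intro mult_left_mono nn_integral_heat_le_1) auto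
   finally show ?case by simp
  qed
  finally show "(\<integral>\<^sup>+t. g t \<xi> \<tau> \<partial>lborel) \<le> (\<Sum>i\<in>UNIV. ennreal (w s \<xi>) * f i \<tau> \<xi>) * indicator {0..T} \<tau>"
   by (simp only: sum_distrib_right)
 qed
 also have "... = FN T f" by (rule swap)
 finally show ?thesis using E unfolding NM_def mult_2 by (intro add_mono)
qed

lemma heat_NM:
 assumes z0: "slice_meas z0"
 shows "NM T (\<lambda>i t \<xi>. cr (hk i t \<xi>) * z0 i \<xi>) \<le> 2 * wn (\<lambda>_. s) z0"
proof -
 note [measurable] = slice_measD[OF z0]
 let ?X = "\<lambda>i t \<xi>. cr (hk i t \<xi>) * z0 i \<xi>"
 have E: "EN T ?X \<le> wn (\<lambda>_. s) z0"
  unfolding EN_def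
 proof (rule SUP_least)
  fix t assume t: "t \<in> {0..T}"
  show "wn (\<lambda>_. s) (\<lambda>i. ?X i t) \<le> wn (\<lambda>_. s) z0"
   unfolding wn_def
  proof (intro nn_integral_mono sum_mono ennreal_leI mult_left_mono)
   fix i \<xi>
   show "norm (?X i t \<xi>) \<le> norm (z0 i \<xi>)"
    using t hk_bounds(2)[of t i \<xi>] hk_bounds(1)[of i t \<xi>] mult_right_mono[of "hk i t \<xi>" 1 "norm (z0 i \<xi>)"]
    by (simp add: norm_mult)
  qed simp
 qed
 have "HN T ?X = (\<integral>\<^sup>+t. \<integral>\<^sup>+\<xi>. (\<Sum>i\<in>UNIV. ennreal (w (sH i) \<xi> * norm (?X i t \<xi>)) * indicator {0..T} t) \<partial>lborel \<partial>lborel)"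
  unfolding HN_def wn_def by (intro nn_integral_cong) (simp only: sum_distrib_right[symmetric], rule nn_integral_multc[symmetric], measurable)
 also have "... = (\<integral>\<^sup>+\<xi>. \<integral>\<^sup>+t. (\<Sum>i\<in>UNIV. ennreal (w (sH i) \<xi> * norm (?X i t \<xi>)) * indicator {0..T} t) \<partial>lborel \<partial>lborel)"
  by (rule lborel_pair.Fubini') measurable
 also have "... \<le> wn (\<lambda>_. s) z0"
  unfolding wn_def
 proof (rule nn_integral_mono, goal_cases)
  case (1 \<xi>)
  have "(\<integral>\<^sup>+t. (\<Sum>i\<in>UNIV. ennreal (w (sH i) \<xi> * norm (?X i t \<xi>)) * indicator {0..T} t) \<partial>lborel)
   = (\<Sum>i\<in>UNIV. \<integral>\<^sup>+t. ennreal (w (sH i) \<xi> * norm (?X i t \<xi>)) * indicator {0..T} t \<partial>lborel)"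
   by (rule nn_integral_sum) measurable
  also have "... \<le> (\<Sum>i\<in>UNIV. ennreal (w s \<xi> * norm (z0 i \<xi>)))"
  proof (rule sum_mono, goal_cases)
   case (1 i)
   let ?r = "norm \<xi> powr (2 * gam i)"
   have "(\<integral>\<^sup>+t. ennreal (w (sH i) \<xi> * norm (?X i t \<xi>)) * indicator {0..T} t \<partial>lborel)
    = (\<integral>\<^sup>+t. (ennreal (w s \<xi> * norm (z0 i \<xi>)) * ennreal ?r) * (ennreal (exp (- (t - 0) * ?r)) * indicator {0..T} t) \<partial>lborel)"
    by (intro nn_integral_cong) (auto simp: indicator_def w_shift[of s] hk_def norm_mult ennreal_mult[symmetric] mult_ac)
   also have "... = ennreal (w s \<xi> * norm (z0 i \<xi>)) * (ennreal ?r * (\<integral>\<^sup>+t. ennreal (exp (- (t - 0) * ?r)) * indicator {0..T} t \<partial>lborel))"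
    by (subst nn_integral_cmult) (auto simp: mult.assoc)
   also have "... \<le> ennreal (w s \<xi> * norm (z0 i \<xi>)) * 1"
    by (intro mult_left_mono nn_integral_heat_le_1) auto
   finally show ?case by simp
  qed
  finally show ?case .
 qed
 finally show ?thesis using E unfolding NM_def mult_2 by (intro add_mono)
qed

lemma Phi_diff_le:
 assumes Z: "jmeas Z" and Z': "jmeas Z'"
 shows "enorm (Phi z0 Z i t \<xi> - Phi z0 Z' i t \<xi>)
  \<le> (\<integral>\<^sup>+\<tau>. ennreal (hk i (t - \<tau>) \<xi>) * enorm (force (sl Z \<tau>) i \<xi> - force (sl Z' \<tau>) i \<xi>) * indicator {0..t} \<tau> \<partial>lborel)"
proof -
 note [measurable (raw)] = jmeas_force[OF Z] jmeas_force[OF Z']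
 have "Phi z0 Z i t \<xi> - Phi z0 Z' i t \<xi> =
   (LINT \<tau>|lborel. (dint Z i t \<xi> \<tau>))
  - (LINT \<tau>|lborel. (dint Z' i t \<xi> \<tau>))"
  by (simp add: Phi_def)
 then have "enorm (Phi z0 Z i t \<xi> - Phi z0 Z' i t \<xi>) \<le>
  (\<integral>\<^sup>+\<tau>. enorm ((dint Z i t \<xi> \<tau>)
    - (dint Z' i t \<xi> \<tau>)) \<partial>lborel)"
  by (simp only:) (rule norm_integral_diff_le; measurable)
 also have "... = (\<integral>\<^sup>+\<tau>. ennreal (hk i (t - \<tau>) \<xi>) * enorm (force (sl Z \<tau>) i \<xi> - force (sl Z' \<tau>) i \<xi>) * indicator {0..t} \<tau> \<partial>lborel)"
 proof (rule nn_integral_cong, goal_cases)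
  case (1 \<tau>)
  have "enorm (cr (hk i (t - \<tau>) \<xi>) * force (sl Z \<tau>) i \<xi> - cr (hk i (t - \<tau>) \<xi>) * force (sl Z' \<tau>) i \<xi>)
    = ennreal (hk i (t - \<tau>) \<xi>) * enorm (force (sl Z \<tau>) i \<xi> - force (sl Z' \<tau>) i \<xi>)"
   unfolding right_diff_distrib[symmetric] norm_mult using hk_bounds(1)[of i "t - \<tau>" \<xi>] by (simp add: ennreal_mult)
  then show ?case
   by (simp add: indicator_def)
 qed
 finally show ?thesis .
qed

text \<open>The quadratic terms are estimated by \<open>force_wint\<close> at each time, with one factor in
  \<open>L\<^sup>\<infinity>\<^sub>T \<X>\<^sup>s\<close> and the other in \<open>L\<^sup>1\<^sub>T
  \<X>\<^sup>s\<^sup>+\<^sup>1\<close>; the buoyancy term costs a factor \<open>T\<close>.\<close>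

lemma force_FN:
 assumes Z: "jmeas Z" and Z': "jmeas Z'" and T: "T > 0"
 shows "FN T (\<lambda>i \<tau> \<xi>. enorm (force (sl Z \<tau>) i \<xi> - force (sl Z' \<tau>) i \<xi>))
  \<le> (ennreal (96 * Kw * lam T) * (NM T Z + NM T Z') + ennreal (24 * T)) * NM T (stdiff Z Z')"
proof -
 let ?D = "stdiff Z Z'"
 let ?E = "\<lambda>Z t. wn (\<lambda>_. s) (sl Z t)" and ?G = "\<lambda>Z t. wn (\<lambda>_. s + 1) (sl Z t)"
 note D = jmeas_diff[OF Z Z']
 note [measurable] = wn_measurable[OF Z] wn_measurable[OF Z'] wn_measurable[OF D]
 have l0: "lam T \<ge> 0" by (rule lam_nonneg)
 have "FN T (\<lambda>i \<tau> \<xi>. enorm (force (sl Z \<tau>) i \<xi> - force (sl Z' \<tau>) i \<xi>))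
  \<le> (\<integral>\<^sup>+\<tau>. 24 * (ennreal (2 * Kw) * ((EN T Z + EN T Z') * (?G ?D \<tau> * indicator {0..T} \<tau>)
     + EN T ?D * (?G Z \<tau> * indicator {0..T} \<tau> + ?G Z' \<tau> * indicator {0..T} \<tau>)) + EN T ?D * indicator {0..T} \<tau>) \<partial>lborel)"
  unfolding FN_def
 proof (rule nn_integral_mono, goal_cases)
  case (1 \<tau>)
  show ?case
  proof (cases "\<tau> \<in> {0..T}")
   case True
   have "(\<integral>\<^sup>+\<xi>. ennreal (w s \<xi>) * (\<Sum>i\<in>UNIV. enorm (force (sl Z \<tau>) i \<xi> - force (sl Z' \<tau>) i \<xi>)) \<partial>lborel)
    \<le> 24 * (ennreal (2 * Kw) * (?G ?D \<tau> * (?E Z \<tau> + ?E Z' \<tau>) + ?E ?D \<tau> * (?G Z \<tau> + ?G Z' \<tau>)) + ?E ?D \<tau>)"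
    unfolding wn_const by (rule force_wint[OF jmeas_slice[OF Z] jmeas_slice[OF Z']])
   also have "... \<le> 24 * (ennreal (2 * Kw) * (?G ?D \<tau> * (EN T Z + EN T Z') + EN T ?D * (?G Z \<tau> + ?G Z' \<tau>)) + EN T ?D)"
    by (intro mult_left_mono add_mono mult_right_mono EN_upper True) auto
   finally show ?thesis using True by (simp add: mult.commute)
  qed simp
 qed
 also have "... = 24 * (ennreal (2 * Kw) * ((EN T Z + EN T Z') * (\<integral>\<^sup>+\<tau>. ?G ?D \<tau> * indicator {0..T} \<tau> \<partial>lborel)
     + EN T ?D * ((\<integral>\<^sup>+\<tau>. ?G Z \<tau> * indicator {0..T} \<tau> \<partial>lborel) + (\<integral>\<^sup>+\<tau>. ?G Z' \<tau> * indicator {0..T} \<tau> \<partial>lborel))) + EN T ?D * ennreal T)"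
  using T by (simp add: nn_integral_cmult nn_integral_add)
 also have "... \<le> 24 * (ennreal (2 * Kw) * ((NM T Z + NM T Z') * (ennreal (lam T) * NM T ?D)
     + NM T ?D * (ennreal (lam T) * NM T Z + ennreal (lam T) * NM T Z')) + NM T ?D * ennreal T)"
  using GN_le[OF T Z] GN_le[OF T Z'] GN_le[OF T D]
  by (intro mult_left_mono add_mono mult_right_mono mult_mono) (auto simp: NM_def)
 also have "... = (96 * (ennreal Kw * ennreal (lam T)) * (NM T Z + NM T Z') + 24 * ennreal T) * NM T ?D"
 proof -
  have K2: "ennreal (2 * Kw) = 2 * ennreal Kw" using Kw(1) by (simp add: ennreal_mult)
  show ?thesis unfolding K2 by (rule contraction_algebra)
 qed
 also have "96 * (ennreal Kw * ennreal (lam T)) = ennreal (96 * Kw * lam T)"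
  using Kw(1) l0 by (simp add: ennreal_mult mult.assoc)
 also have "24 * ennreal T = ennreal (24 * T)" using T by (simp add: ennreal_mult)
 finally show ?thesis .
qed

text \<open>In the balls of radius \<open>M\<close> the Lipschitz constant is \<open>2 (96 K \<lambda>(T) 2 M
  + 24 T)\<close>, twice the one of \<open>force_FN\<close> because of \<open>duhamel_NM\<close>.\<close>

lemma Phi_lipschitz:
 assumes Z: "jmeas Z" and Z': "jmeas Z'" and T: "T > 0"
  and M: "NM T Z \<le> ennreal M" "NM T Z' \<le> ennreal M" "M \<ge> 0"
  and small: "384 * Kw * lam T * M + 48 * T \<le> 1/2"
 shows "NM T (stdiff (Phi z0 Z) (Phi z0 Z')) \<le> ennreal (1/2) * NM T (stdiff Z Z')"
proof -
 have l0: "lam T \<ge> 0" by (rule lam_nonneg)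
 have K: "0 \<le> 96 * Kw * lam T" using Kw(1) l0 by simp
 let ?N = "NM T (stdiff Z Z')"
 define c where "c = 96 * Kw * lam T"
 have c: "0 \<le> c" using K by (simp only: c_def)
 have e1: "NM T (stdiff (Phi z0 Z) (Phi z0 Z')) \<le> 2 * FN T (\<lambda>i \<tau> \<xi>. enorm (force (sl Z \<tau>) i \<xi> - force (sl Z' \<tau>) i \<xi>))"
 proof (rule duhamel_NM[OF _ Phi_diff_le[OF Z Z']])
  note [measurable (raw)] = jmeas_force[OF Z] jmeas_force[OF Z']
  show "(\<lambda>p. enorm (force (\<lambda>k. Z k (fst p)) i (snd p) - force (\<lambda>k. Z' k (fst p)) i (snd p))) \<in> borel_measurable (borel \<Otimes>\<^sub>M borel)" for i
   by measurable
 qed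
 have e2: "FN T (\<lambda>i \<tau> \<xi>. enorm (force (sl Z \<tau>) i \<xi> - force (sl Z' \<tau>) i \<xi>))
   \<le> (ennreal c * (ennreal M + ennreal M) + ennreal (24 * T)) * ?N"
  by (rule order_trans[OF force_FN[OF Z Z' T]], fold c_def)
    (rule mult_right_mono[OF add_right_mono[OF mult_left_mono[OF add_mono[OF M(1) M(2)]]]]; simp)
 have e3: "2 * (ennreal c * (ennreal M + ennreal M) + ennreal (24 * T)) \<le> ennreal (1/2)"
 proof -
  have "ennreal (2 * (c * (M + M) + 24 * T)) = 2 * ennreal (c * (M + M) + 24 * T)"
   using c M(3) T by (subst ennreal_mult) auto
  moreover have "ennreal (c * (M + M) + 24 * T) = ennreal (c * (M + M)) + ennreal (24 * T)"
   using c M(3) T by (intro ennreal_plus) auto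
  moreover have "ennreal (c * (M + M)) = ennreal c * (ennreal M + ennreal M)"
   using c M(3) by (simp only: ennreal_plus[symmetric] ennreal_mult[symmetric] add_nonneg_nonneg)
  moreover have "2 * (c * (M + M) + 24 * T) \<le> 1 / 2"
  proof -
   have "2 * (c * (M + M) + 24 * T) = 384 * Kw * lam T * M + 48 * T" unfolding c_def by algebra
   then show ?thesis using small by (simp only:)
  qed
  ultimately show ?thesis by (metis ennreal_leI)
 qed
 have "2 * ((ennreal c * (ennreal M + ennreal M) + ennreal (24 * T)) * ?N) \<le> ennreal (1/2) * ?N"
  using mult_right_mono[OF e3, of ?N] by (simp only: mult.assoc zero_le)
 then show ?thesis using order_trans[OF e1 mult_left_mono[OF e2, of 2]] by (meson order_trans zero_le)
qed

end

section \<open>The fixed point\<close>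

context boussinesq begin

lemma Phi_zero: "Phi z0 (\<lambda>i t \<xi>. 0) = (\<lambda>i t \<xi>. cr (hk i t \<xi>) * z0 i \<xi>)"
 by (intro ext) (simp add: Phi_def force_zero cong: if_cong)

text \<open>The iterates start at 0, so that the first one is the heat flow of the data, of norm at most
  \<open>2 D\<close>; the increments halve in each step, which keeps everything in the ball of radius \<open>4
  D\<close>.\<close>

lemma picard:
 assumes T: "T > 0" and z0: "slice_meas z0" and D: "wn (\<lambda>_. s) z0 \<le> ennreal D" "D \<ge> 0" and M: "4 * D \<le> M"
  and small: "384 * Kw * lam T * M + 48 * T \<le> 1/2"
 shows "\<exists>Z. jmeas Z \<and> NM T Z \<le> ennreal (4 * D) \<and> (\<forall>t\<in>{0..T}. AE \<xi> in lborel. \<forall>i. Z i t \<xi> = Phi z0 Z i t \<xi>)"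
proof -
 define P where "P n = (Phi z0 ^^ n) (\<lambda>i t \<xi>. 0)" for n
 have P0: "P 0 = (\<lambda>i t \<xi>. 0)" and PS: "P (Suc n) = Phi z0 (P n)" for n by (simp_all add: P_def)
 have Pm: "jmeas (P n)" for n by (induct n) (simp_all only: P0 PS jmeas_zero jmeas_Phi[OF _ z0])
 note PhiPm = jmeas_Phi[OF Pm z0]
 have M0: "M \<ge> 0" using D(2) M by simp
 have N0: "NM T (Phi z0 (P 0)) \<le> ennreal (2 * D)"
 proof -
  have "NM T (Phi z0 (P 0)) \<le> 2 * wn (\<lambda>_. s) z0" unfolding P0 Phi_zero by (rule heat_NM[OF z0])
  also have "... \<le> 2 * ennreal D" by (rule mult_left_mono[OF D(1)]) simp
  also have "... = ennreal (2 * D)" using D(2) by (simp add: ennreal_mult)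
  finally show ?thesis .
 qed
 have lip: "NM T (stdiff (Phi z0 A) (Phi z0 B)) \<le> ennreal (1/2) * NM T (stdiff A B)"
  if "jmeas A" "jmeas B" "NM T A \<le> ennreal (4 * D)" "NM T B \<le> ennreal (4 * D)" for A B
  by (rule Phi_lipschitz[OF that(1,2) T _ _ M0 small]) (use that(3,4) M order_trans ennreal_leI in blast)+
 have half: "ennreal (1/2) * ennreal x + ennreal y = ennreal (x / 2 + y)" if "x \<ge> 0" "y \<ge> 0" for x y
 proof -
  have "ennreal (1/2) * ennreal x = ennreal (1/2 * x)" using that by (intro ennreal_mult[symmetric]) auto
  moreover have "ennreal (1/2 * x) + ennreal y = ennreal (1/2 * x + y)" using that by (intro ennreal_plus[symmetric]) auto
  ultimately show ?thesis by (simp only: mult.commute[of "1/2"] times_divide_eq_right mult_1_right)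
 qed
 have NP: "NM T (P n) \<le> ennreal (4 * D)" for n
 proof (induct n)
  case 0
  show ?case by (simp add: P0 NM_zero)
 next
  case (Suc n)
  have z: "NM T (P 0) \<le> ennreal (4 * D)" by (simp add: P0 NM_zero)
  have "NM T (P (Suc n)) \<le> NM T (stdiff (Phi z0 (P n)) (Phi z0 (P 0))) + NM T (Phi z0 (P 0))"
   unfolding PS
  proof (rule NM_triangle[OF jmeas_diff[OF PhiPm PhiPm] PhiPm], intro AE_I2 allI)
   fix i t \<xi>
   show "norm (Phi z0 (P n) i t \<xi>) \<le> norm (Phi z0 (P n) i t \<xi> - Phi z0 (P 0) i t \<xi>) + norm (Phi z0 (P 0) i t \<xi>)"
    using norm_triangle_ineq[of "Phi z0 (P n) i t \<xi> - Phi z0 (P 0) i t \<xi>" "Phi z0 (P 0) i t \<xi>"] by simp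
  qed
  also have "... \<le> ennreal (1/2) * NM T (stdiff (P n) (P 0)) + ennreal (2 * D)"
   by (intro add_mono lip Pm Suc z N0)
  also have "stdiff (P n) (P 0) = P n" by (simp add: P0)
  also have "ennreal (1/2) * NM T (P n) + ennreal (2 * D) \<le> ennreal (1/2) * ennreal (4 * D) + ennreal (2 * D)"
   by (intro add_mono mult_left_mono Suc) auto
  also have "... = ennreal (4 * D)" using half[of "4 * D" "2 * D"] D(2) by simp
  finally show ?case .
 qed
 define \<Delta> where "\<Delta> n = stdiff (P (Suc n)) (P n)" for n
 have \<Delta>m: "jmeas (\<Delta> n)" for n unfolding \<Delta>_def by (rule jmeas_diff[OF Pm Pm])
 have N\<Delta>: "NM T (\<Delta> n) \<le> ennreal (2 * D * (1/2) ^ n)" for n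
 proof (induct n)
  case 0
  have "\<Delta> 0 = Phi z0 (P 0)" unfolding \<Delta>_def PS by (simp add: P0)
  then show ?case using N0 by simp
 next
  case (Suc n)
  have "\<Delta> (Suc n) = stdiff (Phi z0 (P (Suc n))) (Phi z0 (P n))" by (simp add: \<Delta>_def PS)
  then have "NM T (\<Delta> (Suc n)) \<le> ennreal (1/2) * NM T (\<Delta> n)"
   using lip[OF Pm Pm NP NP, of "Suc n" n] by (simp only: \<Delta>_def)
  also have "... \<le> ennreal (1/2) * ennreal (2 * D * (1/2) ^ n)" by (rule mult_left_mono[OF Suc]) simp
  also have "... = ennreal (1/2 * (2 * D * (1/2) ^ n))" using D(2) by (intro ennreal_mult[symmetric]) auto
  also have "1/2 * (2 * D * (1/2) ^ n) = 2 * D * (1/2) ^ Suc n" by simp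
  finally show ?case .
 qed
 have tail: "(\<Sum>n. NM T (\<Delta> (n + N))) \<le> ennreal (4 * D * (1/2) ^ N)" for N
 proof -
  have sm: "(\<lambda>n. (2 * D * (1/2) ^ N) * (1/2 :: real) ^ n) sums ((2 * D * (1/2) ^ N) * 2)"
   using sums_mult[OF geometric_sums[of "1/2 :: real"], of "2 * D * (1/2) ^ N"] by simp
  have "(\<Sum>n. NM T (\<Delta> (n + N))) \<le> (\<Sum>n. ennreal ((2 * D * (1/2) ^ N) * (1/2) ^ n))"
   by (intro suminf_le order_trans[OF N\<Delta>]) (auto simp: power_add mult_ac)
  also have "... = ennreal (\<Sum>n. (2 * D * (1/2) ^ N) * (1/2) ^ n)"
   by (rule suminf_ennreal2) (use D(2) sm in \<open>auto simp: sums_iff\<close>)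
  also have "(\<Sum>n. (2 * D * (1/2) ^ N) * (1/2 :: real) ^ n) = 4 * D * (1/2) ^ N" using sm by (simp add: sums_iff)
  finally show ?thesis .
 qed
 define Z where "Z i t \<xi> = (\<Sum>n. \<Delta> n i t \<xi>)" for i t \<xi>
 have Zm: "jmeas Z"
  unfolding jmeas_def Z_def using \<Delta>m unfolding jmeas_def by (auto intro!: borel_measurable_suminf)
 have conv: "AE \<xi> in lborel. \<forall>i. (\<Sum>n. enorm (\<Delta> n i t \<xi>)) < \<infinity>" if t: "t \<in> {0..T}" for t
 proof -
  note [measurable] = slice_measD[OF jmeas_slice[OF \<Delta>m]]
  have "(\<integral>\<^sup>+\<xi>. (\<Sum>n. \<Sum>i\<in>UNIV. ennreal (w s \<xi> * norm (\<Delta> n i t \<xi>))) \<partial>lborel) = (\<Sum>n. wn (\<lambda>_. s) (sl (\<Delta> n) t))"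
   unfolding wn_def by (rule nn_integral_suminf) measurable
  also have "... \<le> (\<Sum>n. NM T (\<Delta> n))"
  proof (rule suminf_le)
   show "wn (\<lambda>_. s) (sl (\<Delta> n) t) \<le> NM T (\<Delta> n)" for n
    using EN_upper[OF t, of "\<Delta> n"] by (simp add: NM_def add_increasing2)
  qed auto
  also have "... \<le> ennreal (4 * D)" using tail[of 0] by simp
  finally have "(\<integral>\<^sup>+\<xi>. (\<Sum>n. \<Sum>i\<in>UNIV. ennreal (w s \<xi> * norm (\<Delta> n i t \<xi>))) \<partial>lborel) \<noteq> \<infinity>"
   by (auto simp: top_unique)
  then have "AE \<xi> in lborel. (\<Sum>n. \<Sum>i\<in>UNIV. ennreal (w s \<xi> * norm (\<Delta> n i t \<xi>))) \<noteq> \<infinity>"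
   by (rule nn_integral_PInf_AE[rotated]) measurable
  moreover have "AE \<xi> in lborel. \<xi> \<noteq> (0::real^3)" by (rule AE_lborel_singleton)
  ultimately show ?thesis
  proof eventually_elim
   case (elim \<xi>)
   show ?case
   proof
    fix i
    have "ennreal (w s \<xi>) * (\<Sum>n. enorm (\<Delta> n i t \<xi>)) = (\<Sum>n. ennreal (w s \<xi> * norm (\<Delta> n i t \<xi>)))"
     by (simp only: ennreal_mult w_nonneg norm_ge_zero ennreal_suminf_cmult)
    also have "... \<le> (\<Sum>n. \<Sum>i\<in>UNIV. ennreal (w s \<xi> * norm (\<Delta> n i t \<xi>)))"
     by (intro suminf_le member_le_sum) auto
    also have "... < \<infinity>" using elim(1) by (simp add: less_top)
    finally have "ennreal (w s \<xi>) * (\<Sum>n. enorm (\<Delta> n i t \<xi>)) < \<infinity>" .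
    moreover have "ennreal (w s \<xi>) \<noteq> 0" using w_pos[OF elim(2), of s] by (simp add: ennreal_eq_0_iff)
    ultimately show "(\<Sum>n. enorm (\<Delta> n i t \<xi>)) < \<infinity>"
     by (auto simp: ennreal_mult_less_top less_top ennreal_mult_eq_top_iff)
   qed
  qed
 qed
 have NZP: "NM T (stdiff Z (P N)) \<le> ennreal (4 * D * (1/2) ^ N)" for N
 proof (rule order_trans[OF NM_suminf[OF \<Delta>m] tail])
  fix t assume "t \<in> {0..T}"
  from conv[OF this] show "AE \<xi> in lborel. \<forall>i. enorm (stdiff Z (P N) i t \<xi>) \<le> (\<Sum>n. enorm (\<Delta> (n + N) i t \<xi>))"
  proof eventually_elim
   case (elim \<xi>)
   show ?case
   proof
    fix i
    have sn: "summable (\<lambda>n. norm (\<Delta> n i t \<xi>))"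
     using elim[rule_format, of i] by (intro summable_suminf_not_top) auto
    have sd: "summable (\<lambda>n. \<Delta> n i t \<xi>)" by (rule summable_norm_cancel[OF sn])
    have "(\<Sum>n<N. \<Delta> n i t \<xi>) = P N i t \<xi>"
     unfolding \<Delta>_def using sum_lessThan_telescope[of "\<lambda>n. P n i t \<xi>" N] by (simp add: P0)
    then have "Z i t \<xi> - P N i t \<xi> = (\<Sum>n. \<Delta> (n + N) i t \<xi>)"
     unfolding Z_def using suminf_minus_initial_segment[OF sd, of N] by simp
    also have "norm ... \<le> (\<Sum>n. norm (\<Delta> (n + N) i t \<xi>))"
     by (intro summable_norm summable_ignore_initial_segment sn)
    finally have "enorm (Z i t \<xi> - P N i t \<xi>) \<le> ennreal (\<Sum>n. norm (\<Delta> (n + N) i t \<xi>))" by (rule ennreal_leI)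
    also have "... = (\<Sum>n. enorm (\<Delta> (n + N) i t \<xi>))"
     by (rule suminf_ennreal2[symmetric, OF norm_ge_zero summable_ignore_initial_segment[OF sn]])
    finally show "enorm (stdiff Z (P N) i t \<xi>) \<le> (\<Sum>n. enorm (\<Delta> (n + N) i t \<xi>))" .
   qed
  qed
 qed
 have NZ: "NM T Z \<le> ennreal (4 * D)" using NZP[of 0] by (simp add: P0)
 have "NM T (stdiff Z (Phi z0 Z)) \<le> ennreal (4 * D * (1/2) ^ N)" for N
 proof -
  have "NM T (stdiff Z (Phi z0 Z)) \<le> NM T (stdiff Z (P (Suc N))) + NM T (stdiff (Phi z0 Z) (Phi z0 (P N)))"
  proof (rule NM_triangle[OF jmeas_diff[OF Zm Pm] jmeas_diff[OF jmeas_Phi[OF Zm z0] PhiPm]], intro AE_I2 allI)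
   fix i t \<xi>
   show "norm (Z i t \<xi> - Phi z0 Z i t \<xi>) \<le> norm (Z i t \<xi> - P (Suc N) i t \<xi>) + norm (Phi z0 Z i t \<xi> - Phi z0 (P N) i t \<xi>)"
    unfolding PS using norm_triangle_ineq4[of "Z i t \<xi> - Phi z0 (P N) i t \<xi>" "Phi z0 Z i t \<xi> - Phi z0 (P N) i t \<xi>"] by simp
  qed
  also have "... \<le> ennreal (4 * D * (1/2) ^ Suc N) + ennreal (1/2) * NM T (stdiff Z (P N))"
   by (intro add_mono NZP lip Zm Pm NZ NP)
  also have "... \<le> ennreal (4 * D * (1/2) ^ Suc N) + ennreal (1/2) * ennreal (4 * D * (1/2) ^ N)"
   by (intro add_mono mult_left_mono NZP) auto
  also have "... = ennreal (4 * D * (1/2) ^ N)"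
   using half[of "4 * D * (1/2) ^ N" "4 * D * (1/2) ^ Suc N"] D(2) by (simp add: add.commute)
  finally show ?thesis .
 qed
 moreover have "(\<lambda>N. ennreal (4 * D * (1/2) ^ N)) \<longlonglongrightarrow> ennreal (4 * D * 0)"
  by (intro tendsto_ennrealI tendsto_intros LIMSEQ_realpow_zero) auto
 ultimately have "NM T (stdiff Z (Phi z0 Z)) \<le> 0"
  by (intro LIMSEQ_le_const[of "\<lambda>N. ennreal (4 * D * (1/2) ^ N)"]) auto
 then have "NM T (stdiff Z (Phi z0 Z)) = 0" by simp
 from NM_eq_0D[OF this jmeas_diff[OF Zm jmeas_Phi[OF Zm z0]]] Zm NZ show ?thesis
  by (intro exI[of _ Z]) auto
qed

text \<open>The norm of the difference is at most half of itself, and it is finite.\<close>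

lemma fixed_point_unique:
 assumes T: "T > 0" and z0: "slice_meas z0" and M: "M \<ge> 0" and small: "384 * Kw * lam T * M + 48 * T \<le> 1/2"
  and A: "jmeas A" "NM T A \<le> ennreal M" "\<And>t. t \<in> {0..T} ==> AE \<xi> in lborel. \<forall>i. A i t \<xi> = Phi z0 A i t \<xi>"
  and B: "jmeas B" "NM T B \<le> ennreal M" "\<And>t. t \<in> {0..T} ==> AE \<xi> in lborel. \<forall>i. B i t \<xi> = Phi z0 B i t \<xi>"
  and t: "t \<in> {0..T}"
 shows "AE \<xi> in lborel. \<forall>i. A i t \<xi> = B i t \<xi>"
proof -
 note PAB = jmeas_diff[OF jmeas_Phi[OF A(1) z0] jmeas_Phi[OF B(1) z0]]
 have "NM T (stdiff A B) \<le> NM T (stdiff (Phi z0 A) (Phi z0 B))"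
 proof (rule NM_mono[OF PAB])
  fix t assume t: "t \<in> {0..T}"
  show "AE \<xi> in lborel. \<forall>i. norm (stdiff A B i t \<xi>) \<le> norm (stdiff (Phi z0 A) (Phi z0 B) i t \<xi>)"
   using A(3)[OF t] B(3)[OF t] by eventually_elim simp
 qed
 also have "... \<le> ennreal (1/2) * NM T (stdiff A B)"
  by (rule Phi_lipschitz[OF A(1) B(1) T A(2) B(2) M small])
 finally have le: "NM T (stdiff A B) \<le> ennreal (1/2) * NM T (stdiff A B)" .
 have "NM T (stdiff A B) \<le> NM T A + NM T B"
  by (rule NM_triangle[OF A(1) B(1)]) (auto intro!: AE_I2 norm_triangle_ineq4)
 also have "... \<le> ennreal M + ennreal M" by (intro add_mono A B)
 finally have "NM T (stdiff A B) < \<infinity>" by (auto simp: less_top[symmetric] top_unique)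
 then obtain x where x: "x \<ge> 0" "NM T (stdiff A B) = ennreal x" by (cases "NM T (stdiff A B)") auto
 have "ennreal (1/2) * ennreal x = ennreal (1/2 * x)" using x by (intro ennreal_mult[symmetric]) auto
 then have "ennreal x \<le> ennreal (x / 2)" using le unfolding x(2) by (simp only: times_divide_eq_left mult_1_left)
 then have "x \<le> x / 2" using x(1) by (simp add: ennreal_le_iff)
 then have "NM T (stdiff A B) = 0" using x by simp
 from NM_eq_0D[OF this jmeas_diff[OF A(1) B(1)] t] show ?thesis by simp
qed

section \<open>Time regularity and the divergence\<close>

text \<open>The total force \<open>\<integral>\<^sub>0\<^sup>T |F(\<tau>, \<xi>)| d\<tau>\<close> dominates the Duhamel integral at all times simultaneously.\<close>

definition ftot :: "real => state => 3 option => real^3 => ennreal" where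
 "ftot T Z i \<xi> = (\<integral>\<^sup>+\<tau>. enorm (force (sl Z \<tau>) i \<xi>) * indicator {0..T} \<tau> \<partial>lborel)"

lemma ftot_measurable:
 assumes Z: "jmeas Z" shows "ftot T Z i \<in> borel_measurable borel"
proof -
 note [measurable (raw)] = jmeas_force[OF Z]
 show ?thesis unfolding ftot_def[abs_def] by measurable
qed

lemma ftot_finite:
 assumes Z: "jmeas Z" and T: "T > 0" and N: "NM T Z < \<infinity>"
 shows "(\<integral>\<^sup>+\<xi>. ennreal (w s \<xi>) * (\<Sum>i\<in>UNIV. ftot T Z i \<xi>) \<partial>lborel) < \<infinity>"
  and "AE \<xi> in lborel. \<forall>i. ftot T Z i \<xi> < \<infinity>"
proof -
 note [measurable (raw)] = jmeas_force[OF Z] and [measurable] = ftot_measurable[OF Z]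
 have "FN T (\<lambda>i \<tau> \<xi>. enorm (force (sl Z \<tau>) i \<xi> - force (\<lambda>k \<xi>. 0) i \<xi>))
  \<le> (ennreal (96 * Kw * lam T) * (NM T Z + NM T (\<lambda>i t \<xi>. 0)) + ennreal (24 * T)) * NM T (stdiff Z (\<lambda>i t \<xi>. 0))"
  by (rule force_FN[OF Z jmeas_zero T])
 also have "... < \<infinity>" using N by (simp add: NM_zero ennreal_mult_less_top)
 finally have F: "FN T (\<lambda>i \<tau> \<xi>. enorm (force (sl Z \<tau>) i \<xi>)) < \<infinity>" by (simp add: force_zero)
 have "(\<integral>\<^sup>+\<xi>. ennreal (w s \<xi>) * (\<Sum>i\<in>UNIV. ftot T Z i \<xi>) \<partial>lborel)
  = (\<integral>\<^sup>+\<xi>. \<integral>\<^sup>+\<tau>. ennreal (w s \<xi>) * ((\<Sum>i\<in>UNIV. enorm (force (sl Z \<tau>) i \<xi>)) * indicator {0..T} \<tau>) \<partial>lborel \<partial>lborel)"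
 proof (rule nn_integral_cong, goal_cases)
  case (1 \<xi>)
  have "(\<Sum>i\<in>UNIV. ftot T Z i \<xi>) = (\<integral>\<^sup>+\<tau>. (\<Sum>i\<in>UNIV. enorm (force (sl Z \<tau>) i \<xi>)) * indicator {0..T} \<tau> \<partial>lborel)"
   unfolding ftot_def sum_distrib_right by (rule nn_integral_sum[symmetric]) measurable
  then show ?case
   by (simp only:) (rule nn_integral_cmult[symmetric], measurable)
 qed
 also have "... = (\<integral>\<^sup>+\<tau>. \<integral>\<^sup>+\<xi>. ennreal (w s \<xi>) * ((\<Sum>i\<in>UNIV. enorm (force (sl Z \<tau>) i \<xi>)) * indicator {0..T} \<tau>) \<partial>lborel \<partial>lborel)"
  by (rule lborel_pair.Fubini') measurable
 also have "... = FN T (\<lambda>i \<tau> \<xi>. enorm (force (sl Z \<tau>) i \<xi>))"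
  unfolding FN_def by (intro nn_integral_cong) (simp only: mult.assoc[symmetric], rule nn_integral_multc, measurable)
 finally show 1: "(\<integral>\<^sup>+\<xi>. ennreal (w s \<xi>) * (\<Sum>i\<in>UNIV. ftot T Z i \<xi>) \<partial>lborel) < \<infinity>" using F by simp
 then have "AE \<xi> in lborel. ennreal (w s \<xi>) * (\<Sum>i\<in>UNIV. ftot T Z i \<xi>) \<noteq> \<infinity>"
  by (intro nn_integral_PInf_AE) auto
 moreover have "AE \<xi> in lborel. \<xi> \<noteq> (0::real^3)" by (rule AE_lborel_singleton)
 ultimately show "AE \<xi> in lborel. \<forall>i. ftot T Z i \<xi> < \<infinity>"
 proof eventually_elim
  case (elim \<xi>)
  have "ennreal (w s \<xi>) \<noteq> 0" using w_pos[OF elim(2), of s] by (simp add: ennreal_eq_0_iff)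
  then have "(\<Sum>i\<in>UNIV. ftot T Z i \<xi>) \<noteq> \<infinity>" using elim(1) by (auto simp: ennreal_mult_eq_top_iff)
  then show ?case by (auto simp: less_top)
 qed
qed

lemma duhamel_integrable:
 assumes Z: "jmeas Z" and f: "ftot T Z i \<xi> < \<infinity>" and t: "t \<in> {0..T}"
 shows "integrable lborel (\<lambda>\<tau>. dint Z i t \<xi> \<tau>)"
  and "integrable lborel (\<lambda>\<tau>. indicator {0..T} \<tau> * norm (force (sl Z \<tau>) i \<xi>))"
  and "norm (dint Z i t \<xi> \<tau>)
    \<le> indicator {0..T} \<tau> * norm (force (sl Z \<tau>) i \<xi>)"
proof -
 note [measurable (raw)] = jmeas_force[OF Z]
 have le: "norm (dint Z i t \<xi> \<tau>)
  \<le> indicator {0..T} \<tau> * norm (force (sl Z \<tau>) i \<xi>)" for \<tau>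
 proof (cases "0 \<le> \<tau> \<and> \<tau> \<le> t")
  case True
  then have "hk i (t - \<tau>) \<xi> * norm (force (sl Z \<tau>) i \<xi>) \<le> 1 * norm (force (sl Z \<tau>) i \<xi>)"
   by (intro mult_right_mono hk_bounds(2)) auto
  moreover have "indicator {0..T} \<tau> = (1 :: real)" using True t by (simp add: indicator_def)
  ultimately show ?thesis
   unfolding if_P[OF True] by (simp only: norm_mult norm_of_real abs_of_nonneg[OF hk_bounds(1)])
 next
  case False
  show ?thesis unfolding if_not_P[OF False] by simp
 qed
 show i: "integrable lborel (\<lambda>\<tau>. indicator {0..T} \<tau> * norm (force (sl Z \<tau>) i \<xi>))"
 proof (rule integrableI_bounded)
  have "(\<integral>\<^sup>+\<tau>. enorm (indicator {0..T} \<tau> * norm (force (sl Z \<tau>) i \<xi>)) \<partial>lborel) = ftot T Z i \<xi>"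
   unfolding ftot_def by (intro nn_integral_cong) (auto simp: indicator_def)
  then show "(\<integral>\<^sup>+\<tau>. enorm (indicator {0..T} \<tau> * norm (force (sl Z \<tau>) i \<xi>)) \<partial>lborel) < \<infinity>" using f by simp
 qed measurable
 show "integrable lborel (\<lambda>\<tau>. dint Z i t \<xi> \<tau>)"
 proof (rule Bochner_Integration.integrable_bound[OF i])
  show "AE \<tau> in lborel. norm (dint Z i t \<xi> \<tau>)
   \<le> norm (indicator {0..T} \<tau> * norm (force (sl Z \<tau>) i \<xi>))"
   by (rule AE_I2, rule order_trans[OF le]) (simp only: real_norm_def abs_ge_self)
 qed measurable
 show "norm (dint Z i t \<xi> \<tau>)
    \<le> indicator {0..T} \<tau> * norm (force (sl Z \<tau>) i \<xi>)" by (rule le)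
qed

lemma Phi_bound:
 assumes Z: "jmeas Z" and f: "ftot T Z i \<xi> < \<infinity>" and t: "t \<in> {0..T}"
 shows "norm (Phi z0 Z i t \<xi>) \<le> norm (z0 i \<xi>) + enn2real (ftot T Z i \<xi>)"
proof -
 let ?f = "\<lambda>\<tau>. dint Z i t \<xi> \<tau>"
 note [measurable (raw)] = jmeas_force[OF Z]
 have "enorm (LINT \<tau>|lborel. ?f \<tau>) \<le> (\<integral>\<^sup>+\<tau>. enorm (?f \<tau>) \<partial>lborel)" by (rule norm_integral_le) measurable
 also have "... \<le> ftot T Z i \<xi>"
  unfolding ftot_def
 proof (rule nn_integral_mono, goal_cases)
  case (1 \<tau>)
  have "enorm (?f \<tau>) \<le> ennreal (indicator {0..T} \<tau> * norm (force (sl Z \<tau>) i \<xi>))"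
   by (rule ennreal_leI[OF duhamel_integrable(3)[OF Z f t]])
  then show ?case
   by (cases "\<tau> \<in> {0..T}") auto
 qed
 finally have "enorm (LINT \<tau>|lborel. ?f \<tau>) \<le> ftot T Z i \<xi>" .
 then have "norm (LINT \<tau>|lborel. ?f \<tau>) \<le> enn2real (ftot T Z i \<xi>)"
  using f by (cases "ftot T Z i \<xi>") (simp_all only: ennreal_le_iff enn2real_ennreal infinity_ennreal_def less_irrefl)
 moreover have "norm (cr (hk i t \<xi>) * z0 i \<xi>) \<le> norm (z0 i \<xi>)"
 proof -
  have "hk i t \<xi> * norm (z0 i \<xi>) \<le> 1 * norm (z0 i \<xi>)" using t by (intro mult_right_mono hk_bounds(2)) auto
  then show ?thesis by (simp only: norm_mult norm_of_real abs_of_nonneg[OF hk_bounds(1)])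
 qed
 ultimately show ?thesis unfolding Phi_def by (intro order_trans[OF norm_triangle_ineq]) simp
qed

text \<open>Dominated convergence for fixed \<open>\<xi>\<close>; the integrand is discontinuous in
  \<open>t\<close> only at \<open>\<tau> = t\<close>.\<close>

lemma Phi_continuous:
 assumes Z: "jmeas Z" and f: "ftot T Z i \<xi> < \<infinity>" and t: "t \<in> {0..T}" and X: "\<And>n. X n \<in> {0..T}" "X \<longlonglongrightarrow> t"
 shows "(\<lambda>n. Phi z0 Z i (X n) \<xi>) \<longlonglongrightarrow> Phi z0 Z i t \<xi>"
 unfolding Phi_def
proof (intro tendsto_add tendsto_mult tendsto_const)
 note [measurable (raw)] = jmeas_force[OF Z]
 have hc: "(\<lambda>n. hk i (X n - \<tau>) \<xi>) \<longlonglongrightarrow> hk i (t - \<tau>) \<xi>" for \<tau>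
  unfolding hk_def by (intro tendsto_intros X(2))
 show "(\<lambda>n. cr (hk i (X n) \<xi>)) \<longlonglongrightarrow> cr (hk i t \<xi>)"
  using hc[of 0] by (intro tendsto_of_real) simp
 show "(\<lambda>n. LINT \<tau>|lborel. (if 0 \<le> \<tau> \<and> \<tau> \<le> X n then cr (hk i (X n - \<tau>) \<xi>) * force (sl Z \<tau>) i \<xi> else 0))
  \<longlonglongrightarrow> (LINT \<tau>|lborel. (dint Z i t \<xi> \<tau>))"
 proof (rule integral_dominated_convergence[OF _ _ duhamel_integrable(2)[OF Z f t]])
  have "AE \<tau> in lborel. \<tau> \<noteq> t" by (rule AE_lborel_singleton)
  then show "AE \<tau> in lborel. (\<lambda>n. if 0 \<le> \<tau> \<and> \<tau> \<le> X n then cr (hk i (X n - \<tau>) \<xi>) * force (sl Z \<tau>) i \<xi> else 0)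
   \<longlonglongrightarrow> (dint Z i t \<xi> \<tau>)"
  proof eventually_elim
   case (elim \<tau>)
   consider "0 \<le> \<tau> \<and> \<tau> < t" | "\<not> 0 \<le> \<tau>" | "t < \<tau>" using elim by linarith
   then show ?case
   proof cases
    case 1
    have "\<forall>\<^sub>F n in sequentially. cr (hk i (X n - \<tau>) \<xi>) * force (sl Z \<tau>) i \<xi>
      = (if 0 \<le> \<tau> \<and> \<tau> \<le> X n then cr (hk i (X n - \<tau>) \<xi>) * force (sl Z \<tau>) i \<xi> else 0)"
     using order_tendstoD(1)[OF X(2), of \<tau>] 1 by (auto elim!: eventually_mono)
    moreover have "(\<lambda>n. cr (hk i (X n - \<tau>) \<xi>) * force (sl Z \<tau>) i \<xi>) \<longlonglongrightarrow> cr (hk i (t - \<tau>) \<xi>) * force (sl Z \<tau>) i \<xi>"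
     by (intro tendsto_mult tendsto_of_real hc tendsto_const)
    ultimately show ?thesis using 1 Lim_transform_eventually by fastforce
   next
    case 3
    have "\<forall>\<^sub>F n in sequentially. (if 0 \<le> \<tau> \<and> \<tau> \<le> X n then cr (hk i (X n - \<tau>) \<xi>) * force (sl Z \<tau>) i \<xi> else 0) = 0"
     using order_tendstoD(2)[OF X(2) 3] by (auto elim!: eventually_mono)
    then show ?thesis using 3 tendsto_eventually by fastforce
   qed simp
  qed
  show "AE \<tau> in lborel. norm (if 0 \<le> \<tau> \<and> \<tau> \<le> X n then cr (hk i (X n - \<tau>) \<xi>) * force (sl Z \<tau>) i \<xi> else 0)
    \<le> indicator {0..T} \<tau> * norm (force (sl Z \<tau>) i \<xi>)" for n
   by (rule AE_I2) (rule duhamel_integrable(3)[OF Z f X(1)])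
 qed measurable
qed

lemma proj_div: "(\<Sum>l\<in>UNIV. cr (\<xi> $ l) * proj l k \<xi>) = 0"
proof (cases "\<xi> = 0")
 case False
 then have n: "(\<Sum>l\<in>UNIV. \<xi> $ l * \<xi> $ l) = (norm \<xi>)\<^sup>2" by (simp add: power2_norm_eq_inner inner_real3)
 have "(\<Sum>l\<in>UNIV. cr (\<xi> $ l) * proj l k \<xi>)
   = (\<Sum>l\<in>UNIV. cr (\<xi> $ l) * (if k = l then 1 else 0)) - cr ((\<Sum>l\<in>UNIV. \<xi> $ l * \<xi> $ l) * \<xi> $ k / (norm \<xi>)\<^sup>2)"
  unfolding proj_def right_diff_distrib sum_subtractf
  by (simp add: sum_distrib_right sum_divide_distrib mult.assoc)
 also have "... = cr (\<xi> $ k) - cr (\<xi> $ k)"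
  unfolding n using False by (simp add: if_distrib[of "\<lambda>x. _ * x"] cong: if_cong)
 finally show ?thesis by simp
qed simp

lemma force_div: "(\<Sum>l\<in>UNIV. cr (\<xi> $ l) * force z (Some l) \<xi>) = 0"
proof -
 have "(\<Sum>l\<in>UNIV. cr (\<xi> $ l) * force z (Some l) \<xi>)
  = (\<Sum>k\<in>UNIV. (\<Sum>l\<in>UNIV. cr (\<xi> $ l) * proj l k \<xi>) * ((if k = 3 then z None \<xi> else 0) - flux z (Some k) \<xi>))"
  unfolding force_def option.case sum_distrib_left sum_distrib_right by (subst sum.swap) (simp only: mult.assoc)
 then show ?thesis by (simp add: proj_div)
qed

text \<open>The symbol of the projector is orthogonal to \<open>\<xi>\<close>.\<close>

lemma Phi_div:
 assumes Z: "jmeas Z" and T: "T > 0" and N: "NM T Z < \<infinity>" and t: "t \<in> {0..T}"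
  and z0: "AE \<xi> in lborel. (\<Sum>l\<in>UNIV. cr (\<xi> $ l) * z0 (Some l) \<xi>) = 0"
 shows "AE \<xi> in lborel. (\<Sum>l\<in>UNIV. cr (\<xi> $ l) * Phi z0 Z (Some l) t \<xi>) = 0"
 using z0 ftot_finite(2)[OF Z T N]
proof eventually_elim
 case (elim \<xi>)
 have hkS: "hk (Some l) t \<xi> = hk (Some 0) t \<xi>" for l t by (simp add: hk_def gam_def)
 let ?f = "\<lambda>l \<tau>. if 0 \<le> \<tau> \<and> \<tau> \<le> t then cr (hk (Some l) (t - \<tau>) \<xi>) * force (sl Z \<tau>) (Some l) \<xi> else 0"
 have i: "integrable lborel (?f l)" for l using duhamel_integrable(1)[OF Z _ t] elim(2) by blast
 have "(\<Sum>l\<in>UNIV. cr (\<xi> $ l) * Phi z0 Z (Some l) t \<xi>)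
  = cr (hk (Some 0) t \<xi>) * (\<Sum>l\<in>UNIV. cr (\<xi> $ l) * z0 (Some l) \<xi>)
   + (\<Sum>l\<in>UNIV. cr (\<xi> $ l) * (LINT \<tau>|lborel. ?f l \<tau>))"
  unfolding Phi_def distrib_left sum.distrib sum_distrib_left by (subst hkS) (simp only: mult.left_commute)
 also have "(\<Sum>l\<in>UNIV. cr (\<xi> $ l) * (LINT \<tau>|lborel. ?f l \<tau>)) = (LINT \<tau>|lborel. (\<Sum>l\<in>UNIV. cr (\<xi> $ l) * ?f l \<tau>))"
  by (subst Bochner_Integration.integral_sum) (simp_all only: integral_mult_right_zero integrable_mult_right[OF i])
 also have "... = (LINT \<tau>|(lborel :: real measure). 0)"
 proof (rule Bochner_Integration.integral_cong)
  fix \<tau>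
  have "(\<Sum>l\<in>UNIV. cr (\<xi> $ l) * (cr (hk (Some l) (t - \<tau>) \<xi>) * force (sl Z \<tau>) (Some l) \<xi>))
   = cr (hk (Some 0) (t - \<tau>) \<xi>) * (\<Sum>l\<in>UNIV. cr (\<xi> $ l) * force (sl Z \<tau>) (Some l) \<xi>)"
   unfolding sum_distrib_left by (subst hkS) (simp only: mult.left_commute)
  then have "(\<Sum>l\<in>UNIV. cr (\<xi> $ l) * (cr (hk (Some l) (t - \<tau>) \<xi>) * force (sl Z \<tau>) (Some l) \<xi>)) = 0"
   by (simp add: force_div)
  then show "(\<Sum>l\<in>UNIV. cr (\<xi> $ l) * ?f l \<tau>) = 0" by (cases "0 \<le> \<tau> \<and> \<tau> \<le> t") (simp_all only: simp_thms if_True if_False mult_zero_right sum.neutral_const)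
 qed simp
 finally show ?case using elim(1) by simp
qed

end

section \<open>Reflection symmetry\<close>

lemma lborel_uminus: "distr lborel borel uminus = (lborel :: (real^3) measure)"
 by (subst lborel_affine[of "-1" 0]) (auto simp: density_1)

lemma AE_uminus:
 assumes "AE \<xi> in lborel. P (\<xi> :: real^3)" shows "AE \<xi> in lborel. P (- \<xi>)"
 by (rule AE_distrD[of uminus lborel borel]) (simp, unfold lborel_uminus, rule assms)

lemma integral_cnj_eq:
 fixes f :: "'a => complex"
 shows "(LINT x|M. cnj (f x)) = cnj (LINT x|M. f x)"
 by (rule integral_bounded_linear'[OF bounded_linear_cnj bounded_linear_cnj]) simp

lemma nn_integral_uminus:
 fixes f :: "real^3 => ennreal"
 assumes "f \<in> borel_measurable borel"
 shows "(\<integral>\<^sup>+x. f (- x) \<partial>lborel) = (\<integral>\<^sup>+x. f x \<partial>lborel)"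
proof -
 have "(\<integral>\<^sup>+x. f x \<partial>distr lborel borel uminus) = (\<integral>\<^sup>+x. f (- x) \<partial>lborel)"
  by (rule nn_integral_distr) (use assms in auto)
 then show ?thesis by (simp only: lborel_uminus)
qed

lemma integral_uminus:
 fixes f :: "real^3 => complex"
 assumes "f \<in> borel_measurable borel"
 shows "(LINT x|lborel. f (- x)) = (LINT x|lborel. f x)"
 using integral_affine3[OF assms, of "-1" 0] by simp

text \<open>The transform of the complex conjugate fields.\<close>

definition star :: "state => state" where
 "star Z i t \<xi> = cnj (Z i t (- \<xi>))"

lemma jmeas_star: assumes "jmeas Z" shows "jmeas (star Z)"
proof -
 note [measurable (raw)] = jmeasD[OF assms]
 have "(\<lambda>p. cnj (Z i (fst p) (- snd p))) \<in> borel_measurable (borel \<Otimes>\<^sub>M borel)" for i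
  by (intro measurable_compose[OF _ borel_measurable_continuous_onI[of cnj]] continuous_intros) measurable
 then show ?thesis by (simp add: jmeas_def star_def)
qed

lemma conv_cnj:
 assumes [measurable]: "f \<in> borel_measurable borel" "g \<in> borel_measurable borel"
 shows "conv (\<lambda>\<eta>. cnj (f (- \<eta>))) (\<lambda>\<eta>. cnj (g (- \<eta>))) \<xi> = cnj (conv f g (- \<xi>))"
proof -
 have "conv (\<lambda>\<eta>. cnj (f (- \<eta>))) (\<lambda>\<eta>. cnj (g (- \<eta>))) \<xi> = (LINT \<eta>|lborel. cnj (f (- \<eta>) * g (- \<xi> - (- \<eta>))))"
  by (simp add: conv_def)
 also have "... = cnj (LINT \<eta>|lborel. f (- \<eta>) * g (- \<xi> - (- \<eta>)))" by (rule integral_cnj_eq)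
 also have "(LINT \<eta>|lborel. f (- \<eta>) * g (- \<xi> - (- \<eta>))) = conv f g (- \<xi>)"
  unfolding conv_def by (rule integral_uminus[of "\<lambda>\<eta>. f \<eta> * g (- \<xi> - \<eta>)"]) measurable
 finally show ?thesis .
qed

lemma flux_star:
 assumes Z: "jmeas Z" shows "flux (\<lambda>i. star Z i t) k \<xi> = cnj (flux (sl Z t) k (- \<xi>))"
proof -
 have m: "Z i t \<in> borel_measurable borel" for i using slice_measD[OF jmeas_slice[OF Z]] .
 show ?thesis unfolding flux_def star_def[abs_def] conv_cnj[OF m m] by (simp del: of_real_power of_real_mult)
qed

lemma force_star:
 assumes Z: "jmeas Z" shows "force (\<lambda>i. star Z i t) i \<xi> = cnj (force (sl Z t) i (- \<xi>))"
proof (cases i)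
 case (Some l)
 have p: "cnj (proj l k (- \<xi>)) = proj l k \<xi>" for k unfolding proj_def by (simp del: of_real_power of_real_mult of_real_divide)
 have "star Z None t \<xi> = cnj (Z None t (- \<xi>))" by (simp add: star_def)
 then show ?thesis unfolding Some force_def flux_star[OF Z] option.case cnj_sum complex_cnj_mult p
  by (intro sum.cong refl arg_cong2[where f = "(*)"]) simp
qed (simp add: force_def flux_star[OF Z])

context boussinesq begin

lemma Phi_star:
 assumes Z: "jmeas Z" and z0: "z0 i \<xi> = cnj (z0 i (- \<xi>))"
 shows "Phi z0 (star Z) i t \<xi> = cnj (Phi z0 Z i t (- \<xi>))"
proof -
 have h: "hk i r (- \<xi>) = hk i r \<xi>" for r by (simp add: hk_def)
 have "(LINT \<tau>|lborel. (if 0 \<le> \<tau> \<and> \<tau> \<le> t then cr (hk i (t - \<tau>) \<xi>) * force (\<lambda>k. star Z k \<tau>) i \<xi> else 0))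
  = (LINT \<tau>|lborel. cnj (if 0 \<le> \<tau> \<and> \<tau> \<le> t then cr (hk i (t - \<tau>) (- \<xi>)) * force (sl Z \<tau>) i (- \<xi>) else 0))"
  by (rule Bochner_Integration.integral_cong) (auto simp: force_star[OF Z] h)
 also have "... = cnj (LINT \<tau>|lborel. (if 0 \<le> \<tau> \<and> \<tau> \<le> t then cr (hk i (t - \<tau>) (- \<xi>)) * force (sl Z \<tau>) i (- \<xi>) else 0))"
  by (rule integral_cnj_eq)
 finally show ?thesis unfolding Phi_def using z0 by (simp add: h)
qed

lemma NM_star: assumes Z: "jmeas Z" shows "NM T (star Z) = NM T Z"
proof -
 have "wn q (\<lambda>i. star Z i t) = wn q (sl Z t)" for q t
 proof -
  note [measurable] = slice_measD[OF jmeas_slice[OF Z]]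
  have "wn q (\<lambda>i. star Z i t) = (\<integral>\<^sup>+\<xi>. (\<Sum>i\<in>UNIV. ennreal (w (q i) (- \<xi>) * norm (Z i t (- \<xi>)))) \<partial>lborel)"
   by (simp add: wn_def star_def X_weight_def)
  also have "... = wn q (sl Z t)"
   unfolding wn_def by (rule nn_integral_uminus[of "\<lambda>\<xi>. \<Sum>i\<in>UNIV. ennreal (w (q i) \<xi> * norm (Z i t \<xi>))"]) measurable
  finally show ?thesis .
 qed
 then show ?thesis by (simp add: NM_def EN_def HN_def)
qed

text \<open>For real data \<open>star\<close> maps fixed points to fixed points of the same norm, so
  uniqueness makes the solution real.\<close>

lemma fixed_point_real:
 assumes T: "T > 0" and z0: "slice_meas z0" and M: "M \<ge> 0" and small: "384 * Kw * lam T * M + 48 * T \<le> 1/2"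
  and A: "jmeas A" "NM T A \<le> ennreal M" "\<And>t. t \<in> {0..T} ==> AE \<xi> in lborel. \<forall>i. A i t \<xi> = Phi z0 A i t \<xi>"
  and r: "AE \<xi> in lborel. \<forall>i. z0 i \<xi> = cnj (z0 i (- \<xi>))"
  and t: "t \<in> {0..T}"
 shows "AE \<xi> in lborel. \<forall>i. A i t \<xi> = cnj (A i t (- \<xi>))"
proof -
 have "AE \<xi> in lborel. \<forall>i. A i t \<xi> = star A i t \<xi>"
 proof (rule fixed_point_unique[OF T z0 M small A jmeas_star[OF A(1)] _ _ t])
  show "NM T (star A) \<le> ennreal M" using A(2) by (simp only: NM_star[OF A(1)])
  fix t assume t: "t \<in> {0..T}"
  show "AE \<xi> in lborel. \<forall>i. star A i t \<xi> = Phi z0 (star A) i t \<xi>"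
   using AE_uminus[OF A(3)[OF t]] r
  proof eventually_elim
   case (elim \<xi>)
   then show ?case using Phi_star[OF A(1)] by (simp add: star_def)
  qed
 qed
 then show ?thesis by (simp add: star_def)
qed

end

section \<open>The operators of the equation on the Fourier side\<close>

text \<open>Fubini against \<open>inv_fourier_fun \<phi>\<close> turns the weak time integral of distributions
  into a pointwise one of densities.\<close>

lemma dist_integral_inv_fourier:
 fixes H :: "real => real^3 => complex"
 assumes m: "(\<lambda>p. H (fst p) (snd p)) \<in> borel_measurable (borel \<Otimes>\<^sub>M borel)"
  and fin: "(\<integral>\<^sup>+\<tau>. \<integral>\<^sup>+\<xi>. enorm (H \<tau> \<xi>) \<partial>lborel \<partial>lborel) < \<infinity>"
  and z: "\<And>\<tau> \<xi>. \<tau> \<notin> {0..t} ==> H \<tau> \<xi> = 0"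
  and F: "AE \<tau> in lborel. \<tau> \<in> {0..t} \<longrightarrow> F \<tau> = inv_fourier (H \<tau>)"
 shows "dist_integrable t F" and "dist_integral t F = inv_fourier (\<lambda>\<xi>. LINT \<tau>|lborel. H \<tau> \<xi>)"
  and "integrable lborel (\<lambda>\<xi>. LINT \<tau>|lborel. H \<tau> \<xi>)"
proof -
 have m': "(\<lambda>(\<tau>, \<xi>). H \<tau> \<xi>) \<in> borel_measurable (lborel \<Otimes>\<^sub>M lborel)" using m by (simp add: case_prod_unfold)
 note [measurable] = m'
 have i: "integrable (lborel \<Otimes>\<^sub>M lborel) (\<lambda>(\<tau>, \<xi>). H \<tau> \<xi>)"
 proof (rule integrableI_bounded)
  have "(\<integral>\<^sup>+p. enorm (case p of (\<tau>, \<xi>) => H \<tau> \<xi>) \<partial>(lborel \<Otimes>\<^sub>M lborel))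
   = (\<integral>\<^sup>+\<tau>. \<integral>\<^sup>+\<xi>. enorm (H \<tau> \<xi>) \<partial>lborel \<partial>lborel)"
   by (subst lborel.nn_integral_fst[symmetric]) auto
  then show "(\<integral>\<^sup>+p. enorm (case p of (\<tau>, \<xi>) => H \<tau> \<xi>) \<partial>(lborel \<Otimes>\<^sub>M lborel)) < \<infinity>" using fin by simp
 qed (rule m')
 show I: "integrable lborel (\<lambda>\<xi>. LINT \<tau>|lborel. H \<tau> \<xi>)"
  using lborel_pair.integrable_snd[OF i] by simp
 have key: "set_integrable lebesgue {0..t} (\<lambda>\<tau>. F \<tau> \<phi>)
   \<and> (LINT \<tau>:{0..t}|lebesgue. F \<tau> \<phi>) = inv_fourier (\<lambda>\<xi>. LINT \<tau>|lborel. H \<tau> \<xi>) \<phi>" if s: "schwartz \<phi>" for \<phi>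
 proof -
  let ?\<psi> = "inv_fourier_fun \<phi>"
  have [measurable]: "?\<psi> \<in> borel_measurable borel" by (rule inv_fourier_fun_measurable[OF schwartz_measurable[OF s]])
  let ?C = "LINT x|lborel. norm (\<phi> x)"
  have ij: "integrable (lborel \<Otimes>\<^sub>M lborel) (\<lambda>(\<tau>, \<xi>). H \<tau> \<xi> * ?\<psi> \<xi>)"
  proof (rule Bochner_Integration.integrable_bound[OF integrable_mult_left[OF integrable_norm[OF i], of ?C]])
   show "AE p in lborel \<Otimes>\<^sub>M lborel. norm (case p of (\<tau>, \<xi>) => H \<tau> \<xi> * ?\<psi> \<xi>) \<le> norm (norm (case p of (\<tau>, \<xi>) => H \<tau> \<xi>) * ?C)"
   proof (rule AE_I2, goal_cases)
    case (1 p)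
    have "norm (H (fst p) (snd p)) * norm (?\<psi> (snd p)) \<le> norm (H (fst p) (snd p)) * ?C"
     by (intro mult_left_mono inv_fourier_fun_bound schwartz_integrable s) auto
    also have "... \<le> norm (norm (H (fst p) (snd p)) * ?C)" unfolding real_norm_def by (rule abs_ge_self)
    finally show ?case
     by (simp only: case_prod_unfold norm_mult)
   qed
  qed measurable
  define g where "g \<tau> = (LINT \<xi>|lborel. H \<tau> \<xi> * ?\<psi> \<xi>)" for \<tau>
  have gi: "integrable lborel g" unfolding g_def using lborel_pair.integrable_fst[OF ij] by simp
  have ae: "AE \<tau> in lebesgue. g \<tau> = indicator {0..t} \<tau> *\<^sub>R F \<tau> \<phi>"
  proof (rule AE_completion)
   show "AE \<tau> in lborel. g \<tau> = indicator {0..t} \<tau> *\<^sub>R F \<tau> \<phi>"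
    using F
   proof eventually_elim
    case (elim \<tau>)
    show ?case
    proof (cases "\<tau> \<in> {0..t}")
     case True
     then show ?thesis using elim s by (simp add: g_def inv_fourier_def)
    next
     case False
     then show ?thesis using z[OF False] by (simp add: g_def)
    qed
   qed
  qed
  have gl: "integrable lebesgue g" using gi by (subst integrable_completion) auto
  have Fm: "(\<lambda>\<tau>. indicator {0..t} \<tau> *\<^sub>R F \<tau> \<phi>) \<in> borel_measurable lebesgue"
   by (rule borel_measurable_AE[OF borel_measurable_integrable[OF gl] ae])
  have 1: "integrable lebesgue (\<lambda>\<tau>. indicator {0..t} \<tau> *\<^sub>R F \<tau> \<phi>)"
   using integrable_cong_AE[OF borel_measurable_integrable[OF gl] Fm ae] gl by simp
  have "(LINT \<tau>|lebesgue. indicator {0..t} \<tau> *\<^sub>R F \<tau> \<phi>) = (LINT \<tau>|lebesgue. g \<tau>)"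
   by (rule integral_cong_AE[symmetric, OF borel_measurable_integrable[OF gl] Fm ae])
  also have "... = (LINT \<tau>|lborel. g \<tau>)" by (rule integral_completion) (use gi in auto)
  also have "... = (LINT \<xi>|lborel. LINT \<tau>|lborel. H \<tau> \<xi> * ?\<psi> \<xi>)"
   unfolding g_def using lborel_pair.Fubini_integral[OF ij] by simp
  also have "... = inv_fourier (\<lambda>\<xi>. LINT \<tau>|lborel. H \<tau> \<xi>) \<phi>" using s by (simp add: inv_fourier_def)
  finally show ?thesis using 1 by (simp add: set_integrable_def set_lebesgue_integral_def)
 qed
 then show "dist_integrable t F" by (simp add: dist_integrable_def)
 show "dist_integral t F = inv_fourier (\<lambda>\<xi>. LINT \<tau>|lborel. H \<tau> \<xi>)"
 proof
  fix \<phi>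
  show "dist_integral t F \<phi> = inv_fourier (\<lambda>\<xi>. LINT \<tau>|lborel. H \<tau> \<xi>) \<phi>"
   using key[of \<phi>] by (cases "schwartz \<phi>") (simp_all add: dist_integral_def)
 qed
qed

lemma heat_inv_fourier:
 assumes g: "integrable lborel g"
 shows "heat \<gamma> t (inv_fourier g) = inv_fourier (\<lambda>\<xi>. cr (exp (- t * norm \<xi> powr (2 * \<gamma>))) * g \<xi>)"
proof -
 note l = integrable_imp_locally_integrable[OF g]
 have [measurable]: "g \<in> borel_measurable borel" "fhat (inv_fourier g) \<in> borel_measurable borel"
  using g fhat_measurable[OF fourier_locally_integrable_inv_fourier[OF l]] by auto
 show ?thesis unfolding heat_def
  by (rule inv_fourier_cong) (use fhat_inv_fourier[OF l] in \<open>auto elim!: eventually_mono\<close>)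
qed

lemma leray_inv_fourier:
 assumes g: "\<And>k. integrable lborel (g k)" and F: "\<And>k. F $ k = inv_fourier (g k)"
 shows "leray F $ l = inv_fourier (\<lambda>\<xi>. \<Sum>k\<in>UNIV. proj l k \<xi> * g k \<xi>)"
  and "integrable lborel (\<lambda>\<xi>. \<Sum>k\<in>UNIV. proj l k \<xi> * g k \<xi>)"
proof -
 note lo = integrable_imp_locally_integrable[OF g]
 have m[measurable]: "g k \<in> borel_measurable borel" "fhat (F $ k) \<in> borel_measurable borel" for k
  using g[of k] fhat_measurable[OF fourier_locally_integrable_inv_fourier[OF lo[of k]]] unfolding F by auto
 have ae: "AE \<xi> in lborel. \<forall>k. fhat (F $ k) \<xi> = g k \<xi>"
 proof -
  have "AE \<xi> in lborel. \<forall>k\<in>UNIV. fhat (F $ k) \<xi> = g k \<xi>"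
   by (rule AE_finite_allI) (auto simp: F intro: fhat_inv_fourier[OF lo])
  then show ?thesis by simp
 qed
 have "leray F $ l = inv_fourier (\<lambda>\<xi>. fhat (F $ l) \<xi> - (\<Sum>k\<in>UNIV. cr (\<xi> $ l * \<xi> $ k / (norm \<xi>)\<^sup>2) * fhat (F $ k) \<xi>))"
  by (simp add: leray_def)
 also have "... = inv_fourier (\<lambda>\<xi>. \<Sum>k\<in>UNIV. proj l k \<xi> * g k \<xi>)"
 proof (rule inv_fourier_cong)
  show "AE \<xi> in lborel. fhat (F $ l) \<xi> - (\<Sum>k\<in>UNIV. cr (\<xi> $ l * \<xi> $ k / (norm \<xi>)\<^sup>2) * fhat (F $ k) \<xi>)
    = (\<Sum>k\<in>UNIV. proj l k \<xi> * g k \<xi>)"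
   using ae
  proof eventually_elim
   case (elim \<xi>)
   have "g l \<xi> = (\<Sum>k\<in>UNIV. (if k = l then 1 else 0) * g k \<xi>)"
    by (simp add: if_distrib[of "\<lambda>a. a * _"] cong: if_cong)
   then show ?case using elim unfolding proj_def left_diff_distrib sum_subtractf by simp
  qed
 qed measurable
 finally show "leray F $ l = inv_fourier (\<lambda>\<xi>. \<Sum>k\<in>UNIV. proj l k \<xi> * g k \<xi>)" .
 have "integrable lborel (\<lambda>\<xi>. g k \<xi> * proj l k \<xi>)" for k
  by (rule integrable_mult_bounded[OF g proj_measurable norm_proj])
 then show "integrable lborel (\<lambda>\<xi>. \<Sum>k\<in>UNIV. proj l k \<xi> * g k \<xi>)"
  by (intro Bochner_Integration.integrable_sum) (simp only: mult.commute)
qed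

text \<open>For a divergence free field the advection term is in divergence form, which is the form in
  which the fixed point equation was stated.\<close>

lemma advect_inv_fourier:
 assumes i0: "\<And>i. integrable lborel (z i)" and i1: "\<And>i j. integrable lborel (\<lambda>\<xi>. cr (\<xi> $ j) * z i \<xi>)"
  and div: "AE \<xi> in lborel. (\<Sum>j\<in>UNIV. cr (\<xi> $ j) * z (Some j) \<xi>) = 0"
  and u: "\<And>j. u $ j = inv_fourier (z (Some j))"
 shows "advect u (inv_fourier (z k)) = inv_fourier (flux z k)" and "integrable lborel (flux z k)"
proof -
 let ?p = "cr ((2 * pi) ^ 3)"
 let ?f = "\<lambda>j \<xi>. \<i> * cr (\<xi> $ j) * z k \<xi>"
 have f: "integrable lborel (?f j)" for j
  using integrable_mult_right[OF i1[of j k], of \<i>] by (simp add: mult.assoc)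
 have C: "integrable lborel (\<lambda>\<xi>. conv (z (Some j)) (?f j) \<xi> / ?p)" for j
  by (intro integrable_divide_zero conv_integrable i0 f)
 show fl: "integrable lborel (flux z k)"
  unfolding flux_def[abs_def]
 proof (intro integrable_divide_zero Bochner_Integration.integrable_sum)
  fix j :: 3
  have "integrable lborel (\<lambda>\<xi>. \<i> * (conv (\<lambda>\<xi>. cr (\<xi> $ j) * z (Some j) \<xi>) (z k) \<xi>) + conv (z (Some j)) (?f j) \<xi>)"
   by (intro Bochner_Integration.integrable_add integrable_mult_right conv_integrable i0 i1 f)
  moreover have "AE \<xi> in lborel. \<i> * (conv (\<lambda>\<xi>. cr (\<xi> $ j) * z (Some j) \<xi>) (z k) \<xi>) + conv (z (Some j)) (?f j) \<xi>
    = \<i> * cr (\<xi> $ j) * conv (z (Some j)) (z k) \<xi>"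
   using lborel_pair.AE_integrable_snd[OF integrable_conv_pair[OF i1[of j "Some j"] i0[of k]]]
    lborel_pair.AE_integrable_snd[OF integrable_conv_pair[OF i0[of "Some j"] f[of j]]]
  proof eventually_elim
   case (elim \<xi>)
   have "\<i> * (conv (\<lambda>\<xi>. cr (\<xi> $ j) * z (Some j) \<xi>) (z k) \<xi>) + conv (z (Some j)) (?f j) \<xi>
    = (LINT \<eta>|lborel. \<i> * (cr (\<eta> $ j) * z (Some j) \<eta> * z k (\<xi> - \<eta>)) + z (Some j) \<eta> * ?f j (\<xi> - \<eta>))"
    unfolding conv_def integral_mult_right_zero[symmetric]
    by (rule Bochner_Integration.integral_add[symmetric]) (use elim in \<open>auto intro!: integrable_mult_right\<close>)
   also have "... = (LINT \<eta>|lborel. \<i> * cr (\<xi> $ j) * (z (Some j) \<eta> * z k (\<xi> - \<eta>)))"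
    by (rule Bochner_Integration.integral_cong) (auto simp: algebra_simps)
   finally show ?case unfolding conv_def integral_mult_right_zero .
  qed
  moreover have "conv (z (Some j)) (z k) \<in> borel_measurable lborel"
   using conv_integrable[OF i0[of "Some j"] i0[of k]] by auto
  ultimately show "integrable lborel (\<lambda>\<xi>. \<i> * cr (\<xi> $ j) * conv (z (Some j)) (z k) \<xi>)"
   by (subst integrable_cong_AE[symmetric]) auto
 qed
 have "advect u (inv_fourier (z k)) = (\<Sum>j\<in>UNIV. inv_fourier (\<lambda>\<xi>. conv (z (Some j)) (?f j) \<xi> / ?p))"
  unfolding advect_def u dist_deriv_inv_fourier by (intro sum.cong refl dist_prod_inv_fourier i0 f)
 also have "... = inv_fourier (\<lambda>\<xi>. \<Sum>j\<in>UNIV. conv (z (Some j)) (?f j) \<xi> / ?p)"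
  by (rule inv_fourier_sum[symmetric, OF finite C])
 also have "... = inv_fourier (flux z k)"
 proof (rule inv_fourier_cong)
  have A1: "AE \<xi> in lborel. \<forall>j. integrable lborel (\<lambda>\<eta>. cr (\<eta> $ j) * z (Some j) \<eta> * z k (\<xi> - \<eta>))"
  proof -
   have "AE \<xi> in lborel. \<forall>j\<in>UNIV. integrable lborel (\<lambda>\<eta>. cr (\<eta> $ j) * z (Some j) \<eta> * z k (\<xi> - \<eta>))"
    by (rule AE_finite_allI[OF finite]) (rule lborel_pair.AE_integrable_snd[OF integrable_conv_pair[OF i1 i0]])
   then show ?thesis by simp
  qed
  have A2: "AE \<xi> in lborel. \<forall>j. integrable lborel (\<lambda>\<eta>. z (Some j) \<eta> * z k (\<xi> - \<eta>))"
  proof -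
   have "AE \<xi> in lborel. \<forall>j\<in>UNIV. integrable lborel (\<lambda>\<eta>. z (Some j) \<eta> * z k (\<xi> - \<eta>))"
    by (rule AE_finite_allI[OF finite]) (rule lborel_pair.AE_integrable_snd[OF integrable_conv_pair[OF i0 i0]])
   then show ?thesis by simp
  qed
  show "AE \<xi> in lborel. (\<Sum>j\<in>UNIV. conv (z (Some j)) (?f j) \<xi> / ?p) = flux z k \<xi>"
   using A1 A2
  proof eventually_elim
   case (elim \<xi>)
   let ?a = "\<lambda>j \<eta>. z (Some j) \<eta> * z k (\<xi> - \<eta>)" and ?b = "\<lambda>j \<eta>. cr (\<eta> $ j) * z (Some j) \<eta> * z k (\<xi> - \<eta>)"
   have c: "conv (z (Some j)) (?f j) \<xi> = \<i> * cr (\<xi> $ j) * (LINT \<eta>|lborel. ?a j \<eta>) - \<i> * (LINT \<eta>|lborel. ?b j \<eta>)" for j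
   proof -
    have "conv (z (Some j)) (?f j) \<xi> = (LINT \<eta>|lborel. \<i> * cr (\<xi> $ j) * ?a j \<eta> - \<i> * ?b j \<eta>)"
     unfolding conv_def by (rule Bochner_Integration.integral_cong) (auto simp: algebra_simps)
    also have "... = (LINT \<eta>|lborel. \<i> * cr (\<xi> $ j) * ?a j \<eta>) - (LINT \<eta>|lborel. \<i> * ?b j \<eta>)"
     using elim by (intro Bochner_Integration.integral_diff integrable_mult_right) auto
    finally show ?thesis by (simp only: integral_mult_right_zero)
   qed
   have "(\<Sum>j\<in>UNIV. LINT \<eta>|lborel. ?b j \<eta>) = (LINT \<eta>|lborel. (\<Sum>j\<in>UNIV. ?b j \<eta>))"
    by (rule Bochner_Integration.integral_sum[symmetric]) (use elim in auto)
   also have "... = 0"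
   proof (rule integral_eq_zero_AE)
    show "AE \<eta> in lborel. (\<Sum>j\<in>UNIV. ?b j \<eta>) = 0"
     using div by eventually_elim (simp add: sum_distrib_right[symmetric])
   qed
   finally have "(\<Sum>j\<in>UNIV. \<i> * (LINT \<eta>|lborel. ?b j \<eta>)) = 0" by (simp add: sum_distrib_left[symmetric])
   then have "(\<Sum>j\<in>UNIV. conv (z (Some j)) (?f j) \<xi>) = (\<Sum>j\<in>UNIV. \<i> * cr (\<xi> $ j) * (LINT \<eta>|lborel. ?a j \<eta>))"
    unfolding c sum_subtractf by simp
   then show ?case unfolding flux_def sum_divide_distrib[symmetric] by (simp only: conv_def)
  qed
  show "(\<lambda>\<xi>. \<Sum>j\<in>UNIV. conv (z (Some j)) (?f j) \<xi> / ?p) \<in> borel_measurable borel"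
   using C by (intro borel_measurable_sum) (auto dest: borel_measurable_integrable)
  show "flux z k \<in> borel_measurable borel" using fl by auto
 qed
 finally show "advect u (inv_fourier (z k)) = inv_fourier (flux z k)" .
qed

section \<open>Real distributions and divergence free fields on the Fourier side\<close>

lemma sum_fun_apply: "(\<Sum>i\<in>I. f i) x = (\<Sum>i\<in>I. f i x)" for f :: "_ => 'a => 'b::comm_monoid_add"
 by (induct I rule: infinite_finite_induct) auto

lemma test_fun_iff: "test_fun \<phi> \<longleftrightarrow> smooth_fun \<phi> \<and> bounded {x. \<phi> x \<noteq> 0}"
proof -
 have "bounded (closure {x. \<phi> x \<noteq> 0}) \<longleftrightarrow> bounded {x. \<phi> x \<noteq> 0}"
  by (rule iffI, erule bounded_subset[OF _ closure_subset], erule bounded_closure)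
 then show ?thesis by (simp add: test_fun_def compact_eq_bounded_closed)
qed

lemma test_fun_add: "test_fun \<phi> ==> test_fun \<psi> ==> test_fun (\<lambda>x. \<phi> x + \<psi> x)"
 unfolding test_fun_iff
proof -
 assume a: "smooth_fun \<phi> \<and> bounded {x. \<phi> x \<noteq> 0}" "smooth_fun \<psi> \<and> bounded {x. \<psi> x \<noteq> 0}"
 have "bounded ({x. \<phi> x \<noteq> 0} \<union> {x. \<psi> x \<noteq> 0})" using a by (simp only: bounded_Un)
 then have "bounded {x. \<phi> x + \<psi> x \<noteq> 0}" by (rule bounded_subset) auto
 with a show "smooth_fun (\<lambda>x. \<phi> x + \<psi> x) \<and> bounded {x. \<phi> x + \<psi> x \<noteq> 0}" by (simp add: smooth_fun_add)
qed

lemma test_fun_cmult: "test_fun \<phi> ==> test_fun (\<lambda>x. c * \<phi> x)"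
 by (rule test_fun_mult[OF smooth_fun_const])

lemma test_fun_reflect: assumes "test_fun \<phi>" shows "test_fun (\<lambda>x. cnj (\<phi> (- x)))"
 unfolding test_fun_iff
proof
 have D: "((\<lambda>x. cnj (f (- x))) has_derivative (\<lambda>h. cnj (frechet_derivative f (at (- x)) (- h)))) (at x)" if "smooth_fun f" for f x
  by (rule bounded_linear.has_derivative[OF bounded_linear_cnj], rule has_derivative_compose[of uminus uminus])
    (auto intro!: derivative_eq_intros has_derivative_frechet smooth_fun_differentiable that)
 have "smooth_fun \<phi>" using assms by (simp add: test_fun_def)
 then show "smooth_fun (\<lambda>x. cnj (\<phi> (- x)))"
 proof (intro smooth_fun_coinduct[of _ "{\<lambda>x. cnj (f (- x)) |f. smooth_fun f}"])
  fix h assume "h \<in> {\<lambda>x. cnj (f (- x)) |f. smooth_fun f}"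
  then obtain f where h: "h = (\<lambda>x. cnj (f (- x)))" and f: "smooth_fun f" by auto
  show "h differentiable (at x)" for x unfolding h using D[OF f] by (auto simp: differentiable_def)
  show "partial_deriv j h \<in> {\<lambda>x. cnj (f (- x)) |f. smooth_fun f}" for j
  proof -
   have "partial_deriv j h = (\<lambda>x. cnj (- 1 * partial_deriv j f (- x)))"
    unfolding h
    by (rule ext, subst partial_deriv_eqI[OF D[OF f]])
      (simp add: partial_deriv_def linear_neg[OF linear_frechet_derivative[OF smooth_fun_differentiable[OF f]]])
   moreover have "smooth_fun (\<lambda>x. - 1 * partial_deriv j f x)" by (intro smooth_fun_cmult smooth_fun_partial_deriv f)
   ultimately show ?thesis by (intro CollectI exI[of _ "\<lambda>x. - 1 * partial_deriv j f x"]) simp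
  qed
 qed auto
 have "bounded (uminus ` {x. \<phi> x \<noteq> 0})" using assms by (intro bounded_linear_image) (auto simp: test_fun_iff intro: bounded_linear_minus bounded_linear_ident)
 moreover have "{x. cnj (\<phi> (- x)) \<noteq> 0} \<subseteq> uminus ` {x. \<phi> x \<noteq> 0}"
 proof
  fix x assume "x \<in> {x. cnj (\<phi> (- x)) \<noteq> 0}"
  then have "- x \<in> {x. \<phi> x \<noteq> 0}" by simp
  then have "- (- x) \<in> uminus ` {x. \<phi> x \<noteq> 0}" by (rule imageI)
  then show "x \<in> uminus ` {x. \<phi> x \<noteq> 0}" by simp
 qed
 ultimately show "bounded {x. cnj (\<phi> (- x)) \<noteq> 0}" by (rule bounded_subset)
qed

lemma cnj_Fexp: "cnj (Fexp \<xi> x) = Fexp (- \<xi>) x" "Fexp \<xi> (- x) = Fexp (- \<xi>) x"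
 by (simp_all add: exp_cnj)

lemma fourier_fun_cnj:
 "cnj (fourier_fun \<phi> \<xi>) = fourier_fun (\<lambda>x. cnj (\<phi> x)) (- \<xi>)"
 unfolding fourier_fun_def integral_cnj_eq[symmetric] complex_cnj_mult cnj_Fexp ..

lemma fourier_fun_reflect:
 assumes [measurable]: "\<phi> \<in> borel_measurable borel"
 shows "fourier_fun (\<lambda>x. \<phi> (- x)) \<xi> = fourier_fun \<phi> (- \<xi>)"
proof -
 have "fourier_fun (\<lambda>x. \<phi> (- x)) \<xi> = (LINT x|lborel. Fexp (- \<xi>) (- x) * \<phi> (- x))"
  unfolding fourier_fun_def by (simp only: cnj_Fexp(2) minus_minus)
 also have "... = fourier_fun \<phi> (- \<xi>)"
  unfolding fourier_fun_def by (rule integral_uminus) measurable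
 finally show ?thesis .
qed

text \<open>A distribution is real if it is real on real functions; test functions with \<open>\<phi>(x) = cnj
  (\<phi>(-x))\<close> have real transforms, and every test function is a combination of two such
  functions.\<close>

lemma real_dist_fhat:
 assumes r: "real_dist f" and l: "fourier_locally_integrable f"
 shows "AE \<xi> in lborel. fhat f \<xi> = cnj (fhat f (- \<xi>))"
proof -
 let ?g = "fhat f"
 have R: "represents ?g (fourier_dist f)" by (rule represents_fhat[OF l])
 have li: "locally_integrable ?g" using R by (simp add: represents_def)
 note [measurable] = locally_integrable_measurable[OF li]
 have li': "locally_integrable (\<lambda>\<xi>. cnj (?g (- \<xi>)))"
  unfolding locally_integrable_def set_integrable_def
 proof (intro allI impI)
  fix K :: "(real^3) set" assume K: "compact K"
  have "compact (uminus ` K)" using K by (intro compact_continuous_image continuous_intros)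
  then have "integrable lborel (\<lambda>x. indicator (uminus ` K) x *\<^sub>R ?g x)"
   using li by (simp add: locally_integrable_def set_integrable_def)
  from integrable_affine3[OF this, of "-1" 0]
  have "integrable lborel (\<lambda>x. indicator (uminus ` K) (- x) *\<^sub>R ?g (- x))" by simp
  then have "integrable lborel (\<lambda>x. cnj (indicator (uminus ` K) (- x) *\<^sub>R ?g (- x)))"
   by (rule integrable_bounded_linear[OF bounded_linear_cnj])
  moreover have "cnj (indicator (uminus ` K) (- x) *\<^sub>R ?g (- x)) = indicator K x *\<^sub>R cnj (?g (- x))" for x
  proof -
   have "- x \<in> uminus ` K \<longleftrightarrow> x \<in> K" by (auto simp: image_iff)
   then show ?thesis by (simp add: indicator_def)
  qed
  ultimately show "integrable lborel (\<lambda>x. indicator K x *\<^sub>R cnj (?g (- x)))" by (simp only:)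
 qed
 have key: "(LINT \<xi>|lborel. ?g \<xi> * \<phi> \<xi>) = (LINT \<xi>|lborel. cnj (?g (- \<xi>)) * \<phi> \<xi>)"
  if t: "test_fun \<phi>" and h: "\<And>x. cnj (\<phi> (- x)) = \<phi> x" for \<phi>
 proof -
  have s: "schwartz \<phi>" by (rule test_fun_schwartz[OF t])
  note [measurable] = schwartz_measurable[OF s]
  have "fourier_fun \<phi> x \<in> \<real>" for x
  proof -
   have "cnj (fourier_fun \<phi> x) = fourier_fun (\<lambda>x. cnj (\<phi> (- (- x)))) (- x)" by (simp add: fourier_fun_cnj)
   also have "... = fourier_fun (\<lambda>x. \<phi> (- x)) (- x)" by (simp only: h)
   also have "... = fourier_fun \<phi> x" by (subst fourier_fun_reflect) simp_all
   finally show ?thesis by (simp add: Reals_cnj_iff)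
  qed
  then have "f (fourier_fun \<phi>) \<in> \<real>" using r schwartz_fourier_fun[OF s] unfolding real_dist_def by blast
  moreover have "f (fourier_fun \<phi>) = (LINT \<xi>|lborel. ?g \<xi> * \<phi> \<xi>)"
   using R t s unfolding represents_def fourier_dist_def by auto
  ultimately have "(LINT \<xi>|lborel. ?g \<xi> * \<phi> \<xi>) = cnj (LINT \<xi>|lborel. ?g \<xi> * \<phi> \<xi>)" by (simp add: Reals_cnj_iff)
  also have "... = (LINT \<xi>|lborel. cnj (?g (- (- \<xi>))) * \<phi> (- \<xi>))"
   unfolding integral_cnj_eq[symmetric] complex_cnj_mult using h[of "- _"] by simp
  also have "... = (LINT \<xi>|lborel. cnj (?g (- \<xi>)) * \<phi> \<xi>)"
  proof (rule integral_uminus[of "\<lambda>\<xi>. cnj (?g (- \<xi>)) * \<phi> \<xi>"])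
   have [measurable]: "cnj \<in> borel_measurable borel" by (intro borel_measurable_continuous_onI continuous_intros)
   show "(\<lambda>\<xi>. cnj (?g (- \<xi>)) * \<phi> \<xi>) \<in> borel_measurable borel" by measurable
  qed
  finally show ?thesis .
 qed
 have "AE \<xi> in lborel. ?g \<xi> - cnj (?g (- \<xi>)) = 0"
 proof (rule fundamental_lemma[OF locally_integrable_diff[OF li li']])
  fix \<phi> assume t: "test_fun \<phi>"
  let ?p = "\<lambda>x. (1/2) * (\<phi> x + cnj (\<phi> (- x)))" and ?q = "\<lambda>x. (\<i>/2) * (cnj (\<phi> (- x)) + (-1) * \<phi> x)"
  have tp: "test_fun ?p" "test_fun ?q" by (intro test_fun_cmult test_fun_add t test_fun_reflect)+
  have split: "\<phi> x = ?p x + \<i> * ?q x" for x by (simp add: field_simps)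
  have I: "(LINT \<xi>|lborel. k \<xi> * \<phi> \<xi>) = (LINT \<xi>|lborel. k \<xi> * ?p \<xi>) + \<i> * (LINT \<xi>|lborel. k \<xi> * ?q \<xi>)" if k: "locally_integrable k" for k
  proof -
   have "(LINT \<xi>|lborel. k \<xi> * \<phi> \<xi>) = (LINT \<xi>|lborel. k \<xi> * ?p \<xi> + \<i> * (k \<xi> * ?q \<xi>))"
    by (rule Bochner_Integration.integral_cong) (simp, subst split, simp only: distrib_left mult.left_commute)
   also have "... = (LINT \<xi>|lborel. k \<xi> * ?p \<xi>) + (LINT \<xi>|lborel. \<i> * (k \<xi> * ?q \<xi>))"
    by (intro Bochner_Integration.integral_add integrable_mult_right integrable_times_test k tp)
   finally show ?thesis by (simp only: integral_mult_right_zero)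
  qed
  have kp: "(LINT \<xi>|lborel. ?g \<xi> * ?p \<xi>) = (LINT \<xi>|lborel. cnj (?g (- \<xi>)) * ?p \<xi>)"
   by (rule key[OF tp(1)]) (simp add: add.commute)
  have kq: "(LINT \<xi>|lborel. ?g \<xi> * ?q \<xi>) = (LINT \<xi>|lborel. cnj (?g (- \<xi>)) * ?q \<xi>)"
   by (rule key[OF tp(2)]) (simp add: algebra_simps)
  have "(LINT \<xi>|lborel. ?g \<xi> * \<phi> \<xi>) = (LINT \<xi>|lborel. cnj (?g (- \<xi>)) * \<phi> \<xi>)"
   unfolding I[OF li] I[OF li'] kp kq ..
  then show "(LINT \<xi>|lborel. (?g \<xi> - cnj (?g (- \<xi>))) * \<phi> \<xi>) = 0"
   unfolding left_diff_distrib
   by (subst Bochner_Integration.integral_diff[OF integrable_times_test[OF li t] integrable_times_test[OF li' t]]) simp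
 qed
 then show ?thesis by simp
qed

lemma real_dist_inv_fourier:
 assumes g: "integrable lborel g" and h: "AE \<xi> in lborel. g \<xi> = cnj (g (- \<xi>))"
 shows "real_dist (inv_fourier g)"
 unfolding real_dist_def
proof (intro allI impI)
 fix \<phi> assume s: "schwartz \<phi>" and r: "\<forall>x. \<phi> x \<in> \<real>"
 let ?\<psi> = "inv_fourier_fun \<phi>"
 have [measurable]: "g \<in> borel_measurable borel" "?\<psi> \<in> borel_measurable borel" "cnj \<in> borel_measurable borel"
  using g inv_fourier_fun_measurable[OF schwartz_measurable[OF s]] by (auto intro!: borel_measurable_continuous_onI continuous_intros)
 have c: "(\<lambda>x. cnj (\<phi> x)) = \<phi>" using r by (auto simp: Reals_cnj_iff)
 have psi: "cnj (?\<psi> \<xi>) = ?\<psi> (- \<xi>)" for \<xi>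
  unfolding inv_fourier_fun_eq complex_cnj_divide fourier_fun_cnj c by (simp del: of_real_power of_real_mult)
 have "cnj (LINT \<xi>|lborel. g \<xi> * ?\<psi> \<xi>) = (LINT \<xi>|lborel. cnj (g (- (- \<xi>))) * ?\<psi> (- \<xi>))"
  unfolding integral_cnj_eq[symmetric] complex_cnj_mult psi by simp
 also have "... = (LINT \<xi>|lborel. cnj (g (- \<xi>)) * ?\<psi> \<xi>)"
  by (rule integral_uminus[of "\<lambda>\<xi>. cnj (g (- \<xi>)) * ?\<psi> \<xi>"]) measurable
 also have "... = (LINT \<xi>|lborel. g \<xi> * ?\<psi> \<xi>)"
  by (rule integral_cong_AE) (measurable, use h in \<open>auto elim!: eventually_mono\<close>)
 finally show "inv_fourier g \<phi> \<in> \<real>" using s by (simp add: inv_fourier_def Reals_cnj_iff)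
qed

lemma div_free_inv_fourier:
 assumes g: "\<And>j. integrable lborel (g j)" and u: "\<And>j. u $ j = inv_fourier (g j)"
  and d: "AE \<xi> in lborel. (\<Sum>j\<in>UNIV. cr (\<xi> $ j) * g j \<xi>) = 0"
 shows "div_free u"
 unfolding div_free_def
proof
 fix \<phi>
 show "(\<Sum>j\<in>UNIV. dist_deriv j (u $ j)) \<phi> = 0 \<phi>"
 proof (cases "schwartz \<phi>")
  case True
  let ?\<psi> = "inv_fourier_fun \<phi>"
  have i: "integrable lborel (\<lambda>\<xi>. \<i> * cr (\<xi> $ j) * g j \<xi> * ?\<psi> \<xi>)" for j
  proof -
   have "integrable lborel (\<lambda>\<xi>. - (g j \<xi> * inv_fourier_fun (partial_deriv j \<phi>) \<xi>))"
    by (intro Bochner_Integration.integrable_minus integrable_mult_inv_fourier g schwartz_partial_deriv True)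
   then show ?thesis by (simp add: inv_fourier_fun_partial_deriv[OF True] mult_ac)
  qed
  have "(\<Sum>j\<in>UNIV. dist_deriv j (u $ j)) \<phi> = (\<Sum>j\<in>UNIV. LINT \<xi>|lborel. \<i> * cr (\<xi> $ j) * g j \<xi> * ?\<psi> \<xi>)"
   unfolding sum_fun_apply u dist_deriv_inv_fourier using True by (simp add: inv_fourier_def)
  also have "... = (LINT \<xi>|lborel. (\<Sum>j\<in>UNIV. \<i> * cr (\<xi> $ j) * g j \<xi> * ?\<psi> \<xi>))"
   by (rule Bochner_Integration.integral_sum[symmetric]) (rule i)
  also have "... = 0"
  proof (rule integral_eq_zero_AE)
   show "AE \<xi> in lborel. (\<Sum>j\<in>UNIV. \<i> * cr (\<xi> $ j) * g j \<xi> * ?\<psi> \<xi>) = 0"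
    using d
   proof eventually_elim
    case (elim \<xi>)
    have "(\<Sum>j\<in>UNIV. \<i> * cr (\<xi> $ j) * g j \<xi> * ?\<psi> \<xi>) = \<i> * ?\<psi> \<xi> * (\<Sum>j\<in>UNIV. cr (\<xi> $ j) * g j \<xi>)"
     unfolding sum_distrib_left by (simp only: mult_ac)
    then show ?case using elim by simp
   qed
  qed
  finally show ?thesis by simp
 next
  case False
  then show ?thesis by (simp add: sum_fun_apply dist_deriv_def)
 qed
qed

text \<open>Testing the divergence with transforms of test functions gives the fundamental lemma for
  \<open>\<Sum> \<xi>\<^sub>j u\<^sub>j\<close>.\<close>

lemma div_free_fhat:
 assumes d: "div_free u" and l: "\<And>k. fourier_locally_integrable (u $ k)"
 shows "AE \<xi> in lborel. (\<Sum>j\<in>UNIV. cr (\<xi> $ j) * fhat (u $ j) \<xi>) = 0"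
proof -
 let ?g = "\<lambda>j. fhat (u $ j)"
 have R: "represents (?g j) (fourier_dist (u $ j))" for j by (rule represents_fhat[OF l])
 have li: "locally_integrable (?g j)" for j using R by (simp add: represents_def)
 note [measurable] = locally_integrable_measurable[OF li]
 have lj: "locally_integrable (\<lambda>\<xi>. cr (\<xi> $ j) * ?g j \<xi>)" for j
  unfolding locally_integrable_def set_integrable_def
 proof (intro allI impI)
  fix K :: "(real^3) set" assume K: "compact K"
  have [measurable]: "K \<in> sets borel" by (rule borel_closed[OF compact_imp_closed[OF K]])
  obtain B where B: "\<And>x. x \<in> K ==> norm x \<le> B" using compact_imp_bounded[OF K] by (auto simp: bounded_iff)
  have "integrable lborel (\<lambda>x. B * norm (indicator K x *\<^sub>R ?g j x))"
   using li[of j] K by (intro integrable_mult_right integrable_norm) (auto simp: locally_integrable_def set_integrable_def)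
  then show "integrable lborel (\<lambda>x. indicator K x *\<^sub>R (cr (x $ j) * ?g j x))"
  proof (rule Bochner_Integration.integrable_bound)
   show "AE x in lborel. norm (indicator K x *\<^sub>R (cr (x $ j) * ?g j x)) \<le> norm (B * norm (indicator K x *\<^sub>R ?g j x))"
   proof (rule AE_I2, goal_cases)
    case (1 x)
    show ?case
    proof (cases "x \<in> K")
     case True
     have "\<bar>x $ j\<bar> \<le> \<bar>B\<bar>" using B[OF True] component_le_norm_cart[of x j] by linarith
     then show ?thesis using True by (simp add: norm_mult abs_mult mult_right_mono)
    qed simp
   qed
  qed measurable
 qed
 have lsum: "locally_integrable (\<lambda>\<xi>. \<Sum>j\<in>UNIV. cr (\<xi> $ j) * ?g j \<xi>)"
  unfolding locally_integrable_def set_integrable_def scaleR_sum_right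
  using lj by (intro allI impI Bochner_Integration.integrable_sum) (auto simp: locally_integrable_def set_integrable_def)
 show ?thesis
 proof (rule fundamental_lemma[OF lsum])
  fix \<phi> assume t: "test_fun \<phi>"
  have s: "schwartz \<phi>" by (rule test_fun_schwartz[OF t])
  have tj: "test_fun (\<lambda>x. - \<i> * (cr (x $ j) * \<phi> x))" for j
   by (intro test_fun_cmult test_fun_mult smooth_fun_coord t)
  have "0 = (\<Sum>j\<in>UNIV. dist_deriv j (u $ j)) (fourier_fun \<phi>)" using d by (simp add: div_free_def)
  also have "... = (\<Sum>j\<in>UNIV. - (u $ j) (partial_deriv j (fourier_fun \<phi>)))"
   unfolding sum_fun_apply by (simp add: dist_deriv_def schwartz_fourier_fun[OF s])
  also have "... = (\<Sum>j\<in>UNIV. \<i> * (LINT \<xi>|lborel. cr (\<xi> $ j) * ?g j \<xi> * \<phi> \<xi>))"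
  proof (rule sum.cong[OF refl], goal_cases)
   case (1 j)
   have "(u $ j) (partial_deriv j (fourier_fun \<phi>)) = fourier_dist (u $ j) (\<lambda>x. - \<i> * (cr (x $ j) * \<phi> x))"
    unfolding fourier_dist_def partial_deriv_fourier_fun[OF s] using test_fun_schwartz[OF tj] by simp
   also have "... = (LINT \<xi>|lborel. ?g j \<xi> * (- \<i> * (cr (\<xi> $ j) * \<phi> \<xi>)))"
    using R[of j] tj[of j] unfolding represents_def by blast
   also have "... = (LINT \<xi>|lborel. - \<i> * (cr (\<xi> $ j) * ?g j \<xi> * \<phi> \<xi>))"
    by (simp only: mult_ac)
   also have "... = - \<i> * (LINT \<xi>|lborel. cr (\<xi> $ j) * ?g j \<xi> * \<phi> \<xi>)" by (rule integral_mult_right_zero)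
   finally show ?case by simp
  qed
  also have "... = \<i> * (LINT \<xi>|lborel. (\<Sum>j\<in>UNIV. cr (\<xi> $ j) * ?g j \<xi> * \<phi> \<xi>))"
   unfolding sum_distrib_left[symmetric]
   by (subst Bochner_Integration.integral_sum) (auto intro: integrable_times_test[OF lj t])
  finally show "(LINT \<xi>|lborel. (\<Sum>j\<in>UNIV. cr (\<xi> $ j) * ?g j \<xi>) * \<phi> \<xi>) = 0"
   by (simp add: sum_distrib_right)
 qed
qed

section \<open>The mild formulation is the fixed point equation\<close>

context boussinesq begin

definition duh :: "state => state" where
 "duh Y i t \<xi> = (LINT \<tau>|lborel. (dint Y i t \<xi> \<tau>))"

lemma Phi_duh: "Phi z0 Z i t \<xi> = cr (hk i t \<xi>) * z0 i \<xi> + duh Z i t \<xi>"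
 by (simp add: Phi_def duh_def)

lemma ftot_L1:
 assumes Z: "jmeas Z" and T: "T > 0" and N: "NM T Z < \<infinity>"
 shows "(\<integral>\<^sup>+\<xi>. ftot T Z i \<xi> \<partial>lborel) < \<infinity>"
proof -
 note [measurable] = ftot_measurable[OF Z]
 have "(\<integral>\<^sup>+\<xi>. ftot T Z i \<xi> \<partial>lborel) \<le> (\<integral>\<^sup>+\<xi>. ennreal Kw * (ennreal (w s \<xi>) * (\<Sum>i\<in>UNIV. ftot T Z i \<xi>)) \<partial>lborel)"
 proof (rule nn_integral_mono_AE)
  have "AE \<xi> in lborel. \<xi> \<noteq> (0::real^3)" by (rule AE_lborel_singleton)
  then show "AE \<xi> in lborel. ftot T Z i \<xi> \<le> ennreal Kw * (ennreal (w s \<xi>) * (\<Sum>i\<in>UNIV. ftot T Z i \<xi>))"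
  proof eventually_elim
   case (elim \<xi>)
   have "ennreal 1 \<le> ennreal (Kw * w s \<xi>)" by (rule ennreal_leI[OF one_le_w[OF elim]])
   then have "1 * ftot T Z i \<xi> \<le> ennreal (Kw * w s \<xi>) * (\<Sum>i\<in>UNIV. ftot T Z i \<xi>)"
    by (intro mult_mono member_le_sum) auto
   then show ?case using Kw(1) by (simp only: ennreal_mult less_imp_le w_nonneg mult.assoc mult_1_left)
  qed
 qed
 also have "... = ennreal Kw * (\<integral>\<^sup>+\<xi>. ennreal (w s \<xi>) * (\<Sum>i\<in>UNIV. ftot T Z i \<xi>) \<partial>lborel)"
  by (rule nn_integral_cmult) measurable
 also have "... < \<infinity>" using ftot_finite(1)[OF Z T N] by (simp add: ennreal_mult_less_top)
 finally show ?thesis .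
qed

text \<open>The scalar \<open>c\<close> accounts for the sign with which a term enters the mild
  equations.\<close>

lemma duh_link:
 assumes Y: "jmeas Y" and T: "T > 0" and N: "NM T Y < \<infinity>" and t: "t \<in> {0..T}"
  and F: "AE \<tau> in lborel. \<tau> \<in> {0..t} \<longrightarrow> F \<tau> = inv_fourier (\<lambda>\<xi>. c * (cr (hk i (t - \<tau>) \<xi>) * force (sl Y \<tau>) i \<xi>))"
 shows "dist_integrable t F" and "dist_integral t F = inv_fourier (\<lambda>\<xi>. c * duh Y i t \<xi>)"
  and "integrable lborel (\<lambda>\<xi>. c * duh Y i t \<xi>)"
proof -
 let ?h = "\<lambda>\<tau> \<xi>. dint Y i t \<xi> \<tau>"
 let ?H = "\<lambda>\<tau> \<xi>. c * ?h \<tau> \<xi>"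
 note [measurable (raw)] = jmeas_force[OF Y]
 have m: "(\<lambda>p. ?H (fst p) (snd p)) \<in> borel_measurable (borel \<Otimes>\<^sub>M borel)" by measurable
 have m2: "(\<lambda>(\<xi>, \<tau>). enorm (?H \<tau> \<xi>)) \<in> borel_measurable (lborel \<Otimes>\<^sub>M lborel)" by measurable
 have "(\<integral>\<^sup>+\<tau>. \<integral>\<^sup>+\<xi>. enorm (?H \<tau> \<xi>) \<partial>lborel \<partial>lborel) = (\<integral>\<^sup>+\<xi>. \<integral>\<^sup>+\<tau>. enorm (?H \<tau> \<xi>) \<partial>lborel \<partial>lborel)"
  by (rule lborel_pair.Fubini'[OF m2])
 also have "... \<le> (\<integral>\<^sup>+\<xi>. enorm c * ftot T Y i \<xi> \<partial>lborel)"
 proof (rule nn_integral_mono, goal_cases)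
  case (1 \<xi>)
  have "(\<integral>\<^sup>+\<tau>. enorm (?H \<tau> \<xi>) \<partial>lborel) = enorm c * (\<integral>\<^sup>+\<tau>. enorm (?h \<tau> \<xi>) \<partial>lborel)"
   unfolding norm_mult[of c] ennreal_mult[OF norm_ge_zero norm_ge_zero] by (rule nn_integral_cmult) measurable
  also have "... \<le> enorm c * ftot T Y i \<xi>"
   unfolding ftot_def
  proof (intro mult_left_mono nn_integral_mono)
   fix \<tau>
   show "enorm (?h \<tau> \<xi>) \<le> enorm (force (sl Y \<tau>) i \<xi>) * indicator {0..T} \<tau>"
   proof (cases "0 \<le> \<tau> \<and> \<tau> \<le> t")
    case True
    have "hk i (t - \<tau>) \<xi> * norm (force (sl Y \<tau>) i \<xi>) \<le> 1 * norm (force (sl Y \<tau>) i \<xi>)"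
     using True by (intro mult_right_mono hk_bounds(2)) auto
    moreover have "indicator {0..T} \<tau> = (1 :: ennreal)" using True t by (simp add: indicator_def)
    ultimately show ?thesis unfolding if_P[OF True]
     by (simp only: norm_mult norm_of_real abs_of_nonneg[OF hk_bounds(1)] mult_1_left mult_1_right ennreal_leI)
   next
    case False
    show ?thesis unfolding if_not_P[OF False] by simp
   qed
  qed simp
  finally show ?case .
 qed
 also have "... = enorm c * (\<integral>\<^sup>+\<xi>. ftot T Y i \<xi> \<partial>lborel)"
  by (rule nn_integral_cmult) (use ftot_measurable[OF Y] in measurable)
 also have "... < \<infinity>" using ftot_L1[OF Y T N] by (simp add: ennreal_mult_less_top)
 finally have fin: "(\<integral>\<^sup>+\<tau>. \<integral>\<^sup>+\<xi>. enorm (?H \<tau> \<xi>) \<partial>lborel \<partial>lborel) < \<infinity>" .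
 have z: "?H \<tau> \<xi> = 0" if "\<tau> \<notin> {0..t}" for \<tau> \<xi> using that by auto
 have F': "AE \<tau> in lborel. \<tau> \<in> {0..t} \<longrightarrow> F \<tau> = inv_fourier (?H \<tau>)"
  using F by eventually_elim simp
 have e: "(\<lambda>\<xi>. LINT \<tau>|lborel. ?H \<tau> \<xi>) = (\<lambda>\<xi>. c * duh Y i t \<xi>)"
  by (simp only: duh_def integral_mult_right_zero)
 show "dist_integrable t F" by (rule dist_integral_inv_fourier(1)[OF m fin z F'])
 show "dist_integral t F = inv_fourier (\<lambda>\<xi>. c * duh Y i t \<xi>)"
  by (rule dist_integral_inv_fourier(2)[OF m fin z F', unfolded e])
 show "integrable lborel (\<lambda>\<xi>. c * duh Y i t \<xi>)"
  by (rule dist_integral_inv_fourier(3)[OF m fin z F', unfolded e])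
qed

lemma slice_L1:
 assumes Z: "slice_meas z" and N: "wn (\<lambda>_. s) z < \<infinity>"
 shows "integrable lborel (z i)"
proof (rule integrableI_bounded)
 note [measurable] = slice_measD[OF Z]
 show "z i \<in> borel_measurable lborel" by measurable
 have "(\<integral>\<^sup>+\<xi>. enorm (z i \<xi>) \<partial>lborel) \<le> (\<integral>\<^sup>+\<xi>. ennreal Kw * (\<Sum>i\<in>UNIV. ennreal (w s \<xi> * norm (z i \<xi>))) \<partial>lborel)"
 proof (rule nn_integral_mono_AE)
  have "AE \<xi> in lborel. \<xi> \<noteq> (0::real^3)" by (rule AE_lborel_singleton)
  then show "AE \<xi> in lborel. enorm (z i \<xi>) \<le> ennreal Kw * (\<Sum>i\<in>UNIV. ennreal (w s \<xi> * norm (z i \<xi>)))"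
  proof eventually_elim
   case (elim \<xi>)
   have "1 * norm (z i \<xi>) \<le> (Kw * w s \<xi>) * norm (z i \<xi>)" by (intro mult_right_mono one_le_w elim) simp
   then have "enorm (z i \<xi>) \<le> ennreal (Kw * (w s \<xi> * norm (z i \<xi>)))"
    by (intro ennreal_leI) (simp only: mult.assoc mult_1_left)
   also have "... = ennreal Kw * ennreal (w s \<xi> * norm (z i \<xi>))" using Kw(1) by (intro ennreal_mult) auto
   also have "... \<le> ennreal Kw * (\<Sum>i\<in>UNIV. ennreal (w s \<xi> * norm (z i \<xi>)))"
    by (intro mult_left_mono member_le_sum) auto
   finally show ?case .
  qed
 qed
 also have "... = ennreal Kw * wn (\<lambda>_. s) z" unfolding wn_def by (rule nn_integral_cmult) measurable
 also have "... < \<infinity>" using N by (simp add: ennreal_mult_less_top)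
 finally show "(\<integral>\<^sup>+\<xi>. enorm (z i \<xi>) \<partial>lborel) < \<infinity>" .
qed

lemma slice_deriv_L1:
 assumes Z: "slice_meas z" and N: "wn (\<lambda>_. s + 1) z < \<infinity>"
 shows "integrable lborel (\<lambda>\<xi>. cr (\<xi> $ j) * z i \<xi>)"
proof (rule integrableI_bounded)
 note [measurable] = slice_measD[OF Z]
 show "(\<lambda>\<xi>. cr (\<xi> $ j) * z i \<xi>) \<in> borel_measurable lborel" by measurable
 have "(\<integral>\<^sup>+\<xi>. enorm (cr (\<xi> $ j) * z i \<xi>) \<partial>lborel) \<le> (\<integral>\<^sup>+\<xi>. ennreal Kw * (\<Sum>i\<in>UNIV. ennreal (w (s + 1) \<xi> * norm (z i \<xi>))) \<partial>lborel)"
 proof (rule nn_integral_mono, goal_cases)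
  case (1 \<xi>)
  have "\<bar>\<xi> $ j\<bar> * norm (z i \<xi>) \<le> (Kw * w (s + 1) \<xi>) * norm (z i \<xi>)"
   by (intro mult_right_mono order_trans[OF component_le_norm_cart norm_le_w]) simp
  then have "enorm (cr (\<xi> $ j) * z i \<xi>) \<le> ennreal (Kw * (w (s + 1) \<xi> * norm (z i \<xi>)))"
   by (intro ennreal_leI) (simp only: mult.assoc norm_mult norm_of_real)
  also have "... = ennreal Kw * ennreal (w (s + 1) \<xi> * norm (z i \<xi>))" using Kw(1) by (intro ennreal_mult) auto
  also have "... \<le> ennreal Kw * (\<Sum>i\<in>UNIV. ennreal (w (s + 1) \<xi> * norm (z i \<xi>)))"
   by (intro mult_left_mono member_le_sum) auto
  finally show ?case .
 qed
 also have "... = ennreal Kw * wn (\<lambda>_. s + 1) z" unfolding wn_def by (rule nn_integral_cmult) measurable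
 also have "... < \<infinity>" using N by (simp add: ennreal_mult_less_top)
 finally show "(\<integral>\<^sup>+\<xi>. enorm (cr (\<xi> $ j) * z i \<xi>) \<partial>lborel) < \<infinity>" .
qed

lemma state_L1:
 assumes Z: "jmeas Z" and N: "NM T Z < \<infinity>" and t: "t \<in> {0..T}"
 shows "integrable lborel (Z i t)"
proof (rule slice_L1[OF jmeas_slice[OF Z]])
 have "wn (\<lambda>_. s) (sl Z t) \<le> NM T Z" using EN_upper[OF t, of Z] by (simp add: NM_def add_increasing2)
 then show "wn (\<lambda>_. s) (sl Z t) < \<infinity>" using N by (rule order.strict_trans1)
qed

lemma state_deriv_L1:
 assumes Z: "jmeas Z" and T: "T > 0" and N: "NM T Z < \<infinity>"
 shows "AE t in lborel. t \<in> {0..T} \<longrightarrow> (\<forall>i j. integrable lborel (\<lambda>\<xi>. cr (\<xi> $ j) * Z i t \<xi>))"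
proof -
 note [measurable] = wn_measurable[OF Z]
 have "(\<integral>\<^sup>+t. wn (\<lambda>_. s + 1) (sl Z t) * indicator {0..T} t \<partial>lborel) \<le> ennreal (lam T) * NM T Z" by (rule GN_le[OF T Z])
 also have "... < \<infinity>" using N by (simp add: ennreal_mult_less_top)
 finally have "AE t in lborel. wn (\<lambda>_. s + 1) (sl Z t) * indicator {0..T} t \<noteq> \<infinity>"
  by (intro nn_integral_PInf_AE) auto
 then show ?thesis
 proof eventually_elim
  case (elim t)
  then show ?case using slice_deriv_L1[OF jmeas_slice[OF Z]] by (auto simp: less_top)
 qed
qed

abbreviation adv_term :: "(real => dist^3) => real => real => dist^3" where
 "adv_term u t \<equiv> (\<lambda>\<tau>. heat_vec \<alpha> (t - \<tau>) (leray (advect_vec (u \<tau>) (u \<tau>))))"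

abbreviation buoy_term :: "(real => dist) => real => real => dist^3" where
 "buoy_term \<theta> t \<equiv> (\<lambda>\<tau>. heat_vec \<alpha> (t - \<tau>) (leray (times_e3 (\<theta> \<tau>))))"

abbreviation transp_term :: "(real => dist^3) => (real => dist) => real => real => dist" where
 "transp_term u \<theta> t \<equiv> (\<lambda>\<tau>. heat \<beta> (t - \<tau>) (advect (u \<tau>) (\<theta> \<tau>)))"

text \<open>The velocity equation has two time integrals where \<open>Phi\<close> has one. The force on the
  velocity is the sum of the forces of the two states in which only the velocity or only the temperature is
  kept, so each integral is an instance of \<open>duh_link\<close>.\<close>

lemma mild_link:
 fixes u :: "real => dist^3" and \<theta> :: "real => dist"
 assumes Z: "jmeas Z" and T: "T > 0" and N: "NM T Z < \<infinity>"
  and div: "\<And>t. t \<in> {0..T} ==> AE \<xi> in lborel. (\<Sum>j\<in>UNIV. cr (\<xi> $ j) * Z (Some j) t \<xi>) = 0"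
  and u: "\<And>t k. t \<in> {0..T} ==> u t $ k = inv_fourier (Z (Some k) t)"
  and \<theta>: "\<And>t. t \<in> {0..T} ==> \<theta> t = inv_fourier (Z None t)"
  and z0: "\<And>k. z0 (Some k) = fhat (u0 $ k)" "z0 None = fhat \<theta>0" "\<And>i. integrable lborel (z0 i)"
  and t: "t \<in> {0..T}"
 shows "dist_integrable_vec t (adv_term u t)"
  and "dist_integrable_vec t (buoy_term \<theta> t)"
  and "dist_integrable t (transp_term u \<theta> t)"
  and "(heat_vec \<alpha> t u0 - dist_integral_vec t (adv_term u t)
     + dist_integral_vec t (buoy_term \<theta> t)) $ l = inv_fourier (Phi z0 Z (Some l) t)"
  and "heat \<beta> t \<theta>0 - dist_integral t (transp_term u \<theta> t) = inv_fourier (Phi z0 Z None t)"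
  and "integrable lborel (Phi z0 Z i t)"
proof -
 define Zu where "Zu = (\<lambda>i t \<xi>. if i = None then 0 else Z i t \<xi>)"
 define Zt where "Zt = (\<lambda>i t \<xi>. if i = None then Z i t \<xi> else 0)"
 have ju: "jmeas Zu"
  unfolding jmeas_def
 proof
  fix i show "(\<lambda>p. Zu i (fst p) (snd p)) \<in> borel_measurable (borel \<Otimes>\<^sub>M borel)"
   using Z by (cases i) (simp_all add: Zu_def jmeas_def)
 qed
 have jt: "jmeas Zt"
  unfolding jmeas_def
 proof
  fix i show "(\<lambda>p. Zt i (fst p) (snd p)) \<in> borel_measurable (borel \<Otimes>\<^sub>M borel)"
   using Z by (cases i) (simp_all add: Zt_def jmeas_def)
 qed
 have Nu: "NM T Zu < \<infinity>" by (rule order.strict_trans1[OF NM_mono[OF Z] N]) (auto simp: Zu_def)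
 have Nt: "NM T Zt < \<infinity>" by (rule order.strict_trans1[OF NM_mono[OF Z] N]) (auto simp: Zt_def)
 have fu: "force (sl Zu \<tau>) (Some l) \<xi> = - (\<Sum>k\<in>UNIV. proj l k \<xi> * flux (sl Z \<tau>) (Some k) \<xi>)" for l \<tau> \<xi>
  by (simp add: force_def Zu_def flux_def sum_negf)
 have ft: "force (sl Zt \<tau>) (Some l) \<xi> = (\<Sum>k\<in>UNIV. proj l k \<xi> * (if k = 3 then Z None \<tau> \<xi> else 0))" for l \<tau> \<xi>
  by (simp add: force_def Zt_def flux_def conv_def cong: if_cong)
 have fs: "force (sl Z \<tau>) (Some l) \<xi> = force (sl Zu \<tau>) (Some l) \<xi> + force (sl Zt \<tau>) (Some l) \<xi>" for l \<tau> \<xi>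
  unfolding fu ft by (simp add: force_def right_diff_distrib sum_subtractf)
 have sub: "\<tau> \<in> {0..T}" if "\<tau> \<in> {0..t}" for \<tau> using that t by auto
 have adv: "AE \<tau> in lborel. \<tau> \<in> {0..t} \<longrightarrow> (\<forall>k. advect (u \<tau>) (inv_fourier (Z k \<tau>)) = inv_fourier (flux (sl Z \<tau>) k) \<and> integrable lborel (flux (sl Z \<tau>) k))"
  using state_deriv_L1[OF Z T N]
 proof eventually_elim
  case (elim \<tau>)
  show ?case
  proof (intro impI allI)
   fix k assume "\<tau> \<in> {0..t}"
   then have \<tau>: "\<tau> \<in> {0..T}" by (rule sub)
   show "advect (u \<tau>) (inv_fourier (Z k \<tau>)) = inv_fourier (flux (sl Z \<tau>) k) \<and> integrable lborel (flux (sl Z \<tau>) k)"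
    using advect_inv_fourier[of "\<lambda>i. Z i \<tau>" "u \<tau>" k] state_L1[OF Z N \<tau>] elim \<tau> div[OF \<tau>] u[OF \<tau>] by blast
  qed
 qed
 have hkS: "cr (exp (- r * norm \<xi> powr (2 * \<alpha>))) = cr (hk (Some l) r \<xi>)" for l r \<xi>
  by (simp add: hk_def gam_def)
 have hkN: "cr (exp (- r * norm \<xi> powr (2 * \<beta>))) = cr (hk None r \<xi>)" for r \<xi>
  by (simp add: hk_def gam_def)
 have F1: "AE \<tau> in lborel. \<tau> \<in> {0..t} \<longrightarrow> adv_term u t \<tau> $ l
   = inv_fourier (\<lambda>\<xi>. (-1) * (cr (hk (Some l) (t - \<tau>) \<xi>) * force (sl Zu \<tau>) (Some l) \<xi>))" for l
  using adv
 proof eventually_elim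
  case (elim \<tau>)
  show ?case
  proof
   assume "\<tau> \<in> {0..t}"
   with elim have e: "advect (u \<tau>) (inv_fourier (Z k \<tau>)) = inv_fourier (flux (sl Z \<tau>) k)"
    and i: "integrable lborel (flux (sl Z \<tau>) k)" for k by auto
   have a: "advect_vec (u \<tau>) (u \<tau>) $ k = inv_fourier (flux (sl Z \<tau>) (Some k))" for k
    unfolding advect_vec_def using e[of "Some k"] u[OF sub[OF \<open>\<tau> \<in> {0..t}\<close>]] by simp
   show "adv_term u t \<tau> $ l
    = inv_fourier (\<lambda>\<xi>. (-1) * (cr (hk (Some l) (t - \<tau>) \<xi>) * force (sl Zu \<tau>) (Some l) \<xi>))"
    unfolding heat_vec_def vec_lambda_beta leray_inv_fourier(1)[OF i a] heat_inv_fourier[OF leray_inv_fourier(2)[OF i a]] hkS[of _ _ l] fu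
    by simp
  qed
 qed
 have F2: "AE \<tau> in lborel. \<tau> \<in> {0..t} \<longrightarrow> buoy_term \<theta> t \<tau> $ l
   = inv_fourier (\<lambda>\<xi>. 1 * (cr (hk (Some l) (t - \<tau>) \<xi>) * force (sl Zt \<tau>) (Some l) \<xi>))" for l
 proof (intro AE_I2 impI)
  fix \<tau> assume "\<tau> \<in> {0..t}"
  then have \<tau>: "\<tau> \<in> {0..T}" by (rule sub)
  let ?g = "\<lambda>k \<xi>. if k = 3 then Z None \<tau> \<xi> else 0"
  have i: "integrable lborel (?g k)" for k :: 3 using state_L1[OF Z N \<tau>, of None] by (cases "k = 3") auto
  have a: "times_e3 (\<theta> \<tau>) $ k = inv_fourier (?g k)" for k
   unfolding times_e3_def using \<theta>[OF \<tau>] by (auto simp: inv_fourier_zero)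
  show "buoy_term \<theta> t \<tau> $ l
   = inv_fourier (\<lambda>\<xi>. 1 * (cr (hk (Some l) (t - \<tau>) \<xi>) * force (sl Zt \<tau>) (Some l) \<xi>))"
   unfolding heat_vec_def vec_lambda_beta leray_inv_fourier(1)[OF i a] heat_inv_fourier[OF leray_inv_fourier(2)[OF i a]] hkS[of _ _ l] ft mult_1_left ..
 qed
 have F3: "AE \<tau> in lborel. \<tau> \<in> {0..t} \<longrightarrow> transp_term u \<theta> t \<tau>
   = inv_fourier (\<lambda>\<xi>. (-1) * (cr (hk None (t - \<tau>) \<xi>) * force (sl Z \<tau>) None \<xi>))"
  using adv
 proof eventually_elim
  case (elim \<tau>)
  show ?case
  proof
   assume "\<tau> \<in> {0..t}"
   with elim have e: "advect (u \<tau>) (\<theta> \<tau>) = inv_fourier (flux (sl Z \<tau>) None)"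
    and i: "integrable lborel (flux (sl Z \<tau>) None)" using \<theta>[OF sub] by auto
   show "transp_term u \<theta> t \<tau>
    = inv_fourier (\<lambda>\<xi>. (-1) * (cr (hk None (t - \<tau>) \<xi>) * force (sl Z \<tau>) None \<xi>))"
    unfolding e heat_inv_fourier[OF i] hkN by (simp add: force_def)
  qed
 qed
 show "dist_integrable_vec t (adv_term u t)"
  unfolding dist_integrable_vec_def using duh_link(1)[OF ju T Nu t F1] by blast
 show "dist_integrable_vec t (buoy_term \<theta> t)"
  unfolding dist_integrable_vec_def using duh_link(1)[OF jt T Nt t F2] by blast
 show "dist_integrable t (transp_term u \<theta> t)"
  by (rule duh_link(1)[OF Z T N t F3])
 have hi: "integrable lborel (\<lambda>\<xi>. cr (hk i t \<xi>) * z0 i \<xi>)" for i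
 proof (rule Bochner_Integration.integrable_bound[OF z0(3)[of i]])
  show "AE \<xi> in lborel. norm (cr (hk i t \<xi>) * z0 i \<xi>) \<le> norm (z0 i \<xi>)"
  proof (rule AE_I2, goal_cases)
   case (1 \<xi>)
   have "hk i t \<xi> * norm (z0 i \<xi>) \<le> 1 * norm (z0 i \<xi>)" using t by (intro mult_right_mono hk_bounds(2)) auto
   then show ?case
    by (simp only: norm_mult norm_of_real abs_of_nonneg[OF hk_bounds(1)] mult_1_left)
  qed
  show "(\<lambda>\<xi>. cr (hk i t \<xi>) * z0 i \<xi>) \<in> borel_measurable lborel"
   using borel_measurable_integrable[OF z0(3)[of i]] by measurable
 qed
 have du: "integrable lborel (duh Zu (Some l) t)" for l using duh_link(3)[OF ju T Nu t F1, of l] by simp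
 have dt: "integrable lborel (duh Zt (Some l) t)" for l using duh_link(3)[OF jt T Nt t F2, of l] by simp
 have dn: "integrable lborel (duh Z None t)" using duh_link(3)[OF Z T N t F3] by simp
 have pm: "Phi z0 Z i t \<in> borel_measurable borel" for i
  by (rule jmeasD[OF jmeas_Phi[OF Z], of z0 "\<lambda>_. t" borel "\<lambda>x. x" i])
    (use z0(3) in \<open>auto simp: slice_meas_def dest: borel_measurable_integrable\<close>)
 have ps: "AE \<xi> in lborel. Phi z0 Z (Some l) t \<xi> = (cr (hk (Some l) t \<xi>) * z0 (Some l) \<xi> + duh Zu (Some l) t \<xi>) + duh Zt (Some l) t \<xi>" for l
  using ftot_finite(2)[OF ju T Nu] ftot_finite(2)[OF jt T Nt]
 proof eventually_elim
  case (elim \<xi>)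
  have "duh Z (Some l) t \<xi> = duh Zu (Some l) t \<xi> + duh Zt (Some l) t \<xi>"
   unfolding duh_def
   by (subst Bochner_Integration.integral_add[symmetric,
      OF duhamel_integrable(1)[OF ju _ t] duhamel_integrable(1)[OF jt _ t]])
     (use elim in \<open>auto intro!: Bochner_Integration.integral_cong simp: fs distrib_left\<close>)
  then show ?case by (simp add: Phi_duh)
 qed
 have eq: "heat_vec \<alpha> t u0 $ l = inv_fourier (\<lambda>\<xi>. cr (hk (Some l) t \<xi>) * z0 (Some l) \<xi>)" for l
  by (simp add: heat_vec_def heat_def z0(1) hk_def gam_def)
 have isum: "integrable lborel (\<lambda>\<xi>. (cr (hk (Some l) t \<xi>) * z0 (Some l) \<xi> + duh Zu (Some l) t \<xi>) + duh Zt (Some l) t \<xi>)" for l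
  by (intro Bochner_Integration.integrable_add hi du dt)
 have "inv_fourier (Phi z0 Z (Some l) t) = inv_fourier (\<lambda>\<xi>. (cr (hk (Some l) t \<xi>) * z0 (Some l) \<xi> + duh Zu (Some l) t \<xi>) + duh Zt (Some l) t \<xi>)"
  using borel_measurable_integrable[OF isum[of l]] by (intro inv_fourier_cong ps pm) auto
 also have "... = (inv_fourier (\<lambda>\<xi>. cr (hk (Some l) t \<xi>) * z0 (Some l) \<xi>) + inv_fourier (duh Zu (Some l) t)) + inv_fourier (duh Zt (Some l) t)"
  by (simp only: inv_fourier_add Bochner_Integration.integrable_add hi du dt)
 also have "inv_fourier (duh Zu (Some l) t) = - inv_fourier (\<lambda>\<xi>. (-1) * duh Zu (Some l) t \<xi>)"
  using inv_fourier_diff[of "\<lambda>_. 0" "duh Zu (Some l) t"] du[of l] by (simp add: inv_fourier_zero)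
 finally show "(heat_vec \<alpha> t u0 - dist_integral_vec t (adv_term u t)
     + dist_integral_vec t (buoy_term \<theta> t)) $ l = inv_fourier (Phi z0 Z (Some l) t)"
  unfolding vector_add_component vector_minus_component dist_integral_vec_def vec_lambda_beta eq
   duh_link(2)[OF ju T Nu t F1] duh_link(2)[OF jt T Nt t F2]
  by (simp add: plus_fun_def fun_diff_def)
 have "inv_fourier (Phi z0 Z None t) = inv_fourier (\<lambda>\<xi>. cr (hk None t \<xi>) * z0 None \<xi>) - inv_fourier (\<lambda>\<xi>. (-1) * duh Z None t \<xi>)"
  using inv_fourier_diff[of "\<lambda>\<xi>. cr (hk None t \<xi>) * z0 None \<xi>" "\<lambda>\<xi>. (-1) * duh Z None t \<xi>"] hi[of None] dn
  by (simp add: Phi_duh[abs_def])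
 then show "heat \<beta> t \<theta>0 - dist_integral t (transp_term u \<theta> t) = inv_fourier (Phi z0 Z None t)"
  unfolding duh_link(2)[OF Z T N t F3] by (simp add: heat_def z0(2) hk_def gam_def)
 show "integrable lborel (Phi z0 Z i t)"
 proof (cases i)
  case None
  have "integrable lborel (\<lambda>\<xi>. cr (hk None t \<xi>) * z0 None \<xi> + duh Z None t \<xi>)"
   by (intro Bochner_Integration.integrable_add hi dn)
  then show ?thesis by (simp add: None Phi_duh[abs_def])
 next
  case (Some l)
  have "integrable lborel (Phi z0 Z (Some l) t)"
   by (rule integrable_cong_AE[THEN iffD2, OF _ _ ps isum]) (use pm borel_measurable_integrable[OF isum[of l]] in auto)
  then show ?thesis by (simp add: Some)
 qed
qed

end

section \<open>Spaces of fields given by components on the Fourier side\<close>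

lemma AE_lebesgue_on_iff: "(AE t in lebesgue_on {0..T::real}. P t) \<longleftrightarrow> (AE t in lborel. t \<in> {0..T} \<longrightarrow> P t)"
 by (simp add: AE_restrict_space_iff AE_completion_iff)

lemma integrable_lebesgue_on_enn2real:
 fixes h :: "real => ennreal"
 assumes [measurable]: "h \<in> borel_measurable borel"
  and fin: "(\<integral>\<^sup>+t. h t * indicator {0..T} t \<partial>lborel) < \<infinity>"
 shows "integrable (lebesgue_on {0..T}) (\<lambda>t. enn2real (h t))"
proof -
 have "integrable lborel (\<lambda>t. indicator {0..T} t *\<^sub>R enn2real (h t))"
 proof (rule integrableI_nonneg)
  have "(\<integral>\<^sup>+t. ennreal (indicator {0..T} t *\<^sub>R enn2real (h t)) \<partial>lborel) \<le> (\<integral>\<^sup>+t. h t * indicator {0..T} t \<partial>lborel)"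
   by (rule nn_integral_mono) (auto simp: indicator_def ennreal_enn2real_if)
  then show "(\<integral>\<^sup>+t. ennreal (indicator {0..T} t *\<^sub>R enn2real (h t)) \<partial>lborel) < \<infinity>" using fin by (rule order.strict_trans1)
 qed auto
 then show ?thesis by (simp add: integrable_restrict_space integrable_completion)
qed

text \<open>With \<open>J = range Some\<close> and \<open>J = {None}\<close> these are the Euclidean norm of
  the velocity and the modulus of the temperature.\<close>

definition vnorm :: "3 option set => (3 option => complex) => real" where
 "vnorm J c = L2_set (\<lambda>i. norm (c i)) J"

lemma vnorm_measurable [measurable (raw)]:
 assumes [measurable]: "\<And>i. f i \<in> borel_measurable M"
 shows "(\<lambda>x. vnorm J (\<lambda>i. f i x)) \<in> borel_measurable M"
 unfolding vnorm_def L2_set_def by measurable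

lemma vnorm_nonneg [simp]: "0 \<le> vnorm J c" by (simp add: vnorm_def L2_set_nonneg)

lemma vnorm_le_sum: "vnorm J c \<le> (\<Sum>i\<in>J. norm (c i))" unfolding vnorm_def by (rule L2_set_le_sum) simp

lemma norm_le_vnorm: "i \<in> J ==> norm (c i) \<le> vnorm J c"
 unfolding vnorm_def using member_le_L2_set[of J i "\<lambda>i. norm (c i)"] by simp

lemma vnorm_triangle:
 assumes "\<And>i. i \<in> J ==> norm (c i) \<le> norm (b i) + norm (d i)"
 shows "vnorm J c \<le> vnorm J b + vnorm J d"
proof -
 have "vnorm J c \<le> L2_set (\<lambda>i. norm (b i) + norm (d i)) J" unfolding vnorm_def using assms by (intro L2_set_mono) auto
 also have "... \<le> vnorm J b + vnorm J d" unfolding vnorm_def by (rule L2_set_triangle_ineq)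
 finally show ?thesis .
qed

lemma vnorm_mono: "(\<And>i. i \<in> J ==> norm (c i) \<le> norm (b i)) ==> vnorm J c \<le> vnorm J b"
 unfolding vnorm_def by (rule L2_set_mono) auto

abbreviation L1 :: "slice => bool" where
 "L1 z \<equiv> \<forall>i. integrable lborel (z i)"

lemma L1_meas: assumes "L1 z" shows "slice_meas z"
 unfolding slice_meas_def
proof
 fix i
 have "integrable lborel (z i)" using assms by blast
 from borel_measurable_integrable[OF this] show "z i \<in> borel_measurable borel" by simp
qed

lemma L1_diff: "L1 y ==> L1 z ==> L1 (sdiff y z)" by auto

text \<open>Common interface of the scalar and the vector valued spaces: \<open>mk\<close> builds an element
  from a state at one time, reading only the components in \<open>J\<close>, and \<open>cf\<close> recovers
  the Fourier transforms of an element.\<close>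

locale component_space = boussinesq +
 fixes J :: "3 option set" and \<gamma> :: real
  and X :: "real => ('v::minus) nspace"
  and mk :: "slice => 'v" and cf :: "'v => slice"
 assumes gam_J: "i \<in> J ==> gam i = \<gamma>" and \<gamma>: "\<gamma> > 0"
  and mk_diff: "L1 y ==> L1 z ==> mk y - mk z = mk (sdiff y z)"
  and mk_elems: "L1 z ==> mk z \<in> elems (X r) \<longleftrightarrow> integrable lborel (\<lambda>\<xi>. w r \<xi> * vnorm J (\<lambda>i. z i \<xi>))"
  and mk_nrm: "L1 z ==> nrm (X r) (mk z) = (LINT \<xi>|lborel. w r \<xi> * vnorm J (\<lambda>i. z i \<xi>))"
  and mk_cong: "slice_meas y ==> slice_meas z ==> AE \<xi> in lborel. \<forall>i\<in>J. y i \<xi> = z i \<xi> ==> mk y = mk z"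
  and mk_cf: "v \<in> elems (X s) ==> mk (cf v) = v" and L1_cf: "v \<in> elems (X s) ==> L1 (cf v)"
  and cf_outside: "i \<notin> J ==> cf v i = (\<lambda>\<xi>. 0)"
begin

definition sn :: "real => slice => ennreal" where
 "sn r z = (\<integral>\<^sup>+\<xi>. ennreal (w r \<xi> * vnorm J (\<lambda>i. z i \<xi>)) \<partial>lborel)"

lemma slice_vnorm_measurable: "slice_meas z ==> (\<lambda>\<xi>. vnorm J (\<lambda>i. z i \<xi>)) \<in> borel_measurable borel"
 by (intro vnorm_measurable) (simp add: slice_meas_def)

lemma sn_measurable:
 assumes "jmeas Z" shows "(\<lambda>t. sn r (sl Z t)) \<in> borel_measurable borel"
proof -
 note [measurable (raw)] = jmeasD[OF assms]
 show ?thesis unfolding sn_def by measurable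
qed

lemma nrm_sn: assumes "L1 z" shows "nrm (X r) (mk z) = enn2real (sn r z)"
 unfolding mk_nrm[OF assms] sn_def
 using slice_vnorm_measurable[OF L1_meas[OF assms]] by (intro integral_eq_nn_integral) auto

lemma elems_iff: assumes "L1 z" shows "mk z \<in> elems (X r) \<longleftrightarrow> sn r z < \<infinity>"
 unfolding mk_elems[OF assms] sn_def integrable_iff_bounded
 using slice_vnorm_measurable[OF L1_meas[OF assms]] by (auto simp: abs_mult)

lemma sn_nrm: assumes "L1 z" "sn r z < \<infinity>" shows "sn r z = ennreal (nrm (X r) (mk z))"
 using assms by (simp add: nrm_sn less_top)

lemma sn_cong: assumes "AE \<xi> in lborel. \<forall>i\<in>J. y i \<xi> = z i \<xi>" shows "sn r y = sn r z"
 unfolding sn_def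
 by (rule nn_integral_cong_AE) (use assms in \<open>eventually_elim; auto simp: vnorm_def cong: L2_set_cong\<close>)

lemma sn_le_wn: assumes "slice_meas z" and q: "\<And>i. i \<in> J ==> q i = r" shows "sn r z \<le> wn q z"
 unfolding sn_def wn_def
proof (rule nn_integral_mono, goal_cases)
 case (1 \<xi>)
 have "w r \<xi> * vnorm J (\<lambda>i. z i \<xi>) \<le> w r \<xi> * (\<Sum>i\<in>J. norm (z i \<xi>))"
  by (intro mult_left_mono vnorm_le_sum w_nonneg)
 also have "... = (\<Sum>i\<in>J. w (q i) \<xi> * norm (z i \<xi>))" by (simp add: sum_distrib_left q)
 also have "... \<le> (\<Sum>i\<in>UNIV. w (q i) \<xi> * norm (z i \<xi>))" by (rule sum_mono2) auto
 finally show ?case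
  by (simp add: ennreal_leI)
qed

lemma component_le_sn: assumes "i \<in> J" shows "(\<integral>\<^sup>+\<xi>. ennreal (w r \<xi> * norm (z i \<xi>)) \<partial>lborel) \<le> sn r z"
 unfolding sn_def by (intro nn_integral_mono ennreal_leI mult_left_mono norm_le_vnorm[OF assms, of "\<lambda>i. z i _"]) auto

lemma sn_triangle:
 assumes m: "slice_meas y" "slice_meas y'"
  and le: "\<And>i \<xi>. i \<in> J ==> norm (z i \<xi>) \<le> norm (y i \<xi>) + norm (y' i \<xi>)"
 shows "sn r z \<le> sn r y + sn r y'"
proof -
 note [measurable] = slice_vnorm_measurable[OF m(1)] slice_vnorm_measurable[OF m(2)]
 have "sn r z \<le> (\<integral>\<^sup>+\<xi>. ennreal (w r \<xi> * vnorm J (\<lambda>i. y i \<xi>)) + ennreal (w r \<xi> * vnorm J (\<lambda>i. y' i \<xi>)) \<partial>lborel)"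
  unfolding sn_def
 proof (rule nn_integral_mono, goal_cases)
  case (1 \<xi>)
  have "w r \<xi> * vnorm J (\<lambda>i. z i \<xi>) \<le> w r \<xi> * (vnorm J (\<lambda>i. y i \<xi>) + vnorm J (\<lambda>i. y' i \<xi>))"
   by (intro mult_left_mono vnorm_triangle w_nonneg le)
  then show ?case
   by (simp add: distrib_left ennreal_leI flip: ennreal_plus)
 qed
 also have "... = sn r y + sn r y'" unfolding sn_def by (rule nn_integral_add) auto
 finally show ?thesis .
qed

lemma sn_cf: "v \<in> elems (X s) ==> sn s (cf v) < \<infinity>"
 using elems_iff[of "cf v" s] by (simp add: L1_cf mk_cf)

lemma sn_sdiff_finite:
 assumes "L1 y" "L1 z" "sn r y < \<infinity>" "sn r z < \<infinity>" shows "sn r (sdiff y z) < \<infinity>"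
proof -
 have "sn r (sdiff y z) \<le> sn r y + sn r z"
  using assms by (intro sn_triangle L1_meas norm_triangle_ineq4) auto
 also have "... < \<infinity>" using assms by simp
 finally show ?thesis .
qed

lemma nrm_diff:
 assumes "L1 y" "L1 z" "sn r y < \<infinity>" "sn r z < \<infinity>"
 shows "sn r (sdiff y z) = ennreal (nrm (X r) (mk y - mk z))"
 using sn_nrm[OF L1_diff[OF assms(1,2)] sn_sdiff_finite[OF assms]] by (simp add: mk_diff assms)

lemma nrm_nonneg: assumes "v \<in> elems (X s)" shows "0 \<le> nrm (X s) v"
 using nrm_sn[OF L1_cf[OF assms], of s] by (simp add: mk_cf assms)

lemma nrm_triangle:
 assumes e: "v \<in> elems (X s)" "v' \<in> elems (X s)" "v'' \<in> elems (X s)"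
 shows "nrm (X s) (v - v'') \<le> nrm (X s) (v - v') + nrm (X s) (v'' - v')" "0 \<le> nrm (X s) (v - v')"
  "nrm (X s) v \<le> nrm (X s) v' + nrm (X s) (v - v')" "nrm (X s) (v - v') = nrm (X s) (v' - v)"
proof -
 have D: "sn s (sdiff (cf x) (cf y)) = ennreal (nrm (X s) (x - y))" "0 \<le> nrm (X s) (x - y)" if "x \<in> elems (X s)" "y \<in> elems (X s)" for x y
 proof -
  show "sn s (sdiff (cf x) (cf y)) = ennreal (nrm (X s) (x - y))"
   using nrm_diff[OF L1_cf[OF that(1)] L1_cf[OF that(2)] sn_cf[OF that(1)] sn_cf[OF that(2)]] by (simp add: mk_cf that)
  show "0 \<le> nrm (X s) (x - y)"
   using nrm_sn[OF L1_diff[OF L1_cf[OF that(1)] L1_cf[OF that(2)]], of s] mk_diff[OF L1_cf[OF that(1)] L1_cf[OF that(2)]]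
   by (simp add: mk_cf that)
 qed
 note m = L1_meas[OF L1_cf]
 have "sn s (sdiff (cf v) (cf v'')) \<le> sn s (sdiff (cf v) (cf v')) + sn s (sdiff (cf v'') (cf v'))"
 proof (intro sn_triangle slice_meas_diff m e)
  fix i \<xi>
  show "norm (cf v i \<xi> - cf v'' i \<xi>) \<le> norm (cf v i \<xi> - cf v' i \<xi>) + norm (cf v'' i \<xi> - cf v' i \<xi>)"
   using norm_triangle_ineq4[of "cf v i \<xi> - cf v' i \<xi>" "cf v'' i \<xi> - cf v' i \<xi>"] by simp
 qed
 then show "nrm (X s) (v - v'') \<le> nrm (X s) (v - v') + nrm (X s) (v'' - v')"
  using D e by (simp flip: ennreal_plus)
 show "0 \<le> nrm (X s) (v - v')" using D e by simp
 have "sn s (sdiff (cf v) (cf v')) = sn s (sdiff (cf v') (cf v))" unfolding sn_def vnorm_def by (simp only: norm_minus_commute)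
 then show "nrm (X s) (v - v') = nrm (X s) (v' - v)" using D e by simp
 have "sn s (cf v) \<le> sn s (cf v') + sn s (sdiff (cf v) (cf v'))"
 proof (intro sn_triangle slice_meas_diff m e)
  fix i \<xi>
  show "norm (cf v i \<xi>) \<le> norm (cf v' i \<xi>) + norm (cf v i \<xi> - cf v' i \<xi>)"
   using norm_triangle_ineq[of "cf v' i \<xi>" "cf v i \<xi> - cf v' i \<xi>"] by simp
 qed
 then show "nrm (X s) v \<le> nrm (X s) v' + nrm (X s) (v - v')"
  using sn_nrm[OF L1_cf sn_cf] D e by (simp add: mk_cf nrm_nonneg flip: ennreal_plus)
qed

lemma C_T_elems: "f \<in> C_T T (X s) ==> t \<in> {0..T} ==> f t \<in> elems (X s)"
 by (simp add: C_T_def)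

text \<open>The usual compactness argument, carried out by hand because the difference norm is only a
  pseudometric on the ambient type.\<close>

lemma C_T_uniform:
 assumes f: "f \<in> C_T T (X s)" and e: "e > 0"
 shows "\<exists>\<delta>>0. \<forall>r\<in>{0..T}. \<forall>t\<in>{0..T}. \<bar>r - t\<bar> < \<delta> \<longrightarrow> nrm (X s) (f r - f t) < e"
proof -
 have "\<exists>d>0. \<forall>r\<in>{0..T}. dist r t < d \<longrightarrow> nrm (X s) (f r - f t) < e / 2" if t: "t \<in> {0..T}" for t
 proof -
  have "((\<lambda>r. nrm (X s) (f r - f t)) \<longlongrightarrow> 0) (at t within {0..T})" using f t by (simp add: C_T_def)
  then have "eventually (\<lambda>r. nrm (X s) (f r - f t) < e / 2) (at t within {0..T})"
   using e by (intro order_tendstoD(2)) auto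
  then obtain d where d: "d > 0" "\<And>r. r \<in> {0..T} ==> r \<noteq> t ==> dist r t < d ==> nrm (X s) (f r - f t) < e / 2"
   by (auto simp: eventually_at)
  have "nrm (X s) (f t - f t) = 0"
  proof -
   have E: "f t \<in> elems (X s)" by (rule C_T_elems[OF f t])
   have "nrm (X s) (mk (cf (f t)) - mk (cf (f t))) = 0"
    unfolding mk_diff[OF L1_cf[OF E] L1_cf[OF E]] using L1_cf[OF E]
    by (subst mk_nrm) (auto simp: vnorm_def L2_set_def)
   then show ?thesis by (simp add: mk_cf[OF E])
  qed
  then show ?thesis using d e by (intro exI[of _ d]) fastforce
 qed
 then obtain d where d: "\<And>t. t \<in> {0..T} ==> d t > 0"
  "\<And>t r. t \<in> {0..T} ==> r \<in> {0..T} ==> dist r t < d t ==> nrm (X s) (f r - f t) < e / 2" by metis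
 have cov: "{0..T} \<subseteq> \<Union>((\<lambda>t. ball t (d t)) ` {0..T})" using d(1) by fastforce
 obtain \<delta> where \<delta>: "\<delta> > 0" "\<And>x. x \<in> {0..T} ==> \<exists>G\<in>(\<lambda>t. ball t (d t)) ` {0..T}. ball x \<delta> \<subseteq> G"
  by (rule Heine_Borel_lemma[OF _ cov]) auto
 show ?thesis
 proof (intro exI[of _ \<delta>] conjI ballI impI \<delta>(1))
  fix r t assume r: "r \<in> {0..T}" and t: "t \<in> {0..T}" and rt: "\<bar>r - t\<bar> < \<delta>"
  obtain q where q: "q \<in> {0..T}" "ball t \<delta> \<subseteq> ball q (d q)" using \<delta>(2)[OF t] by auto
  have "t \<in> ball q (d q)" "r \<in> ball q (d q)"
   using q(2) rt \<delta>(1) subsetD[OF q(2), of t] subsetD[OF q(2), of r] by (auto simp: dist_real_def abs_minus_commute)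
  then have "nrm (X s) (f t - f q) < e / 2" "nrm (X s) (f r - f q) < e / 2"
   using d(2)[OF q(1)] r t by (auto simp: dist_commute)
  then show "nrm (X s) (f r - f t) < e"
   using nrm_triangle(1)[OF C_T_elems[OF f r] C_T_elems[OF f q(1)] C_T_elems[OF f t]] by linarith
 qed
qed

lemma Linf_norm_upper:
 assumes f: "f \<in> C_T T (X s)" and t: "t \<in> {0..T}"
 shows "nrm (X s) (f t) \<le> Linf_norm T (X s) f"
 unfolding Linf_norm_def
proof (rule cSUP_upper[OF t])
 have "continuous_on {0..T} (\<lambda>t. nrm (X s) (f t))"
  unfolding continuous_on_def
 proof
  fix t assume t: "t \<in> {0..T}"
  have "((\<lambda>r. nrm (X s) (f r) - nrm (X s) (f t)) \<longlongrightarrow> 0) (at t within {0..T})"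
  proof (rule Lim_null_comparison)
   show "((\<lambda>r. nrm (X s) (f r - f t)) \<longlongrightarrow> 0) (at t within {0..T})" using f t by (simp add: C_T_def)
   show "\<forall>\<^sub>F r in at t within {0..T}. norm (nrm (X s) (f r) - nrm (X s) (f t)) \<le> nrm (X s) (f r - f t)"
    unfolding eventually_at
   proof (intro exI[of _ 1] conjI ballI impI)
    fix r assume r: "r \<in> {0..T}"
    note E = C_T_elems[OF f r] C_T_elems[OF f t]
    show "norm (nrm (X s) (f r) - nrm (X s) (f t)) \<le> nrm (X s) (f r - f t)"
     using nrm_triangle(3)[OF E(1,2,2)] nrm_triangle(3)[OF E(2,1,1)] nrm_triangle(4)[OF E(2,1,1)] by (simp add: abs_le_iff)
   qed simp
  qed
  then show "((\<lambda>r. nrm (X s) (f r)) \<longlongrightarrow> nrm (X s) (f t)) (at t within {0..T})" by (rule LIM_zero_cancel)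
 qed
 then have "compact ((\<lambda>t. nrm (X s) (f t)) ` {0..T})" by (intro compact_continuous_image) auto
 then show "bdd_above ((\<lambda>t. nrm (X s) (f t)) ` {0..T})" by (intro bounded_imp_bdd_above compact_imp_bounded)
qed

end

section \<open>Sampling in time\<close>

text \<open>Sample point number \<open>j\<close> of \<open>m\<close>, clipped to the interval so that a
  function on \<open>[0, T]\<close> is never evaluated outside.\<close>

definition samp :: "real => nat => int => real" where
 "samp T m j = max 0 (min T (real_of_int j * T / real m))"

definition sidx :: "real => nat => real => int" where
 "sidx T m t = \<lfloor>real m * t / T\<rfloor>"

lemma samp_in: "T \<ge> 0 ==> samp T m j \<in> {0..T}" by (auto simp: samp_def)

lemma samp_near:
 assumes "T > 0" "m > 0" "t \<in> {0..T}" shows "\<bar>samp T m (sidx T m t) - t\<bar> \<le> T / m"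
proof -
 have "real_of_int (sidx T m t) \<le> real m * t / T" "real m * t / T \<le> real_of_int (sidx T m t) + 1"
  unfolding sidx_def by linarith+
 then have "real_of_int (sidx T m t) * T / m \<le> t" "t \<le> real_of_int (sidx T m t) * T / m + T / m"
  using assms by (simp_all add: field_simps)
 then show ?thesis using assms unfolding samp_def by (auto simp: max_def min_def)
qed

lemma sidx_measurable [measurable]: "sidx T m \<in> borel \<rightarrow>\<^sub>M count_space UNIV"
 unfolding sidx_def by measurable

lemma measurable_lebesgue_on_borel: "f \<in> borel \<rightarrow>\<^sub>M N ==> f \<in> lebesgue_on S \<rightarrow>\<^sub>M N"
 by (intro measurable_restrict_space1 measurable_completion) simp

lemma sidx_simple: assumes T: "T > 0" shows "simple_function (lebesgue_on {0..T}) (\<lambda>t. g (sidx T m t))"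
proof (rule simple_function_compose1[of _ "sidx T m"])
 have m: "sidx T m \<in> lebesgue_on {0..T} \<rightarrow>\<^sub>M count_space UNIV" by (rule measurable_lebesgue_on_borel) measurable
 have "sidx T m ` {0..T} \<subseteq> {0..int m}"
 proof
  fix j assume "j \<in> sidx T m ` {0..T}"
  then obtain t where t: "t \<in> {0..T}" "j = \<lfloor>real m * t / T\<rfloor>" by (auto simp: sidx_def)
  have "real m * t / T \<le> real m" "0 \<le> real m * t / T" using t T by (auto simp: field_simps intro: mult_right_mono)
  then show "j \<in> {0..int m}" unfolding t(2) by (auto simp: floor_le_iff le_floor_iff)
 qed
 then have "finite (sidx T m ` {0..T})" by (rule finite_subset) simp
 then show "simple_function (lebesgue_on {0..T}) (sidx T m)"
  unfolding simple_function_def using measurable_sets[OF m] by auto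
qed

lemma AE_all_option: assumes "\<And>i :: 3 option. AE x in M. P i x" shows "AE x in M. \<forall>i. P i x"
 using assms by (rule eventually_all_finite)

context component_space begin

lemma sampling:
 assumes f: "f \<in> C_T T (X s)" and T: "T > 0" and e: "\<And>n. e n > 0"
 shows "\<exists>m. \<forall>n. m n > 0 \<and> (\<forall>t\<in>{0..T}. nrm (X s) (f (samp T (m n) (sidx T (m n) t)) - f t) < e n)"
proof -
 have "\<exists>m>0. \<forall>t\<in>{0..T}. nrm (X s) (f (samp T m (sidx T m t)) - f t) < e n" for n
 proof -
  obtain \<delta> where \<delta>: "\<delta> > 0" "\<And>r t. r \<in> {0..T} ==> t \<in> {0..T} ==> \<bar>r - t\<bar> < \<delta> ==> nrm (X s) (f r - f t) < e n"
   using C_T_uniform[OF f e[of n]] by blast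
  obtain m :: nat where m: "T / \<delta> < real m" using reals_Archimedean2 by blast
  have "0 < T / \<delta>" using T \<delta>(1) by simp
  then have m0: "m > 0" using m by (cases m) auto
  have "T / m < \<delta>" using m m0 \<delta>(1) by (simp add: field_simps)
  then have "\<bar>samp T m (sidx T m t) - t\<bar> < \<delta>" if "t \<in> {0..T}" for t using samp_near[OF T m0 that] by linarith
  then show ?thesis using m0 \<delta>(2)[OF samp_in] T by (intro exI[of _ m] conjI ballI) auto
 qed
 then have "\<forall>n. \<exists>m>0. \<forall>t\<in>{0..T}. nrm (X s) (f (samp T m (sidx T m t)) - f t) < e n" by blast
 from choice[OF this] show ?thesis by blast
qed

text \<open>Dominated convergence in \<open>\<xi>\<close>; the total force bounds the Duhamel integral
  uniformly in time.\<close>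

lemma mk_C_T:
 assumes Z: "jmeas Z" and T: "T > 0" and N: "NM T Z < \<infinity>" and z0: "slice_meas z0" "wn (\<lambda>_. s) z0 < \<infinity>"
  and fp: "\<And>t. t \<in> {0..T} ==> AE \<xi> in lborel. \<forall>i. Z i t \<xi> = Phi z0 Z i t \<xi>"
 shows "(\<lambda>t. mk (sl Z t)) \<in> C_T T (X s)"
proof -
 have L: "L1 (sl Z t)" if "t \<in> {0..T}" for t using state_L1[OF Z N that] by blast
 have sn: "sn s (sl Z t) < \<infinity>" if "t \<in> {0..T}" for t
 proof -
  have "sn s (sl Z t) \<le> wn (\<lambda>_. s) (sl Z t)" by (rule sn_le_wn[OF jmeas_slice[OF Z]]) simp
  also have "... \<le> EN T Z" by (rule EN_upper[OF that])
  also have "... \<le> NM T Z" by (simp add: NM_def)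
  finally show ?thesis using N by (rule order.strict_trans1)
 qed
 define G where "G = (\<lambda>\<xi>. w s \<xi> * (\<Sum>i\<in>UNIV. 2 * (norm (z0 i \<xi>) + enn2real (ftot T Z i \<xi>))))"
 note [measurable] = ftot_measurable[OF Z] slice_measD[OF z0(1)]
 have G: "integrable lborel G"
 proof (rule integrableI_nonneg)
  show "G \<in> borel_measurable lborel" unfolding G_def by measurable
  show "AE \<xi> in lborel. 0 \<le> G \<xi>" unfolding G_def by (intro AE_I2 mult_nonneg_nonneg sum_nonneg) auto
  have "(\<integral>\<^sup>+\<xi>. ennreal (G \<xi>) \<partial>lborel) \<le> (\<integral>\<^sup>+\<xi>. 2 * (\<Sum>i\<in>UNIV. ennreal (w s \<xi> * norm (z0 i \<xi>))) + 2 * (ennreal (w s \<xi>) * (\<Sum>i\<in>UNIV. ftot T Z i \<xi>)) \<partial>lborel)"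
  proof (rule nn_integral_mono, goal_cases)
   case (1 \<xi>)
   have "G \<xi> = 2 * (\<Sum>i\<in>UNIV. w s \<xi> * norm (z0 i \<xi>)) + 2 * (w s \<xi> * (\<Sum>i\<in>UNIV. enn2real (ftot T Z i \<xi>)))"
    unfolding G_def by (simp add: sum_distrib_left sum.distrib distrib_left mult_ac)
   also have "ennreal ... = 2 * (\<Sum>i\<in>UNIV. ennreal (w s \<xi> * norm (z0 i \<xi>))) + 2 * (ennreal (w s \<xi>) * (\<Sum>i\<in>UNIV. ennreal (enn2real (ftot T Z i \<xi>))))"
    by (simp only: ennreal_plus ennreal_mult sum_nonneg mult_nonneg_nonneg w_nonneg norm_ge_zero enn2real_nonneg
       ennreal_numeral zero_le_numeral sum_ennreal[symmetric])
   also have "... \<le> 2 * (\<Sum>i\<in>UNIV. ennreal (w s \<xi> * norm (z0 i \<xi>))) + 2 * (ennreal (w s \<xi>) * (\<Sum>i\<in>UNIV. ftot T Z i \<xi>))"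
    by (intro add_left_mono mult_left_mono sum_mono) (auto simp: ennreal_enn2real_if)
   finally show ?case .
  qed
  also have "... = 2 * wn (\<lambda>_. s) z0 + 2 * (\<integral>\<^sup>+\<xi>. ennreal (w s \<xi>) * (\<Sum>i\<in>UNIV. ftot T Z i \<xi>) \<partial>lborel)"
   unfolding wn_def by (simp add: nn_integral_add nn_integral_cmult)
  also have "... < \<infinity>" using z0(2) ftot_finite(1)[OF Z T N] by (simp add: ennreal_mult_less_top)
  finally show "(\<integral>\<^sup>+\<xi>. ennreal (G \<xi>) \<partial>lborel) < \<infinity>" .
 qed
 show ?thesis
  unfolding C_T_def
 proof (intro CollectI ballI conjI)
  fix t assume t: "t \<in> {0..T}"
  show "mk (sl Z t) \<in> elems (X s)" using elems_iff[OF L[OF t]] sn[OF t] by blast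
  show "((\<lambda>r. nrm (X s) (mk (\<lambda>i. Z i r) - mk (sl Z t))) \<longlongrightarrow> 0) (at t within {0..T})"
   unfolding tendsto_at_iff_sequentially
  proof (intro allI impI)
   fix Y assume "\<forall>i. Y i \<in> {0..T} - {t}" and Yt: "Y \<longlonglongrightarrow> t"
   then have Y: "Y n \<in> {0..T}" for n by auto
   have eq: "nrm (X s) (mk (\<lambda>i. Z i (Y n)) - mk (sl Z t)) = (LINT \<xi>|lborel. w s \<xi> * vnorm J (\<lambda>i. Z i (Y n) \<xi> - Z i t \<xi>))" for n
    using mk_nrm[OF L1_diff[OF L[OF Y] L[OF t]]] mk_diff[OF L[OF Y] L[OF t]] by simp
   have fpY: "AE \<xi> in lborel. \<forall>n. \<forall>i. Z i (Y n) \<xi> = Phi z0 Z i (Y n) \<xi>" using fp[OF Y] by (subst AE_all_countable) blast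
   have "(\<lambda>n. LINT \<xi>|lborel. w s \<xi> * vnorm J (\<lambda>i. Z i (Y n) \<xi> - Z i t \<xi>)) \<longlonglongrightarrow> (LINT \<xi>|(lborel :: (real^3) measure). 0)"
   proof (rule integral_dominated_convergence[OF _ _ G])
    show "(\<lambda>\<xi>. w s \<xi> * vnorm J (\<lambda>i. Z i (Y n) \<xi> - Z i t \<xi>)) \<in> borel_measurable lborel" for n
     using slice_vnorm_measurable[OF L1_meas[OF L1_diff[OF L[OF Y] L[OF t]]]] by simp
    show "AE \<xi> in lborel. (\<lambda>n. w s \<xi> * vnorm J (\<lambda>i. Z i (Y n) \<xi> - Z i t \<xi>)) \<longlonglongrightarrow> 0"
     using fpY fp[OF t] ftot_finite(2)[OF Z T N]
    proof eventually_elim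
     case (elim \<xi>)
     have "(\<lambda>n. Z i (Y n) \<xi> - Z i t \<xi>) \<longlonglongrightarrow> 0" for i
      using Phi_continuous[OF Z _ t Y Yt, of i \<xi> z0] elim by (simp add: LIM_zero)
     then have "(\<lambda>n. w s \<xi> * sqrt (\<Sum>i\<in>J. (norm (Z i (Y n) \<xi> - Z i t \<xi>))\<^sup>2)) \<longlonglongrightarrow> w s \<xi> * sqrt (\<Sum>i\<in>J. (norm (0::complex))\<^sup>2)"
      by (intro tendsto_intros)
     then show ?case by (simp add: vnorm_def L2_set_def)
    qed
    show "AE \<xi> in lborel. norm (w s \<xi> * vnorm J (\<lambda>i. Z i (Y n) \<xi> - Z i t \<xi>)) \<le> G \<xi>" for n
     using fpY fp[OF t] ftot_finite(2)[OF Z T N]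
    proof eventually_elim
     case (elim \<xi>)
     have b: "norm (Z i (Y n) \<xi> - Z i t \<xi>) \<le> 2 * (norm (z0 i \<xi>) + enn2real (ftot T Z i \<xi>))" for i
      using norm_triangle_ineq4[of "Z i (Y n) \<xi>" "Z i t \<xi>"] Phi_bound[OF Z _ Y, of i \<xi> z0 n] Phi_bound[OF Z _ t, of i \<xi> z0] elim
      by fastforce
     have "vnorm J (\<lambda>i. Z i (Y n) \<xi> - Z i t \<xi>) \<le> (\<Sum>i\<in>J. norm (Z i (Y n) \<xi> - Z i t \<xi>))" by (rule vnorm_le_sum)
     also have "... \<le> (\<Sum>i\<in>UNIV. norm (Z i (Y n) \<xi> - Z i t \<xi>))" by (rule sum_mono2) auto
     also have "... \<le> (\<Sum>i\<in>UNIV. 2 * (norm (z0 i \<xi>) + enn2real (ftot T Z i \<xi>)))" by (rule sum_mono) (rule b)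
     finally show ?case unfolding G_def by (simp add: abs_mult mult_left_mono)
    qed
   qed simp
   then show "((\<lambda>r. nrm (X s) (mk (\<lambda>i. Z i r) - mk (sl Z t))) \<circ> Y) \<longlonglongrightarrow> 0" by (simp add: o_def eq)
  qed
 qed
qed

text \<open>Young's inequality in the form \<open>x \<le> \<mu> + \<mu>\<^sup>1\<^sup>-\<^sup>p
  x\<^sup>p\<close> for \<open>x = |\<xi>|\<^sup>2\<^sup>\<gamma>\<^sup>/\<^sup>p\<close>.\<close>

lemma sn_interpolate:
 assumes z: "slice_meas z" and p: "p \<ge> 1" and \<mu>: "\<mu> > 0"
 shows "sn (s + 2 * \<gamma> / p) z \<le> ennreal \<mu> * sn s z + ennreal (\<mu> powr (1 - p)) * sn (s + 2 * \<gamma>) z"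
proof -
 note [measurable] = slice_vnorm_measurable[OF z]
 have le: "w (s + 2 * \<gamma> / p) \<xi> \<le> \<mu> * w s \<xi> + \<mu> powr (1 - p) * w (s + 2 * \<gamma>) \<xi>" for \<xi>
 proof -
  let ?x = "norm \<xi> powr (2 * \<gamma> / p)"
  have xp: "?x powr p = norm \<xi> powr (2 * \<gamma>)" using p by (simp add: powr_powr)
  have "?x \<le> \<mu> + \<mu> powr (1 - p) * ?x powr p"
  proof (cases "?x \<le> \<mu>")
   case False
   have "?x = ?x powr (1 - p) * ?x powr p" using False \<mu> by (simp flip: powr_add)
   also have "... \<le> \<mu> powr (1 - p) * ?x powr p" using False \<mu> p by (intro mult_right_mono powr_mono2') auto
   finally show ?thesis using \<mu> by linarith
  qed (simp add: add_increasing2)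
  then have "?x * w s \<xi> \<le> (\<mu> + \<mu> powr (1 - p) * norm \<xi> powr (2 * \<gamma>)) * w s \<xi>"
   unfolding xp by (intro mult_right_mono) auto
  then show ?thesis unfolding w_shift by (simp add: algebra_simps)
 qed
 have "sn (s + 2 * \<gamma> / p) z \<le> (\<integral>\<^sup>+\<xi>. ennreal \<mu> * ennreal (w s \<xi> * vnorm J (\<lambda>i. z i \<xi>))
   + ennreal (\<mu> powr (1 - p)) * ennreal (w (s + 2 * \<gamma>) \<xi> * vnorm J (\<lambda>i. z i \<xi>)) \<partial>lborel)"
  unfolding sn_def
 proof (rule nn_integral_mono, goal_cases)
  case (1 \<xi>)
  have "w (s + 2 * \<gamma> / p) \<xi> * vnorm J (\<lambda>i. z i \<xi>) \<le> (\<mu> * w s \<xi> + \<mu> powr (1 - p) * w (s + 2 * \<gamma>) \<xi>) * vnorm J (\<lambda>i. z i \<xi>)"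
   by (intro mult_right_mono le) simp
  also have "... = \<mu> * (w s \<xi> * vnorm J (\<lambda>i. z i \<xi>)) + \<mu> powr (1 - p) * (w (s + 2 * \<gamma>) \<xi> * vnorm J (\<lambda>i. z i \<xi>))"
   by (simp add: algebra_simps)
  finally show ?case
   using \<mu> by (subst (1 2) ennreal_mult[symmetric]) (auto simp: ennreal_leI simp flip: ennreal_plus)
 qed
 also have "... = ennreal \<mu> * sn s z + ennreal (\<mu> powr (1 - p)) * sn (s + 2 * \<gamma>) z"
  unfolding sn_def by (simp add: nn_integral_add nn_integral_cmult)
 finally show ?thesis .
qed

text \<open>The choice \<open>\<mu>\<^sup>p = max 1 h\<close> balances the two terms, where \<open>h\<close>
 is the norm in \<open>\<X>\<^sup>s\<^sup>+\<^sup>2\<^sup>\<gamma>\<close>.\<close>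

lemma sn_power_le:
 assumes z: "slice_meas z" and p: "p \<ge> 1" and E: "sn s z \<le> ennreal E" "E \<ge> 0" and H: "sn (s + 2 * \<gamma>) z < \<infinity>"
 shows "sn (s + 2 * \<gamma> / p) z < \<infinity>"
  and "enn2real (sn (s + 2 * \<gamma> / p) z) powr p \<le> (E + 1) powr p * (1 + enn2real (sn (s + 2 * \<gamma>) z))"
proof -
 define h where "h = enn2real (sn (s + 2 * \<gamma>) z)"
 have h: "sn (s + 2 * \<gamma>) z = ennreal h" "h \<ge> 0" using H by (auto simp: h_def less_top)
 define \<mu> where "\<mu> = max 1 h powr (1 / p)"
 have \<mu>: "\<mu> > 0" by (simp add: \<mu>_def)
 have \<mu>p: "\<mu> powr p = max 1 h" using p by (simp add: \<mu>_def powr_powr)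
 have "sn (s + 2 * \<gamma> / p) z \<le> ennreal \<mu> * ennreal E + ennreal (\<mu> powr (1 - p)) * ennreal h"
  using sn_interpolate[OF z p \<mu>] E(1) unfolding h(1) by (meson add_right_mono mult_left_mono order_trans zero_le)
 also have "... = ennreal (\<mu> * E + \<mu> powr (1 - p) * h)" using \<mu> E h by (simp add: ennreal_mult ennreal_plus)
 also have "... \<le> ennreal (\<mu> * (E + 1))"
 proof (rule ennreal_leI)
  have "\<mu> powr (1 - p) * h \<le> \<mu> powr (1 - p) * \<mu> powr p" unfolding \<mu>p by (intro mult_left_mono) auto
  also have "... = \<mu>" using \<mu> by (simp flip: powr_add)
  finally show "\<mu> * E + \<mu> powr (1 - p) * h \<le> \<mu> * (E + 1)" by (simp add: algebra_simps)
 qed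
 finally have le: "sn (s + 2 * \<gamma> / p) z \<le> ennreal (\<mu> * (E + 1))" .
 then show "sn (s + 2 * \<gamma> / p) z < \<infinity>" by (rule order.strict_trans1) simp
 have "enn2real (sn (s + 2 * \<gamma> / p) z) \<le> \<mu> * (E + 1)"
  using enn2real_mono[OF le] \<mu> E by simp
 then have "enn2real (sn (s + 2 * \<gamma> / p) z) powr p \<le> (\<mu> * (E + 1)) powr p" using p by (intro powr_mono2) auto
 also have "... = (E + 1) powr p * max 1 h" using \<mu> E by (simp add: powr_mult \<mu>p)
 also have "... \<le> (E + 1) powr p * (1 + h)" using h by (intro mult_left_mono) auto
 finally show "enn2real (sn (s + 2 * \<gamma> / p) z) powr p \<le> (E + 1) powr p * (1 + enn2real (sn (s + 2 * \<gamma>) z))" by (simp add: h_def)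
qed

end

context component_space begin

text \<open>Truncation to low frequencies, on which the norms of all spaces
  \<open>\<X>\<^sup>s\<^sup>+\<^sup>q\<close> with \<open>q \<ge> 0\<close> are controlled by that of
  \<open>\<X>\<^sup>s\<close>.\<close>

definition low :: "nat => slice => slice" where
 "low n z = (\<lambda>i \<xi>. if norm \<xi> \<le> real n then z i \<xi> else 0)"

lemma L1_low: assumes "L1 z" shows "L1 (low n z)"
proof
 fix i
 have "integrable lborel (z i)" using assms by blast
 from integrable_mult_indicator[OF _ this, of "cball 0 (real n)"]
 have "integrable lborel (\<lambda>\<xi>. indicator (cball 0 (real n)) \<xi> *\<^sub>R z i \<xi>)" by simp
 moreover have "(\<lambda>\<xi>. indicator (cball 0 (real n)) \<xi> *\<^sub>R z i \<xi>) = low n z i" by (auto simp: low_def indicator_def fun_eq_iff)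
 ultimately show "integrable lborel (low n z i)" by simp
qed

lemma sn_low: assumes z: "slice_meas z" and q: "q \<ge> 0" shows "sn (s + q) (low n z) \<le> ennreal (real n powr q) * sn s z"
proof -
 note [measurable] = slice_vnorm_measurable[OF z]
 have "sn (s + q) (low n z) \<le> (\<integral>\<^sup>+\<xi>. ennreal (real n powr q) * ennreal (w s \<xi> * vnorm J (\<lambda>i. z i \<xi>)) \<partial>lborel)"
  unfolding sn_def
 proof (rule nn_integral_mono, goal_cases)
  case (1 \<xi>)
  show ?case
  proof (cases "norm \<xi> \<le> real n")
   case True
   have "w (s + q) \<xi> * vnorm J (\<lambda>i. low n z i \<xi>) = norm \<xi> powr q * (w s \<xi> * vnorm J (\<lambda>i. z i \<xi>))"
    using True by (simp add: low_def w_shift)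
   also have "... \<le> real n powr q * (w s \<xi> * vnorm J (\<lambda>i. z i \<xi>))"
    using True q by (intro mult_right_mono powr_mono2) auto
   finally show ?thesis by (subst ennreal_mult[symmetric]) (auto simp: ennreal_leI)
  qed (simp add: low_def vnorm_def L2_set_def)
 qed
 also have "... = ennreal (real n powr q) * sn s z" unfolding sn_def by (rule nn_integral_cmult) measurable
 finally show ?thesis .
qed

lemma high_frequency_limit:
 assumes z: "L1 z" and fin: "sn r z < \<infinity>"
 shows "(\<lambda>n. enn2real (sn r (sdiff (low n z) z))) \<longlonglongrightarrow> 0"
proof -
 have L: "L1 (sdiff (low n z) z)" for n by (rule L1_diff[OF L1_low[OF z] z])
 have "(\<lambda>n. LINT \<xi>|lborel. w r \<xi> * vnorm J (\<lambda>i. low n z i \<xi> - z i \<xi>)) \<longlonglongrightarrow> (LINT \<xi>|(lborel :: (real^3) measure). 0)"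
 proof (rule integral_dominated_convergence)
  show "integrable lborel (\<lambda>\<xi>. w r \<xi> * vnorm J (\<lambda>i. z i \<xi>))"
   using elems_iff[OF z] mk_elems[OF z] fin by blast
  show "(\<lambda>\<xi>. w r \<xi> * vnorm J (\<lambda>i. low n z i \<xi> - z i \<xi>)) \<in> borel_measurable lborel" for n
   using slice_vnorm_measurable[OF L1_meas[OF L]] by simp
  show "AE \<xi> in lborel. (\<lambda>n. w r \<xi> * vnorm J (\<lambda>i. low n z i \<xi> - z i \<xi>)) \<longlonglongrightarrow> 0"
  proof (rule AE_I2, goal_cases)
   case (1 \<xi>)
   obtain N :: nat where N: "norm \<xi> \<le> real N" using real_arch_simple by blast
   have "w r \<xi> * vnorm J (\<lambda>i. low n z i \<xi> - z i \<xi>) = 0" if "n \<ge> N" for n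
   proof -
    have "norm \<xi> \<le> real n" using N that by linarith
    then show ?thesis by (simp add: low_def vnorm_def L2_set_def)
   qed
   then have "eventually (\<lambda>n. w r \<xi> * vnorm J (\<lambda>i. low n z i \<xi> - z i \<xi>) = 0) sequentially"
    unfolding eventually_sequentially by blast
   then show ?case by (rule tendsto_eventually)
  qed
  show "AE \<xi> in lborel. norm (w r \<xi> * vnorm J (\<lambda>i. low n z i \<xi> - z i \<xi>)) \<le> w r \<xi> * vnorm J (\<lambda>i. z i \<xi>)" for n
  proof (rule AE_I2, goal_cases)
   case (1 \<xi>)
   have "vnorm J (\<lambda>i. low n z i \<xi> - z i \<xi>) \<le> vnorm J (\<lambda>i. z i \<xi>)" by (rule vnorm_mono) (simp add: low_def)
   then show ?case
    by (simp add: mult_left_mono)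
  qed
 qed simp
 moreover have "enn2real (sn r (sdiff (low n z) z)) = (LINT \<xi>|lborel. w r \<xi> * vnorm J (\<lambda>i. low n z i \<xi> - z i \<xi>))" for n
  using nrm_sn[OF L, of r n] mk_nrm[OF L, of r n] by simp
 ultimately show ?thesis by simp
qed

text \<open>The simple functions sample the truncated solution at finitely many times. Continuity is known in
  \<open>\<X>\<^sup>s\<close> only, so the mesh is chosen after the truncation level: fine enough to beat the
  factor \<open>n\<^sup>q\<close> that truncation costs.\<close>

lemma mk_Lp:
 assumes Z: "jmeas Z" and T: "T > 0" and L: "\<And>t. t \<in> {0..T} ==> L1 (sl Z t)"
  and E: "\<And>t. t \<in> {0..T} ==> sn s (sl Z t) \<le> ennreal E" "E \<ge> 0"
  and H: "(\<integral>\<^sup>+t. sn (s + 2 * \<gamma>) (sl Z t) * indicator {0..T} t \<partial>lborel) < \<infinity>"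
  and C: "(\<lambda>t. mk (sl Z t)) \<in> C_T T (X s)" and p: "p \<ge> 1"
 shows "(\<lambda>t. mk (sl Z t)) \<in> Lp_T p T (X (s + 2 * \<gamma> / p))"
proof -
 define q where "q = 2 * \<gamma> / p"
 have q: "q \<ge> 0" using \<gamma> p by (simp add: q_def)
 note [measurable] = sn_measurable[OF Z]
 note jm = jmeas_slice[OF Z]
 have sfin: "sn s (sl Z t) < \<infinity>" if "t \<in> {0..T}" for t using E(1)[OF that] by (rule order.strict_trans1) simp
 have Hfin: "AE t in lborel. t \<in> {0..T} \<longrightarrow> sn (s + 2 * \<gamma>) (sl Z t) < \<infinity>"
 proof -
  have "AE t in lborel. sn (s + 2 * \<gamma>) (sl Z t) * indicator {0..T} t \<noteq> \<infinity>"
   using H by (intro nn_integral_PInf_AE) auto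
  then show ?thesis by eventually_elim (auto simp: less_top)
 qed
 have fin: "AE t in lborel. t \<in> {0..T} \<longrightarrow> sn (s + q) (sl Z t) < \<infinity>"
  using Hfin by eventually_elim (use sn_power_le(1)[OF jm p E(1) E(2)] in \<open>simp add: q_def\<close>)
 have integ: "integrable (lebesgue_on {0..T}) (\<lambda>t. nrm (X (s + q)) (mk (sl Z t)) powr p)"
 proof -
  have "integrable (lebesgue_on {0..T}) (\<lambda>t. (E + 1) powr p * (1 + enn2real (sn (s + 2 * \<gamma>) (sl Z t))))"
   using H by (intro integrable_mult_right Bochner_Integration.integrable_add integrable_lebesgue_on_enn2real)
    (auto intro!: finite_measure.integrable_const finite_measure_lebesgue_on)
  then have "integrable (lebesgue_on {0..T}) (\<lambda>t. enn2real (sn (s + q) (sl Z t)) powr p)"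
  proof (rule Bochner_Integration.integrable_bound)
   show "(\<lambda>t. enn2real (sn (s + q) (sl Z t)) powr p) \<in> borel_measurable (lebesgue_on {0..T})"
    by (rule measurable_lebesgue_on_borel) measurable
   show "AE t in lebesgue_on {0..T}. norm (enn2real (sn (s + q) (sl Z t)) powr p)
     \<le> norm ((E + 1) powr p * (1 + enn2real (sn (s + 2 * \<gamma>) (sl Z t))))"
    unfolding AE_lebesgue_on_iff using Hfin
   proof eventually_elim
    case (elim t)
    show ?case
    proof
     assume t: "t \<in> {0..T}"
     show "norm (enn2real (sn (s + q) (sl Z t)) powr p) \<le> norm ((E + 1) powr p * (1 + enn2real (sn (s + 2 * \<gamma>) (sl Z t))))"
      using sn_power_le(2)[OF jm p E(1)[OF t] E(2)] elim t by (simp add: q_def abs_mult)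
    qed
   qed
  qed
  moreover have "integrable (lebesgue_on {0..T}) (\<lambda>t. nrm (X (s + q)) (mk (sl Z t)) powr p)
    \<longleftrightarrow> integrable (lebesgue_on {0..T}) (\<lambda>t. enn2real (sn (s + q) (sl Z t)) powr p)"
   by (rule Bochner_Integration.integrable_cong[OF refl]) (simp add: nrm_sn[OF L])
  ultimately show ?thesis by blast
 qed
 define e where "e = (\<lambda>n::nat. 1 / (real (Suc n) * (1 + real n powr q)))"
 have e: "e n > 0" for n by (simp add: e_def add_pos_nonneg)
 obtain m where m': "\<forall>n. m n > 0 \<and> (\<forall>t\<in>{0..T}. nrm (X s) (mk (\<lambda>i. Z i (samp T (m n) (sidx T (m n) t))) - mk (sl Z t)) < e n)"
  using sampling[OF C T e] by (rule exE)
 have m: "m n > 0" "t \<in> {0..T} ==> nrm (X s) (mk (\<lambda>i. Z i (samp T (m n) (sidx T (m n) t))) - mk (sl Z t)) < e n" for n t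
  using spec[OF m', of n] by simp_all
 define S where "S = (\<lambda>n t. mk (low n (\<lambda>i. Z i (samp T (m n) (sidx T (m n) t)))))"
 have sI: "samp T (m n) j \<in> {0..T}" for n j using T by (intro samp_in) simp
 have Sel: "S n t \<in> elems (X (s + q))" for n t
 proof -
  have "sn (s + q) (low n (\<lambda>i. Z i (samp T (m n) (sidx T (m n) t)))) \<le> ennreal (real n powr q) * sn s (\<lambda>i. Z i (samp T (m n) (sidx T (m n) t)))"
   by (rule sn_low[OF jm q])
  also have "... < \<infinity>" using sfin[OF sI] by (simp add: ennreal_mult_less_top)
  finally show ?thesis unfolding S_def elems_iff[OF L1_low[OF L[OF sI]]] .
 qed
 have conv: "(\<lambda>n. nrm (X (s + q)) (S n t - mk (sl Z t))) \<longlonglongrightarrow> 0" if t: "t \<in> {0..T}" and ft: "sn (s + q) (sl Z t) < \<infinity>" for t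
 proof (rule tendsto_sandwich)
  let ?z = "\<lambda>i. Z i t" and ?y = "\<lambda>n i. Z i (samp T (m n) (sidx T (m n) t))"
  have Lz: "L1 ?z" and Ly: "L1 (?y n)" for n using L t sI by auto
  have eq: "nrm (X (s + q)) (S n t - mk ?z) = enn2real (sn (s + q) (sdiff (low n (?y n)) ?z))" for n
   unfolding S_def mk_diff[OF L1_low[OF Ly] Lz] by (rule nrm_sn[OF L1_diff[OF L1_low[OF Ly] Lz]])
  have le: "nrm (X (s + q)) (S n t - mk ?z) \<le> 1 / real (Suc n) + enn2real (sn (s + q) (sdiff (low n ?z) ?z))" for n
  proof -
   have f2: "sn (s + q) (sdiff (low n ?z) ?z) < \<infinity>"
   proof (rule sn_sdiff_finite[OF L1_low[OF Lz] Lz _ ft])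
    show "sn (s + q) (low n ?z) < \<infinity>"
     by (rule order.strict_trans1[OF sn_low[OF jm q]]) (use sfin[OF t] in \<open>simp add: ennreal_mult_less_top\<close>)
   qed
   have "sn (s + q) (low n (sdiff (?y n) ?z)) \<le> ennreal (real n powr q) * sn s (sdiff (?y n) ?z)"
    by (rule sn_low[OF L1_meas[OF L1_diff[OF Ly Lz]] q])
   also have "... \<le> ennreal (real n powr q) * ennreal (e n)"
    unfolding nrm_diff[OF Ly Lz sfin[OF sI] sfin[OF t]] using m(2)[OF t, of n] by (intro mult_left_mono ennreal_leI) auto
   also have "... = ennreal (real n powr q * e n)" using e[of n] by (simp add: ennreal_mult)
   also have "... \<le> ennreal (1 / real (Suc n))"
   proof (rule ennreal_leI)
    have "real n powr q * e n = (real n powr q / (1 + real n powr q)) * (1 / real (Suc n))" by (simp add: e_def)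
    also have "... \<le> 1 * (1 / real (Suc n))" by (intro mult_right_mono) (auto simp: divide_le_eq_1 add_pos_nonneg)
    finally show "real n powr q * e n \<le> 1 / real (Suc n)" by simp
   qed
   finally have f1: "sn (s + q) (low n (sdiff (?y n) ?z)) \<le> ennreal (1 / real (Suc n))" .
   have "sn (s + q) (sdiff (low n (?y n)) ?z) \<le> sn (s + q) (low n (sdiff (?y n) ?z)) + sn (s + q) (sdiff (low n ?z) ?z)"
   proof (rule sn_triangle)
    show "slice_meas (low n (sdiff (?y n) ?z))" by (rule L1_meas[OF L1_low[OF L1_diff[OF Ly Lz]]])
    show "slice_meas (sdiff (low n ?z) ?z)" by (rule L1_meas[OF L1_diff[OF L1_low[OF Lz] Lz]])
   qed (simp add: low_def)
   also have "... \<le> ennreal (1 / real (Suc n)) + ennreal (enn2real (sn (s + q) (sdiff (low n ?z) ?z)))"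
    using f1 f2 by (intro add_mono) (auto simp: less_top)
   also have "... = ennreal (1 / real (Suc n) + enn2real (sn (s + q) (sdiff (low n ?z) ?z)))"
    by (rule ennreal_plus[symmetric]) auto
   finally show ?thesis unfolding eq by (intro enn2real_leI) auto
  qed
  show "eventually (\<lambda>n. nrm (X (s + q)) (S n t - mk ?z) \<le> 1 / real (Suc n) + enn2real (sn (s + q) (sdiff (low n ?z) ?z))) sequentially"
   using le by (intro always_eventually) blast
  show "eventually (\<lambda>n. 0 \<le> nrm (X (s + q)) (S n t - mk ?z)) sequentially" by (simp add: eq)
  show "(\<lambda>n. 1 / real (Suc n) + enn2real (sn (s + q) (sdiff (low n ?z) ?z))) \<longlonglongrightarrow> 0"
   using tendsto_add[OF LIMSEQ_Suc[OF lim_1_over_n] high_frequency_limit[OF Lz ft]] by simp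
 qed simp
 have simp: "simple_function (lebesgue_on {0..T}) (S n)" for n
  unfolding S_def by (rule sidx_simple[OF T, of "\<lambda>j. mk (low n (\<lambda>i. Z i (samp T (m n) j)))"])
 have "(AE t in lebesgue_on {0..T}. mk (sl Z t) \<in> elems (X (s + q)))"
  unfolding AE_lebesgue_on_iff using fin by eventually_elim (use elems_iff[OF L] in blast)
 moreover have "AE t in lebesgue_on {0..T}. (\<lambda>n. nrm (X (s + q)) (S n t - mk (sl Z t))) \<longlonglongrightarrow> 0"
  unfolding AE_lebesgue_on_iff using fin by eventually_elim (use conv in blast)
 ultimately have "(\<lambda>t. mk (sl Z t)) \<in> Lp_T p T (X (s + q))"
  unfolding Lp_T_def by (intro CollectI conjI exI[of _ S] allI ballI simp Sel integ)
 then show ?thesis by (simp only: q_def)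
qed

text \<open>The Bochner norm in the form in which it is added to other extended integrals.\<close>

lemma Lp_norm_one:
 assumes Z: "jmeas Z" and L: "\<And>t. t \<in> {0..T} ==> L1 (sl Z t)" and f: "\<And>t. t \<in> {0..T} ==> f t = mk (sl Z t)"
  and F: "f \<in> Lp_T 1 T (X r)"
 shows "(\<integral>\<^sup>+t. sn r (sl Z t) * indicator {0..T} t \<partial>lborel) = ennreal (Lp_norm 1 T (X r) f)"
proof -
 note [measurable] = sn_measurable[OF Z]
 have nf: "nrm (X r) (f t) = enn2real (sn r (sl Z t))" if "t \<in> {0..T}" for t
  unfolding f[OF that] by (rule nrm_sn[OF L[OF that]])
 have el: "AE t in lebesgue_on {0..T}. f t \<in> elems (X r)" and int: "integrable (lebesgue_on {0..T}) (\<lambda>t. nrm (X r) (f t) powr 1)"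
  using F by (auto simp: Lp_T_def)
 have fin: "AE t in lborel. t \<in> {0..T} \<longrightarrow> sn r (sl Z t) < \<infinity>"
  using el[unfolded AE_lebesgue_on_iff] by eventually_elim (use f elems_iff[OF L] in auto)
 let ?h = "\<lambda>t. indicator {0..T} t *\<^sub>R enn2real (sn r (sl Z t))"
 have "integrable (lebesgue_on {0..T}) (\<lambda>t. nrm (X r) (f t) powr 1) \<longleftrightarrow> integrable (lebesgue_on {0..T}) (\<lambda>t. enn2real (sn r (sl Z t)))"
  by (rule Bochner_Integration.integrable_cong[OF refl]) (simp add: nf)
 then have i: "integrable lborel ?h" using int by (simp add: integrable_restrict_space integrable_completion)
 have "(LINT t|lebesgue_on {0..T}. nrm (X r) (f t) powr 1) = (LINT t|lebesgue_on {0..T}. enn2real (sn r (sl Z t)))"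
  by (rule Bochner_Integration.integral_cong[OF refl]) (simp add: nf)
 also have "... = (LINT t|lborel. ?h t)" by (simp add: integral_restrict_space integral_completion)
 finally have eq: "Lp_norm 1 T (X r) f = (LINT t|lborel. ?h t)" unfolding Lp_norm_def by simp
 have "(\<integral>\<^sup>+t. sn r (sl Z t) * indicator {0..T} t \<partial>lborel) = (\<integral>\<^sup>+t. ennreal (?h t) \<partial>lborel)"
  by (rule nn_integral_cong_AE) (use fin in \<open>eventually_elim; auto simp: indicator_def less_top\<close>)
 also have "... = ennreal (LINT t|lborel. ?h t)" by (rule nn_integral_eq_integral[OF i]) auto
 finally show ?thesis by (simp only: eq)
qed

text \<open>The transform of \<open>f t\<close> is determined only up to a null set for each \<open>t\<close>,
  so measurability in \<open>t\<close> is not for free. Sampling with errors \<open>2\<^sup>-\<^sup>n\<close>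
 gives jointly measurable step functions that converge almost everywhere in \<open>\<xi>\<close> for every
 single \<open>t\<close>.\<close>

lemma exists_state:
 assumes f: "f \<in> C_T T (X s)" and T: "T > 0"
 shows "\<exists>V. jmeas V \<and> (\<forall>t\<in>{0..T}. L1 (sl V t) \<and> f t = mk (sl V t) \<and> (AE \<xi> in lborel. \<forall>i. V i t \<xi> = cf (f t) i \<xi>))"
proof -
 obtain m where m: "\<And>n. m n > 0"
  "\<And>n t. t \<in> {0..T} ==> nrm (X s) (f (samp T (m n) (sidx T (m n) t)) - f t) < (1/2)^n"
 proof -
  have "\<exists>m. \<forall>n. m n > 0 \<and> (\<forall>t\<in>{0..T}. nrm (X s) (f (samp T (m n) (sidx T (m n) t)) - f t) < (1/2)^n)"
   by (rule sampling[OF f T]) simp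
  then show ?thesis using that by blast
 qed
 have sI: "samp T (m n) j \<in> {0..T}" for n j using T by (intro samp_in) simp
 define W where "W = (\<lambda>n i t. cf (f (samp T (m n) (sidx T (m n) t))) i)"
 have W: "(\<lambda>p. W n i (fst p) (snd p)) \<in> borel_measurable (borel \<Otimes>\<^sub>M borel)" for n i
  unfolding W_def
 proof (rule measurable_compose_countable[where g = "\<lambda>p. sidx T (m n) (fst p)"])
  show "(\<lambda>p. cf (f (samp T (m n) j)) i (snd p)) \<in> borel_measurable (borel \<Otimes>\<^sub>M borel)" for j
   using slice_measD[OF L1_meas[OF L1_cf[OF C_T_elems[OF f sI]]], of n j i] by measurable
 qed measurable
 define V where "V = (\<lambda>i t \<xi>. lim (\<lambda>n. W n i t \<xi>))"
 have V: "jmeas V" unfolding jmeas_def V_def using W by (intro allI borel_measurable_lim_metric)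
 have VE: "AE \<xi> in lborel. \<forall>i. V i t \<xi> = cf (f t) i \<xi>" if t: "t \<in> {0..T}" for t
 proof (rule AE_all_option)
  fix i
  note E = C_T_elems[OF f sI] C_T_elems[OF f t]
  note mm = L1_meas[OF L1_cf[OF E(1)]] L1_meas[OF L1_cf[OF E(2)]]
  show "AE \<xi> in lborel. V i t \<xi> = cf (f t) i \<xi>"
  proof (cases "i \<in> J")
   case False
   then show ?thesis by (intro AE_I2) (simp add: V_def W_def cf_outside lim_const)
  next
   case i: True
   let ?a = "\<lambda>n \<xi>. w s \<xi> * norm (W n i t \<xi> - cf (f t) i \<xi>)"
   have am: "(\<lambda>\<xi>. ennreal (?a n \<xi>)) \<in> borel_measurable lborel" for n
    unfolding W_def using slice_measD[OF mm(1), of n "sidx T (m n) t" i] slice_measD[OF mm(2), of i] by measurable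
   have b: "(\<integral>\<^sup>+\<xi>. ennreal (?a n \<xi>) \<partial>lborel) \<le> ennreal ((1/2)^n)" for n
   proof -
    let ?y = "cf (f (samp T (m n) (sidx T (m n) t)))"
    have "(\<integral>\<^sup>+\<xi>. ennreal (?a n \<xi>) \<partial>lborel) \<le> sn s (sdiff ?y (cf (f t)))"
     unfolding W_def by (rule component_le_sn[OF i])
    also have "... = ennreal (nrm (X s) (f (samp T (m n) (sidx T (m n) t)) - f t))"
     using nrm_diff[OF L1_cf[OF E(1)] L1_cf[OF E(2)] sn_cf[OF E(1)] sn_cf[OF E(2)]] by (simp add: mk_cf[OF E(1)] mk_cf[OF E(2)])
    also have "... \<le> ennreal ((1/2)^n)" using m(2)[OF t, of n] by (intro ennreal_leI) simp
    finally show ?thesis .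
   qed
   have "(\<integral>\<^sup>+\<xi>. (\<Sum>n. ennreal (?a n \<xi>)) \<partial>lborel) = (\<Sum>n. \<integral>\<^sup>+\<xi>. ennreal (?a n \<xi>) \<partial>lborel)"
    by (rule nn_integral_suminf[OF am])
   also have "... \<le> (\<Sum>n. ennreal ((1/2)^n))" by (intro suminf_le b) auto
   also have "... = ennreal (\<Sum>n. (1/2)^n)" by (rule suminf_ennreal2) (auto intro: summable_geometric)
   also have "... < \<infinity>" by simp
   finally have "AE \<xi> in lborel. (\<Sum>n. ennreal (?a n \<xi>)) \<noteq> \<infinity>" using am by (intro nn_integral_PInf_AE) auto
   moreover have "AE \<xi> in lborel. \<xi> \<noteq> (0::real^3)" by (rule AE_lborel_singleton)
   ultimately show ?thesis
   proof eventually_elim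
    case (elim \<xi>)
    have "summable (\<lambda>n. ?a n \<xi>)" using elim(1) by (intro summable_suminf_not_top) auto
    then have "(\<lambda>n. ?a n \<xi>) \<longlonglongrightarrow> 0" by (rule summable_LIMSEQ_zero)
    then have "(\<lambda>n. ?a n \<xi> / w s \<xi>) \<longlonglongrightarrow> 0 / w s \<xi>" using w_pos[OF elim(2), of s] by (intro tendsto_divide) auto
    then have "(\<lambda>n. norm (W n i t \<xi> - cf (f t) i \<xi>)) \<longlonglongrightarrow> 0" using w_pos[OF elim(2), of s] by simp
    then have "(\<lambda>n. W n i t \<xi>) \<longlonglongrightarrow> cf (f t) i \<xi>" by (simp only: tendsto_norm_zero_iff LIM_zero_iff)
    then show ?case unfolding V_def by (rule limI)
   qed
  qed
 qed
 have "L1 (sl V t) \<and> f t = mk (sl V t)" if t: "t \<in> {0..T}" for t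
 proof
  note E = C_T_elems[OF f t]
  show L: "L1 (sl V t)"
  proof
   fix i
   have "integrable lborel (cf (f t) i)" using L1_cf[OF E] by blast
   then show "integrable lborel (V i t)"
    by (rule Bochner_Integration.integrable_bound)
      (use VE[OF t] slice_measD[OF jmeas_slice[OF V], of i t] in \<open>auto elim!: eventually_mono\<close>)
  qed
  have "mk (sl V t) = mk (cf (f t))"
   by (rule mk_cong[OF jmeas_slice[OF V] L1_meas[OF L1_cf[OF E]]]) (use VE[OF t] in \<open>auto elim!: eventually_mono\<close>)
  then show "f t = mk (sl V t)" by (simp add: mk_cf[OF E])
 qed
 then show ?thesis using V VE by blast
qed

end

section \<open>Existence and uniqueness\<close>

lemma vnorm_None: "vnorm {None} c = norm (c None)" by (simp add: vnorm_def)

lemma vnorm_Some: "vnorm (range Some) c = norm (\<chi> k. c (Some k))"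
proof -
 have "(\<Sum>i\<in>range Some. (norm (c i))\<^sup>2) = (\<Sum>k\<in>UNIV. (norm (c (Some k)))\<^sup>2)" by (subst sum.reindex) auto
 then show ?thesis by (simp add: vnorm_def norm_vec_def L2_set_def)
qed

definition mkv :: "slice => dist^3" where "mkv z = (\<chi> k. inv_fourier (z (Some k)))"

definition mks :: "slice => dist" where "mks z = inv_fourier (z None)"

definition cfv :: "dist^3 => slice" where
 "cfv v i = (case i of None => (\<lambda>\<xi>. 0) | Some k => fhat (v $ k))"

definition cfs :: "dist => slice" where
 "cfs f i = (case i of None => fhat f | Some k => (\<lambda>\<xi>. 0))"

lemma fhat_inv_fourier_L1:
 assumes "integrable lborel g"
 shows "AE \<xi> in lborel. fhat (inv_fourier g) \<xi> = g \<xi>" "fourier_locally_integrable (inv_fourier g)"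
  "tempered (inv_fourier g)" "fhat (inv_fourier g) \<in> borel_measurable borel"
 using assms by (auto intro: fhat_inv_fourier fourier_locally_integrable_inv_fourier tempered_inv_fourier
   integrable_imp_locally_integrable fhat_measurable)

lemma X_scal_simps:
 "f \<in> elems (X_scal a \<sigma> r) \<longleftrightarrow> tempered f \<and> fourier_locally_integrable f \<and> integrable lborel (\<lambda>\<xi>. X_weight a \<sigma> r \<xi> * norm (fhat f \<xi>))"
 "nrm (X_scal a \<sigma> r) f = (LINT \<xi>|lborel. X_weight a \<sigma> r \<xi> * norm (fhat f \<xi>))"
 by (simp_all add: X_scal_def)

lemma X_vec_simps:
 "v \<in> elems (X_vec a \<sigma> r) \<longleftrightarrow> (\<forall>k. tempered (v $ k) \<and> fourier_locally_integrable (v $ k)) \<and> integrable lborel (\<lambda>\<xi>. X_weight a \<sigma> r \<xi> * norm (fhat_vec v \<xi>))"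
 "nrm (X_vec a \<sigma> r) v = (LINT \<xi>|lborel. X_weight a \<sigma> r \<xi> * norm (fhat_vec v \<xi>))"
 by (simp_all add: X_vec_def)

context boussinesq begin

lemma integrable_of_weighted:
 assumes m: "g \<in> borel_measurable borel" and h: "integrable lborel (\<lambda>\<xi>. w s \<xi> * h \<xi>)" and le: "\<And>\<xi>. norm (g \<xi>) \<le> h \<xi>"
 shows "integrable lborel (g :: real^3 => complex)"
proof (rule Bochner_Integration.integrable_bound)
 show "integrable lborel (\<lambda>\<xi>. Kw * (w s \<xi> * h \<xi>))" using h by (rule integrable_mult_right)
 have "AE \<xi> in lborel. \<xi> \<noteq> (0::real^3)" by (rule AE_lborel_singleton)
 then show "AE \<xi> in lborel. norm (g \<xi>) \<le> norm (Kw * (w s \<xi> * h \<xi>))"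
 proof eventually_elim
  case (elim \<xi>)
  have h0: "0 \<le> h \<xi>" using le[of \<xi>] norm_ge_zero[of "g \<xi>"] by linarith
  have "1 * h \<xi> \<le> (Kw * w s \<xi>) * h \<xi>" by (intro mult_right_mono one_le_w elim h0)
  then show ?case using le[of \<xi>] by (simp add: mult.assoc)
 qed
qed (use m in simp)

abbreviation "regsol \<equiv> regular_solution a \<sigma> s \<alpha> \<beta>"

abbreviation "snorm \<equiv> solution_norm a \<sigma> s \<alpha> \<beta>"

abbreviation "dnorm \<equiv> data_norm a \<sigma> s"

lemma component_space_vec: "component_space \<alpha> \<beta> a s \<sigma> (range Some) \<alpha> (X_vec a \<sigma>) mkv cfv"
proof
 have ae: "AE \<xi> in lborel. fhat_vec (mkv z) \<xi> = (\<chi> k. z (Some k) \<xi>)" if L: "L1 z" for z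
 proof -
  have "AE \<xi> in lborel. \<forall>k. fhat (mkv z $ k) \<xi> = z (Some k) \<xi>"
   unfolding mkv_def vec_lambda_beta by (rule eventually_all_finite) (use fhat_inv_fourier_L1(1) L in blast)
  then show ?thesis by eventually_elim (simp add: fhat_vec_def)
 qed
 have m1: "(\<lambda>\<xi>. norm (fhat_vec (mkv z) \<xi>)) \<in> borel_measurable borel" if L: "L1 z" for z
 proof -
  have [measurable]: "fhat (mkv z $ k) \<in> borel_measurable borel" for k
   unfolding mkv_def vec_lambda_beta using fhat_inv_fourier_L1(4) L by blast
  show ?thesis unfolding fhat_vec_def norm_vec_def L2_set_def vec_lambda_beta by measurable
 qed
 have m2: "(\<lambda>\<xi>. norm (\<chi> k. z (Some k) \<xi>)) \<in> borel_measurable borel" if L: "L1 z" for z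
 proof -
  have [measurable]: "z i \<in> borel_measurable borel" for i using L1_meas[OF L] by (rule slice_measD)
  show ?thesis unfolding norm_vec_def L2_set_def vec_lambda_beta by measurable
 qed
 show "\<And>i. i \<in> range Some ==> gam i = \<alpha>" by (auto simp: gam_def)
 show "\<alpha> > 0" using alpha by simp
 show "mkv y - mkv z = mkv (sdiff y z)" if "L1 y" "L1 z" for y z
  using that by (simp add: vec_eq_iff mkv_def inv_fourier_diff)
 show "mkv z \<in> elems (X_vec a \<sigma> r) \<longleftrightarrow> integrable lborel (\<lambda>\<xi>. w r \<xi> * vnorm (range Some) (\<lambda>i. z i \<xi>))" if L: "L1 z" for z r
 proof -
  have "integrable lborel (\<lambda>\<xi>. w r \<xi> * norm (fhat_vec (mkv z) \<xi>)) \<longleftrightarrow> integrable lborel (\<lambda>\<xi>. w r \<xi> * norm (\<chi> k. z (Some k) \<xi>))"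
   by (rule integrable_cong_AE) (use ae[OF L] m1[OF L] m2[OF L] in \<open>auto elim!: eventually_mono\<close>)
  then show ?thesis using fhat_inv_fourier_L1(2,3) L by (simp add: X_vec_simps vnorm_Some mkv_def)
 qed
 show "nrm (X_vec a \<sigma> r) (mkv z) = (LINT \<xi>|lborel. w r \<xi> * vnorm (range Some) (\<lambda>i. z i \<xi>))" if L: "L1 z" for z r
  unfolding X_vec_simps vnorm_Some
  by (rule integral_cong_AE) (use ae[OF L] m1[OF L] m2[OF L] in \<open>auto elim!: eventually_mono\<close>)
 show "mkv y = mkv z" if "slice_meas y" "slice_meas z" "AE \<xi> in lborel. \<forall>i\<in>range Some. y i \<xi> = z i \<xi>" for y z
  unfolding mkv_def vec_eq_iff vec_lambda_beta
  by (intro allI inv_fourier_cong slice_measD that(1,2)) (use that(3) in \<open>auto elim!: eventually_mono\<close>)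
 have i: "integrable lborel (fhat (v $ k))" if v: "v \<in> elems (X_vec a \<sigma> s)" for v k
 proof (rule integrable_of_weighted)
  show "fhat (v $ k) \<in> borel_measurable borel" using v by (intro fhat_measurable) (simp add: X_vec_simps)
  show "integrable lborel (\<lambda>\<xi>. w s \<xi> * norm (fhat_vec v \<xi>))" using v by (simp add: X_vec_simps)
  show "norm (fhat (v $ k) \<xi>) \<le> norm (fhat_vec v \<xi>)" for \<xi> using Finite_Cartesian_Product.norm_nth_le[of "fhat_vec v \<xi>" k] by (simp add: fhat_vec_def)
 qed
 show "mkv (cfv v) = v" if v: "v \<in> elems (X_vec a \<sigma> s)" for v
  unfolding vec_eq_iff mkv_def cfv_def using v i[OF v] by (auto simp: X_vec_simps tempered_eq_inv_fourier[symmetric])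
 show "L1 (cfv v)" if v: "v \<in> elems (X_vec a \<sigma> s)" for v
  using i[OF v] by (auto simp: cfv_def split: option.split)
 show "cfv v i = (\<lambda>\<xi>. 0)" if "i \<notin> range Some" for v i using that by (cases i) (auto simp: cfv_def)
qed

lemma component_space_scal: "component_space \<alpha> \<beta> a s \<sigma> {None} \<beta> (X_scal a \<sigma>) mks cfs"
proof
 have ae: "AE \<xi> in lborel. fhat (mks z) \<xi> = z None \<xi>" and m1: "fhat (mks z) \<in> borel_measurable borel"
  and m2: "z None \<in> borel_measurable borel" if L: "L1 z" for z
 proof -
  have i: "integrable lborel (z None)" using L by blast
  show "AE \<xi> in lborel. fhat (mks z) \<xi> = z None \<xi>" "fhat (mks z) \<in> borel_measurable borel"
   unfolding mks_def by (rule fhat_inv_fourier_L1(1)[OF i], rule fhat_inv_fourier_L1(4)[OF i])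
  show "z None \<in> borel_measurable borel" by (rule slice_measD[OF L1_meas[OF L]])
 qed
 show "\<And>i. i \<in> {None} ==> gam i = \<beta>" by (auto simp: gam_def)
 show "\<beta> > 0" using beta by simp
 show "mks y - mks z = mks (sdiff y z)" if "L1 y" "L1 z" for y z
  using that by (simp add: mks_def inv_fourier_diff)
 show "mks z \<in> elems (X_scal a \<sigma> r) \<longleftrightarrow> integrable lborel (\<lambda>\<xi>. w r \<xi> * vnorm {None} (\<lambda>i. z i \<xi>))" if L: "L1 z" for z r
 proof -
  have "integrable lborel (\<lambda>\<xi>. w r \<xi> * norm (fhat (mks z) \<xi>)) \<longleftrightarrow> integrable lborel (\<lambda>\<xi>. w r \<xi> * norm (z None \<xi>))"
   by (rule integrable_cong_AE) (use ae[OF L] m1[OF L] m2[OF L] in \<open>auto elim!: eventually_mono\<close>)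
  then show ?thesis using fhat_inv_fourier_L1(2,3) L by (simp add: X_scal_simps vnorm_None mks_def)
 qed
 show "nrm (X_scal a \<sigma> r) (mks z) = (LINT \<xi>|lborel. w r \<xi> * vnorm {None} (\<lambda>i. z i \<xi>))" if L: "L1 z" for z r
  unfolding X_scal_simps vnorm_None
  by (rule integral_cong_AE) (use ae[OF L] m1[OF L] m2[OF L] in \<open>auto elim!: eventually_mono\<close>)
 show "mks y = mks z" if "slice_meas y" "slice_meas z" "AE \<xi> in lborel. \<forall>i\<in>{None}. y i \<xi> = z i \<xi>" for y z
  unfolding mks_def
  by (intro inv_fourier_cong slice_measD that(1,2)) (use that(3) in \<open>auto elim!: eventually_mono\<close>)
 have i: "integrable lborel (fhat f)" if f: "f \<in> elems (X_scal a \<sigma> s)" for f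
 proof (rule integrable_of_weighted)
  show "fhat f \<in> borel_measurable borel" using f by (intro fhat_measurable) (simp add: X_scal_simps)
  show "integrable lborel (\<lambda>\<xi>. w s \<xi> * norm (fhat f \<xi>))" using f by (simp add: X_scal_simps)
 qed simp
 show "mks (cfs f) = f" if f: "f \<in> elems (X_scal a \<sigma> s)" for f
  unfolding mks_def cfs_def using f i[OF f] by (auto simp: X_scal_simps tempered_eq_inv_fourier[symmetric])
 show "L1 (cfs f)" if f: "f \<in> elems (X_scal a \<sigma> s)" for f
  using i[OF f] by (auto simp: cfs_def split: option.split)
 show "cfs f i = (\<lambda>\<xi>. 0)" if "i \<notin> {None}" for f i using that by (cases i) (auto simp: cfs_def)
qed

interpretation vec: component_space \<alpha> \<beta> a s \<sigma> "range Some" \<alpha> "X_vec a \<sigma>" mkv cfv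
 by (rule component_space_vec)

interpretation scal: component_space \<alpha> \<beta> a s \<sigma> "{None}" \<beta> "X_scal a \<sigma>" mks cfs
 by (rule component_space_scal)

text \<open>Three velocity components, each bounded by the Euclidean norm.\<close>

lemma wn_le_sn:
 assumes z: "slice_meas z" and q: "\<And>k. q (Some k) = r" "q None = r'"
 shows "wn q z \<le> 3 * (vec.sn r z + scal.sn r' z)"
proof -
 note [measurable] = slice_measD[OF z]
 have "wn q z = (\<integral>\<^sup>+\<xi>. ennreal (w r' \<xi> * norm (z None \<xi>)) \<partial>lborel) + (\<Sum>k\<in>UNIV. \<integral>\<^sup>+\<xi>. ennreal (w r \<xi> * norm (z (Some k) \<xi>)) \<partial>lborel)"
  unfolding wn_def sum_UNIV_option q
  by (subst nn_integral_add) (simp_all add: nn_integral_sum del: sum_ennreal)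
 also have "... \<le> scal.sn r' z + (\<Sum>k\<in>(UNIV::3 set). vec.sn r z)"
  by (intro add_mono sum_mono scal.component_le_sn vec.component_le_sn) auto
 also have "... = scal.sn r' z + 3 * vec.sn r z" by simp
 also have "... \<le> 3 * scal.sn r' z + 3 * vec.sn r z"
  using mult_right_mono[of "1::ennreal" 3 "scal.sn r' z"] by (intro add_right_mono) simp
 finally show ?thesis by (simp add: distrib_left add.commute)
qed

lemma data_norm_nonneg: "u0 \<in> elems (X_vec a \<sigma> s) ==> \<theta>0 \<in> elems (X_scal a \<sigma> s) ==> 0 \<le> dnorm u0 \<theta>0"
 unfolding data_norm_def by (intro add_nonneg_nonneg vec.nrm_nonneg scal.nrm_nonneg)

definition dat :: "dist^3 => dist => slice" where
 "dat u0 \<theta>0 i = (case i of None => fhat \<theta>0 | Some k => fhat (u0 $ k))"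

lemma dat:
 assumes u0: "u0 \<in> elems (X_vec a \<sigma> s)" and \<theta>0: "\<theta>0 \<in> elems (X_scal a \<sigma> s)"
 shows "L1 (dat u0 \<theta>0)" "slice_meas (dat u0 \<theta>0)" "wn (\<lambda>_. s) (dat u0 \<theta>0) \<le> ennreal (3 * dnorm u0 \<theta>0)"
proof -
 show L: "L1 (dat u0 \<theta>0)"
 proof
  fix i show "integrable lborel (dat u0 \<theta>0 i)"
   using spec[OF vec.L1_cf[OF u0], of i] spec[OF scal.L1_cf[OF \<theta>0], of i] by (cases i) (simp_all add: dat_def cfv_def cfs_def)
 qed
 show m: "slice_meas (dat u0 \<theta>0)" by (rule L1_meas[OF L])
 have 1: "vec.sn s (dat u0 \<theta>0) = ennreal (nrm (X_vec a \<sigma> s) u0)"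
 proof -
  have "vec.sn s (dat u0 \<theta>0) = vec.sn s (cfv u0)" by (rule vec.sn_cong) (auto simp: dat_def cfv_def)
  also have "... = ennreal (nrm (X_vec a \<sigma> s) (mkv (cfv u0)))" by (rule vec.sn_nrm[OF vec.L1_cf[OF u0] vec.sn_cf[OF u0]])
  finally show ?thesis by (simp add: vec.mk_cf[OF u0])
 qed
 have 2: "scal.sn s (dat u0 \<theta>0) = ennreal (nrm (X_scal a \<sigma> s) \<theta>0)"
 proof -
  have "scal.sn s (dat u0 \<theta>0) = scal.sn s (cfs \<theta>0)" by (rule scal.sn_cong) (auto simp: dat_def cfs_def)
  also have "... = ennreal (nrm (X_scal a \<sigma> s) (mks (cfs \<theta>0)))" by (rule scal.sn_nrm[OF scal.L1_cf[OF \<theta>0] scal.sn_cf[OF \<theta>0]])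
  finally show ?thesis by (simp add: scal.mk_cf[OF \<theta>0])
 qed
 have "wn (\<lambda>_. s) (dat u0 \<theta>0) \<le> 3 * (ennreal (nrm (X_vec a \<sigma> s) u0) + ennreal (nrm (X_scal a \<sigma> s) \<theta>0))"
  using wn_le_sn[OF m, of "\<lambda>_. s" s s] unfolding 1 2 by simp
 also have "... = ennreal (3 * dnorm u0 \<theta>0)"
  unfolding data_norm_def using vec.nrm_nonneg[OF u0] scal.nrm_nonneg[OF \<theta>0] by (simp add: ennreal_mult ennreal_plus)
 finally show "wn (\<lambda>_. s) (dat u0 \<theta>0) \<le> ennreal (3 * dnorm u0 \<theta>0)" .
qed

lemma dat_div:
 assumes u0: "u0 \<in> elems (X_vec a \<sigma> s)" and d: "div_free u0"
 shows "AE \<xi> in lborel. (\<Sum>l\<in>UNIV. cr (\<xi> $ l) * dat u0 \<theta>0 (Some l) \<xi>) = 0"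
 using div_free_fhat[OF d] u0 by (simp add: dat_def X_vec_simps)

lemma dat_real:
 assumes u0: "u0 \<in> elems (X_vec a \<sigma> s)" and \<theta>0: "\<theta>0 \<in> elems (X_scal a \<sigma> s)"
  and r: "\<And>k. real_dist (u0 $ k)" "real_dist \<theta>0"
 shows "AE \<xi> in lborel. \<forall>i. dat u0 \<theta>0 i \<xi> = cnj (dat u0 \<theta>0 i (- \<xi>))"
proof (rule AE_all_option, goal_cases)
 case (1 i)
 show ?case
  using real_dist_fhat[OF r(2)] real_dist_fhat[OF r(1)] u0 \<theta>0 by (cases i) (simp_all add: dat_def X_vec_simps X_scal_simps)
qed

text \<open>The constants are \<open>D = 3 d\<close> for data of norm \<open>d\<close>, so the fixed point has
  norm at most \<open>4 D = 12 d\<close>; passing to the four separate norms of the solution costs another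
  factor 2.\<close>

lemma local_solution:
 assumes u0: "u0 \<in> elems (X_vec a \<sigma> s)" and \<theta>0: "\<theta>0 \<in> elems (X_scal a \<sigma> s)"
  and r: "\<And>k. real_dist (u0 $ k)" "real_dist \<theta>0" and d: "div_free u0"
  and T: "T > 0" and M: "12 * dnorm u0 \<theta>0 \<le> M" and small: "384 * Kw * lam T * M + 48 * T \<le> 1/2"
 obtains Z u \<theta> where "jmeas Z" "NM T Z \<le> ennreal (12 * dnorm u0 \<theta>0)"
  "\<And>t. t \<in> {0..T} ==> AE \<xi> in lborel. \<forall>i. Z i t \<xi> = Phi (dat u0 \<theta>0) Z i t \<xi>"
  "u = (\<lambda>t. mkv (sl Z t))" "\<theta> = (\<lambda>t. mks (sl Z t))" "regsol T u0 \<theta>0 u \<theta>" "snorm T u \<theta> \<le> 24 * dnorm u0 \<theta>0"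
  "\<And>p. p \<ge> 1 ==> u \<in> Lp_T p T (X_vec a \<sigma> (s + 2 * \<alpha> / p))"
  "\<And>p. p \<ge> 1 ==> \<theta> \<in> Lp_T p T (X_scal a \<sigma> (s + 2 * \<beta> / p))"
proof -
 let ?d = "dnorm u0 \<theta>0" and ?z0 = "dat u0 \<theta>0"
 have d0: "0 \<le> ?d" by (rule data_norm_nonneg[OF u0 \<theta>0])
 note z0 = dat[OF u0 \<theta>0]
 obtain Z where Z: "jmeas Z" and N: "NM T Z \<le> ennreal (12 * ?d)"
  and fp: "\<And>t. t \<in> {0..T} ==> AE \<xi> in lborel. \<forall>i. Z i t \<xi> = Phi ?z0 Z i t \<xi>"
  using picard[OF T z0(2,3), of M] d0 M small by auto
 have Nf: "NM T Z < \<infinity>" using N by (rule order.strict_trans1) simp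
 have NM: "NM T Z \<le> ennreal M" using N M by (meson ennreal_leI order_trans)
 have M0: "0 \<le> M" using M d0 by linarith
 define u where "u = (\<lambda>t. mkv (sl Z t))"
 define \<theta> where "\<theta> = (\<lambda>t. mks (sl Z t))"
 have z0f: "wn (\<lambda>_. s) ?z0 < \<infinity>" using z0(3) by (rule order.strict_trans1) simp
 have L: "L1 (sl Z t)" if "t \<in> {0..T}" for t using state_L1[OF Z Nf that] by blast
 have Cu: "u \<in> C_T T (X_vec a \<sigma> s)" unfolding u_def by (rule vec.mk_C_T[OF Z T Nf z0(2) z0f fp])
 have Ct: "\<theta> \<in> C_T T (X_scal a \<sigma> s)" unfolding \<theta>_def by (rule scal.mk_C_T[OF Z T Nf z0(2) z0f fp])
 define eN where "eN = enn2real (EN T Z)"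
 define hN where "hN = enn2real (HN T Z)"
 have fin: "EN T Z < \<infinity>" "HN T Z < \<infinity>" using Nf by (simp_all add: NM_def)
 then have eh: "EN T Z = ennreal eN" "HN T Z = ennreal hN" "0 \<le> eN" "0 \<le> hN"
  by (simp_all add: eN_def hN_def less_top)
 have ehd: "eN + hN \<le> 12 * ?d"
  using N d0 eh(3,4) unfolding NM_def eh(1,2) by (simp flip: ennreal_plus)
 have Eu: "vec.sn s (sl Z t) \<le> ennreal eN" and Et: "scal.sn s (sl Z t) \<le> ennreal eN" if t: "t \<in> {0..T}" for t
  using order_trans[OF vec.sn_le_wn[OF jmeas_slice[OF Z], of "\<lambda>_. s" s t] EN_upper[OF t, of Z]]
   order_trans[OF scal.sn_le_wn[OF jmeas_slice[OF Z], of "\<lambda>_. s" s t] EN_upper[OF t, of Z]] by (simp_all add: eh(1))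
 have Hu: "(\<integral>\<^sup>+t. vec.sn (s + 2 * \<alpha>) (sl Z t) * indicator {0..T} t \<partial>lborel) \<le> ennreal hN"
  unfolding eh(2)[symmetric] HN_def
  by (intro nn_integral_mono mult_right_mono vec.sn_le_wn[OF jmeas_slice[OF Z]]) (auto simp: gam_def)
 have Ht: "(\<integral>\<^sup>+t. scal.sn (s + 2 * \<beta>) (sl Z t) * indicator {0..T} t \<partial>lborel) \<le> ennreal hN"
  unfolding eh(2)[symmetric] HN_def
  by (intro nn_integral_mono mult_right_mono scal.sn_le_wn[OF jmeas_slice[OF Z]]) (auto simp: gam_def)
 have Lpu: "u \<in> Lp_T p T (X_vec a \<sigma> (s + 2 * \<alpha> / p))" if "p \<ge> 1" for p
  unfolding u_def by (rule vec.mk_Lp[OF Z T L Eu eh(3) order.strict_trans1[OF Hu] Cu[unfolded u_def] that]) auto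
 have Lpt: "\<theta> \<in> Lp_T p T (X_scal a \<sigma> (s + 2 * \<beta> / p))" if "p \<ge> 1" for p
  unfolding \<theta>_def by (rule scal.mk_Lp[OF Z T L Et eh(3) order.strict_trans1[OF Ht] Ct[unfolded \<theta>_def] that]) auto
 have L1u: "u \<in> Lp_T 1 T (X_vec a \<sigma> (s + 2 * \<alpha>))" and L1t: "\<theta> \<in> Lp_T 1 T (X_scal a \<sigma> (s + 2 * \<beta>))"
  using Lpu[of 1] Lpt[of 1] by simp_all
 have T0: "{0..T} \<noteq> {}" using T by simp
 have "Linf_norm T (X_vec a \<sigma> s) u \<le> eN" unfolding Linf_norm_def
  by (rule cSUP_least[OF T0]) (use vec.nrm_sn[OF L, of _ s] Eu eh(3) in \<open>auto simp: u_def intro!: enn2real_leI\<close>)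
 moreover have "Linf_norm T (X_scal a \<sigma> s) \<theta> \<le> eN" unfolding Linf_norm_def
  by (rule cSUP_least[OF T0]) (use scal.nrm_sn[OF L, of _ s] Et eh(3) in \<open>auto simp: \<theta>_def intro!: enn2real_leI\<close>)
 moreover have "Lp_norm 1 T (X_vec a \<sigma> (s + 2 * \<alpha>)) u \<le> hN"
  using Hu vec.Lp_norm_one[OF Z L _ L1u] eh(4) by (simp add: u_def)
 moreover have "Lp_norm 1 T (X_scal a \<sigma> (s + 2 * \<beta>)) \<theta> \<le> hN"
  using Ht scal.Lp_norm_one[OF Z L _ L1t] eh(4) by (simp add: \<theta>_def)
 ultimately have sol: "snorm T u \<theta> \<le> 24 * ?d" unfolding solution_norm_def using ehd by linarith
 have div: "AE \<xi> in lborel. (\<Sum>j\<in>UNIV. cr (\<xi> $ j) * Z (Some j) t \<xi>) = 0" if t: "t \<in> {0..T}" for t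
  using fp[OF t] Phi_div[OF Z T Nf t dat_div[OF u0 d], of \<theta>0] by eventually_elim simp
 have uk: "u t $ k = inv_fourier (Z (Some k) t)" and tk: "\<theta> t = inv_fourier (Z None t)" for t k
  by (simp_all add: u_def \<theta>_def mkv_def mks_def)
 have ph: "inv_fourier (Z i t) = inv_fourier (Phi ?z0 Z i t)" if t: "t \<in> {0..T}" for i t
  by (rule inv_fourier_cong) (use fp[OF t] slice_measD[OF jmeas_slice[OF Z]] slice_measD[OF jmeas_slice[OF jmeas_Phi[OF Z z0(2)]]]
   in \<open>auto elim!: eventually_mono\<close>)
 have mild: "mild_solution \<alpha> \<beta> T u0 \<theta>0 u \<theta>"
  unfolding mild_solution_def
 proof (rule ballI)
  fix t assume t: "t \<in> {0..T}"
  have re: "real_dist (inv_fourier (Z i t))" for i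
   using L[OF t] fixed_point_real[OF T z0(2) M0 small Z NM fp dat_real[OF u0 \<theta>0 r] t]
   by (intro real_dist_inv_fourier) (auto elim!: eventually_mono)
  have df: "div_free (u t)" by (rule div_free_inv_fourier[OF _ uk div[OF t]]) (use L[OF t] in blast)
  have zz: "dat u0 \<theta>0 (Some k) = fhat (u0 $ k)" "dat u0 \<theta>0 None = fhat \<theta>0" "integrable lborel (dat u0 \<theta>0 i)" for k i
   using z0(1) by (auto simp: dat_def)
  note ml = mild_link[where u=u and \<theta>=\<theta> and ?z0.0="dat u0 \<theta>0" and ?u0.0=u0 and ?\<theta>0.0=\<theta>0, OF Z T Nf div uk tk zz t]
  have eu: "u t = heat_vec \<alpha> t u0 - dist_integral_vec t (adv_term u t)
     + dist_integral_vec t (buoy_term \<theta> t)"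
  proof (rule vec_eq_iff[THEN iffD2], rule allI)
   fix l show "u t $ l = (heat_vec \<alpha> t u0 - dist_integral_vec t (adv_term u t)
     + dist_integral_vec t (buoy_term \<theta> t)) $ l"
    by (rule trans[OF trans[OF uk[of t l] ph[OF t, of "Some l"]] ml(4)[of l, symmetric]])
  qed
  have et: "\<theta> t = heat \<beta> t \<theta>0 - dist_integral t (transp_term u \<theta> t)"
   by (rule trans[OF trans[OF tk[of t] ph[OF t, of None]] ml(5)[symmetric]])
  have ru: "real_dist (u t $ k)" and rt: "real_dist (\<theta> t)" for k by (simp_all only: uk tk re)
  show "(\<forall>k. real_dist (u t $ k)) \<and> real_dist (\<theta> t) \<and> div_free (u t) \<and>
    dist_integrable_vec t (adv_term u t) \<and>
    dist_integrable_vec t (buoy_term \<theta> t) \<and>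
    dist_integrable t (transp_term u \<theta> t) \<and>
    u t = heat_vec \<alpha> t u0
       - dist_integral_vec t (adv_term u t)
       + dist_integral_vec t (buoy_term \<theta> t) \<and>
    \<theta> t = heat \<beta> t \<theta>0 - dist_integral t (transp_term u \<theta> t)"
   by (intro conjI allI ru rt df ml(1-3) eu et)
 qed
 have "regsol T u0 \<theta>0 u \<theta>"
  unfolding regular_solution_def by (intro conjI IntI Cu Ct L1u L1t mild)
 then show ?thesis using that[OF Z N fp u_def \<theta>_def _ sol Lpu Lpt] by simp
qed

text \<open>Inverse transforms are injective, so the mild equations, read on the Fourier side, say that the
  state of a solution is a fixed point. The factor 3 is that of \<open>wn_le_sn\<close>.\<close>

lemma solution_is_fixed_point:
 assumes u0: "u0 \<in> elems (X_vec a \<sigma> s)" and \<theta>0: "\<theta>0 \<in> elems (X_scal a \<sigma> s)" and T: "T > 0"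
  and sol: "regsol T u0 \<theta>0 v \<eta>"
 obtains V where "jmeas V" "NM T V \<le> ennreal (3 * snorm T v \<eta>)"
  "\<And>t. t \<in> {0..T} ==> AE \<xi> in lborel. \<forall>i. V i t \<xi> = Phi (dat u0 \<theta>0) V i t \<xi>"
  "\<And>t. t \<in> {0..T} ==> v t = mkv (sl V t)" "\<And>t. t \<in> {0..T} ==> \<eta> t = mks (sl V t)"
proof -
 have C: "v \<in> C_T T (X_vec a \<sigma> s)" "\<eta> \<in> C_T T (X_scal a \<sigma> s)"
  and P: "v \<in> Lp_T 1 T (X_vec a \<sigma> (s + 2 * \<alpha>))" "\<eta> \<in> Lp_T 1 T (X_scal a \<sigma> (s + 2 * \<beta>))"
  and mild: "mild_solution \<alpha> \<beta> T u0 \<theta>0 v \<eta>"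
  using sol by (auto simp: regular_solution_def)
 obtain A where A: "jmeas A" "\<And>t. t \<in> {0..T} ==> L1 (sl A t) \<and> v t = mkv (sl A t) \<and> (AE \<xi> in lborel. \<forall>i. A i t \<xi> = cfv (v t) i \<xi>)"
  using vec.exists_state[OF C(1) T] by blast
 obtain B where B: "jmeas B" "\<And>t. t \<in> {0..T} ==> L1 (sl B t) \<and> \<eta> t = mks (sl B t) \<and> (AE \<xi> in lborel. \<forall>i. B i t \<xi> = cfs (\<eta> t) i \<xi>)"
  using scal.exists_state[OF C(2) T] by blast
 define V where "V = (\<lambda>i. case i of None => B None | Some k => A (Some k))"
 have V: "jmeas V"
  unfolding jmeas_def
 proof
  fix i show "(\<lambda>p. V i (fst p) (snd p)) \<in> borel_measurable (borel \<Otimes>\<^sub>M borel)"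
   using A(1) B(1) by (cases i) (simp_all add: V_def jmeas_def)
 qed
 have L: "L1 (sl V t)" if t: "t \<in> {0..T}" for t
 proof
  fix i show "integrable lborel (V i t)" using A(2)[OF t] B(2)[OF t] by (cases i) (simp_all add: V_def)
 qed
 have v: "v t = mkv (sl V t)" and \<eta>: "\<eta> t = mks (sl V t)" if t: "t \<in> {0..T}" for t
  using A(2)[OF t] B(2)[OF t] by (simp_all add: V_def mkv_def mks_def)
 have vk: "v t $ k = inv_fourier (V (Some k) t)" and ek: "\<eta> t = inv_fourier (V None t)" if t: "t \<in> {0..T}" for t k
  using v[OF t] \<eta>[OF t] by (simp_all add: mkv_def mks_def)
 have su: "vec.sn s (sl V t) \<le> ennreal (Linf_norm T (X_vec a \<sigma> s) v)"
  and st: "scal.sn s (sl V t) \<le> ennreal (Linf_norm T (X_scal a \<sigma> s) \<eta>)" if t: "t \<in> {0..T}" for t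
 proof -
  have "vec.sn s (sl V t) < \<infinity>" using vec.elems_iff[OF L[OF t]] vec.C_T_elems[OF C(1) t] v[OF t] by simp
  then have "vec.sn s (sl V t) = ennreal (nrm (X_vec a \<sigma> s) (v t))" using vec.sn_nrm[OF L[OF t]] v[OF t] by simp
  then show "vec.sn s (sl V t) \<le> ennreal (Linf_norm T (X_vec a \<sigma> s) v)"
   using vec.Linf_norm_upper[OF C(1) t] by (simp add: ennreal_leI)
  have "scal.sn s (sl V t) < \<infinity>" using scal.elems_iff[OF L[OF t]] scal.C_T_elems[OF C(2) t] \<eta>[OF t] by simp
  then have "scal.sn s (sl V t) = ennreal (nrm (X_scal a \<sigma> s) (\<eta> t))" using scal.sn_nrm[OF L[OF t]] \<eta>[OF t] by simp
  then show "scal.sn s (sl V t) \<le> ennreal (Linf_norm T (X_scal a \<sigma> s) \<eta>)"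
   using scal.Linf_norm_upper[OF C(2) t] by (simp add: ennreal_leI)
 qed
 let ?eu = "Linf_norm T (X_vec a \<sigma> s) v" and ?et = "Linf_norm T (X_scal a \<sigma> s) \<eta>"
  and ?hu = "Lp_norm 1 T (X_vec a \<sigma> (s + 2 * \<alpha>)) v" and ?ht = "Lp_norm 1 T (X_scal a \<sigma> (s + 2 * \<beta>)) \<eta>"
 have t0: "0 \<in> {0..T}" using T by simp
 have nn: "0 \<le> ?eu" "0 \<le> ?et" "0 \<le> ?hu" "0 \<le> ?ht"
  using vec.Linf_norm_upper[OF C(1) t0] vec.nrm_nonneg[OF vec.C_T_elems[OF C(1) t0]]
   scal.Linf_norm_upper[OF C(2) t0] scal.nrm_nonneg[OF scal.C_T_elems[OF C(2) t0]] by (auto simp: Lp_norm_def)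
 note [measurable] = vec.sn_measurable[OF V] scal.sn_measurable[OF V]
 have "EN T V \<le> 3 * (ennreal ?eu + ennreal ?et)"
  unfolding EN_def
 proof (rule SUP_least)
  fix t assume t: "t \<in> {0..T}"
  have "wn (\<lambda>_. s) (sl V t) \<le> 3 * (vec.sn s (sl V t) + scal.sn s (sl V t))" by (rule wn_le_sn[OF jmeas_slice[OF V]]) auto
  also have "... \<le> 3 * (ennreal ?eu + ennreal ?et)" by (intro mult_left_mono add_mono su st t) simp
  finally show "wn (\<lambda>_. s) (sl V t) \<le> 3 * (ennreal ?eu + ennreal ?et)" .
 qed
 moreover have "HN T V \<le> 3 * (ennreal ?hu + ennreal ?ht)"
 proof -
  have "HN T V \<le> (\<integral>\<^sup>+t. 3 * (vec.sn (s + 2 * \<alpha>) (sl V t) * indicator {0..T} t + scal.sn (s + 2 * \<beta>) (sl V t) * indicator {0..T} t) \<partial>lborel)"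
   unfolding HN_def
  proof (rule nn_integral_mono, goal_cases)
   case (1 t)
   have "wn sH (sl V t) \<le> 3 * (vec.sn (s + 2 * \<alpha>) (sl V t) + scal.sn (s + 2 * \<beta>) (sl V t))"
    by (rule wn_le_sn[OF jmeas_slice[OF V]]) (auto simp: gam_def)
   then show ?case
    by (simp add: indicator_def)
  qed
  also have "... = 3 * ((\<integral>\<^sup>+t. vec.sn (s + 2 * \<alpha>) (sl V t) * indicator {0..T} t \<partial>lborel) + (\<integral>\<^sup>+t. scal.sn (s + 2 * \<beta>) (sl V t) * indicator {0..T} t \<partial>lborel))"
   by (simp add: nn_integral_cmult nn_integral_add)
  also have "... = 3 * (ennreal ?hu + ennreal ?ht)"
   using vec.Lp_norm_one[OF V L v P(1)] scal.Lp_norm_one[OF V L \<eta> P(2)] by simp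
  finally show ?thesis .
 qed
 ultimately have "NM T V \<le> 3 * (ennreal ?eu + ennreal ?et) + 3 * (ennreal ?hu + ennreal ?ht)" unfolding NM_def by (rule add_mono)
 also have "... = ennreal (3 * snorm T v \<eta>)"
 proof -
  have "3 * snorm T v \<eta> = 3 * (?eu + ?et) + 3 * (?hu + ?ht)" by (simp add: solution_norm_def)
  then show ?thesis using nn by (simp add: ennreal_plus ennreal_mult)
 qed
 finally have N: "NM T V \<le> ennreal (3 * snorm T v \<eta>)" .
 have Nf: "NM T V < \<infinity>" using N by (rule order.strict_trans1) simp
 have div: "AE \<xi> in lborel. (\<Sum>j\<in>UNIV. cr (\<xi> $ j) * V (Some j) t \<xi>) = 0" if t: "t \<in> {0..T}" for t
 proof -
  have "div_free (v t)" using bspec[OF mild[unfolded mild_solution_def] t] by (elim conjE)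
  moreover have "fourier_locally_integrable (v t $ k)" for k using vec.C_T_elems[OF C(1) t] by (simp add: X_vec_simps)
  ultimately have "AE \<xi> in lborel. (\<Sum>j\<in>UNIV. cr (\<xi> $ j) * fhat (v t $ j) \<xi>) = 0" by (rule div_free_fhat)
  moreover have "AE \<xi> in lborel. \<forall>i. A i t \<xi> = cfv (v t) i \<xi>" using A(2)[OF t] by blast
  ultimately show ?thesis by eventually_elim (simp add: V_def cfv_def)
 qed
 have zz: "dat u0 \<theta>0 (Some k) = fhat (u0 $ k)" "dat u0 \<theta>0 None = fhat \<theta>0" "integrable lborel (dat u0 \<theta>0 i)" for k i
  using dat(1)[OF u0 \<theta>0] by (auto simp: dat_def)
 have fp: "AE \<xi> in lborel. \<forall>i. V i t \<xi> = Phi (dat u0 \<theta>0) V i t \<xi>" if t: "t \<in> {0..T}" for t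
 proof (rule AE_all_option)
  fix i
  note ml = mild_link[where u=v and \<theta>=\<eta> and ?z0.0="dat u0 \<theta>0" and ?u0.0=u0 and ?\<theta>0.0=\<theta>0, OF V T Nf div vk ek zz t]
  have "inv_fourier (V i t) = inv_fourier (Phi (dat u0 \<theta>0) V i t)"
  proof (cases i)
   case None
   have "\<eta> t = heat \<beta> t \<theta>0 - dist_integral t (transp_term v \<eta> t)"
    using mild t unfolding mild_solution_def by blast
   from trans[OF trans[OF ek[OF t, symmetric] this] ml(5)] show ?thesis unfolding None .
  next
   case (Some l)
   have "v t = heat_vec \<alpha> t u0 - dist_integral_vec t (adv_term v t)
       + dist_integral_vec t (buoy_term \<eta> t)"
    using mild t unfolding mild_solution_def by blast
   then have "v t $ l = (heat_vec \<alpha> t u0 - dist_integral_vec t (adv_term v t)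
       + dist_integral_vec t (buoy_term \<eta> t)) $ l" by (rule arg_cong)
   from trans[OF trans[OF vk[OF t, of l, symmetric] this] ml(4)[of l]] show ?thesis unfolding Some .
  qed
  then show "AE \<xi> in lborel. V i t \<xi> = Phi (dat u0 \<theta>0) V i t \<xi>"
   by (rule inv_fourier_inj) (use L[OF t] ml(6) in \<open>auto intro: integrable_imp_locally_integrable\<close>)
 qed
 show ?thesis by (rule that[OF V N fp v \<eta>])
qed

lemma solution_unique:
 assumes u0: "u0 \<in> elems (X_vec a \<sigma> s)" and \<theta>0: "\<theta>0 \<in> elems (X_scal a \<sigma> s)" and T: "T > 0"
  and M: "M \<ge> 0" and small: "384 * Kw * lam T * M + 48 * T \<le> 1/2"
  and Z: "jmeas Z" "NM T Z \<le> ennreal M" "\<And>t. t \<in> {0..T} ==> AE \<xi> in lborel. \<forall>i. Z i t \<xi> = Phi (dat u0 \<theta>0) Z i t \<xi>"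
  and sol: "regsol T u0 \<theta>0 v \<eta>" and N: "3 * snorm T v \<eta> \<le> M"
  and t: "t \<in> {0..T}"
 shows "v t = mkv (sl Z t)" "\<eta> t = mks (sl Z t)"
proof -
 obtain V where V: "jmeas V" "NM T V \<le> ennreal (3 * snorm T v \<eta>)"
  "\<And>t. t \<in> {0..T} ==> AE \<xi> in lborel. \<forall>i. V i t \<xi> = Phi (dat u0 \<theta>0) V i t \<xi>"
  and v: "\<And>t. t \<in> {0..T} ==> v t = mkv (sl V t)" "\<And>t. t \<in> {0..T} ==> \<eta> t = mks (sl V t)"
  by (rule solution_is_fixed_point[OF u0 \<theta>0 T sol]) blast
 have NV: "NM T V \<le> ennreal M" using V(2) N by (meson ennreal_leI order_trans)
 have ae: "AE \<xi> in lborel. \<forall>i. V i t \<xi> = Z i t \<xi>"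
  by (rule fixed_point_unique[OF T dat(2)[OF u0 \<theta>0] M small V(1) NV V(3) Z t])
 then have J: "AE \<xi> in lborel. \<forall>i\<in>J. V i t \<xi> = Z i t \<xi>" for J by eventually_elim simp
 have "mkv (sl V t) = mkv (sl Z t)" by (rule vec.mk_cong[OF jmeas_slice[OF V(1)] jmeas_slice[OF Z(1)] J])
 then show "v t = mkv (sl Z t)" using v(1)[OF t] by simp
 have "mks (sl V t) = mks (sl Z t)" by (rule scal.mk_cong[OF jmeas_slice[OF V(1)] jmeas_slice[OF Z(1)] J])
 then show "\<eta> t = mks (sl Z t)" using v(2)[OF t] by simp
qed

lemma lam_tendsto_0:
 assumes "\<alpha> > 1/2" "\<beta> > 1/2"
 shows "(lam \<longlongrightarrow> 0) (at_right 0)"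
proof -
 have p: "((\<lambda>T::real. T powr c) \<longlongrightarrow> 0) (at_right 0)" if "c > 0" for c :: real
  by (rule tendsto_zero_powrI[OF _ tendsto_const _ that]) (auto intro: tendsto_ident_at simp: eventually_at_right_less eventually_at_filter)
 have "((\<lambda>T. max (T powr (1 - 1 / (2 * \<alpha>))) (T powr (1 - 1 / (2 * \<beta>)))) \<longlongrightarrow> max 0 0) (at_right 0)"
  using assms by (intro tendsto_max p) auto
 then show ?thesis by (simp add: lam_def[abs_def])
qed

lemma lam_le_1: assumes "0 \<le> T" "T \<le> 1" shows "lam T \<le> 1"
 using assms alpha beta unfolding lam_def by (auto intro!: powr_le1)

end

theorem theorem1p3:
 fixes \<alpha> \<beta> a s \<sigma> :: real
 assumes "\<alpha> \<ge> 1/2" and "\<beta> \<ge> 1/2"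
  and "(a, s, \<sigma>) \<in> {0<..} \<times> {-1..<0} \<times> {1<..} \<union> {0..} \<times> {0} \<times> {1..}"
 shows "\<exists>\<epsilon>>0. \<forall>u0 \<theta>0.
  u0 \<in> elems (X_vec a \<sigma> s) \<and> \<theta>0 \<in> elems (X_scal a \<sigma> s) \<and>
  (\<forall>k. real_dist (u0 $ k)) \<and> real_dist \<theta>0 \<and> div_free u0 \<and>
  (\<alpha> = 1/2 \<or> \<beta> = 1/2 \<longrightarrow> data_norm a \<sigma> s u0 \<theta>0 < \<epsilon>)
  \<longrightarrow>
  (\<exists>T>0. \<exists>C1>0. \<exists>C2>0. \<exists>u \<theta>.
    regular_solution a \<sigma> s \<alpha> \<beta> T u0 \<theta>0 u \<theta> \<and>
    solution_norm a \<sigma> s \<alpha> \<beta> T u \<theta> < C1 \<and>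
    (\<forall>v \<eta>. regular_solution a \<sigma> s \<alpha> \<beta> T u0 \<theta>0 v \<eta> \<and>
        solution_norm a \<sigma> s \<alpha> \<beta> T v \<eta> < C1
        \<longrightarrow> (\<forall>t\<in>{0..T}. v t = u t \<and> \<eta> t = \<theta> t)) \<and>
    solution_norm a \<sigma> s \<alpha> \<beta> T u \<theta> \<le> C2 * data_norm a \<sigma> s u0 \<theta>0 \<and>
    (\<forall>p\<ge>1. u \<in> Lp_T p T (X_vec a \<sigma> (s + 2 * \<alpha> / p)) \<and>
        \<theta> \<in> Lp_T p T (X_scal a \<sigma> (s + 2 * \<beta> / p))))"
proof -
 interpret boussinesq \<alpha> \<beta> a s \<sigma> using assms by unfold_locales
 \<comment> \<open>In the critical case \<open>T = 1/192\<close>, so that \<open>48 T = 1/4\<close> and \<open>lam T \<le> 1\<close>, and \<open>M\<close> is such that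
  \<open>384 Kw M = 1/4\<close>. With \<open>C1 = M/3\<close> the condition \<open>24 d < C1\<close> on the data becomes \<open>d < M/72\<close>.\<close>
 define M where "M = 1 / (1536 * Kw)"
 have M: "M > 0" "Kw * M = 1 / 1536" using Kw(1) by (simp_all add: M_def)
 show ?thesis
 proof (rule exI[of _ "M / 72"], intro conjI allI impI)
  show "M / 72 > 0" using M by simp
  fix u0 \<theta>0
  assume as: "u0 \<in> elems (X_vec a \<sigma> s) \<and> \<theta>0 \<in> elems (X_scal a \<sigma> s) \<and>
   (\<forall>k. real_dist (u0 $ k)) \<and> real_dist \<theta>0 \<and> div_free u0 \<and> (\<alpha> = 1/2 \<or> \<beta> = 1/2 \<longrightarrow> data_norm a \<sigma> s u0 \<theta>0 < M / 72)"
  let ?d = "data_norm a \<sigma> s u0 \<theta>0"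
  obtain T C1 where T: "T > 0" "384 * Kw * lam T * (3 * C1) + 48 * T \<le> 1/2" and C1: "24 * ?d < C1"
  proof (cases "\<alpha> = 1/2 \<or> \<beta> = 1/2")
   case True
   have "384 * Kw * lam (1/192) * M = 384 * (Kw * M) * lam (1/192)" by simp
   also have "... \<le> 384 * (Kw * M) * 1" using lam_le_1[of "1/192"] M by (intro mult_left_mono) auto
   finally have "384 * Kw * lam (1/192) * (3 * (M / 3)) + 48 * (1/192) \<le> 1/2" using M(2) by simp
   moreover have "?d < M / 72" using as True by blast
   then have "24 * ?d < M / 3" by simp
   ultimately show ?thesis using that[of "1/192" "M / 3"] by simp
  next
   case False
   then have ab: "\<alpha> > 1/2" "\<beta> > 1/2" using assms by auto
   let ?C = "24 * ?d + 1"
   have "((\<lambda>T. 384 * Kw * lam T * (3 * ?C) + 48 * T) \<longlongrightarrow> 384 * Kw * 0 * (3 * ?C) + 48 * 0) (at_right 0)"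
    by (intro tendsto_intros lam_tendsto_0[OF ab] tendsto_ident_at)
   then have "eventually (\<lambda>T. 384 * Kw * lam T * (3 * ?C) + 48 * T < 1/2) (at_right 0)"
    by (rule order_tendstoD(2)) simp
   then have "eventually (\<lambda>T. T > 0 \<and> 384 * Kw * lam T * (3 * ?C) + 48 * T < 1/2) (at_right 0)"
    by (intro eventually_conj eventually_at_right_less)
   then obtain T where "T > 0" "384 * Kw * lam T * (3 * ?C) + 48 * T < 1/2"
    using eventually_happens[of _ "at_right (0::real)"] by auto
   then show ?thesis by (intro that[of T ?C]) auto
  qed
  have u0: "u0 \<in> elems (X_vec a \<sigma> s)" and \<theta>0: "\<theta>0 \<in> elems (X_scal a \<sigma> s)"
   and d: "\<And>k. real_dist (u0 $ k)" "real_dist \<theta>0" "div_free u0" using as by auto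
  have d0: "0 \<le> ?d" by (rule data_norm_nonneg[OF u0 \<theta>0])
  have C: "12 * ?d \<le> 3 * C1" "0 \<le> 3 * C1" "0 < C1" using d0 C1 by linarith+
  obtain Z u \<theta> where Z: "jmeas Z" "NM T Z \<le> ennreal (12 * ?d)"
   and fp: "\<And>t. t \<in> {0..T} \<Longrightarrow> AE \<xi> in lborel. \<forall>i. Z i t \<xi> = Phi (dat u0 \<theta>0) Z i t \<xi>"
   and u: "u = (\<lambda>t. mkv (sl Z t))" "\<theta> = (\<lambda>t. mks (sl Z t))" and reg: "regsol T u0 \<theta>0 u \<theta>" and sol: "snorm T u \<theta> \<le> 24 * ?d"
   and Lp: "\<And>p. p \<ge> 1 \<Longrightarrow> u \<in> Lp_T p T (X_vec a \<sigma> (s + 2 * \<alpha> / p))"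
    "\<And>p. p \<ge> 1 \<Longrightarrow> \<theta> \<in> Lp_T p T (X_scal a \<sigma> (s + 2 * \<beta> / p))"
   by (rule local_solution[OF u0 \<theta>0 d T(1) C(1) T(2)]) blast
  have N: "NM T Z \<le> ennreal (3 * C1)" using Z(2) C(1) by (meson ennreal_leI order_trans)
  have uniq: "\<forall>v \<eta>. regsol T u0 \<theta>0 v \<eta> \<and> snorm T v \<eta> < C1 \<longrightarrow> (\<forall>t\<in>{0..T}. v t = u t \<and> \<eta> t = \<theta> t)"
  proof (intro allI impI ballI)
   fix v \<eta> t assume v: "regsol T u0 \<theta>0 v \<eta> \<and> snorm T v \<eta> < C1" and t: "t \<in> {0..T}"
   then have "regsol T u0 \<theta>0 v \<eta>" "3 * snorm T v \<eta> \<le> 3 * C1" by auto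
   from solution_unique[OF u0 \<theta>0 T(1) C(2) T(2) Z(1) N fp this t] show "v t = u t \<and> \<eta> t = \<theta> t" unfolding u by (rule conjI)
  qed
  have lt: "snorm T u \<theta> < C1" using sol C1 by linarith
  have lp: "\<forall>p\<ge>1. u \<in> Lp_T p T (X_vec a \<sigma> (s + 2 * \<alpha> / p)) \<and> \<theta> \<in> Lp_T p T (X_scal a \<sigma> (s + 2 * \<beta> / p))"
   using Lp by (intro allI impI conjI)
  show "\<exists>T>0. \<exists>C1>0. \<exists>C2>0. \<exists>u \<theta>.
    regsol T u0 \<theta>0 u \<theta> \<and> snorm T u \<theta> < C1 \<and>
    (\<forall>v \<eta>. regsol T u0 \<theta>0 v \<eta> \<and> snorm T v \<eta> < C1 \<longrightarrow> (\<forall>t\<in>{0..T}. v t = u t \<and> \<eta> t = \<theta> t)) \<and>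
    snorm T u \<theta> \<le> C2 * dnorm u0 \<theta>0 \<and>
    (\<forall>p\<ge>1. u \<in> Lp_T p T (X_vec a \<sigma> (s + 2 * \<alpha> / p)) \<and> \<theta> \<in> Lp_T p T (X_scal a \<sigma> (s + 2 * \<beta> / p)))"
   by (rule exI[of _ T], rule conjI[OF T(1)], rule exI[of _ C1], rule conjI[OF C(3)], rule exI[of _ 24],
     rule conjI[OF zero_less_numeral], rule exI[of _ u], rule exI[of _ \<theta>], intro conjI reg uniq sol lt lp)
 qed
qed

end
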